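(* Let $F$ be a non-archimedean local field of characteristic zero, $\mathrm{H}=\mathrm{GL}_n\times\mathrm{GL}_n$ acting on $\mathfrak{X}=\mathfrak{gl}_n\times\mathfrak{gl}_n$ by $(h_1,h_2)\cdot(X,Y)=(h_1Xh_2^{-1},h_2Yh_1^{-1})$. Suppose $\phi\in C_c^\infty(\mathfrak{X}(F))$ satisfies $\phi(0)\neq0$. Then there exists an $\mathrm{H}$-regular elliptic $(X,Y)\in\mathfrak{X}(F)$ such that $\mathrm{Orb}^{\mathrm{H}}(\phi,(X,Y))\neq0$.
   Context: $(X,Y)\in\mathfrak{X}(F)$ is $\mathrm{H}$-regular semisimple if the fibre through it of the categorical quotient $\mathfrak{X}\to\mathfrak{X}/\!\!/\mathrm{H}$ consists of a single $\mathrm{H}(\overline F)$-orbit, and $\mathrm{H}$-regular elliptic if moreover its stabilizer $\mathrm{H}_{(X,Y)}$ is anisotropic modulo the diagonally embedded scalars $\{(z,z)\}$. $\mathrm{Orb}^{\mathrm{H}}(\phi,(X,Y))=\int_{\mathrm{H}_{(X,Y)}(F)\backslash\mathrm{H}(F)}\phi(h^{-1}\cdot(X,Y))\,dh$. *)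

theory Defs
  imports
    "HOL-Analysis.Analysis"
    "HOL-Algebra.Group_Action"
    "HOL-Algebra.Algebraic_Closure_Type"
begin

text \<open>
  The topology of the field is the metric topology of a nontrivial non-archimedean absolute
  value \<open>absval\<close>, which is not assumed to be normalized. Local compactness is equivalent to
  completeness together with discreteness of the value group and finiteness of the residue field.
\<close>

class nonarch_local_field_0 = field_char_0 + metric_space +
  fixes absval :: "'a \<Rightarrow> real"
  assumes dist_absval: "dist x y = absval (x - y)"
    and absval_mult: "absval (x * y) = absval x * absval y"
    and absval_add: "absval (x + y) \<le> max (absval x) (absval y)"
    and absval_nontrivial: "\<exists>x. x \<noteq> 0 \<and> absval x \<noteq> 1"
    and locally_compact: "\<exists>U K. open U \<and> x \<in> U \<and> U \<subseteq> K \<and> compact K"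

type_synonym ('k, 'n) mat2 = "('k^'n^'n) \<times> ('k^'n^'n)"

definition GLxGL :: "('k::field, 'n::finite) mat2 monoid" where
  "GLxGL = \<lparr>carrier = {h. invertible (fst h) \<and> invertible (snd h)},
          mult = (\<lambda>g h. (fst g ** fst h, snd g ** snd h)),
          one = (mat 1, mat 1)\<rparr>"

definition act :: "('k::field, 'n::finite) mat2 \<Rightarrow> ('k, 'n) mat2 \<Rightarrow> ('k, 'n) mat2" where
  "act h x = (fst h ** fst x ** matrix_inv (snd h), snd h ** snd x ** matrix_inv (fst h))"

lemma matrix_inv_props:
  fixes A :: "'k::field^'n^'n"
  assumes "invertible A"
  shows "A ** matrix_inv A = mat 1" "matrix_inv A ** A = mat 1" "invertible (matrix_inv A)"
proof -
  have *: "A ** matrix_inv A = mat 1 \<and> matrix_inv A ** A = mat 1"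
    using assms unfolding invertible_def matrix_inv_def by (rule someI_ex)
  then show "A ** matrix_inv A = mat 1" "matrix_inv A ** A = mat 1" by auto
  from * show "invertible (matrix_inv A)" unfolding invertible_def by blast
qed

lemma group_GLxGL: "group (GLxGL :: ('k::field, 'n::finite) mat2 monoid)"
proof (rule groupI)
  fix x :: "('k, 'n) mat2"
  assume "x \<in> carrier GLxGL"
  then show "\<exists>y\<in>carrier GLxGL. y \<otimes>\<^bsub>GLxGL\<^esub> x = \<one>\<^bsub>GLxGL\<^esub>"
    by (intro bexI[of _ "(matrix_inv (fst x), matrix_inv (snd x))"])
       (auto simp: GLxGL_def matrix_inv_props)
qed (auto simp: GLxGL_def invertible_mult matrix_mul_assoc invertible_def[of "mat 1"])

lemma matrix_inv_mult:
  fixes A B :: "'k::field^'n^'n"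
  assumes "invertible A" "invertible B"
  shows "matrix_inv (A ** B) = matrix_inv B ** matrix_inv A"
proof -
  have "invertible (A ** B)" using assms by (rule invertible_mult)
  then have 1: "matrix_inv (A ** B) ** (A ** B) = mat 1" by (rule matrix_inv_props)
  have "(A ** B) ** (matrix_inv B ** matrix_inv A) = A ** (B ** matrix_inv B) ** matrix_inv A"
    by (simp only: matrix_mul_assoc)
  also have "\<dots> = mat 1" using assms by (simp add: matrix_inv_props)
  finally have "matrix_inv (A ** B) ** ((A ** B) ** (matrix_inv B ** matrix_inv A))
      = matrix_inv (A ** B)" by simp
  moreover have "matrix_inv (A ** B) ** ((A ** B) ** C) = C" for C :: "'k^'n^'n"
    by (metis 1 matrix_mul_assoc matrix_mul_lid)
  ultimately show ?thesis by metis
qed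

lemma matrix_inv_mat_1: "matrix_inv (mat 1 :: 'k::field^'n^'n) = mat 1"
  using matrix_inv_props(1)[of "mat 1 :: 'k^'n^'n"] by (simp add: invertible_def)

lemma act_one: "act \<one>\<^bsub>GLxGL\<^esub> x = x"
  by (simp add: act_def GLxGL_def matrix_inv_mat_1)

lemma act_mult:
  assumes "g \<in> carrier GLxGL" "h \<in> carrier GLxGL"
  shows "act (g \<otimes>\<^bsub>GLxGL\<^esub> h) x = act g (act h x)"
  using assms by (simp add: act_def GLxGL_def matrix_inv_mult matrix_mul_assoc)

text \<open>
  The algebra over \<open>'a\<close> generated by a set of functions with values in the algebraic closure.
\<close>

inductive_set rat_algebra ::
  "('x \<Rightarrow> 'a::field alg_closure) set \<Rightarrow> ('x \<Rightarrow> 'a alg_closure) set"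
  for S :: "('x \<Rightarrow> 'a::field alg_closure) set"
where
  const: "(\<lambda>_. to_ac c) \<in> rat_algebra S"
| gen: "f \<in> S \<Longrightarrow> f \<in> rat_algebra S"
| add: "f \<in> rat_algebra S \<Longrightarrow> g \<in> rat_algebra S \<Longrightarrow> (\<lambda>x. f x + g x) \<in> rat_algebra S"
| mult: "f \<in> rat_algebra S \<Longrightarrow> g \<in> rat_algebra S \<Longrightarrow> (\<lambda>x. f x * g x) \<in> rat_algebra S"

definition coord_funs :: "(('k, 'n::finite) mat2 \<Rightarrow> 'k) set" where
  "coord_funs = {f. \<exists>i j. f = (\<lambda>x. fst x $ i $ j) \<or> f = (\<lambda>x. snd x $ i $ j)}"

text \<open>
  \<open>regular_funs_X\<close> and \<open>regular_funs_H\<close> are the coordinate rings over \<open>'a\<close> of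
  \<open>gl_n \<times> gl_n\<close> and of \<open>GL_n \<times> GL_n\<close>, as functions on points over the algebraic closure;
  the values of the latter outside the group are irrelevant.
\<close>

definition regular_funs_X :: "(('a::field alg_closure, 'n::finite) mat2 \<Rightarrow> 'a alg_closure) set" where
  "regular_funs_X = rat_algebra coord_funs"

definition regular_funs_H :: "(('a::field alg_closure, 'n::finite) mat2 \<Rightarrow> 'a alg_closure) set" where
  "regular_funs_H =
     rat_algebra (coord_funs \<union> {\<lambda>h. inverse (det (fst h)), \<lambda>h. inverse (det (snd h))})"

definition invariant_funs :: "(('a::field alg_closure, 'n::finite) mat2 \<Rightarrow> 'a alg_closure) set" where
  "invariant_funs = {f \<in> regular_funs_X. \<forall>h\<in>carrier GLxGL. \<forall>x. f (act h x) = f x}"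

definition base_change :: "('a::field, 'n::finite) mat2 \<Rightarrow> ('a alg_closure, 'n) mat2" where
  "base_change x = (map_matrix to_ac (fst x), map_matrix to_ac (snd x))"

text \<open>
  The categorical quotient is the spectrum of the ring of invariants, so two geometric points
  have the same image in it iff all invariants agree on them.
\<close>

definition quotient_fibre :: "('a::field, 'n::finite) mat2 \<Rightarrow> ('a alg_closure, 'n) mat2 set" where
  "quotient_fibre x = {y. \<forall>f\<in>invariant_funs. f y = f (base_change x)}"

definition H_regular_semisimple :: "('a::field, 'n::finite) mat2 \<Rightarrow> bool" where
  "H_regular_semisimple x \<longleftrightarrow> (\<exists>y. quotient_fibre x = Group_Action.orbit GLxGL act y)"

definition geom_stabilizer :: "('a::field, 'n::finite) mat2 \<Rightarrow> ('a alg_closure, 'n) mat2 set" where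
  "geom_stabilizer x = stabilizer GLxGL act (base_change x)"

text \<open>
  The stabilizer of an \<open>H\<close>-regular semisimple element is a torus, and a torus is anisotropic if it
  has no nontrivial rational character. The rational characters of the quotient by the scalars
  are the rational characters of the stabilizer which are trivial on the scalars. In
  characteristic 0 the stabilizer is reduced, so its regular functions over \<open>'a\<close> are the
  restrictions of those of \<open>GL_n \<times> GL_n\<close> to its geometric points.
\<close>

definition rational_character ::
  "('a::field, 'n::finite) mat2 \<Rightarrow> (('a alg_closure, 'n) mat2 \<Rightarrow> 'a alg_closure) \<Rightarrow> bool" where
  "rational_character x \<psi> \<longleftrightarrow>
     \<psi> \<in> regular_funs_H \<and>
     (\<forall>h\<in>geom_stabilizer x. \<psi> h \<noteq> 0) \<and>
     (\<forall>g\<in>geom_stabilizer x. \<forall>h\<in>geom_stabilizer x. \<psi> (g \<otimes>\<^bsub>GLxGL\<^esub> h) = \<psi> g * \<psi> h)"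

definition stabilizer_anisotropic_mod_scalars :: "('a::field, 'n::finite) mat2 \<Rightarrow> bool" where
  "stabilizer_anisotropic_mod_scalars x \<longleftrightarrow>
     (\<forall>\<psi>. rational_character x \<psi> \<and> (\<forall>z. z \<noteq> 0 \<longrightarrow> \<psi> (mat z, mat z) = 1)
        \<longrightarrow> (\<forall>h\<in>geom_stabilizer x. \<psi> h = 1))"

definition H_regular_elliptic :: "('a::field, 'n::finite) mat2 \<Rightarrow> bool" where
  "H_regular_elliptic x \<longleftrightarrow> H_regular_semisimple x \<and> stabilizer_anisotropic_mod_scalars x"

text \<open>
  The space of cosets \<open>T h\<close> with the quotient topology: for a set \<open>U\<close> of cosets, \<open>\<Union>U\<close> is its
  preimage in the group.
\<close>

definition coset_topology ::
  "('a::{field,topological_space}, 'n::finite) mat2 set \<Rightarrow> ('a, 'n) mat2 set topology" where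
  "coset_topology T = topology (\<lambda>U. U \<subseteq> rcosets\<^bsub>GLxGL\<^esub> T \<and>
     openin (top_of_set (carrier GLxGL)) (\<Union>U))"

lemma openin_coset_topology:
  assumes "subgroup T (GLxGL :: ('a::{field,topological_space}, 'n::finite) mat2 monoid)"
  shows "openin (coset_topology T) U \<longleftrightarrow>
    U \<subseteq> rcosets\<^bsub>GLxGL\<^esub> T \<and> openin (top_of_set (carrier GLxGL)) (\<Union>U)"
proof -
  interpret group "GLxGL :: ('a, 'n) mat2 monoid" by (rule group_GLxGL)
  have Int: "\<Union>(U \<inter> V) = \<Union>U \<inter> \<Union>V" if "U \<subseteq> rcosets\<^bsub>GLxGL\<^esub> T" "V \<subseteq> rcosets\<^bsub>GLxGL\<^esub> T" for U V
  proof -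
    have "C = D" if "C \<in> U" "D \<in> V" "y \<in> C" "y \<in> D" for C D y
      using that \<open>U \<subseteq> _\<close> \<open>V \<subseteq> _\<close> rcos_disjoint[OF assms]
      unfolding pairwise_def disjnt_def by (meson disjoint_iff subsetD)
    then show ?thesis by blast
  qed
  have UN: "\<Union>(\<Union>\<K>) = (\<Union>U\<in>\<K>. \<Union>U)" for \<K> :: "('a, 'n) mat2 set set set" by blast
  have "istopology (\<lambda>U. U \<subseteq> rcosets\<^bsub>GLxGL\<^esub> T \<and> openin (top_of_set (carrier GLxGL)) (\<Union>U))"
    unfolding istopology_def
  proof (intro conjI allI impI)
    fix U V
    assume U: "U \<subseteq> rcosets\<^bsub>GLxGL\<^esub> T \<and> openin (top_of_set (carrier GLxGL)) (\<Union>U)"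
      and V: "V \<subseteq> rcosets\<^bsub>GLxGL\<^esub> T \<and> openin (top_of_set (carrier GLxGL)) (\<Union>V)"
    then show "U \<inter> V \<subseteq> rcosets\<^bsub>GLxGL\<^esub> T" by blast
    have "openin (top_of_set (carrier GLxGL)) (\<Union>U \<inter> \<Union>V)" using U V by (intro openin_Int) auto
    then show "openin (top_of_set (carrier GLxGL)) (\<Union>(U \<inter> V))" using Int U V by metis
  next
    fix \<K> :: "('a, 'n) mat2 set set set"
    assume K: "\<forall>U\<in>\<K>. U \<subseteq> rcosets\<^bsub>GLxGL\<^esub> T \<and> openin (top_of_set (carrier GLxGL)) (\<Union>U)"
    then show "\<Union>\<K> \<subseteq> rcosets\<^bsub>GLxGL\<^esub> T" by blast
    have "openin (top_of_set (carrier GLxGL)) (\<Union>U\<in>\<K>. \<Union>U)" using K by (intro openin_Union) blast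
    then show "openin (top_of_set (carrier GLxGL)) (\<Union>(\<Union>\<K>))" by (simp only: UN)
  qed
  then show ?thesis unfolding coset_topology_def by (simp add: topology_inverse')
qed

text \<open>
  A nonzero right-invariant Radon measure on the space of cosets \<open>T h\<close>. Over a local field this
  space is locally compact and second countable, so a Borel measure that is finite on compact
  sets is Radon.
\<close>

definition invariant_coset_measure ::
  "('a::{field,topological_space}, 'n::finite) mat2 set \<Rightarrow> ('a, 'n) mat2 set measure \<Rightarrow> bool" where
  "invariant_coset_measure T \<mu> \<longleftrightarrow>
     space \<mu> = rcosets\<^bsub>GLxGL\<^esub> T \<and>
     sets \<mu> = sigma_sets (rcosets\<^bsub>GLxGL\<^esub> T) {U. openin (coset_topology T) U} \<and>
     (\<forall>K. compactin (coset_topology T) K \<longrightarrow> emeasure \<mu> K < \<infinity>) \<and>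
     (\<forall>g\<in>carrier GLxGL. \<forall>A\<in>sets \<mu>. emeasure \<mu> ((\<lambda>C. C #>\<^bsub>GLxGL\<^esub> g) ` A) = emeasure \<mu> A) \<and>
     emeasure \<mu> (space \<mu>) \<noteq> 0"

text \<open>
  \<open>orb_stab_fun GLxGL act C x\<close> is the common value of \<open>h\<^sup>-\<^sup>1 \<cdot> x\<close> for \<open>h\<close> in the coset \<open>C\<close> of the
  stabilizer of \<open>x\<close>.
\<close>

definition Orb ::
  "('a::field, 'n::finite) mat2 set measure \<Rightarrow> (('a, 'n) mat2 \<Rightarrow> complex) \<Rightarrow> ('a, 'n) mat2 \<Rightarrow> complex" where
  "Orb \<mu> \<phi> x = (LINT C|\<mu>. \<phi> (orb_stab_fun GLxGL act C x))"

lemma orb_stab_fun_GLxGL: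
  fixes x h :: "('a::field, 'n::finite) mat2"
  assumes "h \<in> carrier GLxGL"
  shows "orb_stab_fun GLxGL act (stabilizer GLxGL act x #>\<^bsub>GLxGL\<^esub> h) x = act (inv\<^bsub>GLxGL\<^esub> h) x"
proof -
  interpret group "GLxGL :: ('a, 'n) mat2 monoid" by (rule group_GLxGL)
  let ?C = "stabilizer GLxGL act x #>\<^bsub>GLxGL\<^esub> h"
  have "h \<in> ?C"
    using assms by (auto simp: r_coset_def stabilizer_def act_one intro!: bexI[of _ "\<one>\<^bsub>GLxGL\<^esub>"])
  then have "(SOME k. k \<in> ?C) \<in> ?C" by (rule someI)
  then obtain t where t: "t \<in> carrier GLxGL" "act t x = x" "(SOME k. k \<in> ?C) = t \<otimes>\<^bsub>GLxGL\<^esub> h"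
    by (auto simp: r_coset_def stabilizer_def)
  have "act (inv\<^bsub>GLxGL\<^esub> t) x = act (inv\<^bsub>GLxGL\<^esub> t) (act t x)" by (simp add: t)
  also have "\<dots> = act (inv\<^bsub>GLxGL\<^esub> t \<otimes>\<^bsub>GLxGL\<^esub> t) x"
    by (rule act_mult[symmetric]) (use t(1) in simp_all)
  also have "\<dots> = x" using t(1) by (simp add: act_one)
  finally show ?thesis
    using assms t by (simp add: orb_stab_fun_def inv_mult_group act_mult)
qed

text \<open>
  Over a non-archimedean field, smooth means locally constant.
\<close>

definition Cc_infinity :: "('x::topological_space \<Rightarrow> complex) set" where
  "Cc_infinity = {\<phi>. (\<forall>x. \<exists>U. open U \<and> x \<in> U \<and> (\<forall>y\<in>U. \<phi> y = \<phi> x)) \<and>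
     compact (closure {x. \<phi> x \<noteq> 0})}"

end

theory Submission
  imports Defs "HOL-Computational_Algebra.Polynomial_Factorial" "HOL-Algebra.Sylow"
begin

text \<open>
  Let \<open>\<Pi>\<close> be the companion matrix of \<open>T\<^sup>n - w\<close>, where \<open>w\<close> is a uniformizer, and consider the elliptic elements
  \<open>x\<^sub>k = (w\<^sup>k \<Pi>, 1)\<close>. They all have the same stabilizer \<open>T\<close>, the centralizer of \<open>\<Pi>\<close> embedded diagonally. With
  \<open>K = GL_n(O) \<times> GL_n(O)\<close>, and after averaging \<open>\<phi>\<close> over \<open>K\<close>, the orbital integral of \<open>x\<^sub>k\<close> is, up to a common factor,
  the finite sum over \<open>T h K\<close> of \<open>wt(h) \<phi>(h\<^sup>-\<^sup>1 x\<^sub>k)\<close>, where the weight \<open>wt(h)\<close> is the number of cosets \<open>t h K\<close> with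
  \<open>t \<in> T \<inter> K\<close>, a power of the residue characteristic \<open>p\<close>. A \<open>\<rat>\<close>-linear functional on the values reduces the
  claim to integer-valued \<open>\<phi>\<close>, so that the sums may be compared modulo a high power of \<open>p\<close>.

  Modulo \<open>p\<^sup>v\<^sup>+\<^sup>1\<close> only the double cosets with \<open>wt(h) \<le> p\<^sup>v\<close> matter. On these, \<open>h\<^sup>-\<^sup>1 x\<^sub>k\<close> has a small first component when
  \<open>n k + d\<close> is large and a small second component when \<open>- d\<close> is large, where \<open>d = val det h\<^sub>2 - val det h\<^sub>1\<close>.
  Multiplying \<open>h\<^sub>2\<close> by \<open>\<Pi>\<^sup>n\<close> preserves weights and, where the second component is negligible, carries the terms of
  \<open>x\<^bsub>k+1\<^esub>\<close> to those of \<open>x\<^sub>k\<close>. For large \<open>k\<close> the difference of the two sums therefore consists of \<open>n\<close> levels of \<open>d\<close>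
  on which \<open>h\<^sup>-\<^sup>1 x\<^bsub>k+1\<^esub>\<close> is negligible: it is \<open>n \<phi>(0) W\<close>, where \<open>W\<close> is the total weight of one level.
  Only the trivial double coset has weight 1 on level 0, so \<open>W \<equiv> 1\<close> modulo \<open>p\<close>. If all orbital integrals vanished,
  \<open>n \<phi>(0)\<close> would be divisible by every power of \<open>p\<close>.
\<close>

no_notation fps_nth (infixl \<open>$\<close> 75)
hide_const (open) Module.smult UnivPoly.monom UnivPoly.coeff Divisibility.prime Divisibility.irreducible Polynomials.degree

section \<open>Absolute values and uniformizers\<close>

text \<open>Away from 0 the values of \<open>\<phi>\<close> are arbitrary complex numbers, so
  neither positivity nor size isolates the contribution of \<open>\<phi> (0, 0)\<close>. For n > 1 a
  level of d consists of infinitely many double cosets with unbounded weights, so its total weight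
  makes sense only p-adically; this forces integer values and congruences. The weights are powers of
  p because F[\<open>Pi_mat\<close>] is totally ramified over F: its units modulo those of F form a
  pro-p group, and scalar units lie in every conjugate of K. A bounded weight confines h: by
  pigeonhole among the units 1 + w^a Pi^i, the conjugates h^-1 Pi^i h are bounded, so up to powers
  of Pi both components of h are integral matrices with bounded inverse. Hence finiteness of the
  levels and smallness of h^-1 x_k. The shift is by n because passing from k to k + 1 multiplies the
  first component by w = Pi^n, whose determinant has valuation n. No Haar measure on the group
  enters. Weights become measures by counting cosets in two ways, inside K and inside h K h^-1; the
  equality of |K h K / K| and |K h^-1 K / K| takes the place of unimodularity.\<close>

lemma absval_ge_0 [simp]: "0 \<le> absval (x :: 'a::nonarch_local_field_0)"
  using dist_absval[of x 0] zero_le_dist[of x 0] by simp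

lemma absval_eq_0_iff [simp]: "absval x = 0 \<longleftrightarrow> x = (0 :: 'a::nonarch_local_field_0)"
  using dist_absval[of x 0] by (metis diff_zero dist_eq_0_iff)

lemma absval_0 [simp]: "absval (0 :: 'a::nonarch_local_field_0) = 0"
  by simp

lemma absval_pos_iff [simp]: "0 < absval x \<longleftrightarrow> x \<noteq> (0 :: 'a::nonarch_local_field_0)"
  using absval_ge_0[of x] absval_eq_0_iff[of x] by linarith

lemma absval_1 [simp]: "absval (1 :: 'a::nonarch_local_field_0) = 1"
  using absval_mult[of 1 "1::'a"] absval_eq_0_iff[of "1::'a"] by simp

lemma absval_minus [simp]: "absval (- x :: 'a::nonarch_local_field_0) = absval x"
  using dist_absval[of x 0] dist_absval[of 0 x] by (simp add: dist_commute)

lemma absval_diff: "absval (x - y :: 'a::nonarch_local_field_0) \<le> max (absval x) (absval y)"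
  using absval_add[of x "- y"] by simp

lemma absval_power: "absval (x ^ n :: 'a::nonarch_local_field_0) = absval x ^ n"
  by (induction n) (simp_all add: absval_mult)

lemma absval_inverse: "absval (inverse x :: 'a::nonarch_local_field_0) = inverse (absval x)"
proof (cases "x = 0")
  case False
  then have "absval x * absval (inverse x) = 1" by (simp add: absval_mult [symmetric])
  then show ?thesis by (metis inverse_unique)
qed simp

lemma absval_divide: "absval (x / y :: 'a::nonarch_local_field_0) = absval x / absval y"
  by (simp add: divide_inverse absval_mult absval_inverse)

lemma absval_sum:
  assumes "finite S" "0 \<le> r" "\<And>i. i \<in> S \<Longrightarrow> absval (f i :: 'a::nonarch_local_field_0) \<le> r"
  shows "absval (sum f S) \<le> r"
  using assms
proof (induction S rule: finite_induct)
  case (insert x F)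
  then have "absval (f x) \<le> r" "absval (sum f F) \<le> r" by auto
  then show ?case using insert.hyps absval_add[of "f x" "sum f F"] by auto
qed simp

lemma absval_prod: "absval (\<Prod>i\<in>S. f i :: 'a::nonarch_local_field_0) = (\<Prod>i\<in>S. absval (f i))"
  by (induction S rule: infinite_finite_induct) (simp_all add: absval_mult)

lemma exists_absval_less_1: "\<exists>y :: 'a::nonarch_local_field_0. y \<noteq> 0 \<and> absval y < 1"
proof -
  obtain x :: 'a where x: "x \<noteq> 0" "absval x \<noteq> 1" using absval_nontrivial by blast
  show ?thesis
  proof (cases "absval x < 1")
    case False
    then have "absval (inverse x) < 1" using x by (simp add: absval_inverse inverse_less_1_iff)
    then show ?thesis using x by (metis inverse_nonzero_iff_nonzero)
  qed (use x in blast)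
qed

lemma exists_absval_small:
  assumes "0 < e"
  shows "\<exists>y :: 'a::nonarch_local_field_0. y \<noteq> 0 \<and> absval y < e"
proof -
  obtain y :: 'a where y: "y \<noteq> 0" "absval y < 1" using exists_absval_less_1 by blast
  obtain n where "absval y ^ n < e" using real_arch_pow_inv[OF assms y(2)] by blast
  then show ?thesis using y by (intro exI[of _ "y ^ n"]) (simp add: absval_power)
qed

text \<open>Multiplication by a small \<open>y\<close> carries the ball into a compact neighbourhood
  of 0; scaling this neighbourhood back by \<open>inverse y\<close> covers the ball, which is
  closed.\<close>

lemma compact_absval_le: "compact {x :: 'a::nonarch_local_field_0. absval x \<le> R}"
proof -
  obtain U K where UK: "open U" "(0::'a) \<in> U" "U \<subseteq> K" "compact K" using locally_compact by blast
  then obtain e where e: "0 < e" "ball 0 e \<subseteq> U" by (meson openE)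
  let ?R = "max R 1"
  obtain y :: 'a where y: "y \<noteq> 0" "absval y < e / ?R"
    using exists_absval_small[of "e / ?R"] e by auto
  have mem: "x * y \<in> K" if "absval x \<le> R" for x
  proof -
    have "absval (x * y) \<le> ?R * absval y" using that by (simp add: absval_mult mult_right_mono)
    also have "\<dots> < e" using y by (simp add: field_simps)
    finally have "x * y \<in> ball 0 e" by (simp add: dist_absval)
    then show ?thesis using e UK by blast
  qed
  have cont: "continuous_on S (\<lambda>x. x * c)" for c :: 'a and S
  proof (rule continuous_onI)
    fix x and e :: real assume "0 < e"
    show "\<exists>d>0. \<forall>x'\<in>S. dist x' x < d \<longrightarrow> dist (x' * c) (x * c) \<le> e"
    proof (intro exI[of _ "e / (absval c + 1)"] conjI ballI impI)
      show "0 < e / (absval c + 1)" using \<open>0 < e\<close> by (simp add: add_nonneg_pos)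
      fix x' assume "dist x' x < e / (absval c + 1)"
      then have "absval (x' - x) * (absval c + 1) < e"
        by (simp add: dist_absval pos_less_divide_eq add_nonneg_pos)
      moreover have "absval (x' - x) * absval c \<le> absval (x' - x) * (absval c + 1)"
        by (simp add: mult_left_mono)
      ultimately show "dist (x' * c) (x * c) \<le> e"
        by (simp add: dist_absval left_diff_distrib [symmetric] absval_mult)
    qed
  qed
  have "{x :: 'a. absval x \<le> R} = cball 0 R" by (auto simp: dist_absval)
  then have closed: "closed {x :: 'a. absval x \<le> R}" by simp
  have "compact ((\<lambda>x. x * inverse y) ` K)"
    using UK cont by (intro compact_continuous_image) auto
  moreover have "{x. absval x \<le> R} \<subseteq> (\<lambda>x. x * inverse y) ` K"
  proof
    fix x assume "x \<in> {x :: 'a. absval x \<le> R}"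
    then have "x * y \<in> K" "x = x * y * inverse y" using mem y by auto
    then show "x \<in> (\<lambda>x. x * inverse y) ` K" by blast
  qed
  ultimately show ?thesis using closed compact_Int_closed by (metis inf.absorb_iff2)
qed

text \<open>Needed so that closed bounded sets of matrices are compact, in particular
  GL_n(O).\<close>

instance nonarch_local_field_0 \<subseteq> heine_borel
proof
  fix f :: "nat \<Rightarrow> 'a" assume "bounded (range f)"
  then obtain R where "\<forall>x\<in>range f. dist 0 x \<le> R" by (metis bounded_any_center)
  then have "\<forall>n. f n \<in> {x. absval x \<le> R}"
    by (simp add: dist_absval)
  moreover have "seq_compact {x :: 'a. absval x \<le> R}"
    using compact_absval_le compact_eq_seq_compact_metric by blast
  ultimately show "\<exists>l r. strict_mono (r::nat\<Rightarrow>nat) \<and> ((f \<circ> r) \<longlongrightarrow> l) sequentially"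
    by (metis seq_compactE)
qed

definition uniformizer :: "'a::nonarch_local_field_0" where
  "uniformizer = (SOME w. w \<noteq> 0 \<and> absval w < 1 \<and> (\<forall>x::'a. absval x < 1 \<longrightarrow> absval x \<le> absval w))"

text \<open>The open unit ball is compact, so the absolute value attains its maximum on it. This is
  where discreteness of the value group comes from.\<close>

lemma uniformizer:
  shows uniformizer_nonzero [simp]: "(uniformizer :: 'a::nonarch_local_field_0) \<noteq> 0"
    and absval_uniformizer_less_1 [simp]: "absval (uniformizer :: 'a) < 1"
    and absval_le_uniformizer: "absval (x :: 'a) < 1 \<Longrightarrow> absval x \<le> absval (uniformizer :: 'a)"
proof -
  \<comment> \<open>By the ultrametric inequality an open unit ball around an element of absolute
    value 1 contains only such elements, so the open ball is the closed ball with open sets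
    removed.\<close>
  have "ball 0 1 = {x :: 'a. absval x \<le> 1} - (\<Union>y\<in>{y. absval y = 1}. ball y 1)"
  proof (intro Set.set_eqI iffI)
    fix x :: 'a assume "x \<in> ball 0 1"
    then have "absval x < 1" by (simp add: dist_absval)
    moreover have "absval x = 1" if "absval y = 1" "absval (y - x) < 1" for y
      using that absval_add[of "y - x" x] absval_diff[of "y" "y - x"] by auto
    ultimately show "x \<in> {x :: 'a. absval x \<le> 1} - (\<Union>y\<in>{y. absval y = 1}. ball y 1)"
      by (fastforce simp: dist_absval)
  next
    fix x :: 'a assume "x \<in> {x :: 'a. absval x \<le> 1} - (\<Union>y\<in>{y. absval y = 1}. ball y 1)"
    then have "absval x \<le> 1" "absval x \<noteq> 1" by (auto simp: dist_absval)
    then show "x \<in> ball 0 1" by (simp add: dist_absval)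
  qed
  moreover have "compact ({x :: 'a. absval x \<le> 1} - (\<Union>y\<in>{y. absval y = 1}. ball y 1))"
    by (intro compact_diff compact_absval_le) auto
  ultimately have "compact (ball (0::'a) 1)" by simp
  moreover have "continuous_on (ball (0::'a) 1) (\<lambda>x. dist 0 x)" by (intro continuous_intros)
  ultimately have "\<exists>w\<in>ball (0::'a) 1. \<forall>x\<in>ball (0::'a) 1. dist 0 x \<le> dist 0 w"
    using continuous_attains_sup[of "ball (0::'a) 1" "dist 0"] by fastforce
  then obtain w :: 'a where w: "w \<in> ball 0 1" "\<forall>x\<in>ball (0::'a) 1. dist 0 x \<le> dist 0 w" ..
  obtain y :: 'a where y: "y \<noteq> 0" "absval y < 1" using exists_absval_less_1 by blast
  have "y \<in> ball 0 1" using y by (simp add: dist_absval)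
  then have "dist 0 y \<le> dist 0 w" using w(2) by blast
  then have "w \<noteq> 0" using y by auto
  then have "\<exists>w :: 'a. w \<noteq> 0 \<and> absval w < 1 \<and> (\<forall>x::'a. absval x < 1 \<longrightarrow> absval x \<le> absval w)"
    using w by (intro exI[of _ w]) (auto simp: dist_absval)
  from someI_ex[OF this]
  show "(uniformizer :: 'a) \<noteq> 0" "absval (uniformizer :: 'a) < 1"
    "absval (x :: 'a) < 1 \<Longrightarrow> absval x \<le> absval (uniformizer :: 'a)"
    unfolding uniformizer_def by blast+
qed

lemma absval_eq_powi:
  assumes "x \<noteq> (0 :: 'a::nonarch_local_field_0)"
  shows "\<exists>k. absval x = absval (uniformizer :: 'a) powi k"
proof -
  let ?r = "absval (uniformizer :: 'a)"
  have r: "0 < ?r" "?r < 1" by simp_all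
  \<comment> \<open>With this exponent x w^-k has absolute value in the half-open interval from |w|
    (excluded) to 1, where 1 is the only value attained.\<close>
  define k where "k = \<lfloor>ln (absval x) / ln ?r\<rfloor>"
  have lnr: "ln ?r < 0" using r by simp
  have "of_int k \<le> ln (absval x) / ln ?r" "ln (absval x) / ln ?r < of_int k + 1"
    unfolding k_def by linarith+
  then have "ln (absval x) \<le> of_int k * ln ?r" "(of_int k + 1) * ln ?r < ln (absval x)"
    using lnr by (simp_all add: neg_le_divide_eq neg_divide_less_eq)
  moreover have "exp (of_int k * ln ?r) = ?r powi k" for k
    using r by (simp add: powr_real_of_int' [symmetric] powr_def)
  from this[of k] this[of "k + 1"] have "exp (of_int k * ln ?r) = ?r powi k"
    "exp ((of_int k + 1) * ln ?r) = ?r powi (k + 1)" by simp_all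
  ultimately have 1: "absval x \<le> ?r powi k" "?r powi (k + 1) < absval x"
    using assms by (metis absval_pos_iff exp_le_cancel_iff exp_ln, metis absval_pos_iff exp_less_cancel_iff exp_ln)
  define y where "y = x * inverse uniformizer powi k"
  have powi: "absval (z powi k) = absval z powi k" for z :: 'a
    by (simp add: power_int_def absval_power absval_inverse)
  have y: "absval y = absval x / ?r powi k"
    by (simp add: y_def absval_mult powi absval_inverse power_int_inverse divide_inverse)
  have "absval y \<le> 1" "?r < absval y"
    using 1 r by (simp_all add: y divide_le_eq_1 power_int_add less_divide_eq mult.commute)
  then have "absval y = 1" using absval_le_uniformizer[of y] by fastforce
  then have "absval x = ?r powi k" using r by (simp add: y)
  then show ?thesis by blast
qed

text \<open>No integer fits the description at 0, so \<open>val 0\<close> is unspecified.\<close>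

definition val :: "'a::nonarch_local_field_0 \<Rightarrow> int" where
  "val x = (THE k. absval x = absval (uniformizer :: 'a) powi k)"

lemma absval_uniformizer_powi_inject:
  "absval (uniformizer :: 'a::nonarch_local_field_0) powi k = absval (uniformizer :: 'a) powi l \<longleftrightarrow> k = l"
proof -
  have "absval (uniformizer :: 'a) powi l < absval (uniformizer :: 'a) powi k" if "k < l" for k l
    using that by (intro power_int_strict_decreasing) auto
  then show ?thesis by (metis less_irrefl linorder_neqE_linordered_idom)
qed

lemma absval_eq_val:
  assumes "x \<noteq> (0 :: 'a::nonarch_local_field_0)"
  shows "absval x = absval (uniformizer :: 'a) powi val x"
proof -
  obtain k where "absval x = absval (uniformizer :: 'a) powi k" using absval_eq_powi[OF assms] by blast
  then show ?thesis unfolding val_def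
    by (rule theI) (metis \<open>absval x = _\<close> absval_uniformizer_powi_inject)
qed

section \<open>Bounded matrices and integral invertible matrices\<close>

text \<open>The sup norm is submultiplicative here without a factor depending on n, since sums are
  bounded by their largest term.\<close>

definition bnd :: "real \<Rightarrow> 'a::nonarch_local_field_0^'n^'n \<Rightarrow> bool" where
  "bnd r A \<longleftrightarrow> (\<forall>i j. absval (A $ i $ j) \<le> r)"

lemma bnd_mono: "bnd r A \<Longrightarrow> r \<le> s \<Longrightarrow> bnd s A"
  unfolding bnd_def by (meson order_trans)

lemma bnd_ge_0: "bnd r A \<Longrightarrow> 0 \<le> r"
  unfolding bnd_def by (meson absval_ge_0 order_trans)

lemma bnd_mult:
  assumes "bnd r A" "bnd s B"
  shows "bnd (r * s) (A ** B)"
  unfolding bnd_def matrix_matrix_mult_def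
proof (intro allI)
  fix i j
  have "absval (\<Sum>k\<in>UNIV. A $ i $ k * B $ k $ j) \<le> r * s"
    using assms bnd_ge_0[OF assms(1)] bnd_ge_0[OF assms(2)]
    by (intro absval_sum) (auto simp: bnd_def absval_mult intro!: mult_mono)
  then show "absval ((\<chi> i j. \<Sum>k\<in>UNIV. A $ i $ k * B $ k $ j) $ i $ j) \<le> r * s" by simp
qed

lemma bnd_mult': "bnd r A \<Longrightarrow> bnd s B \<Longrightarrow> r * s \<le> t \<Longrightarrow> bnd t (A ** B)"
  using bnd_mult bnd_mono by blast

lemma bnd_add: "bnd r A \<Longrightarrow> bnd r B \<Longrightarrow> bnd r (A + B)"
  unfolding bnd_def by (simp add: order_trans[OF absval_add])

lemma bnd_uminus: "bnd r A \<Longrightarrow> bnd r (- A)"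
  unfolding bnd_def by simp

lemma bnd_diff: "bnd r A \<Longrightarrow> bnd r B \<Longrightarrow> bnd r (A - B)"
  using bnd_add[of r A "- B"] bnd_uminus[of r B] by simp

lemma bnd_mat: "absval c \<le> r \<Longrightarrow> bnd r (mat c)"
  unfolding bnd_def mat_def using order_trans[OF absval_ge_0[of c], of r] by simp

lemma bnd_0: "0 \<le> r \<Longrightarrow> bnd r 0"
  unfolding bnd_def by simp

lemma bnd_transpose: "bnd r A \<Longrightarrow> bnd r (transpose A)"
  unfolding bnd_def transpose_def by simp

lemma exists_bnd: "\<exists>r\<ge>1. bnd r A"
proof -
  let ?S = "insert 1 (range (\<lambda>(i, j). absval (A $ i $ j)))"
  have fin: "finite ?S" by simp
  have "1 \<le> Max ?S" using fin by (intro Max_ge) auto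
  moreover have "absval (A $ i $ j) \<in> ?S" for i j
    using rangeI[of "\<lambda>(i, j). absval (A $ i $ j)" "(i, j)"] by simp
  then have "bnd (Max ?S) A" unfolding bnd_def using fin by (blast intro: Max_ge)
  ultimately show ?thesis by blast
qed

lemma matrix_mult_diff_ldistrib: "(A :: 'k::ring_1^'n^'m) ** (B - C) = A ** B - A ** C"
  by (simp add: matrix_matrix_mult_def vec_eq_iff right_diff_distrib sum_subtractf)

lemma matrix_mult_diff_rdistrib: "(A - B) ** (C :: 'k::ring_1^'n^'m) = A ** C - B ** C"
  by (simp add: matrix_matrix_mult_def vec_eq_iff left_diff_distrib sum_subtractf)

lemma matrix_mult_add_rdistrib: "(A + B) ** (C :: 'k::ring_1^'n^'m) = A ** C + B ** C"
  by (simp add: matrix_matrix_mult_def vec_eq_iff distrib_right sum.distrib)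

lemma mat_mult_nth [simp]: "(mat c ** A) $ i $ j = (c :: 'k::semiring_1) * A $ i $ j"
  by (simp add: matrix_matrix_mult_def mat_def if_distrib [of "\<lambda>x. x * _"] cong: if_cong)

lemma mult_mat_nth [simp]: "(A ** mat c) $ i $ j = A $ i $ j * (c :: 'k::semiring_1)"
  by (simp add: matrix_matrix_mult_def mat_def if_distrib [of "\<lambda>x. _ * x"] cong: if_cong)

lemma mat_mult_commute: "mat c ** A = A ** mat (c :: 'k::comm_semiring_1)"
  by (simp add: vec_eq_iff mult.commute)

lemma mat_mult_mat: "mat a ** mat b = (mat (a * b) :: 'k::semiring_1^'n^'n)"
  unfolding vec_eq_iff mat_mult_nth by (simp add: mat_def)

lemma invertible_mat: "c \<noteq> 0 \<Longrightarrow> invertible (mat c :: 'k::field^'n^'n)"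
  unfolding invertible_def by (rule exI[of _ "mat (inverse c)"]) (simp add: mat_mult_mat)

lemma matrix_inv_unique_right:
  fixes A B :: "'k::field^'n^'n"
  assumes "A ** B = mat 1"
  shows "invertible A" "invertible B" "matrix_inv A = B" "matrix_inv B = A"
proof -
  have BA: "B ** A = mat 1" using assms by (rule matrix_left_right_inverse1)
  show i: "invertible A" "invertible B" using assms BA unfolding invertible_def by blast+
  show "matrix_inv A = B"
    by (metis BA i(1) matrix_inv_props(1) matrix_mul_assoc matrix_mul_lid matrix_mul_rid)
  show "matrix_inv B = A"
    by (metis assms i(2) matrix_inv_props(1) matrix_mul_assoc matrix_mul_lid matrix_mul_rid)
qed

lemma invertible_transpose: "invertible (A :: 'k::field^'n^'n) \<Longrightarrow> invertible (transpose A)"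
  by (metis invertible_def matrix_transpose_mul transpose_mat)

lemma matrix_inv_transpose:
  assumes "invertible (A :: 'k::field^'n^'n)"
  shows "matrix_inv (transpose A) = transpose (matrix_inv A)"
  by (rule matrix_inv_unique_right)
    (simp add: matrix_transpose_mul [symmetric] matrix_inv_props assms)

lemma matrix_inv_matrix_inv: "invertible (A :: 'k::field^'n^'n) \<Longrightarrow> matrix_inv (matrix_inv A) = A"
  by (metis matrix_inv_props(1) matrix_inv_unique_right(4))

section \<open>The group GL_n(O)\<close>

definition GLO :: "('a::nonarch_local_field_0^'n^'n) set" where
  "GLO = {g. invertible g \<and> bnd 1 g \<and> bnd 1 (matrix_inv g)}"

lemma GLO_I: "A ** B = mat 1 \<Longrightarrow> bnd 1 A \<Longrightarrow> bnd 1 B \<Longrightarrow> A \<in> GLO"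
  unfolding GLO_def using matrix_inv_unique_right[of A B] by simp

lemma GLO_one [simp]: "mat 1 \<in> GLO"
  by (rule GLO_I[of _ "mat 1"]) (auto intro: bnd_mat)

lemma GLO_mult: "A \<in> GLO \<Longrightarrow> B \<in> GLO \<Longrightarrow> A ** B \<in> GLO"
  unfolding GLO_def by (auto simp: invertible_mult matrix_inv_mult intro: bnd_mult')

lemma GLO_inv: "A \<in> GLO \<Longrightarrow> matrix_inv A \<in> GLO"
  unfolding GLO_def by (auto simp: matrix_inv_props matrix_inv_matrix_inv)

lemma GLO_transpose: "A \<in> GLO \<Longrightarrow> transpose A \<in> GLO"
  unfolding GLO_def by (auto simp: invertible_transpose matrix_inv_transpose bnd_transpose)

lemma GLO_invertible: "A \<in> GLO \<Longrightarrow> invertible A"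
  unfolding GLO_def by simp

text \<open>Both claims look at an entry of maximal absolute value: v = - Y v is impossible for v
  nonzero, and the equation Z = 1 - Y Z for the inverse first gives |Z| <= 1 and then |Z - 1| <=
  r.\<close>

lemma one_plus_bnd:
  fixes Y :: "'a::nonarch_local_field_0^'n^'n"
  assumes "bnd r Y" "r < 1"
  shows "invertible (mat 1 + Y)" "bnd 1 (mat 1 + Y)" "bnd r (matrix_inv (mat 1 + Y) - mat 1)"
proof -
  have r0: "0 \<le> r" using assms(1) by (rule bnd_ge_0)
  have "v = 0" if v: "(mat 1 + Y) *v v = 0" for v
  proof (rule ccontr)
    assume "v \<noteq> 0"
    then obtain i0 where i0: "v $ i0 \<noteq> 0" by (auto simp: vec_eq_iff)
    let ?m = "Max (range (\<lambda>i. absval (v $ i)))"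
    have le: "absval (v $ i) \<le> ?m" for i by (rule Max_ge) auto
    have "?m \<in> range (\<lambda>i. absval (v $ i))" by (rule Max_in) auto
    then obtain i where i: "absval (v $ i) = ?m" by force
    have m: "0 < ?m" using le[of i0] i0 by (meson absval_pos_iff less_le_trans)
    have "v + Y *v v = 0" using v by (simp add: matrix_vector_mult_add_rdistrib)
    then have "v = - (Y *v v)" by (simp add: eq_neg_iff_add_eq_0)
    then have "absval (v $ i) = absval ((Y *v v) $ i)" by (metis absval_minus vector_uminus_component)
    also have "\<dots> \<le> r * ?m"
      unfolding matrix_vector_mult_def using assms(1) le r0 m
      by (auto simp: absval_mult bnd_def intro!: absval_sum mult_mono)
    also have "\<dots> < ?m" using m assms(2) by simp
    finally show False using i by simp
  qed
  then have "inj ((*v) (mat 1 + Y))"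
    by (intro injI) (metis eq_iff_diff_eq_0 matrix_vector_mult_diff_distrib)
  then show inv: "invertible (mat 1 + Y)"
    by (simp add: invertible_left_inverse matrix_left_invertible_injective)
  show "bnd 1 (mat 1 + Y)" using assms by (intro bnd_add bnd_mat) (auto intro: bnd_mono)
  define Z where "Z = matrix_inv (mat 1 + Y)"
  have "(mat 1 + Y) ** Z = mat 1" unfolding Z_def using inv by (rule matrix_inv_props)
  then have Z: "Z = mat 1 - Y ** Z"
    by (simp add: matrix_mult_add_rdistrib eq_diff_eq)
  let ?m = "Max (range (\<lambda>(i, j). absval (Z $ i $ j)))"
  have "absval (Z $ i $ j) \<in> range (\<lambda>(i, j). absval (Z $ i $ j))" for i j
    using rangeI[of "\<lambda>(i, j). absval (Z $ i $ j)" "(i, j)"] by simp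
  then have le: "bnd ?m Z" unfolding bnd_def by (intro allI Max_ge) simp_all
  have "?m \<in> range (\<lambda>(i, j). absval (Z $ i $ j))" by (rule Max_in) auto
  then obtain i j where ij: "absval (Z $ i $ j) = ?m" by force
  have YZ: "bnd (r * ?m) (Y ** Z)" using assms(1) le by (rule bnd_mult)
  have "?m \<le> 1"
  proof (rule ccontr)
    assume m: "\<not> ?m \<le> 1"
    then have "0 < ?m" by linarith
    then have "r * ?m < 1 * ?m" using assms(2) by (rule mult_strict_right_mono [rotated])
    then have "r * ?m < ?m" by simp
    moreover have "bnd (max 1 (r * ?m)) Z"
      by (subst Z, rule bnd_diff) (auto intro: bnd_mat bnd_mono[OF YZ])
    ultimately have "absval (Z $ i $ j) \<le> max 1 (r * ?m)" "r * ?m < ?m" unfolding bnd_def by blast+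
    then show False using m unfolding ij by linarith
  qed
  then have "bnd r (Y ** Z)" using r0 by (intro bnd_mono[OF YZ]) (simp add: mult_left_le)
  then show "bnd r (matrix_inv (mat 1 + Y) - mat 1)"
    using bnd_uminus[of r "Y ** Z"] Z by (simp add: Z_def [symmetric]) (metis add_diff_cancel_left' add_uminus_conv_diff)
qed

lemma GLO_near_one:
  assumes "bnd r (A - mat 1)" "r < 1"
  shows "A \<in> GLO"
proof -
  have A: "A = mat 1 + (A - mat 1)" by simp
  note 1 = one_plus_bnd[OF assms, folded A]
  have "matrix_inv A = mat 1 + (matrix_inv A - mat 1)" by simp
  moreover have "bnd 1 (mat 1 + (matrix_inv A - mat 1))"
    using 1(3) assms(2) by (intro bnd_add bnd_mat) (auto intro: bnd_mono)
  ultimately show ?thesis using 1 unfolding GLO_def by simp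
qed

lemma absval_sign: "absval (of_int (sign p) :: 'a::nonarch_local_field_0) = 1"
  by (simp add: sign_def)

lemma absval_det_le: "bnd 1 A \<Longrightarrow> absval (det A) \<le> 1"
  unfolding det_def
  by (intro absval_sum) (auto simp: absval_mult absval_prod absval_sign bnd_def intro!: prod_le_1)

lemma GLO_det:
  assumes "A \<in> GLO"
  shows "absval (det A) = 1"
proof -
  have "det A * det (matrix_inv A) = 1"
    using assms by (simp add: det_mul [symmetric] matrix_inv_props GLO_invertible)
  then have "absval (det A) * absval (det (matrix_inv A)) = 1" by (metis absval_1 absval_mult)
  moreover have "absval (det A) \<le> 1" "absval (det (matrix_inv A)) \<le> 1"
    using assms unfolding GLO_def by (auto intro: absval_det_le)
  ultimately show ?thesis
    by (metis absval_ge_0 dual_order.antisym mult_left_le mult.commute)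
qed

section \<open>Finiteness modulo GL_n(O) and compactness\<close>

lemma finite_approx_absval:
  assumes "0 < r"
  shows "\<exists>S. finite S \<and> (\<forall>x :: 'a::nonarch_local_field_0. absval x \<le> R \<longrightarrow> (\<exists>y\<in>S. absval (x - y) \<le> r))"
proof -
  have "{x :: 'a. absval x \<le> R} \<subseteq> (\<Union>y\<in>UNIV. ball y r)" using assms centre_in_ball by blast
  then obtain S where "finite S" "{x :: 'a. absval x \<le> R} \<subseteq> (\<Union>y\<in>S. ball y r)"
    using compactE_image[OF compact_absval_le, of UNIV "\<lambda>y. ball y r" R] by auto
  moreover from this have "\<exists>y\<in>S. absval (x - y) \<le> r" if "absval x \<le> R" for x
    using that by (metis (mono_tags, lifting) UN_E dist_absval dist_commute less_imp_le mem_Collect_eq mem_ball subsetD)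
  ultimately show ?thesis by blast
qed

lemma finite_vec_coords: "finite S \<Longrightarrow> finite {v :: 'k^'n. \<forall>i. v $ i \<in> S}"
proof -
  assume "finite S"
  then have "finite (vec_lambda ` (UNIV \<rightarrow>\<^sub>E S) :: ('k^'n) set)" by (intro finite_imageI finite_PiE) auto
  moreover have "{v :: 'k^'n. \<forall>i. v $ i \<in> S} \<subseteq> vec_lambda ` (UNIV \<rightarrow>\<^sub>E S)"
    by (force simp: image_iff intro!: bexI[of _ "vec_nth _"])
  ultimately show ?thesis by (rule finite_subset [rotated])
qed

lemma finite_approx_bnd:
  assumes "0 < r"
  shows "\<exists>S. finite S \<and> (\<forall>A :: 'a::nonarch_local_field_0^'n^'n. bnd R A \<longrightarrow> (\<exists>B\<in>S. bnd r (A - B)))"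
proof -
  obtain S where S: "finite S" "\<forall>x :: 'a. absval x \<le> R \<longrightarrow> (\<exists>y\<in>S. absval (x - y) \<le> r)"
    using finite_approx_absval[OF assms] by blast
  then obtain f where f: "\<And>x :: 'a. absval x \<le> R \<Longrightarrow> f x \<in> S \<and> absval (x - f x) \<le> r" by metis
  have "finite {B :: 'a^'n^'n. \<forall>i. B $ i \<in> {v. \<forall>i. v $ i \<in> S}}"
    by (intro finite_vec_coords S)
  moreover have "\<exists>B\<in>{B :: 'a^'n^'n. \<forall>i. B $ i \<in> {v. \<forall>i. v $ i \<in> S}}. bnd r (A - B)" if "bnd R A" for A
    using that f by (intro bexI[of _ "\<chi> i j. f (A $ i $ j)"]) (auto simp: bnd_def)
  ultimately show ?thesis by blast
qed

text \<open>If g and h are close to the same approximant, then g^-1 h - 1 = g^-1 (h - g) has entries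
  of absolute value at most 1/2.\<close>

lemma finite_mod_GLO:
  "\<exists>S. finite S \<and> (\<forall>h :: 'a::nonarch_local_field_0^'n^'n. invertible h \<and> bnd R h \<and> bnd R (matrix_inv h) \<longrightarrow>
     (\<exists>g\<in>S. invertible g \<and> matrix_inv g ** h \<in> GLO))"
proof -
  let ?P = "\<lambda>h :: 'a^'n^'n. invertible h \<and> bnd R h \<and> bnd R (matrix_inv h)"
  define r where "r = inverse (2 * max R 1)"
  have r: "0 < r" unfolding r_def by simp
  obtain S where S: "finite S" "\<forall>A :: 'a^'n^'n. bnd R A \<longrightarrow> (\<exists>B\<in>S. bnd r (A - B))"
    using finite_approx_bnd[OF r] by blast
  \<comment> \<open>The approximants need not be invertible; each one is replaced by a nearby matrix
    of the set under consideration.\<close>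
  define c where "c B = (SOME h. ?P h \<and> bnd r (h - B))" for B
  show ?thesis
  proof (intro exI conjI allI impI)
    show "finite (c ` S)" using S by simp
    fix h :: "'a^'n^'n" assume h: "?P h"
    then obtain B where B: "B \<in> S" "bnd r (h - B)" using S by blast
    then have c: "?P (c B) \<and> bnd r (c B - B)" unfolding c_def using h by (metis (mono_tags, lifting) someI_ex)
    have "bnd r ((h - B) - (c B - B))" using B(2) c bnd_diff by blast
    then have "bnd (R * r) (matrix_inv (c B) ** (h - c B))" using c by (intro bnd_mult) auto
    moreover have "matrix_inv (c B) ** (h - c B) = matrix_inv (c B) ** h - mat 1"
      using c by (simp add: matrix_mult_diff_ldistrib matrix_inv_props)
    moreover have "R * r < 1" unfolding r_def by (cases "R \<le> 1") (auto simp: field_simps)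
    ultimately have "matrix_inv (c B) ** h \<in> GLO" by (metis GLO_near_one)
    then show "\<exists>g\<in>c ` S. invertible g \<and> matrix_inv g ** h \<in> GLO" using c B by blast
  qed
qed

lemma bnd_of_dist:
  fixes A B :: "'a::nonarch_local_field_0^'n^'n"
  shows "bnd (dist A B) (A - B)"
  unfolding bnd_def
proof (intro allI)
  fix i j
  have "dist (A $ i $ j) (B $ i $ j) \<le> dist A B" by (meson dist_vec_nth_le order_trans)
  then show "absval ((A - B) $ i $ j) \<le> dist A B" by (simp add: dist_absval)
qed

lemma dist_vec_le_sum: "dist (x :: 'k::metric_space^'n) y \<le> (\<Sum>i\<in>UNIV. dist (x $ i) (y $ i))"
  unfolding dist_vec_def by (rule L2_set_le_sum) auto

lemma dist_of_bnd:
  fixes A B :: "'a::nonarch_local_field_0^'n^'n"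
  assumes "bnd r (A - B)"
  shows "dist A B \<le> real CARD('n) * (real CARD('n) * r)"
proof -
  have "dist (A $ i) (B $ i) \<le> real CARD('n) * r" for i
    by (rule order_trans[OF dist_vec_le_sum], rule sum_bounded_above)
      (use assms in \<open>auto simp: bnd_def dist_absval\<close>)
  then have "(\<Sum>i\<in>UNIV. dist (A $ i) (B $ i)) \<le> real CARD('n) * (real CARD('n) * r)"
    by (intro sum_bounded_above) simp
  then show ?thesis using dist_vec_le_sum[of A B] by simp
qed

text \<open>Closedness comes from the group structure: a matrix g near some h in \<open>GLO\<close>
  has h^-1 g near 1, hence in \<open>GLO\<close>.\<close>

lemma compact_GLO: "compact (GLO :: ('a::nonarch_local_field_0^'n^'n) set)"
proof -
  have "bounded (GLO :: ('a^'n^'n) set)"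
    unfolding bounded_def
  proof (intro exI ballI)
    fix g :: "'a^'n^'n" assume "g \<in> GLO"
    then have "bnd 1 (0 - g)" by (simp add: GLO_def bnd_uminus)
    then show "dist 0 g \<le> real CARD('n) * (real CARD('n) * 1)" by (rule dist_of_bnd)
  qed
  moreover have "closed (GLO :: ('a^'n^'n) set)"
    unfolding closure_subset_eq [symmetric]
  proof
    fix g :: "'a^'n^'n" assume "g \<in> closure GLO"
    then obtain h where h: "h \<in> GLO" "dist h g < 1"
      by (meson closure_approachable zero_less_one)
    have "bnd (dist g h) (g - h)" by (rule bnd_of_dist)
    then have "bnd (dist g h) (matrix_inv h ** (g - h))"
      using h bnd_mult[of 1 "matrix_inv h" "dist g h"] unfolding GLO_def by simp
    moreover have "matrix_inv h ** (g - h) = matrix_inv h ** g - mat 1"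
      using h by (simp add: matrix_mult_diff_ldistrib matrix_inv_props GLO_def)
    ultimately have "matrix_inv h ** g \<in> GLO"
      using h by (intro GLO_near_one[of "dist g h"]) (auto simp: dist_commute)
    then have "h ** (matrix_inv h ** g) \<in> GLO" using h GLO_mult by blast
    then show "g \<in> GLO" using h by (simp add: matrix_mul_assoc matrix_inv_props GLO_def)
  qed
  ultimately show ?thesis by (simp add: compact_eq_bounded_closed)
qed

lemma GLO_transvections:
  fixes N :: "'a::nonarch_local_field_0^'n^'n"
  assumes "bnd 1 N" "N ** N = 0"
  shows "mat 1 + N \<in> GLO"
proof (rule GLO_I)
  show "(mat 1 + N) ** (mat 1 - N) = mat 1"
    using assms by (simp add: matrix_mult_add_rdistrib matrix_mult_diff_ldistrib)
qed (use assms in \<open>simp_all add: bnd_add bnd_diff bnd_mat\<close>)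

lemma GLO_swap: "(\<chi> i j. of_bool (j = Transposition.transpose a b i)) \<in> (GLO :: ('a::nonarch_local_field_0^'n^'n) set)"
proof (rule GLO_I)
  let ?P = "(\<chi> i j. of_bool (j = Transposition.transpose a b i)) :: 'a^'n^'n"
  show "?P ** ?P = mat 1"
    by (simp add: vec_eq_iff matrix_matrix_mult_def mat_def of_bool_def
        if_distrib [of "\<lambda>x. x * _"] cong: if_cong)
qed (auto simp: bnd_def)

text \<open>Smith normal form over the ring of integers, without ordering the diagonal. The set
  \<open>S\<close> in the induction collects the indices whose row and column are already cleared.
  Its purpose is to supply representatives of double cosets that are symmetric matrices.\<close>

lemma GLO_cartan:
  fixes A :: "'a::nonarch_local_field_0^'n^'n"
  assumes "invertible A"
  shows "\<exists>k\<in>GLO. \<exists>l\<in>GLO. \<forall>i j. i \<noteq> j \<longrightarrow> (k ** A ** l) $ i $ j = 0"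
proof -
  have "\<exists>k\<in>GLO. \<exists>l\<in>GLO. \<forall>i j. i \<noteq> j \<longrightarrow> (k ** A ** l) $ i $ j = 0"
    if "invertible A" "\<forall>i j. (i \<in> S \<or> j \<in> S) \<and> i \<noteq> j \<longrightarrow> A $ i $ j = 0" for S and A :: "'a^'n^'n"
    using that
  proof (induction "card (- S)" arbitrary: S A)
    case 0
    then have "S = UNIV" by auto
    then show ?case using 0 by (intro bexI[of _ "mat 1"]) auto
  next
    case (Suc m)
    then have "- S \<noteq> {}" by (metis card.empty nat.distinct(1))
    \<comment> \<open>The pivot is an entry of maximal absolute value in the remaining block, so
      that all quotients by it are integral. Column \<open>b\<close> is then exchanged with column
      \<open>a\<close> to move it to the diagonal.\<close>
    have "\<exists>p\<in>(-S) \<times> (-S). \<forall>q\<in>(-S) \<times> (-S). (\<lambda>(i, j). absval (A $ i $ j)) q \<le> (\<lambda>(i, j). absval (A $ i $ j)) p"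
    proof -
      let ?f = "\<lambda>(i, j). absval (A $ i $ j)"
      have "Max (?f ` ((-S) \<times> (-S))) \<in> ?f ` ((-S) \<times> (-S))"
        using \<open>- S \<noteq> {}\<close> by (intro Max_in) auto
      then obtain p where "p \<in> (-S) \<times> (-S)" "?f p = Max (?f ` ((-S) \<times> (-S)))" by (metis (no_types, lifting) imageE)
      then show ?thesis by (intro bexI[of _ p]) (auto intro!: Max_ge)
    qed
    then obtain a b where ab: "a \<notin> S" "b \<notin> S"
      "\<And>i j. i \<notin> S \<Longrightarrow> j \<notin> S \<Longrightarrow> absval (A $ i $ j) \<le> absval (A $ a $ b)" by auto
    have nz: "A $ a $ b \<noteq> 0"
    proof
      assume "A $ a $ b = 0"
      then have "A $ i $ j = 0" if "i \<notin> S" "j \<notin> S" for i j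
        using ab(3)[OF that] by (metis absval_0 absval_eq_0_iff absval_ge_0 order_antisym)
      then have "A $ a $ j = 0" for j using ab(1) Suc.prems(2) by (cases "j \<in> S") metis+
      then have "row a A = 0" by (simp add: row_def vec_eq_iff)
      then have "det A = 0" by (rule det_zero_row(1))
      then show False using Suc.prems by (simp add: invertible_det_nz)
    qed
    define P where "P = (\<chi> i j. of_bool (j = Transposition.transpose a b i) :: 'a^'n^'n)"
    have P: "P \<in> GLO" unfolding P_def by (rule GLO_swap)
    define B where "B = A ** P"
    have B: "B $ i $ j = A $ i $ Transposition.transpose a b j" for i j
    proof -
      have "(j = Transposition.transpose a b k) = (k = Transposition.transpose a b j)" for k
        by (metis transpose_involutory)
      then show ?thesis
        by (simp add: B_def P_def matrix_matrix_mult_def of_bool_def if_distrib [of "\<lambda>x. _ * x"] cong: if_cong)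
    qed
    have Baa: "B $ a $ a = A $ a $ b" by (simp add: B)
    have Ble: "absval (B $ i $ j) \<le> absval (B $ a $ a)" if "i \<notin> S" "j \<notin> S" for i j
      using that ab by (auto simp: B Baa Transposition.transpose_def)
    have B0: "B $ i $ j = 0" if "i \<in> S \<or> j \<in> S" "i \<noteq> j" for i j
      using that Suc.prems(2) ab(1,2) by (auto simp: B Transposition.transpose_def)
    \<comment> \<open>\<open>L\<close> clears the column of the pivot and \<open>M\<close> its row;
      both have square 0.\<close>
    define L where "L = (\<chi> i j. if j = a \<and> i \<noteq> a then - B $ i $ a / B $ a $ a else 0 :: 'a^'n^'n)"
    define M where "M = (\<chi> i j. if i = a \<and> j \<noteq> a then - B $ a $ j / B $ a $ a else 0 :: 'a^'n^'n)"
    have small: "absval (B $ i $ j / B $ a $ a) \<le> 1" if "i = a \<or> j = a" for i j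
    proof (cases "i \<in> S \<or> j \<in> S")
      case True
      then show ?thesis using B0[of i j] that ab(1) by (cases "i = j") auto
    next
      case False
      then show ?thesis using Ble[of i j] nz by (simp add: absval_divide Baa divide_le_eq_1)
    qed
    have "mat 1 + L \<in> GLO"
      by (rule GLO_transvections)
        (use small in \<open>auto simp: L_def bnd_def matrix_matrix_mult_def vec_eq_iff absval_divide intro!: sum.neutral\<close>)
    moreover have "mat 1 + M \<in> GLO"
      by (rule GLO_transvections)
        (use small in \<open>auto simp: M_def bnd_def matrix_matrix_mult_def vec_eq_iff absval_divide intro!: sum.neutral\<close>)
    ultimately have LM: "mat 1 + L \<in> GLO" "mat 1 + M \<in> GLO" .
    define C where "C = (mat 1 + L) ** B ** (mat 1 + M)"
    have LB: "(L ** B) $ i $ j = (if i = a then 0 else - B $ i $ a / B $ a $ a * B $ a $ j)" for i j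
      by (simp add: L_def matrix_matrix_mult_def if_distrib [of "\<lambda>x. x * _"] cong: if_cong)
    have XM: "(Z ** M) $ i $ j = (if j = a then 0 else - Z $ i $ a * B $ a $ j / B $ a $ a)" for Z i j
      by (simp add: M_def matrix_matrix_mult_def if_distrib [of "\<lambda>x. _ * x"] cong: if_cong)
    have C: "C $ i $ j = B $ i $ j + (L ** B) $ i $ j + (if j = a then 0 else - (B $ i $ a + (L ** B) $ i $ a) * B $ a $ j / B $ a $ a)" for i j
      unfolding C_def by (simp add: matrix_mult_add_rdistrib matrix_add_ldistrib XM left_diff_distrib diff_divide_distrib)
    have "invertible C" unfolding C_def B_def
      using LM P Suc.prems(1) by (intro invertible_mult) (auto dest: GLO_invertible)
    moreover have "C $ i $ j = 0" if ij: "i \<in> insert a S \<or> j \<in> insert a S" "i \<noteq> j" for i j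
    proof -
      have "B $ a $ a \<noteq> 0" using nz Baa by simp
      then show ?thesis using ij B0[of i j] B0[of i a] B0[of a j] ab(1)
        by (auto simp: C LB)
    qed
    moreover have "m = card (- insert a S)"
      using Suc.hyps(2) ab(1) by (simp add: Compl_insert)
    ultimately obtain k l where kl: "k \<in> GLO" "l \<in> GLO" "\<forall>i j. i \<noteq> j \<longrightarrow> (k ** C ** l) $ i $ j = 0"
      using Suc.hyps(1)[of "insert a S" C] by blast
    have "k ** C ** l = (k ** (mat 1 + L)) ** A ** (P ** (mat 1 + M) ** l)"
      unfolding C_def B_def by (simp only: matrix_mul_assoc)
    then show ?case using kl LM P by (metis GLO_mult)
  qed
  from this[OF assms, of "{}"] show ?thesis by simp
qed

section \<open>The companion matrix and its commutant\<close>

text \<open>The index type carries no order; an enumeration is fixed once so that a companion matrix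
  can be written down.\<close>

definition idx :: "'n::finite \<Rightarrow> nat" where
  "idx = (SOME f. bij_betw f UNIV {..<CARD('n)})"

lemma bij_idx: "bij_betw (idx :: 'n::finite \<Rightarrow> nat) UNIV {..<CARD('n)}"
proof -
  have "\<exists>f. bij_betw f (UNIV :: 'n set) {..<CARD('n)}"
    using ex_bij_betw_finite_nat[of "UNIV :: 'n set"] by (simp add: atLeast0LessThan)
  then show ?thesis unfolding idx_def by (rule someI_ex)
qed

definition ix :: "nat \<Rightarrow> 'n::finite" where
  "ix = the_inv_into UNIV idx"

lemma idx_less: "idx (i :: 'n::finite) < CARD('n)"
  using bij_idx bij_betwE by blast

lemma ix_idx [simp]: "ix (idx i) = i"
  unfolding ix_def using bij_idx by (metis UNIV_I bij_betw_imp_inj_on the_inv_into_f_f)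

lemma idx_ix [simp]: "k < CARD('n) \<Longrightarrow> idx (ix k :: 'n::finite) = k"
  unfolding ix_def using bij_idx[where ?'n = 'n]
  by (metis bij_betw_def f_the_inv_into_f lessThan_iff)

lemma idx_eq_iff: "k < CARD('n) \<Longrightarrow> idx (i :: 'n::finite) = k \<longleftrightarrow> i = ix k"
  by auto

text \<open>The companion matrix of T^n - c: it maps e_j to e_(j+1) and the last basis vector to c
  e_0. For n = 1 the first case never occurs and the matrix is (c).\<close>

definition cyc :: "'k::field \<Rightarrow> 'k^'n^'n" where
  "cyc c = (\<chi> i j. if idx i = Suc (idx j) then 1 else if idx i = 0 \<and> Suc (idx j) = CARD('n) then c else 0)"

lemma cyc_mult_nth:
  "(cyc c ** A) $ i $ j = (if idx i = 0 then c * A $ ix (CARD('n) - 1) $ j else A $ ix (idx i - 1) $ j)"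
  for A :: "'k::field^'m^'n"
proof (cases "idx i = 0")
  case True
  have "Suc (idx k) = CARD('n) \<longleftrightarrow> k = ix (CARD('n) - 1)" for k :: 'n
    using idx_eq_iff[of "CARD('n) - 1" k] by auto
  then have "cyc c $ i $ k * A $ k $ j = (if k = ix (CARD('n) - 1) then c * A $ k $ j else 0)" for k
    using True by (simp add: cyc_def)
  then show ?thesis using True by (simp add: matrix_matrix_mult_def)
next
  case False
  have "idx i = Suc (idx k) \<longleftrightarrow> k = ix (idx i - 1)" for k :: 'n
    using idx_eq_iff[of "idx i - 1" k] False idx_less[of i] by auto
  then have "cyc c $ i $ k * A $ k $ j = (if k = ix (idx i - 1) then A $ k $ j else 0)" for k
    using False by (simp add: cyc_def)
  then show ?thesis using False by (simp add: matrix_matrix_mult_def)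
qed

lemma mult_axis: "((A :: 'k::semiring_1^'n^'m) *v axis j 1) $ i = A $ i $ j"
  by (simp add: matrix_vector_mult_def axis_def if_distrib [of "\<lambda>x. _ * x"] cong: if_cong)

lemma matrix_eqI_axis:
  "(\<And>j. A *v axis j 1 = B *v axis j 1) \<Longrightarrow> A = (B :: 'k::semiring_1^'n^'m)"
  by (metis mult_axis vec_eq_iff)

lemma cyc_axis:
  "k < CARD('n) \<Longrightarrow> (cyc c :: 'k::field^'n^'n) *v axis (ix k) 1 = (if Suc k = CARD('n) then c *s axis (ix 0) 1 else axis (ix (Suc k)) 1)"
  unfolding vec_eq_iff mult_axis using idx_less[where ?'n = 'n] by (auto simp: cyc_def axis_def idx_eq_iff) (metis less_irrefl)

text \<open>Horner's scheme for the matrix product \<open>**\<close>; the product \<open>*\<close>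
  on this type is entrywise, so \<open>poly\<close> would evaluate something else.\<close>

definition meval :: "'k::comm_ring_1^'n^'n \<Rightarrow> 'k poly \<Rightarrow> 'k^'n^'n" where
  "meval M f = fold_coeffs (\<lambda>a B. mat a + M ** B) f 0"

lemma mat_0 [simp]: "mat 0 = 0"
  by (simp add: mat_def vec_eq_iff)

lemma mat_add: "mat (a + b) = mat a + (mat b :: 'k::comm_ring_1^'n^'n)"
  by (simp add: mat_def vec_eq_iff)

lemma meval_0 [simp]: "meval M 0 = 0"
  by (simp add: meval_def)

lemma meval_pCons [simp]: "meval M (pCons a f) = mat a + M ** meval M f"
  by (cases "a = 0 \<and> f = 0") (auto simp: meval_def)

lemma meval_1 [simp]: "meval M 1 = mat 1"
  by (simp add: one_pCons)

lemma meval_add: "meval M (f + g) = meval M f + meval M g"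
  by (induction f g rule: poly_induct2) (simp_all add: mat_add matrix_add_ldistrib)

lemma meval_smult: "meval M (smult a f) = mat a ** meval M f"
proof (induction f)
  case (pCons b f)
  have "mat a ** (M ** meval M f) = M ** (mat a ** meval M f)"
    by (metis mat_mult_commute matrix_mul_assoc)
  then show ?case by (simp add: matrix_add_ldistrib mat_mult_mat pCons.IH)
qed simp

lemma meval_mult: "meval M (f * g) = meval M f ** meval M g"
  by (induction f) (simp_all add: meval_add meval_smult matrix_mult_add_rdistrib matrix_mul_assoc)

lemma meval_commute: "meval M f ** meval M g = meval M g ** meval M f"
  by (metis meval_mult mult.commute)

lemma meval_X: "meval M [:0, 1:] = M"
  by simp

lemma meval_commute_base: "meval M f ** M = M ** meval M f"
  using meval_commute[of M f "[:0, 1:]"] by simp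

lemma meval_minus: "meval M (- f) = - meval M f"
  using meval_add[of M f "- f"] by (simp add: eq_neg_iff_add_eq_0 add.commute)

lemma meval_diff: "meval M (f - g) = meval M f - meval M g"
  using meval_add[of M f "- g"] by (simp add: meval_minus)

lemma meval_sum: "meval M (sum f S) = (\<Sum>i\<in>S. meval M (f i))"
  by (induction S rule: infinite_finite_induct) (simp_all add: meval_add)

lemma meval_monom: "meval M (monom a k) = mat a ** meval M (monom 1 k)"
  by (metis meval_smult mult.right_neutral smult_monom)

lemma meval_power_cong: "meval M f = meval M g \<Longrightarrow> meval M (f ^ k) = meval M (g ^ k)"
  by (induction k) (simp_all add: meval_mult)

lemma commute_meval:
  assumes "A ** M = M ** A"
  shows "A ** meval M f = meval M f ** A"
proof (induction f)
  case (pCons a f)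
  have "A ** (M ** meval M f) = M ** (A ** meval M f)" by (metis assms matrix_mul_assoc)
  also have "\<dots> = M ** meval M f ** A" by (simp add: pCons.IH matrix_mul_assoc)
  finally show ?case by (simp add: matrix_add_ldistrib matrix_mult_add_rdistrib mat_mult_commute[of a A])
qed simp

lemma cyc_power_axis:
  "i + k < CARD('n) \<Longrightarrow> meval (cyc c :: 'k::field^'n^'n) (monom 1 k) *v axis (ix i) 1 = axis (ix (i + k)) 1"
  by (induction k) (simp_all add: monom_Suc cyc_axis matrix_vector_mul_assoc [symmetric])

text \<open>On e_0 the powers run through the basis and return with the factor c. Every basis vector
  is a power applied to e_0, and powers commute.\<close>

lemma cyc_power_CARD: "meval (cyc c :: 'k::field^'n^'n) (monom 1 CARD('n)) = mat c"
proof (rule matrix_eqI_axis)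
  fix j :: 'n
  let ?M = "cyc c :: 'k^'n^'n" and ?e = "axis (ix 0) 1 :: 'k^'n"
  have n: "0 < CARD('n)" by simp
  have "meval ?M (monom 1 CARD('n)) = ?M ** meval ?M (monom 1 (CARD('n) - 1))"
    using n by (metis Suc_diff_1 add_0 mat_0 meval_pCons monom_Suc)
  then have 0: "meval ?M (monom 1 CARD('n)) *v ?e = mat c *v ?e"
    using n by (simp add: matrix_vector_mul_assoc [symmetric] cyc_power_axis cyc_axis)
      (simp add: vec_eq_iff mult_axis, simp add: mat_def axis_def)
  have j: "axis j 1 = meval ?M (monom 1 (idx j)) *v ?e" using idx_less[of j] by (simp add: cyc_power_axis)
  have "meval ?M (monom 1 CARD('n)) *v axis j 1 = meval ?M (monom 1 (idx j)) *v (meval ?M (monom 1 CARD('n)) *v ?e)"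
    unfolding j by (metis matrix_vector_mul_assoc meval_commute)
  also have "\<dots> = mat c *v (meval ?M (monom 1 (idx j)) *v ?e)"
    unfolding 0 by (metis matrix_vector_mul_assoc mat_mult_commute)
  finally show "meval ?M (monom 1 CARD('n)) *v axis j 1 = mat c *v axis j 1" unfolding j .
qed

lemma cyc_power_CARD_mult: "meval (cyc c :: 'k::field^'n^'n) (monom 1 (CARD('n) * q)) = mat (c ^ q)"
proof (induction q)
  case (Suc q)
  have "monom (1::'k) (CARD('n) * Suc q) = monom 1 CARD('n) * monom 1 (CARD('n) * q)"
    by (simp add: mult_monom)
  then show ?case by (simp only: meval_mult Suc.IH cyc_power_CARD mat_mult_mat power_Suc)
qed (simp add: monom_0)

text \<open>Identifies k^n with k[X]/(X^n - c) through representatives of degree below n, with e_0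
  corresponding to 1.\<close>

definition col_poly :: "'k::comm_ring_1^'n \<Rightarrow> 'k poly" where
  "col_poly v = (\<Sum>i\<in>UNIV. monom (v $ i) (idx i))"

lemma coeff_col_poly: "coeff (col_poly (v :: 'k::comm_ring_1^'n)) k = (if k < CARD('n) then v $ ix k else 0)"
proof -
  have "coeff (col_poly v) k = (\<Sum>i\<in>UNIV. if idx i = k then v $ i else 0)"
    by (simp add: col_poly_def coeff_sum)
  also have "\<dots> = (if k < CARD('n) then v $ ix k else 0)"
  proof (cases "k < CARD('n)")
    case True
    then show ?thesis by (simp add: idx_eq_iff)
  next
    case False
    then have "idx i \<noteq> k" for i :: 'n using idx_less[of i] by auto
    then show ?thesis using False by simp
  qed
  finally show ?thesis .
qed

lemma meval_col_poly_axis: "meval (cyc c :: 'k::field^'n^'n) (col_poly v) *v axis (ix 0) 1 = v"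
proof -
  have "(meval (cyc c :: 'k^'n^'n) (monom a (idx i)) *v axis (ix 0) 1) $ k = (if k = i then a else 0)" for i k a
    using cyc_power_axis[of 0 "idx i", where ?'n = 'n and c = c] idx_less[of i]
    by (subst meval_monom, subst matrix_vector_mul_assoc [symmetric]) (simp add: mult_axis, simp add: mat_def)
  then show ?thesis
    by (simp add: col_poly_def meval_sum vec_eq_iff mult_axis)
qed

text \<open>Since e_0 is a cyclic vector, a matrix commuting with \<open>cyc c\<close> is determined
  by the image of e_0.\<close>

lemma commutant_cyc:
  assumes "A ** cyc c = cyc c ** (A :: 'k::field^'n^'n)"
  shows "A = meval (cyc c) (col_poly (A *v axis (ix 0) 1))"
proof (rule matrix_eqI_axis)
  fix j :: 'n
  let ?M = "cyc c :: 'k^'n^'n" and ?e = "axis (ix 0) 1 :: 'k^'n"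
  let ?f = "col_poly (A *v ?e)"
  have j: "axis j 1 = meval ?M (monom 1 (idx j)) *v ?e" using idx_less[of j] by (simp add: cyc_power_axis)
  have "A *v axis j 1 = meval ?M (monom 1 (idx j)) *v (A *v ?e)"
    unfolding j using commute_meval[OF assms] by (metis matrix_vector_mul_assoc)
  also have "\<dots> = meval ?M (monom 1 (idx j)) *v (meval ?M ?f *v ?e)" by (simp only: meval_col_poly_axis)
  also have "\<dots> = meval ?M ?f *v axis j 1" unfolding j by (metis matrix_vector_mul_assoc meval_commute)
  finally show "A *v axis j 1 = meval ?M ?f *v axis j 1" .
qed

section \<open>Integral polynomials in the companion matrix\<close>

definition int_poly :: "'a::nonarch_local_field_0 poly \<Rightarrow> bool" where
  "int_poly f \<longleftrightarrow> (\<forall>i. absval (coeff f i) \<le> 1)"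

lemma int_poly_pCons [simp]: "int_poly (pCons a f) \<longleftrightarrow> absval a \<le> 1 \<and> int_poly f"
  unfolding int_poly_def by (auto simp: coeff_pCons split: nat.splits)

lemma int_poly_0 [simp]: "int_poly 0" and int_poly_1 [simp]: "int_poly 1"
  by (simp add: int_poly_def) (simp add: one_pCons, simp add: int_poly_def)

lemma int_poly_add: "int_poly f \<Longrightarrow> int_poly g \<Longrightarrow> int_poly (f + g)"
  unfolding int_poly_def by (simp add: order_trans[OF absval_add])

lemma int_poly_uminus: "int_poly f \<Longrightarrow> int_poly (- f)"
  unfolding int_poly_def by simp

lemma int_poly_mult: "int_poly f \<Longrightarrow> int_poly g \<Longrightarrow> int_poly (f * g)"
  unfolding int_poly_def coeff_mult
  by (auto intro!: absval_sum simp: absval_mult mult_le_one)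

lemma int_poly_power: "int_poly f \<Longrightarrow> int_poly (f ^ k)"
  by (induction k) (simp_all add: int_poly_mult)

lemma int_poly_sum: "(\<And>i. i \<in> S \<Longrightarrow> int_poly (f i)) \<Longrightarrow> int_poly (sum f S)"
  by (induction S rule: infinite_finite_induct) (simp_all add: int_poly_add)

lemma int_poly_smult: "absval a \<le> 1 \<Longrightarrow> int_poly f \<Longrightarrow> int_poly (smult a f)"
  unfolding int_poly_def by (simp add: absval_mult mult_le_one)

abbreviation Pi_mat :: "'a::nonarch_local_field_0^'n^'n" where
  "Pi_mat \<equiv> cyc uniformizer"

lemma bnd_Pi: "bnd 1 Pi_mat"
  unfolding bnd_def cyc_def using absval_uniformizer_less_1 by (auto intro: less_imp_le)

lemma bnd_meval: "int_poly f \<Longrightarrow> bnd 1 (meval Pi_mat f)"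
  by (induction f) (auto intro!: bnd_add bnd_mat bnd_0 intro: bnd_mult'[OF bnd_Pi])

lemma invertible_Pi_monom:
  assumes "a \<noteq> 0"
  shows "invertible (meval (Pi_mat :: 'a::nonarch_local_field_0^'n^'n) (monom a k))"
proof -
  let ?w = "uniformizer :: 'a" and ?M = "Pi_mat :: 'a^'n^'n"
  have "?M ** (meval ?M (monom 1 (CARD('n) - 1)) ** mat (inverse ?w)) = mat 1"
  proof -
    have "?M ** meval ?M (monom 1 (CARD('n) - 1)) = meval ?M (monom 1 CARD('n))"
      by (metis Suc_diff_1 add_0 mat_0 meval_pCons monom_Suc zero_less_card_finite)
    then show ?thesis by (simp add: matrix_mul_assoc cyc_power_CARD mat_mult_mat)
  qed
  then have M: "invertible ?M" by (rule matrix_inv_unique_right)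
  have "invertible (meval ?M (monom 1 k))"
    by (induction k) (simp_all add: monom_0 monom_Suc invertible_mult M one_pCons [symmetric] invertible_def[of "mat 1"])
  then show ?thesis using assms by (subst meval_monom) (intro invertible_mult invertible_mat)
qed

text \<open>Write f = a (1 - y) with y divisible by X. The geometric series up to y^(n-1) inverts 1
  - y up to y^n, and y^n takes a value divisible by w because Pi^n = w.\<close>

lemma meval_GLO:
  fixes f :: "'a::nonarch_local_field_0 poly"
  assumes f: "int_poly f" "absval (coeff f 0) = 1"
  shows "meval (Pi_mat :: 'a^'n^'n) f \<in> GLO"
proof -
  let ?M = "Pi_mat :: 'a^'n^'n" and ?w = "uniformizer :: 'a"
  obtain a g where fa: "f = pCons a g" by (cases f)
  have a: "absval a = 1" "a \<noteq> 0" and g: "int_poly g" using f by (auto simp: fa)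
  define y where "y = - (monom 1 1 * smult (inverse a) g)"
  have iy: "int_poly y" unfolding y_def
    by (intro int_poly_uminus int_poly_mult int_poly_smult g) (auto simp: absval_inverse a monom_altdef)
  have fy: "f = smult a (1 - y)" using a by (simp add: y_def fa monom_altdef smult_add_right) (simp add: one_pCons)
  have geo: "(1 - y) * (\<Sum>i<CARD('n). y ^ i) = 1 - y ^ CARD('n)"
    by (simp add: one_diff_power_eq)
  have "y ^ CARD('n) = monom 1 CARD('n) * (- smult (inverse a) g) ^ CARD('n)"
    unfolding y_def minus_mult_right power_mult_distrib by (simp add: monom_power)
  then have yn: "meval ?M (y ^ CARD('n)) = mat ?w ** meval ?M ((- smult (inverse a) g) ^ CARD('n))"
    by (simp add: meval_mult cyc_power_CARD)
  have "bnd (absval ?w * 1) (meval ?M (y ^ CARD('n)))"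
    unfolding yn by (intro bnd_mult bnd_mat bnd_meval int_poly_power int_poly_uminus int_poly_smult g)
      (auto simp: absval_inverse a)
  then have G: "meval ?M (1 - y ^ CARD('n)) \<in> GLO"
    by (intro GLO_near_one[of "absval ?w"]) (auto simp: meval_diff bnd_uminus)
  define B where "B = meval ?M (\<Sum>i<CARD('n). y ^ i)"
  have "bnd 1 B" unfolding B_def by (intro bnd_meval int_poly_sum int_poly_power iy)
  have "meval ?M f ** (mat (inverse a) ** B) = mat a ** mat (inverse a) ** (meval ?M (1 - y) ** B)"
    unfolding fy meval_smult by (metis mat_mult_commute matrix_mul_assoc)
  also have "\<dots> = meval ?M (1 - y ^ CARD('n))"
    using a by (simp add: mat_mult_mat B_def meval_mult [symmetric] geo)
  finally have "meval ?M f ** (mat (inverse a) ** B ** matrix_inv (meval ?M (1 - y ^ CARD('n)))) = mat 1"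
    using G by (metis matrix_mul_assoc matrix_inv_props(1) GLO_invertible)
  moreover have "bnd 1 (mat (inverse a) ** B ** matrix_inv (meval ?M (1 - y ^ CARD('n))))"
    using G \<open>bnd 1 B\<close> a unfolding GLO_def
    by (intro bnd_mult'[of 1 _ 1]) (auto intro: bnd_mat simp: absval_inverse)
  ultimately show ?thesis using f bnd_meval GLO_I by blast
qed

lemma val_unique: "x \<noteq> (0 :: 'a::nonarch_local_field_0) \<Longrightarrow> absval x = absval (uniformizer :: 'a) powi k \<Longrightarrow> val x = k"
  using absval_eq_val[of x] absval_uniformizer_powi_inject by metis

lemma val_mult: "x \<noteq> 0 \<Longrightarrow> y \<noteq> (0 :: 'a::nonarch_local_field_0) \<Longrightarrow> val (x * y) = val x + val y"
  using absval_eq_val[of x] absval_eq_val[of y]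
  by (intro val_unique) (simp_all add: absval_mult power_int_add)

lemma val_power: "x \<noteq> (0 :: 'a::nonarch_local_field_0) \<Longrightarrow> val (x ^ k) = int k * val x"
proof (induction k)
  case 0
  show ?case by (rule val_unique) simp_all
qed (simp add: val_mult algebra_simps)

lemma val_uniformizer [simp]: "val uniformizer = 1"
  by (rule val_unique) simp_all

lemma val_eq_0_iff: "x \<noteq> (0 :: 'a::nonarch_local_field_0) \<Longrightarrow> val x = 0 \<longleftrightarrow> absval x = 1"
  using absval_eq_val[of x] val_unique[of x 0] by auto

lemma det_mat: "det (mat c :: 'k::comm_ring_1^'n^'n) = c ^ CARD('n)"
  by (subst det_diagonal) (auto simp: mat_def)

text \<open>That det Pi has valuation 1 is read off from Pi^n = w; the determinant is never
  expanded.\<close>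

lemma det_Pi_monom:
  assumes "a \<noteq> (0 :: 'a::nonarch_local_field_0)"
  shows "val (det (meval (Pi_mat :: 'a^'n^'n) (monom a k))) = int CARD('n) * val a + int k"
proof -
  let ?M = "Pi_mat :: 'a^'n^'n"
  have pow: "det (meval ?M (monom 1 k)) = det ?M ^ k" for k
    by (induction k) (simp_all add: monom_0 monom_Suc det_mul one_pCons [symmetric])
  have nz: "det ?M \<noteq> 0"
    using invertible_Pi_monom[of "1 :: 'a" 1, where ?'n = 'n] pow[of 1] by (simp add: invertible_det_nz)
  have "det ?M ^ CARD('n) = uniformizer ^ CARD('n)"
    using pow[of "CARD('n)"] by (simp add: cyc_power_CARD det_mat)
  then have "int CARD('n) * val (det ?M) = int CARD('n) * 1"
    using val_power[OF nz] val_power[OF uniformizer_nonzero] by (metis val_uniformizer)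
  then have "val (det ?M) = 1" by simp
  then show ?thesis using assms nz
    by (subst meval_monom) (simp add: det_mul pow det_mat val_mult val_power)
qed

text \<open>Multiply h by the power of Pi that makes it integral but no longer after division by Pi.
  Some column of the result then generates, over O[Pi], the full standard lattice, so the inverse is
  controlled by the conjugates h^-1 Pi^k h alone.\<close>

lemma normalize_lattice:
  fixes h :: "'a::nonarch_local_field_0^'n^'n"
  assumes h: "invertible h" and r: "\<And>k. k < CARD('n) \<Longrightarrow> bnd r (matrix_inv h ** meval Pi_mat (monom 1 k) ** h)"
  shows "\<exists>(m :: int) k. bnd 1 (meval Pi_mat (monom (uniformizer powi m) k) ** h) \<and>
    bnd r (matrix_inv (meval Pi_mat (monom (uniformizer powi m) k) ** h))"
proof -
  let ?M = "Pi_mat :: 'a^'n^'n" and ?w = "uniformizer :: 'a" and ?n = "CARD('n)"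
  have w: "0 < absval ?w" "absval ?w < 1" by simp_all
  obtain R where R: "1 \<le> R" "bnd R h" using exists_bnd by blast
  obtain m where m: "absval ?w ^ m < inverse R" using real_arch_pow_inv[of "inverse R" "absval ?w"] R w by auto
  \<comment> \<open>The value of \<open>e j\<close> at Pi is w^m Pi^(-j), because Pi^-1 = w^-1
    Pi^(n-1); no negative power of X is needed.\<close>
  define e where "e j = monom (inverse ?w ^ j * ?w ^ m) (j * (?n - 1))" for j
  have e_Suc: "meval ?M (e j) = ?M ** meval ?M (e (Suc j))" for j
  proof -
    have "[:0, 1:] * e (Suc j) = monom (inverse ?w) ?n * e j"
      by (simp add: e_def monom_Suc [symmetric] mult_monom)
    then have "?M ** meval ?M (e (Suc j)) = meval ?M (monom (inverse ?w) ?n) ** meval ?M (e j)"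
      by (metis meval_X meval_mult)
    also have "meval ?M (monom (inverse ?w) ?n) = mat 1"
      by (subst meval_monom) (simp add: cyc_power_CARD mat_mult_mat)
    finally show ?thesis by simp
  qed
  define G where "G j = meval ?M (e j) ** h" for j
  have G_Suc: "?M ** G (Suc j) = G j" for j unfolding G_def using e_Suc[of j] by (simp add: matrix_mul_assoc)
  have "absval ?w ^ m * R \<le> 1" using m R by (simp add: field_simps)
  then have "bnd 1 (mat (?w ^ m) ** h)"
    using R by (intro bnd_mult'[OF bnd_mat R(2)]) (auto simp: absval_power)
  then have G0: "bnd 1 (G 0)" unfolding G_def e_def by (simp add: monom_0)
  \<comment> \<open>Every n-th step divides by w, so permanent integrality would force the
    invertible matrix \<open>G 0\<close> to vanish.\<close>
  have "\<exists>j. \<not> bnd 1 (G j)"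
  proof (rule ccontr)
    assume "\<nexists>j. \<not> bnd 1 (G j)"
    then have all: "bnd 1 (G j)" for j by blast
    have Gn: "G (j + ?n * q) = mat (inverse ?w ^ q) ** G j" for j q
    proof -
      have "meval ?M (monom 1 (?n * q)) = mat (?w ^ q)" for q
        by (rule cyc_power_CARD_mult)
      then have "meval ?M (monom (inverse ?w ^ (?n * q)) (?n * q * (?n - 1))) = mat (inverse ?w ^ (?n * q)) ** mat (?w ^ (q * (?n - 1)))"
        by (subst meval_monom) (simp add: mult.assoc)
      also have "\<dots> = mat (inverse ?w ^ q)"
      proof -
        have "?n * q = q + q * (?n - 1)" by (cases "CARD('n)") simp_all
        then have "inverse ?w ^ (?n * q) * ?w ^ (q * (?n - 1)) = inverse ?w ^ q * (inverse ?w * ?w) ^ (q * (?n - 1))"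
          by (simp only: power_add power_mult_distrib mult.assoc)
        then show ?thesis by (simp add: mat_mult_mat)
      qed
      finally have 1: "meval ?M (monom (inverse ?w ^ (?n * q)) (?n * q * (?n - 1))) = mat (inverse ?w ^ q)" .
      have "e (j + ?n * q) = monom (inverse ?w ^ (?n * q)) (?n * q * (?n - 1)) * e j"
        unfolding e_def by (simp add: mult_monom power_add algebra_simps)
      then show ?thesis unfolding G_def by (simp only: meval_mult 1 matrix_mul_assoc)
    qed
    have "G 0 $ i $ j = 0" for i j
    proof (rule ccontr)
      assume nz: "G 0 $ i $ j \<noteq> 0"
      then obtain q where q: "absval ?w ^ q < absval (G 0 $ i $ j)"
        using real_arch_pow_inv[of "absval (G 0 $ i $ j)" "absval ?w"] w by auto
      have "absval (inverse ?w ^ q * G 0 $ i $ j) \<le> 1"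
        using all[of "0 + ?n * q"] unfolding Gn[of 0 q] bnd_def mat_mult_nth by blast
      then have "inverse (absval ?w ^ q) * absval (G 0 $ i $ j) \<le> 1"
        by (simp only: absval_mult absval_power absval_inverse power_inverse)
      moreover have "0 < absval ?w ^ q" using w by simp
      ultimately have "absval ?w ^ q * (inverse (absval ?w ^ q) * absval (G 0 $ i $ j)) \<le> absval ?w ^ q * 1"
        by (intro mult_left_mono) simp_all
      then have "absval (G 0 $ i $ j) \<le> absval ?w ^ q"
        using \<open>0 < absval ?w ^ q\<close> unfolding mult.assoc [symmetric] by simp
      then show False using q by simp
    qed
    then have "G 0 = 0" by (simp add: vec_eq_iff)
    moreover have "invertible (G 0)" unfolding G_def e_def using h by (intro invertible_mult invertible_Pi_monom) simp
    ultimately have "mat 1 = (0 :: 'a^'n^'n)" unfolding invertible_def by simp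
    then have "(mat 1 :: 'a^'n^'n) $ ix 0 $ ix 0 = 0" by simp
    then show False by (simp add: mat_def)
  qed
  then obtain j where j: "bnd 1 (G j)" "\<not> bnd 1 (G (Suc j))"
    using G0 nat_induct[of "\<lambda>j. bnd 1 (G j)"] by blast
  define g where "g = G j"
  let ?H = "G (Suc j)"
  have g: "g = ?M ** ?H" unfolding g_def by (simp add: G_Suc)
  obtain i b where ib: "1 < absval (?H $ i $ b)" using j unfolding bnd_def by (metis linorder_not_le)
  have g1: "absval (g $ i $ b) \<le> 1" for i b using j unfolding g_def bnd_def by blast
  \<comment> \<open>Left multiplication by Pi only shifts the rows except the last, which is
    multiplied by w. A non-integral entry of \<open>?H\<close> must therefore lie in the last row,
    and w times it is a unit in the top row of \<open>g\<close>.\<close>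
  have "Suc (idx i) = ?n"
  proof (rule ccontr)
    assume "Suc (idx i) \<noteq> ?n"
    then have "Suc (idx i) < ?n" using idx_less[of i] by linarith
    then have "g $ ix (Suc (idx i)) $ b = ?H $ i $ b" unfolding g by (simp add: cyc_mult_nth)
    then show False using ib g1 by (metis linorder_not_le)
  qed
  then have "idx i = ?n - 1" by linarith
  then have "i = ix (?n - 1)" by (metis ix_idx)
  then have "g $ ix 0 $ b = ?w * ?H $ i $ b" unfolding g by (simp add: cyc_mult_nth)
  then have "absval ?w < absval (g $ ix 0 $ b)" using ib w by (simp add: absval_mult)
  then have unit: "absval (g $ ix 0 $ b) = 1"
    using g1[of "ix 0" b] absval_le_uniformizer[of "g $ ix 0 $ b"] by linarith
  \<comment> \<open>\<open>V\<close> is the element of F[Pi] with first column g e_b. Its constant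
    coefficient is the unit just found, so it belongs to GL_n(O).\<close>
  define V where "V = meval ?M (col_poly (g *v axis b 1))"
  have V: "V \<in> GLO" unfolding V_def
    by (rule meval_GLO) (use g1 unit in \<open>auto simp: int_poly_def coeff_col_poly mult_axis\<close>)
  have ginv: "invertible g" unfolding g_def G_def e_def using h by (intro invertible_mult invertible_Pi_monom) simp
  have conj: "matrix_inv g ** meval ?M f ** g = matrix_inv h ** meval ?M f ** h" for f
  proof -
    have ei: "invertible (meval ?M (e j))" unfolding e_def by (intro invertible_Pi_monom) simp
    have "meval ?M f ** g = meval ?M (e j) ** (meval ?M f ** h)"
      unfolding g_def G_def matrix_mul_assoc meval_commute[of ?M f "e j"] ..
    moreover have "matrix_inv g = matrix_inv h ** matrix_inv (meval ?M (e j))"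
      unfolding g_def G_def using ei h by (rule matrix_inv_mult)
    ultimately have "matrix_inv g ** (meval ?M f ** g) = matrix_inv h ** (matrix_inv (meval ?M (e j)) ** meval ?M (e j)) ** (meval ?M f ** h)"
      by (simp only: matrix_mul_assoc)
    then show ?thesis using ei by (simp add: matrix_mul_assoc matrix_inv_props)
  qed
  \<comment> \<open>Column k of g^-1 V is g^-1 Pi^k V e_0 = g^-1 Pi^k g e_b, which is column b of
    h^-1 Pi^k h.\<close>
  have "bnd r (matrix_inv g ** V)"
    unfolding bnd_def
  proof (intro allI)
    fix a k
    have "(matrix_inv g ** V) *v axis k 1 = (matrix_inv g ** V) *v (meval ?M (monom 1 (idx k)) *v axis (ix 0) 1)"
      using idx_less[of k] by (simp add: cyc_power_axis)
    also have "\<dots> = (matrix_inv g ** meval ?M (monom 1 (idx k))) *v (V *v axis (ix 0) 1)"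
      using meval_commute[of ?M "col_poly (g *v axis b 1)" "monom 1 (idx k)"]
      by (simp only: V_def matrix_vector_mul_assoc matrix_mul_assoc [symmetric])
    also have "V *v axis (ix 0) 1 = g *v axis b 1" unfolding V_def by (rule meval_col_poly_axis)
    also have "(matrix_inv g ** meval ?M (monom 1 (idx k))) *v (g *v axis b 1) = (matrix_inv h ** meval ?M (monom 1 (idx k)) ** h) *v axis b 1"
      by (simp add: matrix_vector_mul_assoc conj)
    finally have "(matrix_inv g ** V) $ a $ k = (matrix_inv h ** meval ?M (monom 1 (idx k)) ** h) $ a $ b"
      unfolding mult_axis [symmetric] by simp
    then show "absval ((matrix_inv g ** V) $ a $ k) \<le> r" using r[OF idx_less[of k]] unfolding bnd_def by simp
  qed
  then have "bnd (r * 1) (matrix_inv g ** V ** matrix_inv V)" using V by (intro bnd_mult) (auto simp: GLO_def)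
  moreover have "matrix_inv g ** V ** matrix_inv V = matrix_inv g"
    using V by (simp add: matrix_mul_assoc [symmetric] matrix_inv_props GLO_invertible)
  ultimately have "bnd r (matrix_inv g)" by simp
  moreover have "inverse ?w ^ j * ?w ^ m = ?w powi (int m - int j)"
    by (simp add: power_int_diff field_simps)
  ultimately show ?thesis using j(1) unfolding g_def G_def e_def
    by (intro exI[of _ "int m - int j"] exI[of _ "j * (?n - 1)"]) simp
qed

text \<open>Conjugation by e fixes the powers of Pi, so normalization with bound 1 puts some Pi^v e
  into \<open>GLO\<close>; comparing determinants gives v = 0.\<close>

lemma commuting_unit_det_GLO:
  fixes e :: "'a::nonarch_local_field_0^'n^'n"
  assumes e: "invertible e" "e ** Pi_mat = Pi_mat ** e" and d: "absval (det e) = 1"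
  shows "e \<in> GLO"
proof -
  let ?M = "Pi_mat :: 'a^'n^'n"
  have "bnd 1 (matrix_inv e ** meval ?M (monom 1 k) ** e)" for k
  proof -
    have "matrix_inv e ** meval ?M (monom 1 k) ** e = meval ?M (monom 1 k)"
      using e(1) by (simp add: matrix_mul_assoc [symmetric] commute_meval[OF e(2), symmetric])
        (simp add: matrix_mul_assoc matrix_inv_props)
    then show ?thesis by (simp add: bnd_meval int_poly_def)
  qed
  then obtain m k where mk: "bnd 1 (meval ?M (monom (uniformizer powi m) k) ** e)"
    "bnd 1 (matrix_inv (meval ?M (monom (uniformizer powi m) k) ** e))"
    using normalize_lattice[OF e(1), of 1] by auto
  define a :: 'a where "a = uniformizer powi m"
  have ak: "a \<noteq> 0" "bnd 1 (meval ?M (monom a k) ** e)" "bnd 1 (matrix_inv (meval ?M (monom a k) ** e))"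
    using mk by (auto simp: a_def)
  have inv: "invertible (meval ?M (monom a k))" using ak(1) by (rule invertible_Pi_monom)
  have g: "meval ?M (monom a k) ** e \<in> GLO" using ak inv e(1) by (simp add: GLO_def invertible_mult)
  then have "absval (det (meval ?M (monom a k))) = 1"
    using GLO_det[OF g] d by (simp add: det_mul absval_mult)
  then have "int CARD('n) * val a + int k = 0"
    using det_Pi_monom[OF ak(1), where ?'n = 'n, of k] val_eq_0_iff[of "det (meval ?M (monom a k))"] inv
    by (simp add: invertible_det_nz)
  then have "int k = int CARD('n) * (- val a)" by (simp add: algebra_simps)
  then have "int CARD('n) dvd int k" by (rule dvdI)
  then obtain q where q: "k = CARD('n) * q" unfolding int_dvd_int_iff by (rule dvdE)
  have "meval ?M (monom 1 (CARD('n) * q)) = mat (uniformizer ^ q)"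
    by (rule cyc_power_CARD_mult)
  then have m: "meval ?M (monom a k) = mat (a * uniformizer ^ q)"
    unfolding q by (subst meval_monom) (simp add: mat_mult_mat)
  have "absval (a * uniformizer ^ q) ^ CARD('n) = 1"
    using \<open>absval (det (meval ?M (monom a k))) = 1\<close> by (simp add: m det_mat absval_power)
  then have u: "absval (a * uniformizer ^ q) = 1"
    using power_eq_imp_eq_base[of "absval (a * uniformizer ^ q)" "CARD('n)" 1] by simp
  have nz: "a * uniformizer ^ q \<noteq> 0" using ak(1) by simp
  have "mat (a * uniformizer ^ q) ** mat (inverse (a * uniformizer ^ q)) = (mat 1 :: 'a^'n^'n)"
    unfolding mat_mult_mat using nz by (subst right_inverse) auto
  then have "mat (inverse (a * uniformizer ^ q)) ** mat (a * uniformizer ^ q) = (mat 1 :: 'a^'n^'n)"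
    by (rule matrix_left_right_inverse1)
  moreover have "absval (inverse (a * uniformizer ^ q)) \<le> 1" using u by (subst absval_inverse) simp
  ultimately have "mat (inverse (a * uniformizer ^ q)) \<in> (GLO :: ('a^'n^'n) set)"
    using u by (blast intro: GLO_I bnd_mat order_refl eq_refl)
  then have "mat (inverse (a * uniformizer ^ q)) ** (meval ?M (monom a k) ** e) \<in> GLO" using g GLO_mult by blast
  moreover have "mat (inverse (a * uniformizer ^ q)) ** (meval ?M (monom a k) ** e) = e"
    unfolding m matrix_mul_assoc mat_mult_mat left_inverse[OF nz] by (rule matrix_mul_lid)
  ultimately show ?thesis by simp
qed

text \<open>Finiteness of the residue field, in the form of finitely many approximants of the
  integers, makes two natural numbers congruent; a prime factor of their difference is
  small.\<close>

lemma exists_residue_prime: "\<exists>p. prime p \<and> absval (of_nat p :: 'a::nonarch_local_field_0) < 1"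
proof -
  have le1: "absval (of_nat k :: 'a) \<le> 1" for k
    by (induction k) (simp_all add: order_trans[OF absval_add])
  obtain S where S: "finite S" "\<forall>x :: 'a. absval x \<le> 1 \<longrightarrow> (\<exists>y\<in>S. absval (x - y) \<le> 1/2)"
    using finite_approx_absval[OF half_gt_zero[OF zero_less_one], of 1] by blast
  then have "\<forall>k. \<exists>y. y \<in> S \<and> absval (of_nat k - y :: 'a) \<le> 1/2" using le1 by blast
  then obtain f where f: "\<And>k. f k \<in> S \<and> absval (of_nat k - f k :: 'a) \<le> 1/2" by metis
  then have "\<not> inj f" using S(1) by (metis finite_imageD finite_subset image_subsetI infinite_UNIV_nat)
  then obtain k l where kl: "k < l" "f k = f l" by (metis injI linorder_neqE_nat)
  have "absval ((of_nat l - f l) - (of_nat k - f k) :: 'a) \<le> 1/2"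
    using absval_diff[of "of_nat l - f l :: 'a" "of_nat k - f k"] f by (meson max.boundedI order_trans)
  then have "absval (of_nat (l - k) :: 'a) < 1" using kl by (simp add: of_nat_diff)
  moreover have "\<exists>p. prime p \<and> absval (of_nat p :: 'a) < 1" if "absval (of_nat d :: 'a) < 1" "0 < d" for d
    using that
  proof (induction d rule: less_induct)
    case (less d)
    then have "d \<noteq> 1" by auto
    then obtain p where p: "prime p" "p dvd d" using prime_factor_nat by blast
    then obtain c where c: "d = p * c" by auto
    show ?case
    proof (cases "absval (of_nat p :: 'a) < 1")
      case False
      then have "absval (of_nat p :: 'a) = 1" using le1[of p] by simp
      then have "absval (of_nat c :: 'a) < 1" using less.prems by (simp add: c absval_mult)
      moreover have "c < d" "0 < c" using less.prems p c prime_gt_1_nat[of p] by auto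
      ultimately show ?thesis using less.IH by blast
    qed (use p in blast)
  qed
  ultimately show ?thesis using kl by (meson zero_less_diff)
qed

text \<open>The units of O[Pi] modulo the scalar units form a pro-p group: after division by the
  constant coefficient, each p-th power raises the divisibility of the remainder by X.\<close>

lemma power_near_scalar:
  fixes f :: "'a::nonarch_local_field_0 poly"
  assumes p: "absval (of_nat p :: 'a) < 1" and f: "int_poly f" "absval (coeff f 0) = 1" and r: "0 < r"
  shows "\<exists>s a. absval a = 1 \<and> bnd r (meval (Pi_mat :: 'a^'n^'n) (f ^ (p ^ s)) - mat a)"
proof -
  let ?M = "Pi_mat :: 'a^'n^'n" and ?w = "uniformizer :: 'a" and ?n = "CARD('n)"
  obtain a g where fa: "f = pCons a g" by (cases f)
  have a: "absval a = 1" "a \<noteq> 0" and g: "int_poly g" using f by (auto simp: fa)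
  define y where "y = monom 1 1 * smult (inverse a) g"
  have fy: "f = smult a (1 + y)" using a by (simp add: y_def fa monom_altdef smult_add_right)
  have im: "int_poly (monom b k)" if "absval b \<le> 1" for b :: 'a and k using that by (simp add: int_poly_def)
  have binom: "\<exists>z. int_poly z \<and> (1 + u) ^ N = 1 + of_nat N * u + u\<^sup>2 * z" if u: "int_poly u" for u :: "'a poly" and N
  proof (induction N)
    case 0
    show ?case by (rule exI[of _ 0]) simp
  next
    case (Suc N)
    then obtain z where z: "int_poly z" "(1 + u) ^ N = 1 + of_nat N * u + u\<^sup>2 * z" by blast
    have "int_poly (of_nat N)" by (induction N) (simp_all add: int_poly_add)
    then have "int_poly (of_nat N + z + u * z)" using z u by (intro int_poly_add int_poly_mult)
    moreover have "(1 + u) ^ Suc N = 1 + of_nat (Suc N) * u + u\<^sup>2 * (of_nat N + z + u * z)"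
      by (simp add: z algebra_simps power2_eq_square)
    ultimately show ?case by blast
  qed
  have wp: "\<exists>c. absval c \<le> 1 \<and> of_nat p = ?w * c"
    using absval_le_uniformizer[OF p] by (intro exI[of _ "of_nat p / ?w"]) (simp add: absval_divide divide_le_eq_1)
  \<comment> \<open>The identity is one of values at Pi, since p = w c becomes c X^n only there. In
    (1 + u)^p = 1 + p u + u^2 z the middle term gains n factors X and the last one s + 1, so at
    least one in either case.\<close>
  have step: "\<exists>g. int_poly g \<and> meval ?M ((1 + y) ^ (p ^ s)) = meval ?M (1 + monom 1 (Suc s) * g)" for s
  proof (induction s)
    case 0
    show ?case using g a by (intro exI[of _ "smult (inverse a) g"]) (simp add: y_def int_poly_smult absval_inverse)
  next
    case (Suc s)
    then obtain g where g: "int_poly g" "meval ?M ((1 + y) ^ (p ^ s)) = meval ?M (1 + monom 1 (Suc s) * g)" by blast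
    let ?u = "monom 1 (Suc s) * g"
    have "int_poly ?u" using g im by (intro int_poly_mult) auto
    then obtain z where z: "int_poly z" "(1 + ?u) ^ p = 1 + of_nat p * ?u + ?u\<^sup>2 * z" using binom by blast
    obtain c where c: "absval c \<le> 1" "of_nat p = ?w * c" using wp by blast
    have "meval ?M ((1 + y) ^ (p ^ Suc s)) = meval ?M ((1 + ?u) ^ p)"
      using meval_power_cong[OF g(2), of p] by (simp add: power_mult [symmetric] mult.commute)
    also have "\<dots> = meval ?M (1 + monom 1 (Suc s) * (monom c ?n * g) + ?u\<^sup>2 * z)"
    proof -
      have "(of_nat p :: 'a poly) = smult c [:?w:]" using c by (simp add: of_nat_poly)
      then have "meval ?M (of_nat p) = meval ?M (monom c ?n)"
        by (simp add: meval_smult meval_monom[of _ c] cyc_power_CARD mat_mult_mat)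
      then have "meval ?M (of_nat p * ?u) = meval ?M (monom 1 (Suc s) * (monom c ?n * g))"
        by (simp only: mult.left_commute[of "monom 1 (Suc s)"] meval_mult)
      then show ?thesis unfolding z by (simp only: meval_add)
    qed
    also have "1 + monom 1 (Suc s) * (monom c ?n * g) + ?u\<^sup>2 * z =
      1 + monom 1 (Suc (Suc s)) * (monom c (?n - 1) * g + monom 1 s * (g * g * z))"
    proof -
      have "monom 1 (Suc s) * monom c ?n = monom 1 (Suc (Suc s)) * monom c (?n - 1)"
        by (simp add: mult_monom)
      moreover have "monom (1::'a) (Suc s) * monom 1 (Suc s) = monom 1 (Suc (Suc s)) * monom 1 s"
        by (simp add: mult_monom)
      moreover have "?u\<^sup>2 * z = monom 1 (Suc s) * monom 1 (Suc s) * (g * g * z)"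
        by (simp add: power2_eq_square ac_simps)
      ultimately show ?thesis by (simp only: distrib_left add.assoc mult.assoc [symmetric])
    qed
    finally have "meval ?M ((1 + y) ^ (p ^ Suc s)) = meval ?M (1 + monom 1 (Suc (Suc s)) * (monom c (?n - 1) * g + monom 1 s * (g * g * z)))" .
    moreover have "int_poly (monom c (?n - 1) * g + monom 1 s * (g * g * z))"
      using g z c im by (intro int_poly_add int_poly_mult) auto
    ultimately show ?case by blast
  qed
  obtain q where q: "absval ?w ^ q < r" using real_arch_pow_inv[OF r, of "absval ?w"] by auto
  \<comment> \<open>Then X^(s+1) takes the value w^q Pi, which is below the required bound.\<close>
  define s where "s = ?n * q"
  obtain g where g: "int_poly g" "meval ?M ((1 + y) ^ (p ^ s)) = meval ?M (1 + monom 1 (Suc s) * g)" using step by blast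
  let ?b = "a ^ (p ^ s)"
  have "meval ?M (monom 1 (?n * q)) = mat (?w ^ q)"
    by (rule cyc_power_CARD_mult)
  moreover have "monom (1::'a) (Suc s) = monom 1 (?n * q) * monom 1 1" by (simp add: mult_monom s_def)
  ultimately have "meval ?M (monom 1 (Suc s) * g) = mat (?w ^ q) ** meval ?M (monom 1 1 * g)"
    by (simp only: meval_mult matrix_mul_assoc)
  then have "meval ?M (f ^ (p ^ s)) - mat ?b = mat ?b ** (mat (?w ^ q) ** meval ?M (monom 1 1 * g))"
    unfolding fy smult_power meval_smult g(2) by (simp add: meval_add matrix_add_ldistrib)
  moreover have "bnd (1 * (absval ?w ^ q * 1)) (mat ?b ** (mat (?w ^ q) ** meval ?M (monom 1 1 * g)))"
    using g im by (intro bnd_mult bnd_mat bnd_meval int_poly_mult) (auto simp: absval_power a)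
  ultimately have "bnd r (meval ?M (f ^ (p ^ s)) - mat ?b)" using q by (auto intro: bnd_mono)
  then show ?thesis using a by (intro exI[of _ s] exI[of _ ?b]) (simp add: absval_power)
qed

section \<open>Regular semisimplicity\<close>

lemma stabilizer_cyc:
  fixes c s :: "'k::field"
  assumes "s \<noteq> 0"
  shows "stabilizer GLxGL act (mat s ** cyc c :: 'k^'n^'n, mat 1) =
    {(e, e) | e. invertible e \<and> e ** cyc c = cyc c ** e}"
proof (intro equalityI subsetI)
  fix h :: "('k, 'n) mat2" assume "h \<in> stabilizer GLxGL act (mat s ** cyc c, mat 1)"
  then obtain a b where h: "h = (a, b)" "invertible a" "invertible b"
    "a ** (mat s ** cyc c) ** matrix_inv b = mat s ** cyc c" "b ** matrix_inv a = mat 1"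
    by (cases h) (auto simp: stabilizer_def GLxGL_def act_def)
  have ba: "b = a"
  proof -
    have "b ** matrix_inv a ** a = a" using h(5) by simp
    then show ?thesis using h(2) by (simp add: matrix_mul_assoc [symmetric] matrix_inv_props)
  qed
  have "a ** (mat s ** cyc c) ** matrix_inv a ** a = mat s ** cyc c ** a" using h(4) by (simp add: ba)
  then have "a ** (mat s ** cyc c) = mat s ** cyc c ** a"
    using h(2) by (simp add: matrix_mul_assoc [symmetric] matrix_inv_props)
  then have "mat s ** (a ** cyc c) = mat s ** (cyc c ** a)"
    by (simp add: matrix_mul_assoc mat_mult_commute[of s a])
  then have "mat (inverse s) ** (mat s ** (a ** cyc c)) = mat (inverse s) ** (mat s ** (cyc c ** a))" by simp
  then have "a ** cyc c = cyc c ** a" using assms by (simp add: matrix_mul_assoc mat_mult_mat)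
  then show "h \<in> {(e, e) | e. invertible e \<and> e ** cyc c = cyc c ** e}" using h ba by auto
next
  fix h :: "('k, 'n) mat2" assume "h \<in> {(e, e) | e. invertible e \<and> e ** cyc c = cyc c ** e}"
  then obtain e where e: "h = (e, e)" "invertible e" "e ** cyc c = cyc c ** e" by blast
  have "e ** (mat s ** cyc c) = mat s ** cyc c ** e"
  proof -
    have "e ** (mat s ** cyc c) = mat s ** (e ** cyc c)"
      by (simp add: matrix_mul_assoc mat_mult_commute[of s e])
    then show ?thesis by (simp add: e(3) matrix_mul_assoc)
  qed
  then have "e ** (mat s ** cyc c) ** matrix_inv e = mat s ** cyc c"
    using e(2) by (simp add: matrix_mul_assoc [symmetric] matrix_inv_props)
  then show "h \<in> stabilizer GLxGL act (mat s ** cyc c, mat 1)"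
    using e by (simp add: stabilizer_def GLxGL_def act_def matrix_inv_props)
qed

lemma cyc_eigenvector:
  fixes c z :: "'k::field"
  assumes "z ^ CARD('n) = c"
  shows "\<exists>v :: 'k^'n. v \<noteq> 0 \<and> cyc c *v v = z *s v"
proof (intro exI conjI)
  let ?n = "CARD('n)"
  \<comment> \<open>The last coordinate is 1, and the top coordinate of the image is c = z^n = z
    z^(n-1).\<close>
  let ?v = "(\<chi> i. z ^ (?n - 1 - idx i)) :: 'k^'n"
  have "?v $ ix (?n - 1) = 1" by simp
  then show "?v \<noteq> 0" by (metis zero_index zero_neq_one)
  \<comment> \<open>A matrix all of whose columns are the vector, so that
    \<open>cyc_mult_nth\<close> applies; the choice of column is irrelevant.\<close>
  define A where "A = ((\<chi> i j. ?v $ i) :: 'k^'n^'n)"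
  have cv: "(cyc c *v ?v) $ i = (cyc c ** A) $ i $ undefined" for i
    by (simp add: A_def matrix_matrix_mult_def matrix_vector_mult_def)
  have "(cyc c *v ?v) $ i = (z *s ?v) $ i" for i
  proof (cases "idx i = 0")
    case True
    then show ?thesis unfolding cv cyc_mult_nth using assms
      by (simp add: A_def) (metis One_nat_def Suc_pred power_Suc zero_less_card_finite)
  next
    case False
    then have "?n - 1 - (idx i - 1) = Suc (?n - 1 - idx i)" "idx i - 1 < ?n" using idx_less[of i] by auto
    then show ?thesis unfolding cv cyc_mult_nth using False by (simp add: A_def)
  qed
  then show "cyc c *v ?v = z *s ?v" by (simp add: vec_eq_iff)
qed

lemma invertible_iff_inj: "invertible (A :: 'k::field^'n^'n) \<longleftrightarrow> (\<forall>v. A *v v = 0 \<longrightarrow> v = 0)"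
proof -
  have "inj ((*v) A) \<longleftrightarrow> (\<forall>v. A *v v = 0 \<longrightarrow> v = 0)"
    by (metis (no_types, opaque_lifting) eq_iff_diff_eq_0 inj_def matrix_vector_mult_0_right matrix_vector_mult_diff_distrib)
  then show ?thesis by (simp add: invertible_left_inverse matrix_left_invertible_injective)
qed

lemma mat_mult_vec: "mat z *v v = (z :: 'k::semiring_1) *s v"
  by (simp add: vec_eq_iff matrix_vector_mult_def mat_def if_distrib [of "\<lambda>x. x * _"] cong: if_cong)

lemma det_eq_0_iff_eigenvector:
  "det (mat z - A) = 0 \<longleftrightarrow> (\<exists>v. v \<noteq> 0 \<and> A *v v = z *s v)" for A :: "'k::field^'n^'n"
proof -
  have "(mat z - A) *v v = 0 \<longleftrightarrow> A *v v = z *s v" for v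
    by (auto simp: matrix_vector_mult_diff_rdistrib mat_mult_vec)
  then show ?thesis using invertible_det_nz[of "mat z - A"] invertible_iff_inj[of "mat z - A"] by blast
qed

text \<open>Serves to pass from equality of the determinants at the points of the ground field to
  equality at all points of its algebraic closure.\<close>

definition charpoly :: "'k::field^'n^'n \<Rightarrow> 'k poly" where
  "charpoly A = det (\<chi> i j. (if i = j then [:0, 1:] else 0) - [:A $ i $ j:])"

lemma poly_charpoly: "poly (charpoly A) z = det (mat z - A)"
proof -
  have "poly (of_int k) z = of_int k" for k :: int by (simp add: of_int_poly)
  then show ?thesis unfolding charpoly_def det_def
    by (simp add: poly_sum poly_prod mat_def if_distrib [of "\<lambda>p. poly p z"] cong: if_cong)
qed

lemma poly_eq_infinite:
  fixes f g :: "'k::field poly"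
  assumes "infinite S" "\<And>z. z \<in> S \<Longrightarrow> poly f z = poly g z"
  shows "f = g"
proof (rule ccontr)
  assume "f \<noteq> g"
  then have "finite {z. poly (f - g) z = 0}" by (intro poly_roots_finite) simp
  moreover have "S \<subseteq> {z. poly (f - g) z = 0}" using assms(2) by auto
  ultimately show False using assms(1) finite_subset by blast
qed

lemma eigenvectors_independent:
  fixes A :: "'k::field^'n^'n"
  assumes "finite J" "inj_on l J" "\<And>j. j \<in> J \<Longrightarrow> u j \<noteq> 0 \<and> A *v u j = l j *s u j"
    "(\<Sum>j\<in>J. x j *s u j) = 0" "j \<in> J"
  shows "x j = 0"
  using assms
proof (induction J arbitrary: x j rule: finite_induct)
  case (insert k J)
  have lin: "A *v (\<Sum>j\<in>S. y j *s u j) = (\<Sum>j\<in>S. y j *s (A *v u j))" for S and y :: "_ \<Rightarrow> 'k"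
    by (induction S rule: infinite_finite_induct)
      (simp_all add: matrix_vector_right_distrib vector_scalar_commute)
  have "0 = A *v (\<Sum>j\<in>insert k J. x j *s u j)" using insert.prems(3) by simp
  also have "\<dots> = (\<Sum>j\<in>insert k J. (x j * l j) *s u j)"
    unfolding lin by (rule sum.cong) (use insert.prems(2) in \<open>auto simp: vector_smult_assoc\<close>)
  finally have 1: "(\<Sum>j\<in>insert k J. (x j * l j) *s u j) = 0" by simp
  have 2: "(\<Sum>j\<in>insert k J. (x j * l k) *s u j) = 0"
  proof -
    have "(\<Sum>j\<in>insert k J. (x j * l k) *s u j) = l k *s (\<Sum>j\<in>insert k J. x j *s u j)"
      by (simp add: vec_eq_iff sum_distrib_left mult_ac)
    then show ?thesis using insert.prems(3) by simp
  qed
  have "(\<Sum>j\<in>insert k J. (x j * (l j - l k)) *s u j) = 0"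
    using 1 2 by (simp add: right_diff_distrib vector_sub_rdistrib sum_subtractf)
  then have 3: "(\<Sum>j\<in>J. (x j * (l j - l k)) *s u j) = 0" using insert.hyps by simp
  have J0: "x i = 0" if "i \<in> J" for i
  proof -
    have "x i * (l i - l k) = 0"
      using insert.IH[OF _ _ 3 that] insert.prems(1,2) by (auto simp: inj_on_insert)
    moreover have "l i \<noteq> l k" using insert.prems(1) insert.hyps(2) that by (metis inj_on_contraD insertI1 insertI2)
    ultimately show ?thesis by simp
  qed
  then have "x k *s u k = 0" using insert.prems(3) insert.hyps by (simp add: sum.neutral)
  then have "x k = 0" using insert.prems(2)[of k] by (simp add: vector_mul_eq_0)
  then show ?case using J0 insert.prems(4) by auto
qed simp

lemma diagonalize:
  fixes A :: "'k::field^'n^'n" and l :: "'n \<Rightarrow> 'k"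
  assumes "inj l" "\<And>j. \<exists>v. v \<noteq> 0 \<and> A *v v = l j *s v"
  shows "\<exists>P. invertible P \<and> A ** P = P ** (\<chi> i j. if i = j then l i else 0)"
proof -
  obtain u where u: "\<And>j. u j \<noteq> 0 \<and> A *v u j = l j *s u j" using assms(2) by metis
  define P where "P = (\<chi> i j. u j $ i)"
  have "P *v x = (\<Sum>j\<in>UNIV. x $ j *s u j)" for x
    by (simp add: P_def vec_eq_iff matrix_vector_mult_def mult.commute)
  note P = this
  have "x $ j = 0" if "P *v x = 0" for x j
    by (rule eigenvectors_independent[of UNIV l u A "\<lambda>j. x $ j"]) (use u assms(1) that P in simp_all)
  then have "x = 0" if "P *v x = 0" for x unfolding vec_eq_iff using that by simp
  then have "invertible P" unfolding invertible_iff_inj by blast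
  moreover have "A ** P = P ** (\<chi> i j. if i = j then l i else 0)"
  proof -
    have "(A ** P) $ i $ j = (A *v u j) $ i" for i j
      by (simp add: P_def matrix_matrix_mult_def matrix_vector_mult_def)
    then show ?thesis using u
      by (simp add: vec_eq_iff) (simp add: P_def matrix_matrix_mult_def if_distrib [of "\<lambda>x. _ * x"] mult.commute cong: if_cong)
  qed
  ultimately show ?thesis by blast
qed

lemma rat_algebra_sum: "(\<And>i. i \<in> S \<Longrightarrow> f i \<in> rat_algebra Gen) \<Longrightarrow> (\<lambda>x. \<Sum>i\<in>S. f i x) \<in> rat_algebra Gen"
  for Gen :: "('x \<Rightarrow> 'a::field alg_closure) set"
proof (induction S rule: infinite_finite_induct)
  case (insert i S)
  then show ?case using rat_algebra.add[of "f i" Gen "\<lambda>x. \<Sum>i\<in>S. f i x"] by simp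
qed (use rat_algebra.const[of 0 Gen] in simp_all)

lemma rat_algebra_prod: "(\<And>i. i \<in> S \<Longrightarrow> f i \<in> rat_algebra Gen) \<Longrightarrow> (\<lambda>x. \<Prod>i\<in>S. f i x) \<in> rat_algebra Gen"
  for Gen :: "('x \<Rightarrow> 'a::field alg_closure) set"
proof (induction S rule: infinite_finite_induct)
  case (insert i S)
  then show ?case using rat_algebra.mult[of "f i" Gen "\<lambda>x. \<Prod>i\<in>S. f i x"] by simp
qed (use rat_algebra.const[of 1 Gen] in simp_all)

text \<open>XY is conjugated by the first group factor. The argument \<open>l\<close> comes from the
  ground field because the constants of a regular function must be rational.\<close>

lemma charpoly_invariant:
  "(\<lambda>y :: ('a::field alg_closure, 'n::finite) mat2. det (mat (to_ac l) - fst y ** snd y)) \<in> invariant_funs"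
  unfolding invariant_funs_def regular_funs_X_def
proof (intro CollectI conjI ballI allI)
  let ?X = "coord_funs :: (('a alg_closure, 'n) mat2 \<Rightarrow> 'a alg_closure) set"
  have fst: "(\<lambda>y. fst y $ i $ j) \<in> rat_algebra ?X" and snd: "(\<lambda>y. snd y $ i $ j) \<in> rat_algebra ?X" for i j
    by (auto intro!: rat_algebra.gen simp: coord_funs_def)
  have entry: "(\<lambda>y. (mat (to_ac l) - fst y ** snd y) $ i $ j) \<in> rat_algebra ?X" for i j
  proof -
    have "(\<lambda>y. to_ac (if i = j then l else 0) + to_ac (- 1) * (\<Sum>k\<in>UNIV. fst y $ i $ k * snd y $ k $ j)) \<in> rat_algebra ?X"
      by (intro rat_algebra.add rat_algebra.mult rat_algebra.const rat_algebra_sum fst snd)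
    moreover have "(\<lambda>y :: ('a alg_closure, 'n) mat2. to_ac (if i = j then l else 0) + to_ac (- 1) * (\<Sum>k\<in>UNIV. fst y $ i $ k * snd y $ k $ j)) =
      (\<lambda>y. (mat (to_ac l) - fst y ** snd y) $ i $ j)"
      by (auto simp: fun_eq_iff mat_def matrix_matrix_mult_def)
    ultimately show ?thesis by simp
  qed
  have "(\<lambda>y. \<Sum>p | p permutes UNIV. to_ac (of_int (sign p)) * (\<Prod>i\<in>UNIV. (mat (to_ac l) - fst y ** snd y) $ i $ p i)) \<in> rat_algebra ?X"
    by (intro rat_algebra_sum rat_algebra.mult rat_algebra.const rat_algebra_prod entry)
  then show "(\<lambda>y :: ('a alg_closure, 'n) mat2. det (mat (to_ac l) - fst y ** snd y)) \<in> rat_algebra ?X"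
    by (simp add: det_def)
next
  fix h y :: "('a alg_closure, 'n) mat2" assume "h \<in> carrier GLxGL"
  then have h: "invertible (fst h)" "invertible (snd h)" by (auto simp: GLxGL_def)
  let ?a = "fst h" and ?b = "snd h" and ?X = "fst y" and ?Y = "snd y"
  have "fst (act h y) ** snd (act h y) = ?a ** ?X ** (matrix_inv ?b ** ?b) ** ?Y ** matrix_inv ?a"
    by (simp add: act_def matrix_mul_assoc)
  also have "\<dots> = ?a ** (?X ** ?Y) ** matrix_inv ?a"
    using h by (simp add: matrix_inv_props matrix_mul_assoc)
  finally have 1: "fst (act h y) ** snd (act h y) = ?a ** (?X ** ?Y) ** matrix_inv ?a" .
  have "?a ** mat (to_ac l) ** matrix_inv ?a = mat (to_ac l)"
    unfolding mat_mult_commute[of _ ?a, symmetric]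
    using h by (simp add: matrix_mul_assoc [symmetric] matrix_inv_props)
  then have "mat (to_ac l) - fst (act h y) ** snd (act h y) = ?a ** (mat (to_ac l) - ?X ** ?Y) ** matrix_inv ?a"
    unfolding 1 by (simp add: matrix_mult_diff_ldistrib matrix_mult_diff_rdistrib)
  moreover have "det ?a * det (matrix_inv ?a) = 1"
    using h by (simp add: det_mul [symmetric] matrix_inv_props)
  ultimately show "det (mat (to_ac l) - fst (act h y) ** snd (act h y)) = det (mat (to_ac l) - ?X ** ?Y)"
    by (simp add: det_mul mult_ac)
qed

text \<open>The derivative n X^(n-1) vanishes only at 0, which is not a root, so all roots are
  simple.\<close>

lemma card_nth_roots_alg_closed:
  fixes c :: "'k::{alg_closed_field, field_char_0}"
  assumes "c \<noteq> 0" "0 < n"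
  shows "card {z. z ^ n = c} = n"
proof -
  define p where "p = monom 1 n + [:- c:]"
  have deg: "degree p = n" unfolding p_def using assms(2)
    by (subst degree_add_eq_left) (auto simp: degree_monom_eq)
  have lc: "coeff p (degree p) = 1" unfolding deg using assms(2) by (simp add: p_def coeff_pCons split: nat.splits)
  have p0: "p \<noteq> 0" using deg assms(2) by auto
  obtain A where A: "size A = n" "p = (\<Prod>x\<in>#A. [:-x, 1:])"
    using alg_closed_imp_factorization[OF p0] deg lc by auto
  have root: "poly p z = 0 \<longleftrightarrow> z ^ n = c" for z by (simp add: p_def poly_monom)
  have set: "set_mset A = {z. z ^ n = c}"
    unfolding root [symmetric] A(2) by (auto simp: poly_prod_mset prod_mset_zero_iff)
  have "count A x \<le> 1" for x
  proof (rule ccontr)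
    assume "\<not> count A x \<le> 1"
    then have "{#x, x#} \<subseteq># A" by (simp add: subseteq_mset_def)
    then obtain B where "A = {#x, x#} + B" by (metis subset_mset.add_diff_inverse)
    then have "p = [:-x, 1:] * ([:-x, 1:] * (\<Prod>x\<in>#B. [:-x, 1:]))" using A(2) by (simp add: mult.assoc)
    moreover define q where "q = [:-x, 1:] * (\<Prod>x\<in>#B. [:-x, 1:])"
    ultimately have pq: "p = [:-x, 1:] * q" by simp
    have "poly q x = 0" by (simp add: q_def)
    then have "poly (pderiv p) x = 0" "poly p x = 0" unfolding pq pderiv_mult by simp_all
    moreover have "pderiv p = monom (of_nat n) (n - 1)" by (simp add: p_def pderiv_add pderiv_monom pderiv_pCons)
    ultimately have "x ^ (n - 1) = 0" "x ^ n = c" using assms root by (auto simp: poly_monom)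
    then show False using assms by (metis power_eq_0_iff zero_power)
  qed
  then have "count A x = 1" if "x \<in># A" for x using that by (metis count_greater_zero_iff le_antisym Suc_leI One_nat_def)
  then have "size A = card (set_mset A)" by (simp add: size_multiset_overloaded_eq)
  then show ?thesis using A set by simp
qed

text \<open>A point (X', Y) of the fibre has X'Y with the same n distinct eigenvalues as the product
  for the base point; hence the two products are conjugate, Y is invertible, and (X', Y) lies in the
  orbit.\<close>

lemma H_regular_semisimple_cyc:
  fixes s c :: "'a::field_char_0"
  assumes s: "s \<noteq> 0" and c: "c \<noteq> 0"
  shows "H_regular_semisimple (mat s ** cyc c :: 'a^'n^'n, mat 1)"
  unfolding H_regular_semisimple_def
proof
  let ?x = "(mat s ** cyc c :: 'a^'n^'n, mat 1)"
  let ?A = "mat (to_ac s) ** cyc (to_ac c) :: 'a alg_closure^'n^'n"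
  have bc: "base_change ?x = (?A, mat 1)"
    by (simp add: base_change_def vec_eq_iff) (simp add: cyc_def mat_def)
  show "quotient_fibre ?x = Group_Action.orbit GLxGL act (base_change ?x)"
  proof (intro equalityI subsetI)
    fix y assume "y \<in> Group_Action.orbit GLxGL act (base_change ?x)"
    then show "y \<in> quotient_fibre ?x"
      by (auto simp: Group_Action.orbit_def quotient_fibre_def invariant_funs_def bc)
  next
    fix y assume y: "y \<in> quotient_fibre ?x"
    obtain X' Y where XY: "y = (X', Y)" by (cases y)
    let ?M = "X' ** Y"
    have "det (mat (to_ac l) - ?M) = det (mat (to_ac l) - ?A)" for l
      using y charpoly_invariant[of l, where ?'n = 'n] by (force simp: quotient_fibre_def bc XY)
    then have "charpoly ?M = charpoly ?A"
      by (intro poly_eq_infinite[of "range to_ac"])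
        (auto simp: poly_charpoly finite_image_iff inj_to_ac infinite_UNIV_char_0 dest!: finite_imageD)
    then have dets: "det (mat z - ?M) = det (mat z - ?A)" for z by (metis poly_charpoly)
    let ?Z = "{z. z ^ CARD('n) = to_ac c}"
    have "card ?Z = CARD('n)" using c by (intro card_nth_roots_alg_closed) auto
    then obtain b :: "'n \<Rightarrow> 'a alg_closure" where b: "bij_betw b UNIV ?Z"
      by (metis card_ge_0_finite finite finite_same_card_bij zero_less_card_finite)
    define l where "l j = to_ac s * b j" for j
    have l: "inj l" using b s by (auto simp: l_def inj_def bij_betw_def)
    have evA: "\<exists>v. v \<noteq> 0 \<and> ?A *v v = l j *s v" for j
    proof -
      have "b j ^ CARD('n) = to_ac c" using b by (auto simp: bij_betw_def)
      then obtain v where "v \<noteq> 0" "cyc (to_ac c) *v v = b j *s (v :: 'a alg_closure^'n)" using cyc_eigenvector by blast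
      then show ?thesis
        by (intro exI[of _ v]) (simp add: l_def matrix_vector_mul_assoc [symmetric] mat_mult_vec vector_smult_assoc)
    qed
    then have "\<exists>v. v \<noteq> 0 \<and> ?M *v v = l j *s v" for j
      unfolding det_eq_0_iff_eigenvector [symmetric] dets .
    then obtain P where P: "invertible P" "?M ** P = P ** (\<chi> i j. if i = j then l i else 0)"
      using diagonalize[OF l] by blast
    obtain Q where Q: "invertible Q" "?A ** Q = Q ** (\<chi> i j. if i = j then l i else 0)"
      using diagonalize[OF l evA] by blast
    define g where "g = P ** matrix_inv Q"
    have g: "invertible g" unfolding g_def using P Q by (intro invertible_mult matrix_inv_props)
    have Mg: "?M ** g = g ** ?A"
    proof -
      let ?D = "\<chi> i j. if i = j then l i else 0"
      have "g ** ?A = P ** (matrix_inv Q ** (?A ** Q) ** matrix_inv Q)"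
        using Q(1) by (simp add: g_def matrix_mul_assoc [symmetric] matrix_inv_props)
      also have "\<dots> = P ** (matrix_inv Q ** Q ** ?D ** matrix_inv Q)" by (simp only: Q(2) matrix_mul_assoc)
      also have "\<dots> = P ** ?D ** matrix_inv Q" using Q(1) by (simp add: matrix_inv_props matrix_mul_assoc)
      also have "\<dots> = ?M ** g" by (simp only: P(2) [symmetric] g_def matrix_mul_assoc)
      finally show ?thesis by simp
    qed
    \<comment> \<open>Zero is not an eigenvalue, because the n-th powers of the \<open>b i\<close>
      equal c, which is nonzero.\<close>
    have "det (mat 0 - ?M) \<noteq> 0"
    proof -
      have "v = 0" if "?A *v v = 0 *s v" for v
      proof -
        have "?A ** Q *v (matrix_inv Q *v v) = 0" using that Q(1)
          by (simp add: matrix_vector_mul_assoc matrix_mul_assoc [symmetric] matrix_inv_props)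
        then have "Q *v ((\<chi> i j. if i = j then l i else 0) *v (matrix_inv Q *v v)) = 0"
          unfolding Q(2) by (simp only: matrix_vector_mul_assoc matrix_mul_assoc)
        then have "(\<chi> i j. if i = j then l i else 0) *v (matrix_inv Q *v v) = 0"
          using Q(1) unfolding invertible_iff_inj by blast
        moreover have "((\<chi> i j. if i = j then l i else 0) *v u) $ i = l i * u $ i" for u :: "'a alg_closure^'n" and i
          by (simp add: matrix_vector_mult_def if_distrib [of "\<lambda>x. x * _"] cong: if_cong)
        moreover have "l i \<noteq> 0" for i
        proof -
          have "b i ^ CARD('n) = to_ac c" using b by (auto simp: bij_betw_def)
          then have "b i \<noteq> 0" using c by (auto simp: power_0_left)
          then show ?thesis using s by (simp add: l_def)
        qed
        ultimately have "matrix_inv Q *v v = 0" by (simp add: vec_eq_iff)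
        then show ?thesis using Q(1) matrix_inv_props(3) invertible_iff_inj by blast
      qed
      then show ?thesis unfolding dets det_eq_0_iff_eigenvector by blast
    qed
    moreover have "mat 0 - ?M = (- X') ** Y"
      using matrix_mult_diff_rdistrib[of 0 X' Y] by (simp add: matrix_matrix_mult_def vec_eq_iff sum_negf)
    ultimately have Y: "invertible Y" by (auto simp: det_mul invertible_det_nz)
    \<comment> \<open>The first component is chosen to conjugate the products; the second is forced
      by h_2 g^-1 = Y.\<close>
    let ?h = "(g, Y ** g)"
    have "?h \<in> carrier GLxGL" using g Y by (simp add: GLxGL_def invertible_mult)
    moreover have "act ?h (base_change ?x) = y"
    proof -
      have "g ** ?A ** matrix_inv (Y ** g) = X' ** (Y ** (g ** matrix_inv g) ** matrix_inv Y)"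
        unfolding Mg [symmetric] using g Y by (simp add: matrix_inv_mult matrix_mul_assoc)
      also have "\<dots> = X'" using g Y by (simp add: matrix_inv_props)
      finally show ?thesis using g by (simp add: act_def bc XY matrix_mul_assoc [symmetric] matrix_inv_props)
    qed
    ultimately show "y \<in> Group_Action.orbit GLxGL act (base_change ?x)"
      unfolding Group_Action.orbit_def by blast
  qed
qed

section \<open>Anisotropy of the stabilizer\<close>

lemma map_poly_to_ac_mult: "map_poly to_ac (f * g) = map_poly to_ac f * map_poly to_ac g"
  by (intro poly_eqI) (simp add: coeff_map_poly coeff_mult to_ac_sum)

lemma map_poly_to_ac_add: "map_poly to_ac (f + g) = map_poly to_ac f + map_poly to_ac g"
  by (intro poly_eqI) (simp add: coeff_map_poly)

lemma map_poly_to_ac_power: "map_poly to_ac (f ^ k) = map_poly to_ac f ^ k"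
  by (induction k) (simp_all add: map_poly_to_ac_mult)

lemma map_poly_to_ac_inj: "map_poly to_ac f = map_poly to_ac g \<Longrightarrow> f = g"
  by (intro poly_eqI) (metis coeff_map_poly to_ac_0 to_ac_eq_iff)

definition pure_poly :: "nat \<Rightarrow> 'k::comm_ring_1 \<Rightarrow> 'k poly" where
  "pure_poly n c = monom 1 n + [:- c:]"

lemma poly_pure_poly: "poly (pure_poly n c) z = z ^ n - c"
  by (simp add: pure_poly_def poly_monom)

lemma degree_pure_poly: "0 < n \<Longrightarrow> degree (pure_poly n (c :: 'k::field)) = n"
  unfolding pure_poly_def by (subst degree_add_eq_left) (auto simp: degree_monom_eq)

lemma map_poly_pure_poly: "map_poly to_ac (pure_poly n c) = pure_poly n (to_ac c)"
  unfolding pure_poly_def map_poly_to_ac_add by (simp add: map_poly_monom map_poly_pCons)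

text \<open>The Eisenstein argument by valuations: the constant term of a factor is, up to the
  leading coefficient and sign, a product of roots x with x^n = w. The valuation of its n-th power
  shows that n divides the degree of the factor.\<close>

lemma irreducible_pure_poly:
  assumes "0 < n"
  shows "irreducible (pure_poly n (uniformizer :: 'a::nonarch_local_field_0))"
proof (rule Factorial_Ring.irreducibleI)
  let ?w = "uniformizer :: 'a" and ?p = "pure_poly n (uniformizer :: 'a)"
  note deg = degree_pure_poly[OF assms, of ?w]
  show "?p \<noteq> 0" using deg assms by auto
  show "\<not> ?p dvd 1"
  proof
    assume "?p dvd 1"
    then have "degree ?p = 0" using is_unit_iff_degree[OF \<open>?p \<noteq> 0\<close>] by blast
    then show False using deg assms by simp
  qed
  fix f g assume fg: "?p = f * g"
  have nz: "f \<noteq> 0" "g \<noteq> 0" using fg \<open>?p \<noteq> 0\<close> by auto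
  have dfg: "degree f + degree g = n" using fg nz deg by (metis degree_mult_eq)
  let ?f = "map_poly to_ac f"
  have degf: "degree ?f = degree f" by (intro degree_map_poly) simp
  have "?f \<noteq> 0" using nz(1) map_poly_to_ac_inj[of f 0] by auto
  then obtain A where A: "size A = degree f" "?f = smult (coeff ?f (degree ?f)) (\<Prod>x\<in>#A. [:-x, 1:])"
    using alg_closed_imp_factorization[of ?f] degf by auto
  define l where "l = coeff f (degree f)"
  have lc: "coeff ?f (degree ?f) = to_ac l" by (simp add: degf coeff_map_poly l_def)
  have l0: "l \<noteq> 0" using nz by (simp add: l_def)
  have roots: "x ^ n = to_ac ?w" if "x \<in># A" for x
  proof -
    have "poly (\<Prod>x\<in>#A. [:-x, 1:]) x = 0" using that by (auto simp: poly_prod_mset prod_mset_zero_iff)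
    then have "poly ?f x = 0" by (subst A(2)) simp
    then have "poly (map_poly to_ac ?p) x = 0" by (simp add: fg map_poly_to_ac_mult)
    then show ?thesis by (simp add: map_poly_pure_poly poly_pure_poly)
  qed
  have "to_ac (coeff f 0) = poly ?f 0" by (simp add: poly_0_coeff_0 coeff_map_poly)
  also have "\<dots> = to_ac l * (\<Prod>x\<in>#A. - x)" by (subst A(2)) (simp add: lc poly_prod_mset)
  finally have "to_ac (coeff f 0) ^ n = to_ac l ^ n * (\<Prod>x\<in>#A. - x) ^ n" by (simp add: power_mult_distrib)
  also have "(\<Prod>x\<in>#A. - x) ^ n = ((- 1) ^ n * to_ac ?w) ^ size A"
    using roots
  proof (induction A)
    case (add x A)
    have "(- x) ^ n = (- 1) ^ n * to_ac ?w" using add.prems[of x] by (metis power_minus union_single_eq_member)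
    moreover have "(\<Prod>x\<in>#add_mset x A. - x) ^ n = (- x) ^ n * (\<Prod>x\<in>#A. - x) ^ n"
      by (simp only: image_mset_add_mset prod_mset.add_mset power_mult_distrib)
    ultimately show ?case using add by simp
  qed simp
  finally have "to_ac (coeff f 0 ^ n) = to_ac (l ^ n * ((- 1) ^ n * ?w) ^ degree f)"
    by (simp add: A(1))
  then have eq: "coeff f 0 ^ n = l ^ n * ((- 1) ^ n * ?w) ^ degree f" by (simp only: to_ac_eq_iff)
  then have c0: "coeff f 0 \<noteq> 0" using l0 assms by (metis mult_eq_0_iff power_eq_0_iff uniformizer_nonzero neg_equal_0_iff_equal zero_neq_one)
  have u: "val ((- 1) ^ n * ?w) = 1" "(- 1) ^ n * ?w \<noteq> 0"
    by (rule val_unique) (simp_all add: absval_mult absval_power)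
  have "val (coeff f 0 ^ n) = val (l ^ n) + val (((- 1) ^ n * ?w) ^ degree f)"
    unfolding eq using l0 by (intro val_mult) simp_all
  then have "int n * val (coeff f 0) = int n * val l + int (degree f)"
    unfolding val_power[OF c0] val_power[OF l0] val_power[OF u(2)] u(1) by simp
  then have "int (degree f) = int n * (val (coeff f 0) - val l)" by (simp add: algebra_simps)
  then have "int n dvd int (degree f)" by (rule dvdI)
  then have "n dvd degree f" by (simp only: int_dvd_int_iff)
  then have "degree f = 0 \<or> degree f = n" using dfg by (metis dvd_imp_le le_add1 le_antisym neq0_conv)
  then have "degree f = 0 \<or> degree g = 0" using dfg by auto
  then show "f dvd 1 \<or> g dvd 1" using nz is_unit_iff_degree by blast
qed

text \<open>The localization F[z][1/p], viewed as functions on the complement of the roots of p; the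
  values at the roots are left free.\<close>

definition rat_funs :: "'a::field poly \<Rightarrow> ('a alg_closure \<Rightarrow> 'a alg_closure) set" where
  "rat_funs p = {f. \<exists>G r. \<forall>z. poly (map_poly to_ac p) z \<noteq> 0 \<longrightarrow>
     f z * poly (map_poly to_ac p) z ^ r = poly (map_poly to_ac G) z}"

lemma rat_funs_poly: "(\<lambda>z. poly (map_poly to_ac G) z) \<in> rat_funs p"
  unfolding rat_funs_def by (intro CollectI exI[of _ G] exI[of _ 0]) simp

lemma rat_funs_const: "(\<lambda>z. to_ac a) \<in> rat_funs p"
  using rat_funs_poly[of "[:a:]" p] by (simp add: map_poly_pCons)

lemma rat_funs_id: "(\<lambda>z. z) \<in> rat_funs p"
  using rat_funs_poly[of "[:0, 1:]" p] by (simp add: map_poly_pCons)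

lemma rat_funs_inverse: "(\<lambda>z. inverse (poly (map_poly to_ac p) z)) \<in> rat_funs p"
  unfolding rat_funs_def by (intro CollectI exI[of _ 1]) simp

lemma rat_funs_mult:
  assumes "f \<in> rat_funs p" "g \<in> rat_funs p"
  shows "(\<lambda>z. f z * g z) \<in> rat_funs p"
proof -
  obtain F r G s where
    F: "\<And>z. poly (map_poly to_ac p) z \<noteq> 0 \<Longrightarrow> f z * poly (map_poly to_ac p) z ^ r = poly (map_poly to_ac F) z" and
    G: "\<And>z. poly (map_poly to_ac p) z \<noteq> 0 \<Longrightarrow> g z * poly (map_poly to_ac p) z ^ s = poly (map_poly to_ac G) z"
    using assms unfolding rat_funs_def by blast
  show ?thesis unfolding rat_funs_def
    by (intro CollectI exI[of _ "F * G"] exI[of _ "r + s"])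
      (simp add: map_poly_to_ac_mult F [symmetric] G [symmetric] power_add mult_ac)
qed

lemma rat_funs_add:
  assumes "f \<in> rat_funs p" "g \<in> rat_funs p"
  shows "(\<lambda>z. f z + g z) \<in> rat_funs p"
proof -
  obtain F r G s where
    F: "\<And>z. poly (map_poly to_ac p) z \<noteq> 0 \<Longrightarrow> f z * poly (map_poly to_ac p) z ^ r = poly (map_poly to_ac F) z" and
    G: "\<And>z. poly (map_poly to_ac p) z \<noteq> 0 \<Longrightarrow> g z * poly (map_poly to_ac p) z ^ s = poly (map_poly to_ac G) z"
    using assms unfolding rat_funs_def by blast
  show ?thesis unfolding rat_funs_def
    by (intro CollectI exI[of _ "F * p ^ s + G * p ^ r"] exI[of _ "r + s"])
      (simp add: map_poly_to_ac_mult map_poly_to_ac_add map_poly_to_ac_power F [symmetric] G [symmetric]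
        power_add distrib_right mult_ac)
qed

lemma rat_funs_sum: "(\<And>i. i \<in> S \<Longrightarrow> f i \<in> rat_funs p) \<Longrightarrow> (\<lambda>x. \<Sum>i\<in>S. f i x) \<in> rat_funs p"
proof (induction S rule: infinite_finite_induct)
  case (insert i S)
  then show ?case using rat_funs_add[of "f i" p "\<lambda>x. \<Sum>i\<in>S. f i x"] by simp
qed (use rat_funs_const[of 0 p] in simp_all)

lemma rat_funs_prod: "(\<And>i. i \<in> S \<Longrightarrow> f i \<in> rat_funs p) \<Longrightarrow> (\<lambda>x. \<Prod>i\<in>S. f i x) \<in> rat_funs p"
proof (induction S rule: infinite_finite_induct)
  case (insert i S)
  then show ?case using rat_funs_mult[of "f i" p "\<lambda>x. \<Prod>i\<in>S. f i x"] by simp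
qed (use rat_funs_const[of 1 p] in simp_all)

lemma rat_funs_det:
  assumes "\<And>i j. (\<lambda>z. E z $ i $ j) \<in> rat_funs p"
  shows "(\<lambda>z. det (E z)) \<in> rat_funs p"
proof -
  have "(\<lambda>z. \<Sum>q | q permutes UNIV. to_ac (of_int (sign q)) * (\<Prod>i\<in>UNIV. E z $ i $ q i)) \<in> rat_funs p"
    by (intro rat_funs_sum rat_funs_mult rat_funs_const rat_funs_prod assms)
  then show ?thesis by (simp add: det_def)
qed

lemma rat_funs_regular:
  assumes E: "\<And>i j. (\<lambda>z. E z $ i $ j) \<in> rat_funs p" and d: "(\<lambda>z. inverse (det (E z))) \<in> rat_funs p"
    and f: "f \<in> regular_funs_H"
  shows "(\<lambda>z. f (E z, E z)) \<in> rat_funs p"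
  using f unfolding regular_funs_H_def
proof (induction rule: rat_algebra.induct)
  case (gen f)
  then show ?case using E d by (auto simp: coord_funs_def)
qed (auto intro: rat_funs_const rat_funs_add rat_funs_mult)

text \<open>For numerators F and G of the two functions, F G is a power of the prime p, so F is a
  constant times a power of p.\<close>

lemma rat_funs_unit:
  fixes p :: "'a::field_char_0 poly"
  assumes p: "irreducible p" and f: "f \<in> rat_funs p" and g: "g \<in> rat_funs p"
    and fg: "\<And>z. poly (map_poly to_ac p) z \<noteq> 0 \<Longrightarrow> f z * g z = 1"
  shows "\<exists>a m. a \<noteq> 0 \<and> (\<forall>z. poly (map_poly to_ac p) z \<noteq> 0 \<longrightarrow> f z = a * poly (map_poly to_ac p) z powi m)"
proof -
  let ?p = "map_poly to_ac p"
  obtain F r G s where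
    F: "\<And>z. poly ?p z \<noteq> 0 \<Longrightarrow> f z * poly ?p z ^ r = poly (map_poly to_ac F) z" and
    G: "\<And>z. poly ?p z \<noteq> 0 \<Longrightarrow> g z * poly ?p z ^ s = poly (map_poly to_ac G) z"
    using f g unfolding rat_funs_def by blast
  have "?p \<noteq> 0" using p map_poly_to_ac_inj[of p 0] by auto
  then have "finite {z. poly ?p z = 0}" by (rule poly_roots_finite)
  then have inf: "infinite {z. poly ?p z \<noteq> 0}"
    using infinite_UNIV_char_0[where 'a = "'a alg_closure"] by (simp add: Collect_neg_eq Compl_eq_Diff_UNIV)
  have "map_poly to_ac (F * G) = map_poly to_ac (p ^ (r + s))"
  proof (rule poly_eq_infinite[OF inf])
    fix z assume "z \<in> {z. poly ?p z \<noteq> 0}"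
    then have z: "poly ?p z \<noteq> 0" by simp
    have "poly (map_poly to_ac (F * G)) z = (f z * g z) * (poly ?p z ^ r * poly ?p z ^ s)"
      by (simp add: map_poly_to_ac_mult F[OF z, symmetric] G[OF z, symmetric] mult_ac)
    then show "poly (map_poly to_ac (F * G)) z = poly (map_poly to_ac (p ^ (r + s))) z"
      using fg[OF z] by (simp add: map_poly_to_ac_power map_poly_to_ac_mult power_add)
  qed
  then have FG: "F * G = p ^ (r + s)" by (rule map_poly_to_ac_inj)
  have prime: "prime_elem p" using p by (rule field_poly_irreducible_imp_prime)
  have "p ^ (r + s) dvd F * G" by (simp add: FG)
  then obtain i j where ij: "i + j = r + s" "p ^ i dvd F" "p ^ j dvd G"
    using prime_elem_power_dvd_prod[OF _ prime] by blast
  then obtain u v where uv: "F = p ^ i * u" "G = p ^ j * v" by (auto elim!: dvdE)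
  have "p ^ (r + s) * (u * v) = p ^ (r + s) * 1"
    using FG unfolding uv ij(1) [symmetric] by (simp add: power_add mult_ac)
  moreover have "p ^ (r + s) \<noteq> 0" using prime by (intro power_not_zero) auto
  ultimately have "u * v = 1" using mult_left_cancel by blast
  then have "u dvd 1" by (metis dvdI)
  moreover have "u \<noteq> 0" using \<open>u * v = 1\<close> by auto
  ultimately have "degree u = 0" using is_unit_iff_degree by blast
  then obtain a where a: "u = [:a:]" by (rule degree_eq_zeroE)
  have "a \<noteq> 0" using \<open>u * v = 1\<close> a by auto
  have "f z = to_ac a * poly ?p z powi (int i - int r)" if z: "poly ?p z \<noteq> 0" for z
  proof -
    have "f z * poly ?p z ^ r = to_ac a * poly ?p z ^ i"
      using F[OF z] by (simp add: uv a map_poly_to_ac_mult map_poly_to_ac_power map_poly_smult)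
    then show ?thesis using z by (simp add: power_int_diff field_simps)
  qed
  then show ?thesis using \<open>a \<noteq> 0\<close> by (intro exI[of _ "to_ac a"] exI[of _ "int i - int r"]) auto
qed

text \<open>Over the algebraic closure the stabilizer consists of values of polynomials at Pi, so a
  character is determined by its values on Pi - z. As a function of z these are units of
  F[z][1/(z^n - w)], hence of the form a (z^n - w)^m. Triviality on scalars yields m = 0 and a =
  1.\<close>

lemma stabilizer_anisotropic_cyc:
  fixes s :: "'a::nonarch_local_field_0"
  assumes s: "s \<noteq> 0"
  shows "stabilizer_anisotropic_mod_scalars (mat s ** Pi_mat :: 'a^'n^'n, mat 1)"
  unfolding stabilizer_anisotropic_mod_scalars_def
proof (intro allI impI ballI)
  fix \<psi> h
  let ?x = "(mat s ** Pi_mat :: 'a^'n^'n, mat 1)"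
  let ?n = "CARD('n)" and ?w = "uniformizer :: 'a"
  let ?c = "to_ac ?w"
  let ?M = "cyc ?c :: 'a alg_closure^'n^'n"
  assume asm: "rational_character ?x \<psi> \<and> (\<forall>z. z \<noteq> 0 \<longrightarrow> \<psi> (mat z, mat z) = 1)" and h: "h \<in> geom_stabilizer ?x"
  have "base_change ?x = (mat (to_ac s) ** ?M, mat 1)"
    by (simp add: base_change_def vec_eq_iff) (simp add: cyc_def mat_def)
  then have stab: "geom_stabilizer ?x = {(e, e) | e. invertible e \<and> e ** ?M = ?M ** e}"
    unfolding geom_stabilizer_def using stabilizer_cyc[of "to_ac s" ?c] s by simp
  define t where "t e = \<psi> (e, e)" for e
  define C where "C = {e. invertible e \<and> e ** ?M = ?M ** e}"
  have Cmeval: "meval ?M f \<in> C" if "invertible (meval ?M f)" for f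
    using that meval_commute_base by (simp add: C_def)
  have mult: "t (e ** e') = t e * t e'" if "e \<in> C" "e' \<in> C" for e e'
    using asm that unfolding rational_character_def stab t_def C_def by (auto simp: GLxGL_def)
  have scalar: "t (mat z) = 1" if "z \<noteq> 0" for z using asm that by (simp add: t_def)
  let ?p = "pure_poly ?n ?w"
  define pe where "pe z = poly (map_poly to_ac ?p) z" for z
  have pe: "pe z = z ^ ?n - ?c" for z by (simp add: pe_def map_poly_pure_poly poly_pure_poly)
  \<comment> \<open>The quotient of X^n - z^n by X - z. At Pi the dividend becomes the scalar w -
    z^n, which makes the inverse of Pi - z explicit and regular in z.\<close>
  define q where "q z = (\<Sum>i<?n. monom 1 (?n - Suc i) * [:z:] ^ i)" for z :: "'a alg_closure"
  define E where "E z = meval ?M [:- z, 1:]" for z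
  define E' where "E' z = mat (- inverse (pe z)) ** meval ?M (q z)" for z
  have Eq: "E z ** meval ?M (q z) = mat (- pe z)" for z
  proof -
    have "[:z:] ^ ?n - monom 1 1 ^ ?n = ([:z:] - monom 1 1) * (\<Sum>i<?n. monom 1 1 ^ (?n - Suc i) * [:z:] ^ i)"
      by (rule power_diff_sumr2)
    then have "monom 1 1 ^ ?n - [:z:] ^ ?n = (monom 1 1 - [:z:]) * (\<Sum>i<?n. monom 1 1 ^ (?n - Suc i) * [:z:] ^ i)"
      by (simp only: minus_diff_eq [symmetric, of "monom 1 1 ^ ?n"] minus_diff_eq [symmetric, of "monom 1 1"] minus_mult_left)
    moreover have "monom 1 1 - [:z:] = [:- z, 1:]" by (simp add: monom_altdef)
    ultimately have "[:- z, 1:] * q z = monom 1 ?n - [:z ^ ?n:]"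
      by (simp add: q_def monom_power poly_const_pow)
    then have "E z ** meval ?M (q z) = meval ?M (monom 1 ?n - [:z ^ ?n:])"
      unfolding E_def by (simp only: meval_mult [symmetric])
    then show ?thesis by (simp add: meval_diff cyc_power_CARD pe) (simp add: vec_eq_iff mat_def)
  qed
  have EE': "E z ** E' z = mat 1" if "pe z \<noteq> 0" for z
  proof -
    have "E z ** E' z = mat (- inverse (pe z)) ** (E z ** meval ?M (q z))"
      unfolding E'_def by (simp add: matrix_mul_assoc mat_mult_commute[of _ "E z"])
    then show ?thesis using that by (simp add: Eq mat_mult_mat)
  qed
  have Einv: "invertible (E z)" "invertible (E' z)" if "pe z \<noteq> 0" for z
    using matrix_inv_unique_right[OF EE'[OF that]] by auto
  have EC: "E z \<in> C" "E' z \<in> C" if "pe z \<noteq> 0" for z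
  proof -
    show "E z \<in> C" using Einv(1)[OF that] unfolding E_def by (rule Cmeval)
    have "E' z = meval ?M (smult (- inverse (pe z)) (q z))" unfolding E'_def meval_smult ..
    then show "E' z \<in> C" using Einv(2)[OF that] Cmeval by simp
  qed
  have entry: "(\<lambda>z. E z $ i $ j) \<in> rat_funs ?p" for i j
  proof -
    have "(\<lambda>z. to_ac (if i = j then - 1 else 0) * z + to_ac ((cyc ?w :: 'a^'n^'n) $ i $ j)) \<in> rat_funs ?p"
      by (intro rat_funs_add rat_funs_mult rat_funs_const rat_funs_id)
    moreover have "(\<lambda>z. to_ac (if i = j then - 1 else 0) * z + to_ac ((cyc ?w :: 'a^'n^'n) $ i $ j)) = (\<lambda>z. E z $ i $ j)"
    proof -
      have "E z = mat (- z) + ?M" for z by (simp add: E_def)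
      then show ?thesis by (auto simp: fun_eq_iff) (auto simp: mat_def cyc_def)
    qed
    ultimately show ?thesis by simp
  qed
  have pw: "\<exists>G. meval ?M (monom 1 k) $ i $ j = to_ac G" for k i j
  proof (induction k arbitrary: i j)
    case 0
    show ?case by (rule exI[of _ "if i = j then 1 else 0"]) (simp add: monom_0 mat_def)
  next
    case (Suc k)
    show ?case
    proof (cases "idx i = 0")
      case True
      obtain G where "meval ?M (monom 1 k) $ ix (?n - 1) $ j = to_ac G" using Suc.IH by blast
      then show ?thesis using True by (intro exI[of _ "?w * G"]) (simp add: monom_Suc cyc_mult_nth)
    next
      case False
      then show ?thesis using Suc.IH[of "ix (idx i - 1)" j] by (simp add: monom_Suc cyc_mult_nth)
    qed
  qed
  have entry': "(\<lambda>z. E' z $ i $ j) \<in> rat_funs ?p" for i j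
  proof -
    have "\<forall>k. \<exists>G. meval ?M (monom 1 k) $ i $ j = to_ac G" by (intro allI pw)
    from choice[OF this] obtain G where G: "\<And>k. meval ?M (monom 1 k) $ i $ j = to_ac (G k)" by blast
    have "(\<lambda>z. to_ac (- 1) * inverse (pe z) * (\<Sum>k<?n. to_ac (G (?n - Suc k)) * (\<Prod>l<k. z))) \<in> rat_funs ?p"
      unfolding pe_def
      by (intro rat_funs_sum rat_funs_mult rat_funs_const rat_funs_id rat_funs_inverse rat_funs_prod)
    moreover have "(\<lambda>z. to_ac (- 1) * inverse (pe z) * (\<Sum>k<?n. to_ac (G (?n - Suc k)) * (\<Prod>l<k. z))) = (\<lambda>z. E' z $ i $ j)"
      by (auto simp: E'_def fun_eq_iff q_def meval_sum meval_smult G poly_const_pow mult.commute simp del: smult_monom)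
    ultimately show ?thesis by simp
  qed
  have dets: "det (E z) * det (E' z) = 1" if "pe z \<noteq> 0" for z
    using EE'[OF that] by (simp add: det_mul [symmetric])
  have cong: "f \<in> rat_funs ?p" if "g \<in> rat_funs ?p" "\<And>z. pe z \<noteq> 0 \<Longrightarrow> f z = g z" for f g
    using that unfolding rat_funs_def pe_def by auto
  have \<psi>: "\<psi> \<in> regular_funs_H" using asm by (simp add: rational_character_def)
  have "(\<lambda>z. \<psi> (E z, E z)) \<in> rat_funs ?p"
  proof (rule rat_funs_regular[OF entry _ \<psi>])
    show "(\<lambda>z. inverse (det (E z))) \<in> rat_funs ?p"
      by (rule cong[OF rat_funs_det[OF entry']]) (use dets inverse_unique in metis)
  qed
  moreover have "(\<lambda>z. \<psi> (E' z, E' z)) \<in> rat_funs ?p"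
  proof (rule rat_funs_regular[OF entry' _ \<psi>])
    show "(\<lambda>z. inverse (det (E' z))) \<in> rat_funs ?p"
      by (rule cong[OF rat_funs_det[OF entry]]) (use dets inverse_unique mult.commute in metis)
  qed
  moreover have "t (E z) * t (E' z) = 1" if "pe z \<noteq> 0" for z
    using mult[OF EC[OF that]] EE'[OF that] scalar[of 1] by simp
  ultimately obtain a m where am: "a \<noteq> 0" "\<And>z. pe z \<noteq> 0 \<Longrightarrow> t (E z) = a * pe z powi m"
    using rat_funs_unit[OF irreducible_pure_poly[of ?n], of "\<lambda>z. \<psi> (E z, E z)" "\<lambda>z. \<psi> (E' z, E' z)"]
    unfolding t_def pe_def by auto
  have Esing: "pe z \<noteq> 0" if "invertible (E z)" for z
  proof
    assume "pe z = 0"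
    then obtain v :: "'a alg_closure^'n" where v: "v \<noteq> 0" "?M *v v = z *s v"
      using cyc_eigenvector[of z ?c] by (auto simp: pe)
    have "E z *v v = 0" unfolding E_def
      using v by (simp add: matrix_vector_mult_add_rdistrib mat_mult_vec)
    then show False using that v(1) invertible_iff_inj by blast
  qed
  \<comment> \<open>All linear factors of an invertible value are invertible themselves, so
    multiplicativity can be used factor by factor.\<close>
  have factors: "t (meval ?M (\<Prod>x\<in>#A. [:-x, 1:])) = a ^ size A * (\<Prod>x\<in>#A. pe x) powi m \<and> (\<forall>x\<in>#A. pe x \<noteq> 0)"
    if "invertible (meval ?M (\<Prod>x\<in>#A. [:-x, 1:]))" for A
    using that
  proof (induction A)
    case empty
    show ?case using scalar[of 1] by simp
  next
    case (add x A)
    let ?P = "meval ?M (\<Prod>x\<in>#A. [:-x, 1:])"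
    have eq: "meval ?M (\<Prod>x\<in>#add_mset x A. [:-x, 1:]) = E x ** ?P" by (simp add: E_def meval_mult del: meval_pCons mult_pCons_left)
    have "det (E x) * det ?P \<noteq> 0" using add.prems unfolding eq by (simp add: invertible_det_nz det_mul)
    then have inv: "invertible (E x)" "invertible ?P" by (auto simp: invertible_det_nz)
    have pe: "pe x \<noteq> 0" using Esing inv by blast
    have "t (E x ** ?P) = t (E x) * t ?P" using EC[OF pe] Cmeval[OF inv(2)] by (intro mult)
    then show ?case unfolding eq using add.IH[OF inv(2)] am(2)[OF pe] pe
      by (simp add: power_int_mult_distrib mult_ac)
  qed
  have general: "\<exists>A. size A = degree f \<and> t (meval ?M f) = a ^ size A * (\<Prod>x\<in>#A. pe x) powi m \<and>
      f = smult (coeff f (degree f)) (\<Prod>x\<in>#A. [:-x, 1:])"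
    if f: "f \<noteq> 0" "invertible (meval ?M f)" for f
  proof -
    obtain A where A: "size A = degree f" "f = smult (coeff f (degree f)) (\<Prod>x\<in>#A. [:-x, 1:])"
      using alg_closed_imp_factorization[OF f(1)] by blast
    let ?P = "meval ?M (\<Prod>x\<in>#A. [:-x, 1:])" and ?l = "coeff f (degree f)"
    have l: "?l \<noteq> 0" using f(1) by simp
    have eq: "meval ?M f = mat ?l ** ?P" by (subst A(2)) (rule meval_smult)
    have "det (mat ?l :: 'a alg_closure^'n^'n) * det ?P \<noteq> 0" using f(2) unfolding eq by (simp add: invertible_det_nz det_mul)
    then have P: "invertible ?P" by (auto simp: invertible_det_nz)
    have "mat ?l \<in> C" using l by (simp add: C_def invertible_mat mat_mult_commute)
    then have "t (meval ?M f) = t ?P" unfolding eq using mult Cmeval[OF P] scalar[OF l] by simp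
    then show ?thesis using A factors[OF P] by (intro exI[of _ A]) simp
  qed
  \<comment> \<open>X^n - (w + d) takes the scalar value - d at Pi, while each of its n roots x
    satisfies x^n - w = d.\<close>
  have pure: "1 = a ^ ?n * (d ^ ?n) powi m" if d: "d \<noteq> 0" for d
  proof -
    let ?f = "pure_poly ?n (?c + d)"
    have ev: "meval ?M ?f = mat (- d)"
      by (simp add: pure_poly_def meval_add cyc_power_CARD) (simp add: vec_eq_iff mat_def)
    have "?f \<noteq> 0" using degree_pure_poly[of ?n "?c + d"] by (metis degree_0 less_irrefl zero_less_card_finite)
    moreover have "invertible (meval ?M ?f)" unfolding ev using d by (intro invertible_mat) simp
    ultimately obtain A where A: "size A = degree ?f" "t (meval ?M ?f) = a ^ size A * (\<Prod>x\<in>#A. pe x) powi m"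
      "?f = smult (coeff ?f (degree ?f)) (\<Prod>x\<in>#A. [:-x, 1:])" using general by blast
    have szA: "size A = ?n" using A(1) by (simp add: degree_pure_poly)
    have "pe x = d" if "x \<in># A" for x
    proof -
      have "poly (\<Prod>x\<in>#A. [:-x, 1:]) x = 0" using that by (auto simp: poly_prod_mset prod_mset_zero_iff)
      then have "poly ?f x = 0" by (subst A(3)) simp
      then show ?thesis by (simp add: poly_pure_poly pe)
    qed
    then have "(\<Prod>x\<in>#A. pe x) = (\<Prod>x\<in>#A. d)" by (simp cong: image_mset_cong)
    then have "(\<Prod>x\<in>#A. pe x) = d ^ ?n" by (simp add: szA)
    then show ?thesis using A(2) scalar[of "- d"] d unfolding ev szA by simp
  qed
  have an: "a ^ ?n = 1" using pure[of 1] by simp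
  \<comment> \<open>In characteristic 0 the number 2 is not a root of unity, so taking d = 2 after d
    = 1 rules out every m other than 0.\<close>
  have "((2 :: 'a alg_closure) ^ ?n) powi m = 1" using pure[of 2] an by simp
  then have "(2 :: 'a alg_closure) powi (int ?n * m) = 1" by (simp add: power_int_mult)
  then have m0: "m = 0"
  proof -
    assume two: "(2 :: 'a alg_closure) powi (int ?n * m) = 1"
    have k0: "k = 0" if "(2 :: 'a alg_closure) ^ k = 1" for k
    proof -
      have "of_nat (2 ^ k) = (of_nat 1 :: 'a alg_closure)" using that by simp
      then have "(2::nat) ^ k = 1" by (simp only: of_nat_eq_iff)
      then show ?thesis by simp
    qed
    have "int ?n * m = 0"
    proof (cases "int ?n * m \<ge> 0")
      case True
      then show ?thesis using two k0[of "nat (int ?n * m)"] by (simp add: power_int_def)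
    next
      case False
      then have "inverse (2 :: 'a alg_closure) ^ nat (- (int ?n * m)) = 1" using two by (simp add: power_int_def)
      then have "(2 :: 'a alg_closure) ^ nat (- (int ?n * m)) = 1"
        unfolding power_inverse by (metis inverse_eq_1_iff)
      then show ?thesis using k0 False by fastforce
    qed
    then show ?thesis by simp
  qed
  have deg: "t (meval ?M f) = a ^ degree f" if "f \<noteq> 0" "invertible (meval ?M f)" for f
    using general[OF that] m0 by auto
  have a1: "a = 1"
  proof (cases "?n = 1")
    case True
    then show ?thesis using an by simp
  next
    case False
    then have n: "1 < ?n" by (metis less_one linorder_neqE_nat zero_less_card_finite less_irrefl)
    let ?f = "[:0, 1:] :: 'a alg_closure poly"
    \<comment> \<open>X^n + X - w and X both take the value Pi but have degrees n and 1, so a^n =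
      a.\<close>
    let ?g = "monom 1 ?n + [:- ?c, 1:]"
    have "pe 0 \<noteq> 0" by (simp add: pe power_0_left)
    then have inv: "invertible (meval ?M ?f)" using Einv(1)[of 0] by (simp add: E_def)
    have eq: "meval ?M ?g = meval ?M ?f"
      by (simp add: meval_add cyc_power_CARD) (simp add: vec_eq_iff mat_def)
    have dg: "degree ?g = ?n" using n by (subst degree_add_eq_left) (auto simp: degree_monom_eq)
    then have "?g \<noteq> 0" using n by (metis degree_0 not_less_zero)
    then have "t (meval ?M ?g) = a ^ ?n" using deg[of ?g] inv unfolding eq dg by simp
    moreover have "t (meval ?M ?f) = a ^ 1" using deg[of ?f] inv by simp
    ultimately show ?thesis using an eq by simp
  qed
  obtain e where e: "h = (e, e)" "invertible e" "e ** ?M = ?M ** e" using h stab by auto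
  define f where "f = col_poly (e *v axis (ix 0) 1)"
  have ef: "e = meval ?M f" unfolding f_def using e(3) by (rule commutant_cyc)
  have "f \<noteq> 0"
  proof
    assume "f = 0"
    then have "e = 0" using ef by simp
    then have "e *v axis (ix 0) 1 = 0" by simp
    moreover have "axis (ix 0) 1 \<noteq> (0 :: 'a alg_closure^'n)" by (simp add: axis_eq_0_iff)
    ultimately show False using e(2) invertible_iff_inj by blast
  qed
  then show "\<psi> h = 1" using deg[of f] e ef a1 by (simp add: t_def)
qed

section \<open>Counting cosets\<close>

text \<open>By Cauchy's theorem, taken from Sylow's, every prime divisor of the order is the order
  of an element and so divides a power of p.\<close>

lemma group_prime_power_order:
  fixes Q (structure)
  assumes Q: "group Q" "finite (carrier Q)" and p: "prime (p :: nat)"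
    and pow: "\<And>x. x \<in> carrier Q \<Longrightarrow> \<exists>s :: nat. x [^] (p ^ s) = \<one>"
  shows "\<exists>k. order Q = p ^ k"
proof -
  interpret group Q by (rule Q)
  have pos: "0 < order Q" using Q by (simp add: order_gt_0_iff_finite)
  have only: "q = p" if q: "prime q" "q dvd order Q" for q
  proof -
    obtain m where "order Q = q ^ 1 * m" using q(2) by auto
    then obtain H where H: "subgroup H Q" "card H = q"
      using sylow_thm[OF q(1) Q(1) _ Q(2), of 1 m] by auto
    have "\<not> H \<subseteq> {\<one>}"
    proof
      assume "H \<subseteq> {\<one>}"
      then have "card H \<le> 1" using card_mono[of "{\<one>}" H] by simp
      then show False using H(2) prime_gt_1_nat[OF q(1)] by simp
    qed
    then obtain x where x: "x \<in> H" "x \<noteq> \<one>" by blast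
    have xG: "x \<in> carrier Q" using x H subgroup.mem_carrier by metis
    have "x [^] q = \<one>"
    proof -
      interpret H: group "Q\<lparr>carrier := H\<rparr>" using H(1) by (rule subgroup.subgroup_is_group) (rule Q(1))
      have "x [^]\<^bsub>Q\<lparr>carrier := H\<rparr>\<^esub> order (Q\<lparr>carrier := H\<rparr>) = \<one>\<^bsub>Q\<lparr>carrier := H\<rparr>\<^esub>"
        using x(1) by (intro H.pow_order_eq_1) simp
      then show ?thesis using H(2) by (simp add: order_def nat_pow_consistent [symmetric])
    qed
    then have "ord x dvd q" using pow_eq_id[OF xG] by simp
    moreover have "ord x \<noteq> 1" using x(2) xG pow_eq_id[OF xG, of 1] by auto
    ultimately have ordq: "ord x = q" using q(1) by (metis prime_nat_iff)
    obtain s where "x [^] (p ^ s) = \<one>" using pow[OF xG] by blast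
    then have "q dvd p ^ s" using pow_eq_id[OF xG] ordq by simp
    then have "q dvd p" using q(1) prime_dvd_power by blast
    then show ?thesis using p q(1) primes_dvd_imp_eq by blast
  qed
  obtain m where m: "order Q = p ^ multiplicity p (order Q) * m" "\<not> p dvd m"
    using multiplicity_decompose'[of "order Q" p] pos p by (metis not_prime_unit less_irrefl)
  have "m = 1"
  proof (rule ccontr)
    assume "m \<noteq> 1"
    then obtain q where q: "prime q" "q dvd m" using prime_factor_nat by blast
    then have "q dvd order Q" by (subst m(1)) simp
    then show False using only[OF q(1)] q(2) m(2) by simp
  qed
  then show ?thesis using m(1) by auto
qed

lemma card_image_cong_iff:
  assumes "\<And>x y. x \<in> S \<Longrightarrow> y \<in> S \<Longrightarrow> f x = f y \<longleftrightarrow> g x = g y"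
  shows "card (f ` S) = card (g ` S)"
proof -
  have "bij_betw (\<lambda>a. g (SOME x. x \<in> S \<and> f x = a)) (f ` S) (g ` S)"
  proof (rule bij_betw_imageI)
    have some: "(SOME y. y \<in> S \<and> f y = f x) \<in> S \<and> f (SOME y. y \<in> S \<and> f y = f x) = f x" if "x \<in> S" for x
      using someI[of "\<lambda>y. y \<in> S \<and> f y = f x" x] that by blast
    then have g: "g (SOME y. y \<in> S \<and> f y = f x) = g x" if "x \<in> S" for x
      using assms that by blast
    show "inj_on (\<lambda>a. g (SOME x. x \<in> S \<and> f x = a)) (f ` S)"
      using g assms by (auto simp: inj_on_def)
    show "(\<lambda>a. g (SOME x. x \<in> S \<and> f x = a)) ` f ` S = g ` S"
      using g by (auto simp: image_image cong: image_cong)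
  qed
  then show ?thesis by (rule bij_betw_same_card)
qed

context group
begin

text \<open>Commutativity makes \<open>N\<close> normal in \<open>C\<close>, and in the quotient
  every element has p-power order.\<close>

lemma prime_power_card_cosets:
  assumes C: "subgroup C G" and comm: "\<And>x y. x \<in> C \<Longrightarrow> y \<in> C \<Longrightarrow> x \<otimes> y = y \<otimes> x"
    and N: "subgroup N G" "N \<subseteq> C" and fin: "finite ((\<lambda>x. N #> x) ` C)"
    and p: "prime (p :: nat)" "\<And>x. x \<in> C \<Longrightarrow> \<exists>s :: nat. x [^] (p ^ s) \<in> N"
  shows "\<exists>k. card ((\<lambda>x. N #> x) ` C) = p ^ k"
proof -
  let ?C = "G\<lparr>carrier := C\<rparr>"
  interpret C: group ?C using C by (rule subgroup.subgroup_is_group) (rule group_axioms)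
  have NC: "subgroup N ?C" using N C by (intro subgroup_incl)
  interpret C: comm_group ?C by (rule C.group_comm_groupI) (use comm in simp)
  have norm: "normal N ?C" using NC by (rule C.subgroup_imp_normal)
  have coset: "N #>\<^bsub>?C\<^esub> x = N #> x" for x by (simp add: r_coset_def)
  have carr: "carrier (?C Mod N) = (\<lambda>x. N #> x) ` C"
    by (auto simp: FactGroup_def RCOSETS_def coset)
  have grp: "group (?C Mod N)" using norm by (rule normal.factorgroup_is_group)
  interpret N: normal N ?C by (rule norm)
  interpret Q: group "?C Mod N" by (rule grp)
  have powQ: "(N #> x) [^]\<^bsub>?C Mod N\<^esub> (k :: nat) = N #> (x [^] k)" if "x \<in> C" for x k
  proof (induction k)
    case 0
    show ?case using N by (simp add: FactGroup_def coset_mult_one subgroup.subset)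
  next
    case (Suc k)
    have xk: "x [^] k \<in> C" using that C by (induction k) (auto simp: subgroup.one_closed subgroup.m_closed)
    have "(N #> (x [^] k)) <#>\<^bsub>?C\<^esub> (N #> x) = N #> (x [^] k \<otimes> x)"
      using N.rcos_sum[of "x [^] k" x] xk that by (simp add: coset)
    then show ?case using Suc by (simp add: FactGroup_def)
  qed
  have "\<exists>k. order (?C Mod N) = p ^ k"
  proof (rule group_prime_power_order[OF grp _ p(1)])
    show "finite (carrier (?C Mod N))" using fin carr by simp
    fix y assume "y \<in> carrier (?C Mod N)"
    then obtain x where x: "x \<in> C" "y = N #> x" using carr by auto
    obtain s :: nat where "x [^] (p ^ s) \<in> N" using p(2)[OF x(1)] by blast
    then have "N #> (x [^] (p ^ s)) = N" using N(1) by (intro coset_join2) (auto simp: subgroup.mem_carrier)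
    then have "y [^]\<^bsub>?C Mod N\<^esub> (p ^ s) = \<one>\<^bsub>?C Mod N\<^esub>" using powQ[OF x(1)] x(2) by (simp add: FactGroup_def)
    then show "\<exists>s :: nat. y [^]\<^bsub>?C Mod N\<^esub> (p ^ s) = \<one>\<^bsub>?C Mod N\<^esub>" by blast
  qed
  then show ?thesis by (simp add: order_def carr)
qed

lemma lcoset_eq_iff:
  assumes "subgroup K G" "x \<in> carrier G" "y \<in> carrier G"
  shows "x <# K = y <# K \<longleftrightarrow> inv x \<otimes> y \<in> K"
proof
  assume eq: "x <# K = y <# K"
  have "y \<in> y <# K" using assms subgroup.one_closed[OF assms(1)] by (force simp: l_coset_def)
  then obtain k where k: "k \<in> K" "y = x \<otimes> k" using eq by (auto simp: l_coset_def)
  then have "inv x \<otimes> y = k" using assms by (simp add: subgroup.mem_carrier m_assoc [symmetric])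
  then show "inv x \<otimes> y \<in> K" using k by simp
next
  assume k: "inv x \<otimes> y \<in> K"
  have "y = x \<otimes> (inv x \<otimes> y)" using assms by (simp add: m_assoc [symmetric])
  then have "y \<in> x <# K" using k by (auto simp: l_coset_def)
  then show "x <# K = y <# K" using assms by (intro l_repr_independence)
qed

text \<open>The sets of cosets \<open>T s\<close> with s b = c, for b in the \<open>S\<close>-orbit
  of c, are right translates of one another and so have the same measure. Together they cover the
  image of \<open>S\<close>, each coset \<open>T s\<close> being counted once for each b in s^-1 (T
  \<inter> S) c.\<close>

lemma coset_double_count:
  fixes c :: "'a set" and \<mu> :: "'a set measure"
  assumes T: "subgroup T G" and S: "subgroup S G" and c: "c \<subseteq> carrier G"
    and fin: "finite ((\<lambda>s. s <# c) ` S)"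
    and space: "space \<mu> = rcosets T"
    and meas: "\<And>s. s \<in> S \<Longrightarrow> {T #> r | r. r \<in> S \<and> r <# (s <# c) = c} \<in> sets \<mu>" "{T #> s | s. s \<in> S} \<in> sets \<mu>"
    and inv: "\<And>g A. g \<in> carrier G \<Longrightarrow> A \<in> sets \<mu> \<Longrightarrow> emeasure \<mu> ((\<lambda>C. C #> g) ` A) = emeasure \<mu> A"
  shows "of_nat (card ((\<lambda>s. s <# c) ` S)) * emeasure \<mu> {T #> s | s. s \<in> S \<and> s <# c = c} =
    of_nat (card ((\<lambda>t. t <# c) ` (T \<inter> S))) * emeasure \<mu> {T #> s | s. s \<in> S}"
proof -
  define B where "B = (\<lambda>s. s <# c) ` S"
  define E where "E b = {T #> s | s. s \<in> S \<and> s <# b = c}" for b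
  define D where "D = {T #> s | s. s \<in> S}"
  have Sc: "s \<in> carrier G" if "s \<in> S" for s using that S subgroup.mem_carrier by metis
  have Tc: "s \<in> carrier G" if "s \<in> T" for s using that T subgroup.mem_carrier by metis
  have TG: "T \<subseteq> carrier G" using Tc by blast
  have lc: "g <# (g' <# c) = (g \<otimes> g') <# c" if "g \<in> carrier G" "g' \<in> carrier G" for g g'
    using that c by (intro lcos_m_assoc)
  have one: "\<one> <# c = c" using c by (rule lcos_mult_one)
  have Emeas: "E b \<in> sets \<mu>" if "b \<in> B" for b using that meas(1) by (auto simp: B_def E_def)
  have cB: "c \<in> B" unfolding B_def using one subgroup.one_closed[OF S] by force
  have Etrans: "emeasure \<mu> (E b) = emeasure \<mu> (E c)" if bB: "b \<in> B" for b
  proof -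
    obtain s0 where s0: "s0 \<in> S" "b = s0 <# c" using bB by (auto simp: B_def)
    have i0: "inv s0 \<in> S" using s0 S subgroup.m_inv_closed by metis
    have "E b = (\<lambda>C. C #> inv s0) ` E c"
    proof (intro equalityI subsetI)
      fix C assume "C \<in> E b"
      then obtain s where s: "s \<in> S" "s <# b = c" "C = T #> s" by (auto simp: E_def)
      have "s \<otimes> s0 \<in> S" using s s0 S subgroup.m_closed by metis
      moreover have "(s \<otimes> s0) <# c = c" using s s0 lc[of s s0] Sc by simp
      ultimately have "T #> (s \<otimes> s0) \<in> E c" by (auto simp: E_def)
      moreover have "C = (T #> (s \<otimes> s0)) #> inv s0"
        using s s0 Sc TG by (simp add: coset_mult_assoc m_assoc)
      ultimately show "C \<in> (\<lambda>C. C #> inv s0) ` E c" by blast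
    next
      fix C assume "C \<in> (\<lambda>C. C #> inv s0) ` E c"
      then obtain s where s: "s \<in> S" "s <# c = c" "C = (T #> s) #> inv s0" by (auto simp: E_def)
      have "s \<otimes> inv s0 \<in> S" using s i0 S subgroup.m_closed by metis
      moreover have "(s \<otimes> inv s0) <# b = c"
        using s s0 Sc lc[of "s \<otimes> inv s0" s0] by (simp add: m_assoc)
      moreover have "C = T #> (s \<otimes> inv s0)" using s s0 Sc TG by (simp add: coset_mult_assoc)
      ultimately show "C \<in> E b" by (auto simp: E_def)
    qed
    then show ?thesis using inv[of "inv s0" "E c"] i0 Sc Emeas[OF cB] by simp
  qed
  \<comment> \<open>Another representative of the same coset is t s with t in T \<inter> S, and it
    forces b = s^-1 t^-1 c.\<close>
  have count: "card {b \<in> B. T #> s \<in> E b} = card ((\<lambda>t. t <# c) ` (T \<inter> S))" if s: "s \<in> S" for s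
  proof -
    have iS: "inv s \<in> S" using s S subgroup.m_inv_closed by metis
    have "{b \<in> B. T #> s \<in> E b} = (\<lambda>b. inv s <# b) ` ((\<lambda>t. t <# c) ` (T \<inter> S))"
    proof (intro equalityI subsetI)
      fix b assume "b \<in> {b \<in> B. T #> s \<in> E b}"
      then obtain s' s0 where s': "s' \<in> S" "s' <# b = c" "T #> s = T #> s'" and s0: "s0 \<in> S" "b = s0 <# c"
        by (auto simp: E_def B_def)
      have "s' \<in> T #> s" unfolding s'(3) using s' Sc T by (intro rcos_self) auto
      then obtain t where t: "t \<in> T" "s' = t \<otimes> s" by (auto simp: r_coset_def)
      have "t = s' \<otimes> inv s" using t s Sc Tc by (simp add: m_assoc)
      then have tS: "t \<in> S" using s' iS S subgroup.m_closed by metis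
      have ti: "inv t \<in> T \<inter> S" using t tS T S by (simp add: subgroup.m_inv_closed)
      have "b = (inv s' \<otimes> s') <# b" using s0 s' Sc c by (simp add: lc one lcos_mult_one l_coset_subset_G)
      also have "\<dots> = inv s' <# (s' <# b)"
        using s0 s' Sc c by (intro lcos_m_assoc [symmetric]) (auto simp: l_coset_subset_G)
      also have "\<dots> = inv s <# (inv t <# c)"
        using s'(2) t(2) s Sc Tc t(1) by (simp add: lc inv_mult_group)
      finally show "b \<in> (\<lambda>b. inv s <# b) ` ((\<lambda>t. t <# c) ` (T \<inter> S))" using ti by blast
    next
      fix b assume "b \<in> (\<lambda>b. inv s <# b) ` ((\<lambda>t. t <# c) ` (T \<inter> S))"
      then obtain t where t: "t \<in> T" "t \<in> S" "b = inv s <# (t <# c)" by blast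
      have b: "b = (inv s \<otimes> t) <# c" using t s Sc by (simp add: lc)
      have "inv s \<otimes> t \<in> S" using iS t S subgroup.m_closed by metis
      then have "b \<in> B" using b by (auto simp: B_def)
      moreover have "inv t \<otimes> s \<in> S" using s t S by (simp add: subgroup.m_inv_closed subgroup.m_closed)
      moreover have "(inv t \<otimes> s) <# b = c"
      proof -
        have "(inv t \<otimes> s) <# b = ((inv t \<otimes> s) \<otimes> (inv s \<otimes> t)) <# c"
          unfolding b using t s Sc by (intro lc) auto
        also have "(inv t \<otimes> s) \<otimes> (inv s \<otimes> t) = \<one>"
          using t s Sc by (metis inv_closed inv_inv inv_mult_group m_closed r_inv)
        finally show ?thesis using one by simp
      qed
      moreover have "T #> s = T #> (inv t \<otimes> s)"
      proof -
        have "inv t \<in> T" using t T subgroup.m_inv_closed by metis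
        then have "inv t \<otimes> s \<in> T #> s" by (auto simp: r_coset_def)
        then show ?thesis using s Sc T by (intro repr_independence) auto
      qed
      ultimately show "b \<in> {b \<in> B. T #> s \<in> E b}" by (auto simp: E_def)
    qed
    moreover have "inj_on (\<lambda>b. inv s <# b) ((\<lambda>t. t <# c) ` (T \<inter> S))"
    proof (rule inj_onI)
      fix b b' assume b: "b \<in> (\<lambda>t. t <# c) ` (T \<inter> S)" "b' \<in> (\<lambda>t. t <# c) ` (T \<inter> S)" "inv s <# b = inv s <# b'"
      have "s <# (inv s <# d) = d" if "d \<in> (\<lambda>t. t <# c) ` (T \<inter> S)" for d
      proof -
        have "d \<subseteq> carrier G" using that c Sc by (auto simp: l_coset_def)
        then show ?thesis using s Sc by (simp add: lcos_m_assoc lcos_mult_one)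
      qed
      then show "b = b'" using b by metis
    qed
    ultimately show ?thesis by (simp add: card_image)
  qed
  have fB: "finite B" using fin by (simp add: B_def)
  have sumind: "(\<Sum>b\<in>B. indicator (E b) C) = (of_nat (card ((\<lambda>t. t <# c) ` (T \<inter> S))) * indicator D C :: ennreal)" for C
  proof -
    have "(\<Sum>b\<in>B. indicator (E b) C :: ennreal) = of_nat (card {b \<in> B. C \<in> E b})"
    proof -
      have "(\<Sum>b\<in>B. indicator (E b) C :: ennreal) = (\<Sum>b\<in>{b \<in> B. C \<in> E b}. 1)"
        unfolding sum.inter_filter[OF fB] by (simp add: indicator_def of_bool_def)
      then show ?thesis by simp
    qed
    also have "card {b \<in> B. C \<in> E b} = (if C \<in> D then card ((\<lambda>t. t <# c) ` (T \<inter> S)) else 0)"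
    proof (cases "C \<in> D")
      case True
      then obtain s where "s \<in> S" "C = T #> s" by (auto simp: D_def)
      then show ?thesis using count True by simp
    next
      case False
      then have none: "{b \<in> B. C \<in> E b} = {}" by (auto simp: E_def D_def)
      show ?thesis unfolding none using False by simp
    qed
    finally show ?thesis by (simp add: indicator_def)
  qed
  have "of_nat (card B) * emeasure \<mu> (E c) = (\<Sum>b\<in>B. emeasure \<mu> (E b))" using Etrans by simp
  also have "\<dots> = (\<Sum>b\<in>B. \<integral>\<^sup>+ C. indicator (E b) C \<partial>\<mu>)" using Emeas by (intro sum.cong) simp_all
  also have "\<dots> = (\<integral>\<^sup>+ C. (\<Sum>b\<in>B. indicator (E b) C) \<partial>\<mu>)"
    using Emeas by (intro nn_integral_sum [symmetric]) simp
  also have "\<dots> = (\<integral>\<^sup>+ C. of_nat (card ((\<lambda>t. t <# c) ` (T \<inter> S))) * indicator D C \<partial>\<mu>)"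
    by (simp only: sumind)
  also have "\<dots> = of_nat (card ((\<lambda>t. t <# c) ` (T \<inter> S))) * emeasure \<mu> D"
    using meas(2) by (intro nn_integral_cmult_indicator) (simp add: D_def)
  finally show ?thesis by (simp add: B_def E_def D_def)
qed

end

section \<open>Congruence subgroups\<close>

lemma carrier_GLxGL: "h \<in> carrier GLxGL \<longleftrightarrow> invertible (fst h) \<and> invertible (snd h)"
  by (simp add: GLxGL_def)

lemma mult_GLxGL: "g \<otimes>\<^bsub>GLxGL\<^esub> h = (fst g ** fst h, snd g ** snd h)"
  by (simp add: GLxGL_def)

lemma one_GLxGL: "\<one>\<^bsub>GLxGL\<^esub> = (mat 1, mat 1)"
  by (simp add: GLxGL_def)

lemma inv_GLxGL:
  assumes "h \<in> carrier (GLxGL :: ('k::field, 'n::finite) mat2 monoid)"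
  shows "inv\<^bsub>GLxGL\<^esub> h = (matrix_inv (fst h), matrix_inv (snd h))"
proof -
  interpret group "GLxGL :: ('k, 'n) mat2 monoid" by (rule group_GLxGL)
  show ?thesis
    by (rule inv_equality) (use assms in \<open>auto simp: carrier_GLxGL mult_GLxGL one_GLxGL matrix_inv_props\<close>)
qed

definition KK :: "('a::nonarch_local_field_0, 'n::finite) mat2 set" where
  "KK = GLO \<times> GLO"

lemma KK_carrier: "k \<in> KK \<Longrightarrow> k \<in> carrier GLxGL"
  by (auto simp: KK_def carrier_GLxGL GLO_invertible)

lemma subgroup_KK: "subgroup KK (GLxGL :: ('a::nonarch_local_field_0, 'n::finite) mat2 monoid)"
proof -
  interpret group "GLxGL :: ('a, 'n) mat2 monoid" by (rule group_GLxGL)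
  show ?thesis
  proof (rule subgroupI)
    show "KK \<subseteq> carrier (GLxGL :: ('a, 'n) mat2 monoid)" using KK_carrier by blast
    have "(mat 1, mat 1) \<in> (KK :: ('a, 'n) mat2 set)" by (simp add: KK_def)
    then show "(KK :: ('a, 'n) mat2 set) \<noteq> {}" by blast
    fix a assume a: "a \<in> (KK :: ('a, 'n) mat2 set)"
    then show "inv\<^bsub>GLxGL\<^esub> a \<in> KK" by (auto simp: inv_GLxGL[OF KK_carrier] KK_def GLO_inv)
    fix b assume "b \<in> (KK :: ('a, 'n) mat2 set)"
    then show "a \<otimes>\<^bsub>GLxGL\<^esub> b \<in> KK" using a by (auto simp: mult_GLxGL KK_def GLO_mult)
  qed
qed

text \<open>Principal congruence subgroups when 0 <= r < 1; those with r > 0 are a basis of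
  neighbourhoods of the identity.\<close>

definition QQ :: "real \<Rightarrow> ('a::nonarch_local_field_0, 'n::finite) mat2 set" where
  "QQ r = {q. bnd r (fst q - mat 1) \<and> bnd r (snd q - mat 1)}"

lemma QQ_KK: "r < 1 \<Longrightarrow> QQ r \<subseteq> KK"
  by (auto simp: QQ_def KK_def intro: GLO_near_one)

lemma QQ_mono: "r \<le> s \<Longrightarrow> QQ r \<subseteq> QQ s"
  by (auto simp: QQ_def intro: bnd_mono)

lemma subgroup_QQ:
  assumes "0 \<le> r" "r < 1"
  shows "subgroup (QQ r) (GLxGL :: ('a::nonarch_local_field_0, 'n::finite) mat2 monoid)"
proof -
  interpret group "GLxGL :: ('a, 'n) mat2 monoid" by (rule group_GLxGL)
  have carr: "q \<in> carrier GLxGL" if "q \<in> (QQ r :: ('a, 'n) mat2 set)" for q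
    using that QQ_KK[OF assms(2)] KK_carrier by blast
  have inv: "bnd r (matrix_inv A - mat 1)" if "bnd r (A - mat 1)" for A :: "'a^'n^'n"
    using one_plus_bnd(3)[OF that assms(2)] by simp
  have mult: "bnd r (A ** B - mat 1)" if "bnd r (A - mat 1)" "bnd r (B - mat 1)" for A B :: "'a^'n^'n"
  proof -
    have eq: "A ** B - mat 1 = (A - mat 1) ** B + (B - mat 1)" by (simp add: matrix_mult_diff_rdistrib)
    have "bnd 1 B" using GLO_near_one[OF that(2) assms(2)] by (simp add: GLO_def)
    then have "bnd r ((A - mat 1) ** B)" by (rule bnd_mult'[OF that(1)]) simp
    then show ?thesis unfolding eq using that(2) by (rule bnd_add)
  qed
  show ?thesis
  proof (rule subgroupI)
    show "QQ r \<subseteq> carrier (GLxGL :: ('a, 'n) mat2 monoid)" using carr by blast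
    have "(mat 1, mat 1) \<in> (QQ r :: ('a, 'n) mat2 set)" using assms by (simp add: QQ_def bnd_0)
    then show "(QQ r :: ('a, 'n) mat2 set) \<noteq> {}" by blast
    fix a assume a: "a \<in> (QQ r :: ('a, 'n) mat2 set)"
    then show "inv\<^bsub>GLxGL\<^esub> a \<in> QQ r" using inv by (simp add: inv_GLxGL[OF carr]) (simp add: QQ_def)
    fix b assume "b \<in> (QQ r :: ('a, 'n) mat2 set)"
    then show "a \<otimes>\<^bsub>GLxGL\<^esub> b \<in> QQ r" using a mult by (simp add: mult_GLxGL QQ_def)
  qed
qed

lemma conj_near_one:
  fixes h :: "'a::nonarch_local_field_0^'n^'n"
  assumes "invertible h"
  shows "matrix_inv h ** A ** h - mat 1 = matrix_inv h ** (A - mat 1) ** h"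
  using assms by (simp add: matrix_mult_diff_ldistrib matrix_mult_diff_rdistrib matrix_inv_props)

lemma QQ_conj:
  fixes h :: "('a::nonarch_local_field_0, 'n::finite) mat2"
  assumes h: "h \<in> carrier GLxGL"
  shows "\<exists>r>0. r < 1 \<and> (\<forall>q\<in>QQ r. inv\<^bsub>GLxGL\<^esub> h \<otimes>\<^bsub>GLxGL\<^esub> q \<otimes>\<^bsub>GLxGL\<^esub> h \<in> KK)"
proof -
  have *: "\<exists>R\<ge>1. bnd R A \<and> bnd R (matrix_inv A)" for A :: "'a^'n^'n"
  proof -
    obtain R S where "1 \<le> R" "bnd R A" "1 \<le> S" "bnd S (matrix_inv A)" using exists_bnd by metis
    then show ?thesis by (intro exI[of _ "max R S"]) (auto intro: bnd_mono)
  qed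
  obtain R where R: "1 \<le> R" "bnd R (fst h)" "bnd R (matrix_inv (fst h))" using * by blast
  obtain S where S: "1 \<le> S" "bnd S (snd h)" "bnd S (matrix_inv (snd h))" using * by blast
  \<comment> \<open>Conjugation by h enlarges the distance to 1 at most by the square of the common
    bound on h and its inverse; the factor 2 leaves a distance of at most 1/2.\<close>
  define r where "r = inverse (2 * (max R S * max R S))"
  have rs: "1 \<le> max R S * max R S" using mult_mono[of 1 "max R S" 1 "max R S"] R S by simp
  have r: "0 < r" "r < 1" using rs unfolding r_def by (auto simp: field_simps)
  have half: "max R S * r * max R S \<le> 1/2" using rs unfolding r_def by (simp add: field_simps)
  have "matrix_inv A ** B ** A \<in> GLO" if "bnd (max R S) A" "bnd (max R S) (matrix_inv A)" "bnd r (B - mat 1)" "invertible A"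
    for A B :: "'a^'n^'n"
  proof -
    have "bnd (1/2) (matrix_inv A ** (B - mat 1) ** A)"
      by (rule bnd_mult'[OF bnd_mult[OF that(2,3)] that(1) half])
    then have "bnd (1/2) (matrix_inv A ** B ** A - mat 1)" using conj_near_one[OF that(4)] by simp
    then show ?thesis by (rule GLO_near_one) simp
  qed
  then have "inv\<^bsub>GLxGL\<^esub> h \<otimes>\<^bsub>GLxGL\<^esub> q \<otimes>\<^bsub>GLxGL\<^esub> h \<in> KK" if "q \<in> QQ r" for q
    using that h bnd_mono[OF R(2), of "max R S"] bnd_mono[OF R(3), of "max R S"]
      bnd_mono[OF S(2), of "max R S"] bnd_mono[OF S(3), of "max R S"]
    by (simp add: inv_GLxGL mult_GLxGL KK_def QQ_def carrier_GLxGL)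
  then show ?thesis using r by blast
qed

text \<open>If k - s is small, then so are s^-1 (k - s) and (k - s) s^-1; hence a single finite set
  represents both left and right cosets.\<close>

lemma KK_mod_QQ_finite:
  assumes r: "0 < r" "r < 1"
  shows "\<exists>S. finite S \<and> S \<subseteq> KK \<and> (\<forall>k\<in>KK. \<exists>s\<in>S. inv\<^bsub>GLxGL\<^esub> s \<otimes>\<^bsub>GLxGL\<^esub> k \<in> QQ r \<and> k \<otimes>\<^bsub>GLxGL\<^esub> inv\<^bsub>GLxGL\<^esub> s \<in> (QQ r :: ('a::nonarch_local_field_0, 'n::finite) mat2 set))"
proof -
  obtain S0 where S0: "finite S0" "\<forall>A :: 'a^'n^'n. bnd 1 A \<longrightarrow> (\<exists>B\<in>S0. bnd r (A - B))"
    using finite_approx_bnd[OF r(1)] by blast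
  define P where "P k B \<longleftrightarrow> k \<in> KK \<and> bnd r (fst k - fst B) \<and> bnd r (snd k - snd B)" for k B :: "('a, 'n) mat2"
  define c where "c B = (SOME k. P k B)" for B
  define S where "S = c ` {B \<in> S0 \<times> S0. \<exists>k. P k B}"
  have c: "P (c B) B" if "\<exists>k. P k B" for B unfolding c_def using that by (rule someI_ex)
  show ?thesis
  proof (intro exI conjI ballI)
    show "finite S" using S0 unfolding S_def by simp
    show "S \<subseteq> KK" using c unfolding S_def P_def by blast
    fix k :: "('a, 'n) mat2" assume k: "k \<in> KK"
    then have "bnd 1 (fst k)" "bnd 1 (snd k)" by (auto simp: KK_def GLO_def)
    then obtain A B where AB: "A \<in> S0" "bnd r (fst k - A)" "B \<in> S0" "bnd r (snd k - B)" using S0 by meson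
    then have P: "P k (A, B)" using k by (simp add: P_def)
    let ?s = "c (A, B)"
    have exP: "\<exists>k. P k (A, B)" using P by blast
    then have s: "?s \<in> S" "P ?s (A, B)" using AB c unfolding S_def by blast+
    have sK: "?s \<in> KK" using s by (simp add: P_def)
    have d1: "bnd r (fst k - fst ?s)" using bnd_diff[OF AB(2), of "fst ?s - A"] s(2) by (simp add: P_def)
    have d2: "bnd r (snd k - snd ?s)" using bnd_diff[OF AB(4), of "snd ?s - B"] s(2) by (simp add: P_def)
    have l: "bnd r (matrix_inv A ** B - mat 1) \<and> bnd r (B ** matrix_inv A - mat 1)"
      if "A \<in> GLO" "bnd r (B - A)" for A B :: "'a^'n^'n"
    proof -
      have "bnd r (matrix_inv A ** (B - A))" "bnd r ((B - A) ** matrix_inv A)"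
        using bnd_mult[of 1 "matrix_inv A" r "B - A"] bnd_mult[of r "B - A" 1 "matrix_inv A"] that by (auto simp: GLO_def)
      then show ?thesis using that(1)
        by (simp add: matrix_mult_diff_ldistrib matrix_mult_diff_rdistrib matrix_inv_props GLO_invertible)
    qed
    have "inv\<^bsub>GLxGL\<^esub> ?s \<otimes>\<^bsub>GLxGL\<^esub> k \<in> QQ r \<and> k \<otimes>\<^bsub>GLxGL\<^esub> inv\<^bsub>GLxGL\<^esub> ?s \<in> QQ r"
      using l[OF _ d1] l[OF _ d2] sK by (auto simp: inv_GLxGL[OF KK_carrier[OF sK]] mult_GLxGL QQ_def KK_def)
    then show "\<exists>s\<in>S. inv\<^bsub>GLxGL\<^esub> s \<otimes>\<^bsub>GLxGL\<^esub> k \<in> QQ r \<and> k \<otimes>\<^bsub>GLxGL\<^esub> inv\<^bsub>GLxGL\<^esub> s \<in> QQ r" using s(1) by blast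
  qed
qed

text \<open>h K h^-1 contains a congruence subgroup, which has finite index in K.\<close>

lemma finite_KK_orbit:
  fixes h :: "('a::nonarch_local_field_0, 'n::finite) mat2"
  assumes h: "h \<in> carrier GLxGL"
  shows "finite ((\<lambda>k. (k \<otimes>\<^bsub>GLxGL\<^esub> h) <#\<^bsub>GLxGL\<^esub> KK) ` KK)"
proof -
  interpret group "GLxGL :: ('a, 'n) mat2 monoid" by (rule group_GLxGL)
  obtain r where r: "0 < r" "r < 1" "\<forall>q\<in>QQ r. inv\<^bsub>GLxGL\<^esub> h \<otimes>\<^bsub>GLxGL\<^esub> q \<otimes>\<^bsub>GLxGL\<^esub> h \<in> KK"
    using QQ_conj[OF h] by blast
  obtain S :: "('a, 'n) mat2 set" where S: "finite S" "S \<subseteq> KK"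
    "\<forall>k\<in>KK. \<exists>s\<in>S. inv\<^bsub>GLxGL\<^esub> s \<otimes>\<^bsub>GLxGL\<^esub> k \<in> QQ r \<and> k \<otimes>\<^bsub>GLxGL\<^esub> inv\<^bsub>GLxGL\<^esub> s \<in> QQ r"
    using KK_mod_QQ_finite[OF r(1,2), where ?'a = 'a and ?'n = 'n] by (elim exE conjE)
  have "(\<lambda>k. (k \<otimes>\<^bsub>GLxGL\<^esub> h) <#\<^bsub>GLxGL\<^esub> KK) ` KK \<subseteq> (\<lambda>k. (k \<otimes>\<^bsub>GLxGL\<^esub> h) <#\<^bsub>GLxGL\<^esub> KK) ` S"
  proof
    fix b assume "b \<in> (\<lambda>k. (k \<otimes>\<^bsub>GLxGL\<^esub> h) <#\<^bsub>GLxGL\<^esub> KK) ` KK"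
    then obtain k where k: "k \<in> KK" "b = (k \<otimes>\<^bsub>GLxGL\<^esub> h) <#\<^bsub>GLxGL\<^esub> KK" by blast
    obtain s where s: "s \<in> S" "inv\<^bsub>GLxGL\<^esub> s \<otimes>\<^bsub>GLxGL\<^esub> k \<in> QQ r" using S(3) k(1) by blast
    have c: "k \<in> carrier GLxGL" "s \<in> carrier GLxGL" using k s S KK_carrier by blast+
    have "inv\<^bsub>GLxGL\<^esub> (s \<otimes>\<^bsub>GLxGL\<^esub> h) \<otimes>\<^bsub>GLxGL\<^esub> (k \<otimes>\<^bsub>GLxGL\<^esub> h) = inv\<^bsub>GLxGL\<^esub> h \<otimes>\<^bsub>GLxGL\<^esub> (inv\<^bsub>GLxGL\<^esub> s \<otimes>\<^bsub>GLxGL\<^esub> k) \<otimes>\<^bsub>GLxGL\<^esub> h"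
      using c h by (simp add: inv_mult_group m_assoc)
    then have "inv\<^bsub>GLxGL\<^esub> (s \<otimes>\<^bsub>GLxGL\<^esub> h) \<otimes>\<^bsub>GLxGL\<^esub> (k \<otimes>\<^bsub>GLxGL\<^esub> h) \<in> KK" using r(3) s(2) by simp
    then have "(s \<otimes>\<^bsub>GLxGL\<^esub> h) <#\<^bsub>GLxGL\<^esub> KK = (k \<otimes>\<^bsub>GLxGL\<^esub> h) <#\<^bsub>GLxGL\<^esub> KK"
      using c h by (subst lcoset_eq_iff[OF subgroup_KK]) auto
    then show "b \<in> (\<lambda>k. (k \<otimes>\<^bsub>GLxGL\<^esub> h) <#\<^bsub>GLxGL\<^esub> KK) ` S" using s(1) k(2) by auto
  qed
  then show ?thesis using S(1) finite_surj finite_subset by blast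
qed

text \<open>An automorphism of the group that preserves K and sends D^-1 to D when both components
  of D are symmetric.\<close>

definition contragredient :: "('a::field, 'n::finite) mat2 \<Rightarrow> ('a, 'n) mat2" where
  "contragredient h = (transpose (matrix_inv (fst h)), transpose (matrix_inv (snd h)))"

text \<open>A combinatorial form of unimodularity. Both numbers depend only on the double coset K h
  K, which contains an element D with diagonal components; the contragredient exchanges D^-1 and
  D.\<close>

lemma card_KK_orbit_inv:
  fixes h :: "('a::nonarch_local_field_0, 'n::finite) mat2"
  assumes h: "h \<in> carrier GLxGL"
  shows "card ((\<lambda>k. (k \<otimes>\<^bsub>GLxGL\<^esub> inv\<^bsub>GLxGL\<^esub> h) <#\<^bsub>GLxGL\<^esub> KK) ` KK) = card ((\<lambda>k. (k \<otimes>\<^bsub>GLxGL\<^esub> h) <#\<^bsub>GLxGL\<^esub> KK) ` KK)"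
proof -
  interpret group "GLxGL :: ('a, 'n) mat2 monoid" by (rule group_GLxGL)
  interpret K: subgroup KK "GLxGL :: ('a, 'n) mat2 monoid" by (rule subgroup_KK)
  let ?c = "contragredient :: ('a, 'n) mat2 \<Rightarrow> _"
  have c_carr: "?c g \<in> carrier GLxGL" if "g \<in> carrier GLxGL" for g
    using that by (simp add: contragredient_def carrier_GLxGL invertible_transpose matrix_inv_props)
  have c_mult: "?c (g \<otimes>\<^bsub>GLxGL\<^esub> g') = ?c g \<otimes>\<^bsub>GLxGL\<^esub> ?c g'" if "g \<in> carrier GLxGL" "g' \<in> carrier GLxGL" for g g'
    using that by (simp add: contragredient_def carrier_GLxGL mult_GLxGL matrix_inv_mult matrix_transpose_mul)
  have c_inv: "?c (inv\<^bsub>GLxGL\<^esub> g) = inv\<^bsub>GLxGL\<^esub> (?c g)" if "g \<in> carrier GLxGL" for g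
    using that c_carr[OF that]
    by (simp add: inv_GLxGL) (simp add: contragredient_def carrier_GLxGL matrix_inv_transpose matrix_inv_props)
  have c_c: "?c (?c g) = g" if "g \<in> carrier GLxGL" for g
    using that by (cases g) (simp add: contragredient_def carrier_GLxGL matrix_inv_transpose matrix_inv_props matrix_inv_matrix_inv)
  have c_K: "?c g \<in> KK" if "g \<in> KK" for g
    using that by (auto simp: contragredient_def KK_def GLO_transpose GLO_inv)
  have c_K_iff: "?c g \<in> KK \<longleftrightarrow> g \<in> KK" if "g \<in> carrier GLxGL" for g
    using c_K c_c[OF that] by metis
  have c_image: "?c ` KK = KK"
  proof
    show "?c ` KK \<subseteq> KK" using c_K by blast
    show "KK \<subseteq> ?c ` KK" using c_K c_c KK_carrier by (metis image_eqI subsetI)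
  qed
  have 1: "card ((\<lambda>k. (k \<otimes>\<^bsub>GLxGL\<^esub> g) <#\<^bsub>GLxGL\<^esub> KK) ` KK) = card ((\<lambda>k. (k \<otimes>\<^bsub>GLxGL\<^esub> ?c g) <#\<^bsub>GLxGL\<^esub> KK) ` KK)" if g: "g \<in> carrier GLxGL" for g
  proof -
    have "card ((\<lambda>k. (k \<otimes>\<^bsub>GLxGL\<^esub> g) <#\<^bsub>GLxGL\<^esub> KK) ` KK) = card ((\<lambda>k. (?c k \<otimes>\<^bsub>GLxGL\<^esub> ?c g) <#\<^bsub>GLxGL\<^esub> KK) ` KK)"
    proof (rule card_image_cong_iff)
      fix x y assume xy: "x \<in> (KK :: ('a, 'n) mat2 set)" "y \<in> (KK :: ('a, 'n) mat2 set)"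
      have c: "x \<in> carrier GLxGL" "y \<in> carrier GLxGL" using xy KK_carrier by auto
      let ?z = "inv\<^bsub>GLxGL\<^esub> (x \<otimes>\<^bsub>GLxGL\<^esub> g) \<otimes>\<^bsub>GLxGL\<^esub> (y \<otimes>\<^bsub>GLxGL\<^esub> g)"
      have z: "?c ?z = inv\<^bsub>GLxGL\<^esub> (?c x \<otimes>\<^bsub>GLxGL\<^esub> ?c g) \<otimes>\<^bsub>GLxGL\<^esub> (?c y \<otimes>\<^bsub>GLxGL\<^esub> ?c g)"
        using c g by (simp add: c_mult c_inv)
      show "((x \<otimes>\<^bsub>GLxGL\<^esub> g) <#\<^bsub>GLxGL\<^esub> KK = (y \<otimes>\<^bsub>GLxGL\<^esub> g) <#\<^bsub>GLxGL\<^esub> KK) =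
        ((?c x \<otimes>\<^bsub>GLxGL\<^esub> ?c g) <#\<^bsub>GLxGL\<^esub> KK = (?c y \<otimes>\<^bsub>GLxGL\<^esub> ?c g) <#\<^bsub>GLxGL\<^esub> KK)"
        using c g c_carr c_K_iff[of ?z] by (simp add: lcoset_eq_iff[OF subgroup_KK] z [symmetric])
    qed
    also have "(\<lambda>k. (?c k \<otimes>\<^bsub>GLxGL\<^esub> ?c g) <#\<^bsub>GLxGL\<^esub> KK) ` KK = (\<lambda>k. (k \<otimes>\<^bsub>GLxGL\<^esub> ?c g) <#\<^bsub>GLxGL\<^esub> KK) ` (?c ` KK)"
      by (simp only: image_image)
    finally show ?thesis by (simp only: c_image)
  qed
  have 2: "(\<lambda>k. (k \<otimes>\<^bsub>GLxGL\<^esub> (a \<otimes>\<^bsub>GLxGL\<^esub> g \<otimes>\<^bsub>GLxGL\<^esub> b)) <#\<^bsub>GLxGL\<^esub> KK) ` KK = (\<lambda>k. (k \<otimes>\<^bsub>GLxGL\<^esub> g) <#\<^bsub>GLxGL\<^esub> KK) ` KK"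
    if g: "g \<in> carrier GLxGL" "a \<in> KK" "b \<in> KK" for a b g :: "('a, 'n) mat2"
  proof -
    have c: "a \<in> carrier GLxGL" "b \<in> carrier GLxGL" using g KK_carrier by auto
    have eq: "(k \<otimes>\<^bsub>GLxGL\<^esub> (a \<otimes>\<^bsub>GLxGL\<^esub> g \<otimes>\<^bsub>GLxGL\<^esub> b)) <#\<^bsub>GLxGL\<^esub> KK = (k \<otimes>\<^bsub>GLxGL\<^esub> a \<otimes>\<^bsub>GLxGL\<^esub> g) <#\<^bsub>GLxGL\<^esub> KK" if k: "k \<in> KK" for k
    proof -
      have kc: "k \<in> carrier GLxGL" using k KK_carrier by blast
      have "inv\<^bsub>GLxGL\<^esub> (k \<otimes>\<^bsub>GLxGL\<^esub> a \<otimes>\<^bsub>GLxGL\<^esub> g) \<otimes>\<^bsub>GLxGL\<^esub> (k \<otimes>\<^bsub>GLxGL\<^esub> (a \<otimes>\<^bsub>GLxGL\<^esub> g \<otimes>\<^bsub>GLxGL\<^esub> b)) = b"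
      proof -
        have cancel: "inv\<^bsub>GLxGL\<^esub> y \<otimes>\<^bsub>GLxGL\<^esub> (y \<otimes>\<^bsub>GLxGL\<^esub> b) = b" if "y \<in> carrier GLxGL" for y
          using that c by (simp add: m_assoc [symmetric])
        have "k \<otimes>\<^bsub>GLxGL\<^esub> (a \<otimes>\<^bsub>GLxGL\<^esub> g \<otimes>\<^bsub>GLxGL\<^esub> b) = (k \<otimes>\<^bsub>GLxGL\<^esub> a \<otimes>\<^bsub>GLxGL\<^esub> g) \<otimes>\<^bsub>GLxGL\<^esub> b"
          using kc c g(1) by (simp add: m_assoc)
        then show ?thesis using cancel[of "k \<otimes>\<^bsub>GLxGL\<^esub> a \<otimes>\<^bsub>GLxGL\<^esub> g"] kc c g(1) by simp
      qed
      then show ?thesis using kc c g by (subst eq_commute, subst lcoset_eq_iff[OF subgroup_KK]) auto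
    qed
    have "(\<lambda>k. k \<otimes>\<^bsub>GLxGL\<^esub> a) ` KK = KK"
    proof
      show "(\<lambda>k. k \<otimes>\<^bsub>GLxGL\<^esub> a) ` KK \<subseteq> KK" using g by auto
      show "KK \<subseteq> (\<lambda>k. k \<otimes>\<^bsub>GLxGL\<^esub> a) ` KK"
      proof
        fix k :: "('a, 'n) mat2" assume k: "k \<in> KK"
        then have "k = (k \<otimes>\<^bsub>GLxGL\<^esub> inv\<^bsub>GLxGL\<^esub> a) \<otimes>\<^bsub>GLxGL\<^esub> a" using c KK_carrier by (simp add: m_assoc)
        moreover have "k \<otimes>\<^bsub>GLxGL\<^esub> inv\<^bsub>GLxGL\<^esub> a \<in> KK" using k g by simp
        ultimately show "k \<in> (\<lambda>k. k \<otimes>\<^bsub>GLxGL\<^esub> a) ` KK" by blast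
      qed
    qed
    then have "(\<lambda>k. (k \<otimes>\<^bsub>GLxGL\<^esub> g) <#\<^bsub>GLxGL\<^esub> KK) ` KK = (\<lambda>k. (k \<otimes>\<^bsub>GLxGL\<^esub> g) <#\<^bsub>GLxGL\<^esub> KK) ` (\<lambda>k. k \<otimes>\<^bsub>GLxGL\<^esub> a) ` KK" by simp
    also have "\<dots> = (\<lambda>k. (k \<otimes>\<^bsub>GLxGL\<^esub> a \<otimes>\<^bsub>GLxGL\<^esub> g) <#\<^bsub>GLxGL\<^esub> KK) ` KK" by (simp only: image_image)
    finally show ?thesis using eq by (simp cong: image_cong)
  qed
  have hi: "invertible (fst h)" "invertible (snd h)" using h by (simp_all add: carrier_GLxGL)
  obtain k1 l1 where kl1: "k1 \<in> GLO" "l1 \<in> GLO" "\<forall>i j. i \<noteq> j \<longrightarrow> (k1 ** fst h ** l1) $ i $ j = 0"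
    using GLO_cartan[OF hi(1)] by (elim bexE)
  obtain k2 l2 where kl2: "k2 \<in> GLO" "l2 \<in> GLO" "\<forall>i j. i \<noteq> j \<longrightarrow> (k2 ** snd h ** l2) $ i $ j = 0"
    using GLO_cartan[OF hi(2)] by (elim bexE)
  let ?k = "(k1, k2)" and ?l = "(l1, l2)"
  define D where "D = ?k \<otimes>\<^bsub>GLxGL\<^esub> h \<otimes>\<^bsub>GLxGL\<^esub> ?l"
  have kl: "?k \<in> KK" "?l \<in> KK" using kl1 kl2 by (auto simp: KK_def)
  have c: "?k \<in> carrier GLxGL" "?l \<in> carrier GLxGL" using kl KK_carrier by auto
  have DG: "D \<in> carrier GLxGL" unfolding D_def using c h by simp
  have "transpose (fst D) = fst D" "transpose (snd D) = snd D"
    using kl1(3) kl2(3) by (auto simp: D_def mult_GLxGL vec_eq_iff Finite_Cartesian_Product.transpose_def) metis+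
  then have "?c (inv\<^bsub>GLxGL\<^esub> D) = D"
    using DG by (simp add: inv_GLxGL) (simp add: contragredient_def carrier_GLxGL matrix_inv_matrix_inv)
  then have "card ((\<lambda>k. (k \<otimes>\<^bsub>GLxGL\<^esub> inv\<^bsub>GLxGL\<^esub> D) <#\<^bsub>GLxGL\<^esub> KK) ` KK) = card ((\<lambda>k. (k \<otimes>\<^bsub>GLxGL\<^esub> D) <#\<^bsub>GLxGL\<^esub> KK) ` KK)"
    using 1[of "inv\<^bsub>GLxGL\<^esub> D"] DG by simp
  moreover have "inv\<^bsub>GLxGL\<^esub> D = inv\<^bsub>GLxGL\<^esub> ?l \<otimes>\<^bsub>GLxGL\<^esub> inv\<^bsub>GLxGL\<^esub> h \<otimes>\<^bsub>GLxGL\<^esub> inv\<^bsub>GLxGL\<^esub> ?k"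
    unfolding D_def using c h by (simp add: inv_mult_group m_assoc)
  ultimately show ?thesis using 2[of "inv\<^bsub>GLxGL\<^esub> h" "inv\<^bsub>GLxGL\<^esub> ?l" "inv\<^bsub>GLxGL\<^esub> ?k"] 2[OF h kl] h kl
    by (simp add: D_def)
qed

section \<open>Measures of double cosets\<close>

abbreviation gmult :: "('k::field, 'n::finite) mat2 \<Rightarrow> ('k, 'n) mat2 \<Rightarrow> ('k, 'n) mat2" (infixl \<open>\<star>\<close> 70) where
  "g \<star> h \<equiv> g \<otimes>\<^bsub>GLxGL\<^esub> h"

abbreviation ginv :: "('k::field, 'n::finite) mat2 \<Rightarrow> ('k, 'n) mat2" where
  "ginv h \<equiv> inv\<^bsub>GLxGL\<^esub> h"

abbreviation lco :: "('k::field, 'n::finite) mat2 \<Rightarrow> ('k, 'n) mat2 set \<Rightarrow> ('k, 'n) mat2 set" where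
  "lco h S \<equiv> h <#\<^bsub>GLxGL\<^esub> S"

abbreviation rco :: "('k::field, 'n::finite) mat2 set \<Rightarrow> ('k, 'n) mat2 \<Rightarrow> ('k, 'n) mat2 set" where
  "rco S h \<equiv> S #>\<^bsub>GLxGL\<^esub> h"

text \<open>The double coset T h K is encoded as a set of right cosets of T, so that it is directly
  a subset of the space carrying the measure.\<close>

definition dcoset :: "('a::nonarch_local_field_0, 'n::finite) mat2 set \<Rightarrow> ('a, 'n) mat2 \<Rightarrow> ('a, 'n) mat2 set set" where
  "dcoset T h = {rco T (h \<star> k) | k. k \<in> KK}"

text \<open>If y' is near y = t x, then y^-1 y' lies in \<open>QQ r\<close>, so y' = t x (y^-1 y')
  stays in T Y.\<close>

lemma openin_right_invariant:
  fixes T :: "('a::nonarch_local_field_0, 'n::finite) mat2 set"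
  assumes T: "subgroup T GLxGL" and sub: "Y \<subseteq> carrier GLxGL" and r: "0 < r"
    and inv: "\<And>x q. x \<in> Y \<Longrightarrow> q \<in> QQ r \<Longrightarrow> x \<star> q \<in> Y"
  shows "openin (coset_topology T) {rco T x | x. x \<in> Y}"
proof -
  interpret group "GLxGL :: ('a, 'n) mat2 monoid" by (rule group_GLxGL)
  have Tc: "T \<subseteq> carrier GLxGL" using T by (rule subgroup.subset)
  let ?U = "\<Union>{rco T x | x. x \<in> Y}"
  have U: "?U = {t \<star> x | t x. t \<in> T \<and> x \<in> Y}" by (auto simp: r_coset_def)
  have "openin (top_of_set (carrier GLxGL)) ?U"
    unfolding openin_euclidean_subtopology_iff
  proof (intro conjI ballI)
    show "?U \<subseteq> carrier GLxGL" unfolding U using Tc sub m_closed by blast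
    fix y assume "y \<in> ?U"
    then obtain t x where tx: "t \<in> T" "x \<in> Y" "y = t \<star> x" unfolding U by blast
    have xc: "x \<in> carrier GLxGL" and tc: "t \<in> carrier GLxGL" using tx Tc sub by auto
    then have yc: "y \<in> carrier GLxGL" using tx by simp
    obtain R1 where R1: "1 \<le> R1" "bnd R1 (matrix_inv (fst y))" using exists_bnd by blast
    obtain R2 where R2: "1 \<le> R2" "bnd R2 (matrix_inv (snd y))" using exists_bnd by blast
    define R where "R = max R1 R2"
    have R: "1 \<le> R" "bnd R (matrix_inv (fst y))" "bnd R (matrix_inv (snd y))"
      using R1 R2 bnd_mono[OF R1(2)] bnd_mono[OF R2(2)] by (auto simp: R_def)
    show "\<exists>e>0. \<forall>y'\<in>carrier GLxGL. dist y' y < e \<longrightarrow> y' \<in> ?U"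
    proof (intro exI conjI ballI impI)
      show "0 < r / R" using r R by simp
      fix y' :: "('a, 'n) mat2" assume y': "y' \<in> carrier GLxGL" "dist y' y < r / R"
      have near: "bnd r (matrix_inv A ** B - mat 1)" if "invertible A" "bnd R (matrix_inv A)" "dist B A < r / R" for A B :: "'a^'n^'n"
      proof -
        have "bnd (R * dist B A) (matrix_inv A ** (B - A))" by (intro bnd_mult that bnd_of_dist)
        moreover have "R * dist B A \<le> r" using that(3) R(1) by (simp add: field_simps)
        ultimately show ?thesis using that(1) by (auto simp: matrix_mult_diff_ldistrib matrix_inv_props intro: bnd_mono)
      qed
      let ?q = "ginv y \<star> y'"
      have "dist (fst y') (fst y) < r / R" "dist (snd y') (snd y) < r / R"
        using y'(2) dist_fst_le[of y' y] dist_snd_le[of y' y] by linarith+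
      then have "?q \<in> QQ r"
        using near R yc by (simp add: QQ_def inv_GLxGL mult_GLxGL carrier_GLxGL)
      then have "x \<star> ?q \<in> Y" by (rule inv[OF tx(2)])
      moreover have "y' = t \<star> (x \<star> ?q)"
        using tc xc yc y'(1) by (simp add: m_assoc [symmetric] tx(3) [symmetric])
      ultimately show "y' \<in> ?U" unfolding U using tx(1) by blast
    qed
  qed
  moreover have "{rco T x | x. x \<in> Y} \<subseteq> rcosets\<^bsub>GLxGL\<^esub> T" using sub Tc by (auto intro: rcosetsI)
  ultimately show ?thesis using openin_coset_topology[OF T] by blast
qed

lemma measurable_right_invariant:
  fixes T :: "('a::nonarch_local_field_0, 'n::finite) mat2 set"
  assumes T: "subgroup T GLxGL" and \<mu>: "invariant_coset_measure T \<mu>" and sub: "Y \<subseteq> carrier GLxGL" and r: "0 < r"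
    and inv: "\<And>x q. x \<in> Y \<Longrightarrow> q \<in> QQ r \<Longrightarrow> x \<star> q \<in> Y"
  shows "{rco T x | x. x \<in> Y} \<in> sets \<mu>"
  using openin_right_invariant[OF T sub r inv] \<mu> unfolding invariant_coset_measure_def by auto

lemma lco_stable:
  fixes g q :: "('a::nonarch_local_field_0, 'n::finite) mat2"
  assumes "g \<in> carrier GLxGL" "q \<in> carrier GLxGL"
  shows "lco q (lco g KK) = lco g KK \<longleftrightarrow> ginv g \<star> q \<star> g \<in> KK"
proof -
  interpret group "GLxGL :: ('a, 'n) mat2 monoid" by (rule group_GLxGL)
  have "KK \<subseteq> carrier (GLxGL :: ('a, 'n) mat2 monoid)" using subgroup_KK by (rule subgroup.subset)
  then have "lco q (lco g KK) = lco (q \<star> g) KK" using assms by (intro lcos_m_assoc)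
  then show ?thesis using assms lcoset_eq_iff[OF subgroup_KK, of g "q \<star> g"] by (auto simp: m_assoc)
qed

lemma measurable_double_count:
  fixes T :: "('a::nonarch_local_field_0, 'n::finite) mat2 set"
  assumes T: "subgroup T GLxGL" and \<mu>: "invariant_coset_measure T \<mu>" and S: "subgroup S GLxGL"
    and r: "0 < r" "QQ r \<subseteq> S" and s: "s \<in> S" and g: "g \<in> carrier GLxGL"
  shows "{rco T x | x. x \<in> S \<and> lco x (lco s (lco g KK)) = lco g KK} \<in> sets \<mu>"
proof -
  interpret group "GLxGL :: ('a, 'n) mat2 monoid" by (rule group_GLxGL)
  have KKc: "KK \<subseteq> carrier (GLxGL :: ('a, 'n) mat2 monoid)" using subgroup_KK by (rule subgroup.subset)
  have Sc: "y \<in> carrier GLxGL" if "y \<in> S" for y using that S subgroup.mem_carrier by metis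
  have sg: "s \<star> g \<in> carrier GLxGL" using s g Sc by simp
  have eq: "lco s (lco g KK) = lco (s \<star> g) KK" using s g Sc KKc by (intro lcos_m_assoc) auto
  obtain r' where r': "0 < r'" "r' < 1" "\<forall>q\<in>QQ r'. ginv (s \<star> g) \<star> q \<star> (s \<star> g) \<in> KK"
    using QQ_conj[OF sg] by blast
  let ?r = "min r r'"
  have "{rco T x | x. x \<in> {x \<in> S. lco x (lco s (lco g KK)) = lco g KK}} \<in> sets \<mu>"
  proof (rule measurable_right_invariant[OF T \<mu>, of _ ?r])
    show "{x \<in> S. lco x (lco s (lco g KK)) = lco g KK} \<subseteq> carrier GLxGL" using Sc by blast
    show "0 < ?r" using r r' by simp
    fix x q :: "('a, 'n) mat2" assume x: "x \<in> {x \<in> S. lco x (lco s (lco g KK)) = lco g KK}" and q: "q \<in> QQ ?r"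
    have qS: "q \<in> S" using q QQ_mono[of ?r r] r(2) by auto
    have "ginv (s \<star> g) \<star> q \<star> (s \<star> g) \<in> KK" using q QQ_mono[of ?r r'] r'(3) by auto
    then have fixq: "lco q (lco (s \<star> g) KK) = lco (s \<star> g) KK" using lco_stable[OF sg] qS Sc by blast
    have "lco (x \<star> q) (lco (s \<star> g) KK) = lco x (lco q (lco (s \<star> g) KK))"
      using x qS Sc sg KKc by (intro lcos_m_assoc [symmetric]) (auto intro: l_coset_subset_G [THEN subsetD])
    then show "x \<star> q \<in> {x \<in> S. lco x (lco s (lco g KK)) = lco g KK}"
      using x qS S fixq by (simp add: eq subgroup.m_closed)
  qed
  then show ?thesis by simp
qed

text \<open>Apply \<open>coset_double_count\<close> twice to the image E of K \<inter> h K h^-1 in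
  the coset space. Inside K it gives |K h K / K| mu(E) = wt(h) mu(T K); inside h K h^-1 it gives |K
  h^-1 K / K| mu(E) = mu(T h K h^-1), which equals mu(T h K) by invariance. The two indices
  agree.\<close>

lemma emeasure_dcoset:
  fixes T :: "('a::nonarch_local_field_0, 'n::finite) mat2 set"
  assumes T: "subgroup T GLxGL" and \<mu>: "invariant_coset_measure T \<mu>" and h: "h \<in> carrier GLxGL"
    and TK: "\<And>t. t \<in> T \<Longrightarrow> ginv h \<star> t \<star> h \<in> KK \<Longrightarrow> t \<in> KK"
  shows "dcoset T h \<in> sets \<mu>"
    and "emeasure \<mu> (dcoset T h) = of_nat (card ((\<lambda>t. lco (t \<star> h) KK) ` (T \<inter> KK))) * emeasure \<mu> (dcoset T (mat 1, mat 1))"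
proof -
  interpret group "GLxGL :: ('a, 'n) mat2 monoid" by (rule group_GLxGL)
  interpret K: subgroup KK "GLxGL :: ('a, 'n) mat2 monoid" by (rule subgroup_KK)
  have KKc: "KK \<subseteq> carrier (GLxGL :: ('a, 'n) mat2 monoid)" using subgroup_KK by (rule subgroup.subset)
  have Tc: "t \<in> carrier GLxGL" if "t \<in> T" for t using that T subgroup.mem_carrier by metis
  have TG: "T \<subseteq> carrier GLxGL" using Tc by blast
  have space: "space \<mu> = rcosets\<^bsub>GLxGL\<^esub> T" and
    inv: "\<And>g A. g \<in> carrier GLxGL \<Longrightarrow> A \<in> sets \<mu> \<Longrightarrow> emeasure \<mu> ((\<lambda>C. rco C g) ` A) = emeasure \<mu> A"
    using \<mu> by (auto simp: invariant_coset_measure_def)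
  have one: "(mat 1, mat 1) = \<one>\<^bsub>GLxGL\<^esub>" by (simp add: one_GLxGL)
  have dc1: "dcoset T (mat 1, mat 1) = {rco T s | s. s \<in> KK}"
    unfolding dcoset_def by (auto simp: mult_GLxGL)
  have half: "QQ (1/2) \<subseteq> (KK :: ('a, 'n) mat2 set)" by (rule QQ_KK) simp
  have meas_dc: "{rco T s | s. s \<in> S} \<in> sets \<mu>" if S: "subgroup S GLxGL" "0 < r" "QQ r \<subseteq> S" for S r
    using S by (intro measurable_right_invariant[OF T \<mu>, of _ r]) (auto simp: subgroup.subset subgroup.m_closed subsetD)
  define S where "S = {h \<star> k \<star> ginv h | k. k \<in> KK}"
  have S_iff: "s \<in> S \<longleftrightarrow> ginv h \<star> s \<star> h \<in> KK" if "s \<in> carrier GLxGL" for s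
  proof
    assume "s \<in> S"
    then obtain k where k: "k \<in> KK" "s = h \<star> k \<star> ginv h" by (auto simp: S_def)
    then have "ginv h \<star> s \<star> h = (ginv h \<star> h) \<star> k \<star> (ginv h \<star> h)" using h KK_carrier[OF k(1)] by (simp only: m_assoc inv_closed m_closed)
    then show "ginv h \<star> s \<star> h \<in> KK" using h k KK_carrier[OF k(1)] by simp
  next
    assume k: "ginv h \<star> s \<star> h \<in> KK"
    have "s = (h \<star> ginv h) \<star> s \<star> (h \<star> ginv h)" using h that by simp
    also have "\<dots> = h \<star> (ginv h \<star> s \<star> h) \<star> ginv h" using h that by (simp only: m_assoc inv_closed m_closed)
    finally show "s \<in> S" unfolding S_def using k by blast
  qed
  have Ssub: "S \<subseteq> carrier GLxGL" unfolding S_def using h KK_carrier by auto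
  have S: "subgroup S GLxGL"
  proof (rule subgroupI)
    show "S \<subseteq> carrier GLxGL" by (rule Ssub)
    show "S \<noteq> {}" unfolding S_def using K.one_closed by blast
    fix a assume a: "a \<in> S"
    then have ac: "a \<in> carrier GLxGL" using Ssub by blast
    have "ginv h \<star> ginv a \<star> h = ginv (ginv h \<star> a \<star> h)" using ac h by (simp add: inv_mult_group m_assoc)
    then show "ginv a \<in> S" using a S_iff ac by simp
    fix b assume b: "b \<in> S"
    then have bc: "b \<in> carrier GLxGL" using Ssub by blast
    have "ginv h \<star> (a \<star> b) \<star> h = (ginv h \<star> a \<star> (h \<star> ginv h) \<star> b \<star> h)" using ac bc h by (simp add: m_assoc)
    also have "\<dots> = (ginv h \<star> a \<star> h) \<star> (ginv h \<star> b \<star> h)" using ac bc h by (simp only: m_assoc inv_closed m_closed)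
    finally have "ginv h \<star> (a \<star> b) \<star> h = (ginv h \<star> a \<star> h) \<star> (ginv h \<star> b \<star> h)" .
    then show "a \<star> b \<in> S" using a b S_iff ac bc by simp
  qed
  obtain r where r: "0 < r" "r < 1" "\<forall>q\<in>QQ r. ginv h \<star> q \<star> h \<in> KK" using QQ_conj[OF h] by blast
  have rS: "QQ r \<subseteq> S" using r S_iff QQ_KK[OF r(2)] KK_carrier by blast
  have lh: "lco s (lco h KK) = lco (s \<star> h) KK" if "s \<in> carrier GLxGL" for s
    using that h KKc by (intro lcos_m_assoc)
  let ?E = "{rco T s | s. s \<in> KK \<and> s \<in> S}"
  have E1: "{rco T s | s. s \<in> KK \<and> lco s (lco h KK) = lco h KK} = ?E"
  proof -
    have "lco s (lco h KK) = lco h KK \<longleftrightarrow> s \<in> S" if "s \<in> KK" for s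
      using lco_stable[OF h, of s] S_iff[of s] KK_carrier[OF that] by blast
    then show ?thesis by blast
  qed
  have lK: "lco \<one>\<^bsub>GLxGL\<^esub> KK = (KK :: ('a, 'n) mat2 set)" using KKc by (rule lcos_mult_one)
  have E2: "{rco T s | s. s \<in> S \<and> lco s (lco \<one>\<^bsub>GLxGL\<^esub> KK) = lco \<one>\<^bsub>GLxGL\<^esub> KK} = ?E"
  proof -
    have "lco s (lco \<one>\<^bsub>GLxGL\<^esub> KK) = lco \<one>\<^bsub>GLxGL\<^esub> KK \<longleftrightarrow> s \<in> KK" if "s \<in> S" for s
      using lco_stable[of "\<one>\<^bsub>GLxGL\<^esub>" s] that Ssub by auto
    then show ?thesis by blast
  qed
  have B1: "(\<lambda>s. lco s (lco h KK)) ` A = (\<lambda>s. lco (s \<star> h) KK) ` A" if "A \<subseteq> carrier GLxGL" for A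
    using lh that by (intro image_cong) auto
  have TKc: "T \<inter> KK \<subseteq> carrier GLxGL" using KKc by blast
  have "of_nat (card ((\<lambda>s. lco s (lco h KK)) ` KK)) * emeasure \<mu> {rco T s | s. s \<in> KK \<and> lco s (lco h KK) = lco h KK} =
    of_nat (card ((\<lambda>t. lco t (lco h KK)) ` (T \<inter> KK))) * emeasure \<mu> {rco T s | s. s \<in> KK}"
  proof (rule coset_double_count[OF T subgroup_KK])
    show "lco h KK \<subseteq> carrier GLxGL" using h KKc by (intro l_coset_subset_G)
    show "finite ((\<lambda>s. lco s (lco h KK)) ` KK)" unfolding B1[OF KKc] by (rule finite_KK_orbit[OF h])
    show "{rco T x | x. x \<in> KK \<and> lco x (lco s (lco h KK)) = lco h KK} \<in> sets \<mu>" if "s \<in> KK" for s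
      using that by (intro measurable_double_count[OF T \<mu> subgroup_KK _ half _ h]) auto
    show "{rco T s | s. s \<in> KK} \<in> sets \<mu>" by (rule meas_dc[OF subgroup_KK _ half]) simp
  qed (use space inv in auto)
  then have 1: "of_nat (card ((\<lambda>s. lco (s \<star> h) KK) ` KK)) * emeasure \<mu> ?E =
    of_nat (card ((\<lambda>t. lco (t \<star> h) KK) ` (T \<inter> KK))) * emeasure \<mu> (dcoset T (mat 1, mat 1))"
    unfolding E1 dc1 B1[OF KKc] B1[OF TKc] .
  have lSone: "(\<lambda>s. lco s (lco \<one>\<^bsub>GLxGL\<^esub> KK)) ` S = (\<lambda>k. lco h (lco (k \<star> ginv h) KK)) ` KK"
  proof -
    have "lco (h \<star> k \<star> ginv h) KK = lco h (lco (k \<star> ginv h) KK)" if "k \<in> KK" for k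
      using that h KKc KK_carrier by (subst lcos_m_assoc) (auto simp: m_assoc)
    then have "(\<lambda>k. lco (h \<star> k \<star> ginv h) KK) ` KK = (\<lambda>k. lco h (lco (k \<star> ginv h) KK)) ` KK"
      by (rule image_cong [OF refl])
    moreover have "S = (\<lambda>k. h \<star> k \<star> ginv h) ` KK" unfolding S_def by blast
    ultimately show ?thesis unfolding lK by (simp only: image_image)
  qed
  \<comment> \<open>Cancelling the left factor h reduces the orbit of h K h^-1 on the trivial coset
    to K h^-1 K / K.\<close>
  have card2: "card ((\<lambda>s. lco s (lco \<one>\<^bsub>GLxGL\<^esub> KK)) ` S) = card ((\<lambda>k. lco (k \<star> h) KK) ` KK)"
  proof -
    have "inj_on (lco h) {C. C \<subseteq> carrier GLxGL}"
    proof (rule inj_onI)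
      fix C D assume CD: "C \<in> {C. C \<subseteq> carrier GLxGL}" "D \<in> {C. C \<subseteq> carrier GLxGL}" "lco h C = lco h D"
      have "lco (ginv h) (lco h C) = C" "lco (ginv h) (lco h D) = D"
        using CD(1,2) h by (simp_all add: lcos_m_assoc lcos_mult_one)
      then show "C = D" using CD(3) by metis
    qed
    moreover have "(\<lambda>k. lco (k \<star> ginv h) KK) ` KK \<subseteq> {C. C \<subseteq> carrier GLxGL}"
    proof (intro subsetI CollectI)
      fix C x assume "C \<in> (\<lambda>k. lco (k \<star> ginv h) KK) ` KK" and x: "x \<in> C"
      then obtain k where k: "k \<in> KK" "C = lco (k \<star> ginv h) KK" by blast
      then have "C \<subseteq> carrier GLxGL" using h KKc KK_carrier[OF k(1)] by (simp add: l_coset_subset_G)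
      then show "x \<in> carrier GLxGL" using x by blast
    qed
    ultimately have "card (lco h ` ((\<lambda>k. lco (k \<star> ginv h) KK) ` KK)) = card ((\<lambda>k. lco (k \<star> ginv h) KK) ` KK)"
      by (meson card_image inj_on_subset)
    then show ?thesis using card_KK_orbit_inv[OF h] by (simp add: lSone image_image)
  qed
  have "of_nat (card ((\<lambda>s. lco s (lco \<one>\<^bsub>GLxGL\<^esub> KK)) ` S)) * emeasure \<mu> {rco T s | s. s \<in> S \<and> lco s (lco \<one>\<^bsub>GLxGL\<^esub> KK) = lco \<one>\<^bsub>GLxGL\<^esub> KK} =
    of_nat (card ((\<lambda>t. lco t (lco \<one>\<^bsub>GLxGL\<^esub> KK)) ` (T \<inter> S))) * emeasure \<mu> {rco T s | s. s \<in> S}"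
  proof (rule coset_double_count[OF T S])
    show "lco \<one>\<^bsub>GLxGL\<^esub> KK \<subseteq> carrier (GLxGL :: ('a, 'n) mat2 monoid)" using KKc lK by simp
    have "finite ((\<lambda>k. lco (k \<star> ginv h) KK) ` KK)" using h by (intro finite_KK_orbit) simp
    then have "finite (lco h ` ((\<lambda>k. lco (k \<star> ginv h) KK) ` KK))" by (rule finite_imageI)
    then show "finite ((\<lambda>s. lco s (lco \<one>\<^bsub>GLxGL\<^esub> KK)) ` S)" unfolding lSone by (simp add: image_image)
    show "{rco T x | x. x \<in> S \<and> lco x (lco s (lco \<one>\<^bsub>GLxGL\<^esub> KK)) = lco \<one>\<^bsub>GLxGL\<^esub> KK} \<in> sets \<mu>" if "s \<in> S" for s
      using that r by (intro measurable_double_count[OF T \<mu> S _ rS]) auto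
    show "{rco T s | s. s \<in> S} \<in> sets \<mu>" using r by (intro meas_dc[OF S _ rS])
  qed (use space inv in auto)
  \<comment> \<open>Elements of T inside h K h^-1 already lie in K, so the second counting has
    multiplicity 1.\<close>
  moreover have "(\<lambda>t. lco t (lco \<one>\<^bsub>GLxGL\<^esub> KK)) ` (T \<inter> S) = {KK}"
  proof -
    have "lco t KK = KK" if "t \<in> T \<inter> S" for t
    proof -
      have "t \<in> KK" using that TK S_iff Tc by blast
      then have "lco \<one>\<^bsub>GLxGL\<^esub> KK = lco t KK" using KK_carrier by (subst lcoset_eq_iff[OF subgroup_KK]) auto
      then show ?thesis using lK by simp
    qed
    moreover have "\<one>\<^bsub>GLxGL\<^esub> \<in> T \<inter> S" using T S subgroup.one_closed by blast
    ultimately show ?thesis unfolding lK by blast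
  qed
  ultimately have 2: "of_nat (card ((\<lambda>s. lco (s \<star> h) KK) ` KK)) * emeasure \<mu> ?E = emeasure \<mu> {rco T s | s. s \<in> S}"
    unfolding E2 card2 by simp
  have dch: "dcoset T h = (\<lambda>C. rco C h) ` {rco T s | s. s \<in> S}"
  proof -
    have "rco (rco T (h \<star> k \<star> ginv h)) h = rco T (h \<star> k)" if "k \<in> KK" for k
      using that h KK_carrier[OF that] TG by (simp add: coset_mult_assoc m_assoc)
    then have "(\<lambda>k. rco (rco T (h \<star> k \<star> ginv h)) h) ` KK = (\<lambda>k. rco T (h \<star> k)) ` KK"
      by (rule image_cong [OF refl])
    moreover have "{rco T s | s. s \<in> S} = (\<lambda>k. rco T (h \<star> k \<star> ginv h)) ` KK" unfolding S_def by blast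
    moreover have "dcoset T h = (\<lambda>k. rco T (h \<star> k)) ` KK" unfolding dcoset_def by blast
    ultimately show ?thesis by (simp only: image_image)
  qed
  have mS: "{rco T s | s. s \<in> S} \<in> sets \<mu>" using r by (intro meas_dc[OF S _ rS])
  then have 3: "emeasure \<mu> (dcoset T h) = emeasure \<mu> {rco T s | s. s \<in> S}" unfolding dch using h by (intro inv)
  show "emeasure \<mu> (dcoset T h) = of_nat (card ((\<lambda>t. lco (t \<star> h) KK) ` (T \<inter> KK))) * emeasure \<mu> (dcoset T (mat 1, mat 1))"
    using 1 2 3 by simp
  have "{rco T x | x. x \<in> (\<lambda>k. h \<star> k) ` KK} \<in> sets \<mu>"
  proof (rule measurable_right_invariant[OF T \<mu>, of _ "1/2"])
    show "(\<lambda>k. h \<star> k) ` KK \<subseteq> carrier GLxGL" using h KK_carrier by auto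
    fix x q :: "('a, 'n) mat2" assume x: "x \<in> (\<lambda>k. h \<star> k) ` KK" and q: "q \<in> QQ (1/2)"
    then obtain k where k: "k \<in> KK" "x = h \<star> k" by blast
    have qK: "q \<in> KK" using q half by blast
    have "x \<star> q = h \<star> (k \<star> q)" using k qK h KK_carrier by (simp add: m_assoc)
    then show "x \<star> q \<in> (\<lambda>k. h \<star> k) ` KK" using k qK by blast
  qed simp
  moreover have "{rco T x | x. x \<in> (\<lambda>k. h \<star> k) ` KK} = dcoset T h" unfolding dcoset_def by blast
  ultimately show "dcoset T h \<in> sets \<mu>" by simp
qed

text \<open>The trivial double coset is the image of the compact group K under the continuous
  quotient map.\<close>

lemma emeasure_dcoset_one_finite:
  fixes T :: "('a::nonarch_local_field_0, 'n::finite) mat2 set"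
  assumes T: "subgroup T GLxGL" and \<mu>: "invariant_coset_measure T \<mu>"
  shows "emeasure \<mu> (dcoset T (mat 1, mat 1)) < \<infinity>"
proof -
  interpret group "GLxGL :: ('a, 'n) mat2 monoid" by (rule group_GLxGL)
  have TG: "T \<subseteq> carrier GLxGL" using T by (rule subgroup.subset)
  have cont: "continuous_map (top_of_set (carrier GLxGL)) (coset_topology T) (rco T)"
    unfolding continuous_map
  proof (intro conjI allI impI)
    have top: "topspace (coset_topology T) = rcosets\<^bsub>GLxGL\<^esub> T"
    proof
      show "topspace (coset_topology T) \<subseteq> rcosets\<^bsub>GLxGL\<^esub> T"
        using openin_coset_topology[OF T, of "topspace (coset_topology T)"] by simp
      have "\<Union>(rcosets\<^bsub>GLxGL\<^esub> T) = carrier GLxGL" using T by (rule rcosets_part_G)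
      then have "openin (coset_topology T) (rcosets\<^bsub>GLxGL\<^esub> T)" using openin_coset_topology[OF T] by simp
      then show "rcosets\<^bsub>GLxGL\<^esub> T \<subseteq> topspace (coset_topology T)" by (rule openin_subset)
    qed
    show "rco T ` topspace (top_of_set (carrier GLxGL)) \<subseteq> topspace (coset_topology T)"
      unfolding top using TG by (auto intro: rcosetsI)
    fix U assume "openin (coset_topology T) U"
    then have U: "U \<subseteq> rcosets\<^bsub>GLxGL\<^esub> T" "openin (top_of_set (carrier GLxGL)) (\<Union>U)"
      using openin_coset_topology[OF T] by auto
    have "{x \<in> carrier GLxGL. rco T x \<in> U} = \<Union>U"
    proof (intro equalityI subsetI)
      fix x assume "x \<in> {x \<in> carrier GLxGL. rco T x \<in> U}"
      then show "x \<in> \<Union>U" using rcos_self[OF _ T] by blast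
    next
      fix x assume "x \<in> \<Union>U"
      then obtain C where C: "C \<in> U" "x \<in> C" by blast
      then obtain g where g: "g \<in> carrier GLxGL" "C = rco T g" using U(1) by (auto simp: RCOSETS_def)
      have "C = rco T x" using C(2) g repr_independence[OF _ _ T] by blast
      moreover have "x \<in> carrier GLxGL" using C(2) g TG r_coset_subset_G by blast
      ultimately show "x \<in> {x \<in> carrier GLxGL. rco T x \<in> U}" using C(1) by simp
    qed
    then show "openin (top_of_set (carrier GLxGL)) {x \<in> topspace (top_of_set (carrier GLxGL)). rco T x \<in> U}"
      using U(2) by simp
  qed
  have "compact (KK :: ('a, 'n) mat2 set)" unfolding KK_def by (intro compact_Times compact_GLO)
  then have "compactin (top_of_set (carrier GLxGL)) (KK :: ('a, 'n) mat2 set)"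
    using KK_carrier by (auto simp: compactin_subtopology)
  then have "compactin (coset_topology T) (rco T ` KK)" using cont by (rule image_compactin)
  moreover have "dcoset T (mat 1, mat 1) = rco T ` KK"
    unfolding dcoset_def by (auto simp: mult_GLxGL)
  ultimately show ?thesis using \<mu> by (auto simp: invariant_coset_measure_def)
qed

lemma dcoset_eq:
  fixes T :: "('a::nonarch_local_field_0, 'n::finite) mat2 set"
  assumes T: "subgroup T GLxGL" and g: "g \<in> carrier GLxGL" and t: "t \<in> T" and k: "k \<in> KK"
  shows "dcoset T (t \<star> g \<star> k) = dcoset T g"
proof -
  interpret group "GLxGL :: ('a, 'n) mat2 monoid" by (rule group_GLxGL)
  interpret K: subgroup KK "GLxGL :: ('a, 'n) mat2 monoid" by (rule subgroup_KK)
  have TG: "T \<subseteq> carrier GLxGL" using T by (rule subgroup.subset)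
  have tc: "t \<in> carrier GLxGL" and kc: "k \<in> carrier GLxGL" using t TG k KK_carrier by auto
  have eq: "rco T (t \<star> g \<star> k \<star> l) = rco T (g \<star> (k \<star> l))" if l: "l \<in> KK" for l
  proof -
    have lc: "l \<in> carrier GLxGL" using l KK_carrier by blast
    have "rco T (t \<star> (g \<star> (k \<star> l))) = rco (rco T t) (g \<star> (k \<star> l))"
      using tc kc lc g TG by (intro coset_mult_assoc [symmetric]) auto
    also have "rco T t = T" using tc T t by (rule coset_join2)
    finally show ?thesis using tc kc lc g by (simp add: m_assoc)
  qed
  have "\<exists>l'\<in>KK. rco T (g \<star> l) = rco T (t \<star> g \<star> k \<star> l')" if l: "l \<in> KK" for l
  proof -
    have m: "ginv k \<star> l \<in> KK" using k l by simp
    have "k \<star> (ginv k \<star> l) = l" using kc KK_carrier[OF l] by (simp add: m_assoc [symmetric])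
    then show ?thesis using eq[OF m] m by (intro bexI[of _ "ginv k \<star> l"]) auto
  qed
  note conv = this
  show ?thesis
  proof (intro equalityI subsetI)
    fix C assume "C \<in> dcoset T (t \<star> g \<star> k)"
    then obtain l where l: "l \<in> KK" "C = rco T (t \<star> g \<star> k \<star> l)" unfolding dcoset_def by blast
    have "k \<star> l \<in> KK" using k l by simp
    then show "C \<in> dcoset T g" unfolding dcoset_def l(2) eq[OF l(1)] by blast
  next
    fix C assume "C \<in> dcoset T g"
    then obtain l where l: "l \<in> KK" "C = rco T (g \<star> l)" unfolding dcoset_def by blast
    then show "C \<in> dcoset T (t \<star> g \<star> k)" using conv[OF l(1)] unfolding dcoset_def by blast
  qed
qed

lemma rco_in_dcoset:
  fixes T :: "('a::nonarch_local_field_0, 'n::finite) mat2 set"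
  assumes T: "subgroup T GLxGL" and g: "g \<in> carrier GLxGL" and h: "h \<in> carrier GLxGL"
  shows "rco T h \<in> dcoset T g \<longleftrightarrow> (\<exists>t\<in>T. \<exists>k\<in>KK. h = t \<star> g \<star> k)"
proof -
  interpret group "GLxGL :: ('a, 'n) mat2 monoid" by (rule group_GLxGL)
  have TG: "T \<subseteq> carrier GLxGL" using T by (rule subgroup.subset)
  show ?thesis
  proof
    assume "rco T h \<in> dcoset T g"
    then obtain k where k: "k \<in> KK" "rco T h = rco T (g \<star> k)" unfolding dcoset_def by blast
    then have "h \<in> rco T (g \<star> k)" using rcos_self[OF h T] by simp
    then obtain t where "t \<in> T" "h = t \<star> (g \<star> k)" by (auto simp: r_coset_def)
    then show "\<exists>t\<in>T. \<exists>k\<in>KK. h = t \<star> g \<star> k" using k g KK_carrier[OF k(1)] TG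
      by (intro bexI[of _ t] bexI[of _ k]) (auto simp: m_assoc)
  next
    assume "\<exists>t\<in>T. \<exists>k\<in>KK. h = t \<star> g \<star> k"
    then obtain t k where tk: "t \<in> T" "k \<in> KK" "h = t \<star> g \<star> k" by blast
    have tc: "t \<in> carrier GLxGL" and kc: "k \<in> carrier GLxGL" using tk TG KK_carrier by blast+
    have "rco T (t \<star> (g \<star> k)) = rco (rco T t) (g \<star> k)"
      using tc kc g TG by (intro coset_mult_assoc [symmetric]) auto
    also have "rco T t = T" using tc T tk(1) by (rule coset_join2)
    finally have "rco T h = rco T (g \<star> k)" using tk tc kc g by (simp add: m_assoc)
    then show "rco T h \<in> dcoset T g" unfolding dcoset_def using tk by blast
  qed
qed

text \<open>Countably many double cosets cover the space, and all their measures are multiples of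
  this one; it cannot vanish because the invariant measure is nonzero.\<close>

lemma emeasure_dcoset_one_pos:
  fixes T :: "('a::nonarch_local_field_0, 'n::finite) mat2 set"
  assumes T: "subgroup T GLxGL" and \<mu>: "invariant_coset_measure T \<mu>"
    and TK: "\<And>h t. h \<in> carrier GLxGL \<Longrightarrow> t \<in> T \<Longrightarrow> ginv h \<star> t \<star> h \<in> KK \<Longrightarrow> t \<in> KK"
  shows "emeasure \<mu> (dcoset T (mat 1, mat 1)) \<noteq> 0"
proof
  assume 0: "emeasure \<mu> (dcoset T (mat 1, mat 1)) = 0"
  interpret group "GLxGL :: ('a, 'n) mat2 monoid" by (rule group_GLxGL)
  have TG: "T \<subseteq> carrier GLxGL" using T by (rule subgroup.subset)
  have "\<forall>N :: nat. \<exists>S. finite S \<and> (\<forall>h :: 'a^'n^'n. invertible h \<and> bnd (real N) h \<and> bnd (real N) (matrix_inv h) \<longrightarrow>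
     (\<exists>g\<in>S. invertible g \<and> matrix_inv g ** h \<in> GLO))" using finite_mod_GLO by blast
  from choice[OF this] obtain S where S: "\<And>N. finite (S N)"
    "\<And>N h. invertible h \<Longrightarrow> bnd (real N) h \<Longrightarrow> bnd (real N) (matrix_inv h) \<Longrightarrow> \<exists>g\<in>S N. invertible g \<and> matrix_inv g ** (h :: 'a^'n^'n) \<in> GLO"
    by blast
  define R where "R = (\<Union>N. S N)"
  have cR: "countable R" unfolding R_def using S(1) by (intro countable_UN) (auto intro: countable_finite)
  have R: "\<exists>g\<in>R. invertible g \<and> matrix_inv g ** h \<in> GLO" if inv: "invertible h" for h :: "'a^'n^'n"
  proof -
    obtain r1 where r1: "1 \<le> r1" "bnd r1 h" using exists_bnd by blast
    obtain r2 where r2: "1 \<le> r2" "bnd r2 (matrix_inv h)" using exists_bnd by blast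
    obtain N :: nat where N: "max r1 r2 \<le> real N" using real_arch_simple by blast
    have "bnd (real N) h" "bnd (real N) (matrix_inv h)"
      using bnd_mono[OF r1(2), of "real N"] bnd_mono[OF r2(2), of "real N"] N by auto
    then show ?thesis using S(2)[OF inv, of N] unfolding R_def by blast
  qed
  let ?\<D> = "dcoset T ` ((R \<times> R) \<inter> carrier GLxGL)"
  have sets: "D \<in> sets \<mu>" "emeasure \<mu> D = 0" if D: "D \<in> ?\<D>" for D
  proof -
    obtain g where g: "g \<in> carrier GLxGL" "D = dcoset T g" using D by blast
    show "D \<in> sets \<mu>" unfolding g(2) by (rule emeasure_dcoset(1)[OF T \<mu> g(1)]) (rule TK[OF g(1)])
    have "emeasure \<mu> (dcoset T g) = of_nat (card ((\<lambda>t. lco (t \<star> g) KK) ` (T \<inter> KK))) * emeasure \<mu> (dcoset T (mat 1, mat 1))"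
      by (rule emeasure_dcoset(2)[OF T \<mu> g(1)]) (rule TK[OF g(1)])
    then show "emeasure \<mu> D = 0" using 0 g(2) by simp
  qed
  have cov: "rcosets\<^bsub>GLxGL\<^esub> T \<subseteq> \<Union>?\<D>"
  proof
    fix C assume "C \<in> rcosets\<^bsub>GLxGL\<^esub> T"
    then obtain h where h: "h \<in> carrier GLxGL" "C = rco T h" by (auto simp: RCOSETS_def)
    obtain g1 where g1: "g1 \<in> R" "invertible g1" "matrix_inv g1 ** fst h \<in> GLO" using R h by (auto simp: carrier_GLxGL)
    obtain g2 where g2: "g2 \<in> R" "invertible g2" "matrix_inv g2 ** snd h \<in> GLO" using R h by (auto simp: carrier_GLxGL)
    let ?g = "(g1, g2)"
    have gc: "?g \<in> carrier GLxGL" using g1 g2 by (simp add: carrier_GLxGL)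
    have k: "ginv ?g \<star> h \<in> KK" using g1 g2 by (simp add: inv_GLxGL[OF gc] mult_GLxGL KK_def)
    have "h = \<one>\<^bsub>GLxGL\<^esub> \<star> ?g \<star> (ginv ?g \<star> h)" using gc h by (simp add: m_assoc [symmetric])
    then have "C \<in> dcoset T ?g" unfolding h(2) rco_in_dcoset[OF T gc h(1)]
      using k subgroup.one_closed[OF T] by blast
    then show "C \<in> \<Union>?\<D>" using g1 g2 gc by blast
  qed
  have "countable ?\<D>" using cR by (intro countable_image countable_subset[OF _ countable_SIGMA]) auto
  then have "(\<Union>D\<in>?\<D>. D) \<in> null_sets \<mu>"
    using sets by (intro null_sets_UN') (auto intro!: null_setsI)
  then have "emeasure \<mu> (\<Union>D\<in>?\<D>. D) = 0" by (rule null_setsD1)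
  moreover have "(\<Union>D\<in>?\<D>. D) \<in> sets \<mu>" using \<open>countable ?\<D>\<close> sets(1) by (intro sets.countable_UN') auto
  ultimately have "emeasure \<mu> (space \<mu>) = 0"
    using cov \<mu> emeasure_mono[of "space \<mu>" "\<Union>?\<D>" \<mu>] by (auto simp: invariant_coset_measure_def)
  then show False using \<mu> by (simp add: invariant_coset_measure_def)
qed

section \<open>Orbital integrals as finite sums\<close>

lemma has_bochner_integral_partition:
  fixes f :: "'c \<Rightarrow> complex"
  assumes fin: "finite \<E>" and disj: "\<And>E E'. E \<in> \<E> \<Longrightarrow> E' \<in> \<E> \<Longrightarrow> E \<noteq> E' \<Longrightarrow> E \<inter> E' = {}"
    and meas: "\<And>E. E \<in> \<E> \<Longrightarrow> E \<in> sets \<mu>" "\<And>E. E \<in> \<E> \<Longrightarrow> emeasure \<mu> E < \<infinity>"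
    and const: "\<And>E C. E \<in> \<E> \<Longrightarrow> C \<in> E \<Longrightarrow> f C = c E"
    and zero: "\<And>C. C \<in> space \<mu> \<Longrightarrow> C \<notin> \<Union>\<E> \<Longrightarrow> f C = 0"
  shows "has_bochner_integral \<mu> f (\<Sum>E\<in>\<E>. measure \<mu> E *\<^sub>R c E)"
proof -
  have "has_bochner_integral \<mu> (\<lambda>C. \<Sum>E\<in>\<E>. indicator E C *\<^sub>R c E) (\<Sum>E\<in>\<E>. measure \<mu> E *\<^sub>R c E)"
    using meas by (intro has_bochner_integral_sum has_bochner_integral_scaleR_left has_bochner_integral_real_indicator) auto
  moreover have "(\<Sum>E\<in>\<E>. indicator E C *\<^sub>R c E) = f C" if C: "C \<in> space \<mu>" for C
  proof (cases "C \<in> \<Union>\<E>")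
    case True
    then obtain E where E: "E \<in> \<E>" "C \<in> E" by blast
    then have "(\<Sum>E\<in>\<E>. indicator E C *\<^sub>R c E) = (\<Sum>E'\<in>\<E>. if E' = E then c E else 0)"
      using disj by (intro sum.cong) (auto simp: indicator_def)
    then show ?thesis using E fin const by simp
  next
    case False
    then show ?thesis using zero[OF C] by (auto intro!: sum.neutral)
  qed
  ultimately show ?thesis
    using has_bochner_integral_cong[OF refl, of \<mu> "\<lambda>C. \<Sum>E\<in>\<E>. indicator E C *\<^sub>R c E" f] by blast
qed

lemma QQ_normal:
  fixes k q :: "('a::nonarch_local_field_0, 'n::finite) mat2"
  assumes "k \<in> KK" "q \<in> QQ r"
  shows "ginv k \<star> q \<star> k \<in> QQ r"
proof -
  have "bnd r (matrix_inv A ** B ** A - mat 1)" if "A \<in> GLO" "bnd r (B - mat 1)" for A B :: "'a^'n^'n"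
  proof -
    have "bnd r (matrix_inv A ** (B - mat 1) ** A)"
      using that bnd_mult'[OF bnd_mult[of 1 "matrix_inv A" r "B - mat 1"], of 1 A r] by (simp add: GLO_def)
    then show ?thesis using conj_near_one that(1) GLO_invertible by metis
  qed
  then show ?thesis using assms by (auto simp: inv_GLxGL[OF KK_carrier] mult_GLxGL KK_def QQ_def)
qed

text \<open>\<open>R\<close> represents the cosets Q k of Q = \<open>QQ r\<close> in K. Right
  multiplication by an element of K permutes these cosets, and a Q-invariant function sees nothing
  else.\<close>

lemma exists_averaging_set:
  assumes r: "0 < r" "r < 1"
  shows "\<exists>R. finite R \<and> R \<subseteq> KK \<and> R \<noteq> {} \<and> (\<forall>\<phi> :: ('a::nonarch_local_field_0, 'n::finite) mat2 \<Rightarrow> complex.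
    (\<forall>q\<in>QQ r. \<forall>y. \<phi> (act q y) = \<phi> y) \<longrightarrow> (\<forall>k\<in>KK. \<forall>y. (\<Sum>s\<in>R. \<phi> (act s (act k y))) = (\<Sum>s\<in>R. \<phi> (act s y))))"
proof -
  interpret group "GLxGL :: ('a, 'n) mat2 monoid" by (rule group_GLxGL)
  interpret K: subgroup KK "GLxGL :: ('a, 'n) mat2 monoid" by (rule subgroup_KK)
  have Q: "subgroup (QQ r) (GLxGL :: ('a, 'n) mat2 monoid)" using r by (intro subgroup_QQ) auto
  have QG: "QQ r \<subseteq> carrier (GLxGL :: ('a, 'n) mat2 monoid)" using Q by (rule subgroup.subset)
  have QK: "QQ r \<subseteq> (KK :: ('a, 'n) mat2 set)" using r by (intro QQ_KK)
  define Cs where "Cs = rco (QQ r) ` (KK :: ('a, 'n) mat2 set)"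
  obtain S :: "('a, 'n) mat2 set" where S: "finite S" "S \<subseteq> KK"
    "\<forall>k\<in>KK. \<exists>s\<in>S. ginv s \<star> k \<in> QQ r \<and> k \<star> ginv s \<in> QQ r"
    using KK_mod_QQ_finite[OF r, where ?'a = 'a and ?'n = 'n] by (elim exE conjE)
  have "Cs \<subseteq> rco (QQ r) ` S"
  proof
    fix C assume "C \<in> Cs"
    then obtain k where k: "k \<in> KK" "C = rco (QQ r) k" by (auto simp: Cs_def)
    then obtain s where s: "s \<in> S" "k \<star> ginv s \<in> QQ r" using S(3) by blast
    have c: "k \<in> carrier GLxGL" "s \<in> carrier GLxGL" using k s S KK_carrier by blast+
    have "k = (k \<star> ginv s) \<star> s" using c by (simp add: m_assoc)
    then have "k \<in> rco (QQ r) s" using s(2) unfolding r_coset_def by blast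
    then have "rco (QQ r) s = rco (QQ r) k" using c Q by (intro repr_independence)
    then show "C \<in> rco (QQ r) ` S" using s k by blast
  qed
  then have finC: "finite Cs" using S(1) finite_subset by blast
  define rep where "rep C = (SOME s. s \<in> C)" for C :: "('a, 'n) mat2 set"
  have rep: "rep C \<in> C" if C: "C \<in> Cs" for C
  proof -
    obtain k where k: "k \<in> KK" "C = rco (QQ r) k" using C by (auto simp: Cs_def)
    then have "k \<in> C" using rcos_self[OF KK_carrier[OF k(1)] Q] by simp
    then show ?thesis unfolding rep_def by (rule someI)
  qed
  have CK: "s \<in> KK" "C = rco (QQ r) s" if C: "C \<in> Cs" "s \<in> C" for C s
  proof -
    obtain k where k: "k \<in> KK" "C = rco (QQ r) k" using C by (auto simp: Cs_def)
    then obtain q where "q \<in> QQ r" "s = q \<star> k" using C(2) unfolding r_coset_def by blast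
    then show "s \<in> KK" using k QK by blast
    show "C = rco (QQ r) s" using C(2) k KK_carrier[OF k(1)] Q repr_independence by blast
  qed
  have inj: "inj_on rep Cs"
  proof (rule inj_onI)
    fix C D assume "C \<in> Cs" "D \<in> Cs" "rep C = rep D"
    then show "C = D" using CK(2) rep by metis
  qed
  show ?thesis
  proof (intro exI conjI allI impI ballI)
    show "finite (rep ` Cs)" using finC by simp
    show "rep ` Cs \<subseteq> KK" using CK(1) rep by blast
    show "rep ` Cs \<noteq> {}" unfolding Cs_def using K.one_closed by blast
    fix \<phi> :: "('a, 'n) mat2 \<Rightarrow> complex" and k y
    assume \<phi>: "\<forall>q\<in>QQ r. \<forall>y. \<phi> (act q y) = \<phi> y" and k: "k \<in> (KK :: ('a, 'n) mat2 set)"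
    have kc: "k \<in> carrier GLxGL" using k KK_carrier by blast
    have any: "\<phi> (act s y) = \<phi> (act (rep C) y)" if C: "C \<in> Cs" "s \<in> C" for C s
    proof -
      have s: "s \<in> KK" using CK C by blast
      have "rep C \<in> rco (QQ r) s" using rep[OF C(1)] CK(2)[OF C] by blast
      then obtain q where q: "q \<in> QQ r" "rep C = q \<star> s" unfolding r_coset_def by blast
      have "act (rep C) y = act q (act s y)" unfolding q(2)
        using q(1) QG KK_carrier[OF s] by (intro act_mult) auto
      then show ?thesis using \<phi> q(1) by metis
    qed
    have CG: "C \<subseteq> carrier GLxGL" if "C \<in> Cs" for C using CK(1)[OF that] KK_carrier by blast
    have move: "rco C l \<in> Cs" if C: "C \<in> Cs" "l \<in> KK" for C l
    proof -
      obtain s where s: "s \<in> KK" "C = rco (QQ r) s" using C by (auto simp: Cs_def)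
      have "rco C l = rco (QQ r) (s \<star> l)" unfolding s(2)
        using s C QG KK_carrier by (intro coset_mult_assoc) auto
      then show ?thesis unfolding Cs_def using s C by blast
    qed
    have bij: "bij_betw (\<lambda>C. rco C k) Cs Cs"
    proof (rule bij_betw_byWitness[where f' = "\<lambda>C. rco C (ginv k)"])
      show "\<forall>C\<in>Cs. rco (rco C k) (ginv k) = C" using CG kc by (simp add: coset_mult_assoc coset_mult_one)
      show "\<forall>C\<in>Cs. rco (rco C (ginv k)) k = C" using CG kc by (simp add: coset_mult_assoc coset_mult_one)
    qed (use move k K.m_inv_closed in blast)+
    have "(\<Sum>s\<in>rep ` Cs. \<phi> (act s (act k y))) = (\<Sum>C\<in>Cs. \<phi> (act (rep C) (act k y)))"
      using inj by (simp add: sum.reindex)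
    also have "\<dots> = (\<Sum>C\<in>Cs. \<phi> (act (rep (rco C k)) y))"
    proof (rule sum.cong)
      fix C assume C: "C \<in> Cs"
      have rc: "rep C \<in> carrier GLxGL" using rep[OF C] CG[OF C] by blast
      have "rep C \<star> k \<in> rco C k" using rep[OF C] unfolding r_coset_def by blast
      then have "\<phi> (act (rep C \<star> k) y) = \<phi> (act (rep (rco C k)) y)" using any move[OF C k] by blast
      then show "\<phi> (act (rep C) (act k y)) = \<phi> (act (rep (rco C k)) y)" using act_mult[OF rc kc, of y] by simp
    qed simp
    also have "\<dots> = (\<Sum>C\<in>Cs. \<phi> (act (rep C) y))"
      by (rule sum.reindex_bij_betw[OF bij, of "\<lambda>C. \<phi> (act (rep C) y)"])
    also have "\<dots> = (\<Sum>s\<in>rep ` Cs. \<phi> (act s y))" using inj by (simp add: sum.reindex)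
    finally show "(\<Sum>s\<in>rep ` Cs. \<phi> (act s (act k y))) = (\<Sum>s\<in>rep ` Cs. \<phi> (act s y))" .
  qed
qed

definition dcoset_rep :: "('a::nonarch_local_field_0, 'n::finite) mat2 set \<Rightarrow> ('a, 'n) mat2 set set \<Rightarrow> ('a, 'n) mat2" where
  "dcoset_rep T D = (SOME h. h \<in> carrier GLxGL \<and> dcoset T h = D)"

lemma dcoset_rep:
  assumes "h \<in> carrier GLxGL"
  shows "dcoset_rep T (dcoset T h) \<in> carrier GLxGL" "dcoset T (dcoset_rep T (dcoset T h)) = dcoset T h"
proof -
  have "dcoset_rep T (dcoset T h) \<in> carrier GLxGL \<and> dcoset T (dcoset_rep T (dcoset T h)) = dcoset T h"
    unfolding dcoset_rep_def using assms by (intro someI[of "\<lambda>g. g \<in> carrier GLxGL \<and> dcoset T g = dcoset T h" h]) simp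
  then show "dcoset_rep T (dcoset T h) \<in> carrier GLxGL" "dcoset T (dcoset_rep T (dcoset T h)) = dcoset T h" by auto
qed

lemma rco_in_dcoset_self:
  assumes "subgroup T GLxGL" "h \<in> carrier (GLxGL :: ('a::nonarch_local_field_0, 'n::finite) mat2 monoid)"
  shows "rco T h \<in> dcoset T h"
proof -
  interpret group "GLxGL :: ('a, 'n) mat2 monoid" by (rule group_GLxGL)
  show ?thesis unfolding dcoset_def
    using assms(2) subgroup.one_closed[OF subgroup_KK[where ?'a = 'a and ?'n = 'n]]
    by (intro CollectI exI[of _ "\<one>\<^bsub>GLxGL\<^esub>"]) simp
qed

lemma dcoset_eqI:
  fixes T :: "('a::nonarch_local_field_0, 'n::finite) mat2 set"
  assumes "subgroup T GLxGL" "g \<in> carrier GLxGL" "h \<in> carrier GLxGL" "rco T h \<in> dcoset T g"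
  shows "dcoset T h = dcoset T g"
proof -
  obtain t k where "t \<in> T" "k \<in> KK" "h = t \<star> g \<star> k" using rco_in_dcoset[OF assms(1-3)] assms(4) by blast
  then show ?thesis using dcoset_eq[OF assms(1,2)] by simp
qed

text \<open>The integrand is constant only on the images of the smaller sets g Q with Q =
  \<open>QQ r\<close>. Invariance under right translation by K replaces it by its average over
  \<open>R\<close>, which is constant on whole double cosets.\<close>

lemma Orb_sum:
  fixes x :: "('a::nonarch_local_field_0, 'n::finite) mat2" and \<phi> :: "('a, 'n) mat2 \<Rightarrow> complex"
  defines "T \<equiv> stabilizer GLxGL act x"
  assumes T: "subgroup T GLxGL" and \<mu>: "invariant_coset_measure T \<mu>"
    and TK: "\<And>h t. h \<in> carrier GLxGL \<Longrightarrow> t \<in> T \<Longrightarrow> ginv h \<star> t \<star> h \<in> KK \<Longrightarrow> t \<in> KK"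
    and r: "0 < r" "r < 1" and \<phi>: "\<And>q y. q \<in> QQ r \<Longrightarrow> \<phi> (act q y) = \<phi> y"
    and R: "finite R" "R \<subseteq> KK" "\<And>k y. k \<in> KK \<Longrightarrow> (\<Sum>s\<in>R. \<phi> (act s (act k y))) = (\<Sum>s\<in>R. \<phi> (act s y))"
    and Hs: "finite Hs" "Hs \<subseteq> carrier GLxGL"
    and supp: "\<And>h. h \<in> carrier GLxGL \<Longrightarrow> \<phi> (act (ginv h) x) \<noteq> 0 \<Longrightarrow> \<exists>h'\<in>Hs. rco T h \<in> dcoset T h'"
  shows "of_nat (card R) * Orb \<mu> \<phi> x =
    (\<Sum>D\<in>dcoset T ` Hs. measure \<mu> D *\<^sub>R (\<Sum>s\<in>R. \<phi> (act s (act (ginv (dcoset_rep T D)) x))))"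
proof -
  interpret group "GLxGL :: ('a, 'n) mat2 monoid" by (rule group_GLxGL)
  interpret K: subgroup KK "GLxGL :: ('a, 'n) mat2 monoid" by (rule subgroup_KK)
  have TG: "T \<subseteq> carrier GLxGL" using T by (rule subgroup.subset)
  have Q: "subgroup (QQ r) (GLxGL :: ('a, 'n) mat2 monoid)" using r by (intro subgroup_QQ) auto
  have QG: "q \<in> carrier GLxGL" if "q \<in> QQ r" for q :: "('a, 'n) mat2" using that subgroup.mem_carrier[OF Q] by blast
  have QK: "QQ r \<subseteq> (KK :: ('a, 'n) mat2 set)" using r by (intro QQ_KK)
  have space: "space \<mu> = rcosets\<^bsub>GLxGL\<^esub> T" and
    inv: "\<And>g A. g \<in> carrier GLxGL \<Longrightarrow> A \<in> sets \<mu> \<Longrightarrow> emeasure \<mu> ((\<lambda>C. rco C g) ` A) = emeasure \<mu> A"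
    using \<mu> by (auto simp: invariant_coset_measure_def)
  define f where "f C = \<phi> (orb_stab_fun GLxGL act C x)" for C
  have f: "f (rco T h) = \<phi> (act (ginv h) x)" if "h \<in> carrier GLxGL" for h
    unfolding f_def T_def using orb_stab_fun_GLxGL[OF that, of x] by simp
  define dq where "dq g = {rco T (g \<star> q) | q. q \<in> QQ r}" for g
  have dq_eq: "dq g = dq g'" if g: "g \<in> carrier GLxGL" "g' \<in> carrier GLxGL" "C \<in> dq g" "C \<in> dq g'" for g g' C
  proof -
    have sub: "dq a \<subseteq> dq b" if ab: "a \<in> carrier GLxGL" "b \<in> carrier GLxGL" "C \<in> dq a" "C \<in> dq b" for a b
    proof
      fix D assume "D \<in> dq a"
      then obtain q where q: "q \<in> QQ r" "D = rco T (a \<star> q)" by (auto simp: dq_def)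
      obtain q1 where q1: "q1 \<in> QQ r" "C = rco T (a \<star> q1)" using ab(3) by (auto simp: dq_def)
      obtain q2 where q2: "q2 \<in> QQ r" "C = rco T (b \<star> q2)" using ab(4) by (auto simp: dq_def)
      have cc: "q \<in> carrier GLxGL" "q1 \<in> carrier GLxGL" "q2 \<in> carrier GLxGL" using q q1 q2 QG by auto
      let ?p = "ginv q1 \<star> q"
      have p: "?p \<in> QQ r" "?p \<in> carrier GLxGL" using q q1 Q cc by (auto simp: subgroup.m_closed subgroup.m_inv_closed)
      have "a \<star> q1 \<star> ?p = a \<star> (q1 \<star> ginv q1) \<star> q" using ab cc by (simp only: m_assoc m_closed inv_closed)
      then have "a \<star> q1 \<star> ?p = a \<star> q" using ab cc by simp
      then have "D = rco (rco T (a \<star> q1)) ?p"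
        unfolding q(2) using ab cc TG by (simp add: coset_mult_assoc)
      also have "\<dots> = rco T (b \<star> (q2 \<star> ?p))"
        unfolding q1(2) [symmetric] q2(2) using ab cc TG p(2) by (simp add: coset_mult_assoc m_assoc)
      finally have "D = rco T (b \<star> (q2 \<star> ?p))" .
      moreover have "q2 \<star> ?p \<in> QQ r" using subgroup.m_closed[OF Q q2(1) p(1)] .
      ultimately show "D \<in> dq b" unfolding dq_def by blast
    qed
    then show ?thesis using g by (intro equalityI) auto
  qed
  have dq_const: "f C = \<phi> (act (ginv g) x)" if g: "g \<in> carrier GLxGL" "C \<in> dq g" for g C
  proof -
    obtain q where q: "q \<in> QQ r" "C = rco T (g \<star> q)" using g(2) by (auto simp: dq_def)
    have qc: "q \<in> carrier GLxGL" using q QG by blast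
    have "f C = \<phi> (act (ginv q \<star> ginv g) x)" unfolding q(2) using f[of "g \<star> q"] g qc by (simp add: inv_mult_group)
    also have "act (ginv q \<star> ginv g) x = act (ginv q) (act (ginv g) x)" using qc g by (intro act_mult) auto
    finally show ?thesis using \<phi>[of "ginv q"] q(1) Q by (simp add: subgroup.m_inv_closed)
  qed
  have self: "rco T g \<in> dq g" if "g \<in> carrier GLxGL" for g
    unfolding dq_def using that subgroup.one_closed[OF Q] by (intro CollectI exI[of _ "\<one>\<^bsub>GLxGL\<^esub>"]) simp
  \<comment> \<open>A finite partition of a set containing the support. Q is normal in K, so right
    translation by K permutes the pieces.\<close>
  define \<E> where "\<E> = {dq (h \<star> k) | h k. h \<in> Hs \<and> k \<in> KK}"
  have \<E>D: "\<exists>g\<in>carrier GLxGL. E = dq g \<and> (\<exists>h\<in>Hs. \<exists>k\<in>KK. g = h \<star> k)" if "E \<in> \<E>" for E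
    using that Hs KK_carrier unfolding \<E>_def by blast
  obtain S :: "('a, 'n) mat2 set" where S: "finite S" "S \<subseteq> KK"
    "\<forall>k\<in>KK. \<exists>s\<in>S. ginv s \<star> k \<in> QQ r \<and> k \<star> ginv s \<in> QQ r"
    using KK_mod_QQ_finite[OF r, where ?'a = 'a and ?'n = 'n] by (elim exE conjE)
  have "\<E> \<subseteq> (\<lambda>(h, s). dq (h \<star> s)) ` (Hs \<times> S)"
  proof
    fix E assume "E \<in> \<E>"
    then obtain h k where hk: "h \<in> Hs" "k \<in> KK" "E = dq (h \<star> k)" unfolding \<E>_def by blast
    obtain s where s: "s \<in> S" "ginv s \<star> k \<in> QQ r" using S(3) hk(2) by blast
    have c: "h \<in> carrier GLxGL" "k \<in> carrier GLxGL" "s \<in> carrier GLxGL" using hk s Hs S KK_carrier by blast+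
    have "h \<star> s \<star> (ginv s \<star> k) = h \<star> (s \<star> ginv s) \<star> k" using c by (simp only: m_assoc m_closed inv_closed)
    then have "h \<star> k = h \<star> s \<star> (ginv s \<star> k)" using c by simp
    then have "rco T (h \<star> k) = rco T (h \<star> s \<star> (ginv s \<star> k))" by simp
    then have "rco T (h \<star> k) \<in> dq (h \<star> s)" unfolding dq_def using s(2) by blast
    moreover have "rco T (h \<star> k) \<in> dq (h \<star> k)" using self c by simp
    ultimately have "dq (h \<star> k) = dq (h \<star> s)" using dq_eq[of "h \<star> k" "h \<star> s"] c by simp
    then show "E \<in> (\<lambda>(h, s). dq (h \<star> s)) ` (Hs \<times> S)" using hk s by force
  qed
  then have fin\<E>: "finite \<E>" using Hs(1) S(1) finite_subset by blast
  have meas\<E>: "E \<in> sets \<mu>" if E: "E \<in> \<E>" for E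
  proof -
    obtain g where g: "g \<in> carrier GLxGL" "E = dq g" using \<E>D[OF E] by blast
    have "{rco T y | y. y \<in> (\<lambda>q. g \<star> q) ` QQ r} \<in> sets \<mu>"
    proof (rule measurable_right_invariant[OF T \<mu> _ r(1)])
      show "(\<lambda>q. g \<star> q) ` QQ r \<subseteq> carrier GLxGL" using g QG m_closed by blast
      fix y q :: "('a, 'n) mat2" assume y: "y \<in> (\<lambda>q. g \<star> q) ` QQ r" and q: "q \<in> QQ r"
      then obtain p where p: "p \<in> QQ r" "y = g \<star> p" by blast
      have "y \<star> q = g \<star> (p \<star> q)" unfolding p(2) using g QG[OF p(1)] QG[OF q] by (simp add: m_assoc)
      then show "y \<star> q \<in> (\<lambda>q. g \<star> q) ` QQ r" using p q subgroup.m_closed[OF Q] by blast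
    qed
    moreover have "{rco T y | y. y \<in> (\<lambda>q. g \<star> q) ` QQ r} = E" unfolding g(2) dq_def by blast
    ultimately show ?thesis by simp
  qed
  have dcfin: "emeasure \<mu> (dcoset T h) < \<infinity>" "dcoset T h \<in> sets \<mu>" if h: "h \<in> carrier GLxGL" for h
  proof -
    have "emeasure \<mu> (dcoset T h) = of_nat (card ((\<lambda>t. lco (t \<star> h) KK) ` (T \<inter> KK))) * emeasure \<mu> (dcoset T (mat 1, mat 1))"
      by (rule emeasure_dcoset(2)[OF T \<mu> h]) (rule TK[OF h])
    then show "emeasure \<mu> (dcoset T h) < \<infinity>"
      using emeasure_dcoset_one_finite[OF T \<mu>] by (simp add: ennreal_mult_less_top of_nat_less_top)
    show "dcoset T h \<in> sets \<mu>" by (rule emeasure_dcoset(1)[OF T \<mu> h]) (rule TK[OF h])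
  qed
  have fin_meas: "emeasure \<mu> E < \<infinity>" if E: "E \<in> \<E>" for E
  proof -
    obtain h k where hk: "h \<in> Hs" "k \<in> KK" "E = dq (h \<star> k)" using E unfolding \<E>_def by blast
    have c: "h \<in> carrier GLxGL" "k \<in> carrier GLxGL" using hk Hs KK_carrier by blast+
    have "E \<subseteq> dcoset T h"
    proof
      fix C assume "C \<in> E"
      then obtain q where q: "q \<in> QQ r" "C = rco T (h \<star> k \<star> q)" unfolding hk(3) dq_def by blast
      have "C = rco T (h \<star> (k \<star> q))" unfolding q(2) using c QG[OF q(1)] by (simp add: m_assoc)
      moreover have "k \<star> q \<in> KK" using hk q QK by blast
      ultimately show "C \<in> dcoset T h" unfolding dcoset_def by blast
    qed
    then have "emeasure \<mu> E \<le> emeasure \<mu> (dcoset T h)" using dcfin(2)[OF c(1)] by (rule emeasure_mono)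
    then show ?thesis using dcfin(1)[OF c(1)] by (rule le_less_trans)
  qed
  have disj: "E \<inter> E' = {}" if EE: "E \<in> \<E>" "E' \<in> \<E>" "E \<noteq> E'" for E E'
  proof (rule ccontr)
    assume "E \<inter> E' \<noteq> {}"
    then obtain C where C: "C \<in> E" "C \<in> E'" by blast
    obtain g g' where g: "g \<in> carrier GLxGL" "E = dq g" "g' \<in> carrier GLxGL" "E' = dq g'" using \<E>D EE by blast
    then show False using dq_eq C EE(3) by blast
  qed
  define c where "c E = f (SOME C. C \<in> E)" for E
  have const: "f C = c E" if E: "E \<in> \<E>" "C \<in> E" for E C
  proof -
    obtain g where g: "g \<in> carrier GLxGL" "E = dq g" using \<E>D[OF E(1)] by blast
    have "(SOME C. C \<in> E) \<in> E" using E(2) by (rule someI)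
    then show ?thesis unfolding c_def using dq_const g E(2) by metis
  qed
  have zero: "f C = 0" if C: "C \<in> space \<mu>" "C \<notin> \<Union>\<E>" for C
  proof (rule ccontr)
    assume nz: "f C \<noteq> 0"
    obtain h where h: "h \<in> carrier GLxGL" "C = rco T h" using C(1) unfolding space by (auto simp: RCOSETS_def)
    then have "\<phi> (act (ginv h) x) \<noteq> 0" using nz f by simp
    then obtain h' where h': "h' \<in> Hs" "C \<in> dcoset T h'" using supp h by blast
    then obtain k where k: "k \<in> KK" "C = rco T (h' \<star> k)" unfolding dcoset_def by blast
    have "h' \<star> k \<in> carrier GLxGL" using h' k Hs KK_carrier[OF k(1)] by blast
    then have "C \<in> dq (h' \<star> k)" unfolding k(2) by (rule self)
    then show False using C(2) h' k unfolding \<E>_def by blast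
  qed
  define I where "I = (\<Sum>E\<in>\<E>. measure \<mu> E *\<^sub>R c E)"
  have fI: "has_bochner_integral \<mu> f I"
    unfolding I_def by (rule has_bochner_integral_partition[OF fin\<E> disj meas\<E> fin_meas const zero])
  then have Orb: "Orb \<mu> \<phi> x = I" unfolding Orb_def f_def by (rule has_bochner_integral_integral_eq)
  have EG: "C \<subseteq> carrier GLxGL" if CE: "C \<in> E" "E \<in> \<E>" for C E
  proof -
    obtain g where g: "g \<in> carrier GLxGL" "E = dq g" using \<E>D[OF CE(2)] by blast
    then obtain q where q: "q \<in> QQ r" "C = rco T (g \<star> q)" using CE(1) unfolding dq_def by blast
    show ?thesis unfolding q(2) using g QG[OF q(1)] TG by (simp add: r_coset_subset_G)
  qed
  have move: "(\<lambda>C. rco C l) ` E \<in> \<E>" if E: "E \<in> \<E>" "l \<in> KK" for E l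
  proof -
    obtain h k where hk: "h \<in> Hs" "k \<in> KK" "E = dq (h \<star> k)" using E unfolding \<E>_def by blast
    have cc: "h \<in> carrier GLxGL" "k \<in> carrier GLxGL" "l \<in> carrier GLxGL" using hk Hs E(2) KK_carrier by blast+
    have sub: "(\<lambda>C. rco C l) ` dq g \<subseteq> dq (g \<star> l)" if gl: "g \<in> carrier GLxGL" "l \<in> KK" for g l
    proof
      have lc: "l \<in> carrier GLxGL" using gl KK_carrier by blast
      fix C assume "C \<in> (\<lambda>C. rco C l) ` dq g"
      then obtain q where q: "q \<in> QQ r" "C = rco (rco T (g \<star> q)) l" unfolding dq_def by blast
      have qc: "q \<in> carrier GLxGL" using q QG by blast
      have "g \<star> q \<star> l = g \<star> l \<star> (ginv l \<star> q \<star> l)"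
      proof -
        have "g \<star> l \<star> (ginv l \<star> q \<star> l) = g \<star> (l \<star> ginv l) \<star> q \<star> l" using gl lc qc by (simp only: m_assoc m_closed inv_closed)
        then show ?thesis using gl lc qc by simp
      qed
      then have "C = rco T (g \<star> l \<star> (ginv l \<star> q \<star> l))" unfolding q(2) using gl lc qc TG by (simp add: coset_mult_assoc)
      then show "C \<in> dq (g \<star> l)" unfolding dq_def using QQ_normal[OF gl(2) q(1)] by blast
    qed
    have "dq (h \<star> k \<star> l) \<subseteq> (\<lambda>C. rco C l) ` dq (h \<star> k)"
    proof
      fix C assume C: "C \<in> dq (h \<star> k \<star> l)"
      have "rco C (ginv l) \<in> dq (h \<star> k \<star> l \<star> ginv l)"
        using sub[of "h \<star> k \<star> l" "ginv l"] C m_closed[OF m_closed[OF cc(1,2)] cc(3)] K.m_inv_closed[OF E(2)] by blast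
      also have "h \<star> k \<star> l \<star> ginv l = h \<star> k" using cc by (simp add: m_assoc)
      finally have 1: "rco C (ginv l) \<in> dq (h \<star> k)" .
      have "C \<subseteq> carrier GLxGL"
      proof -
        obtain q where "q \<in> QQ r" "C = rco T (h \<star> k \<star> l \<star> q)" using C unfolding dq_def by blast
        then show ?thesis using cc QG TG by (simp add: r_coset_subset_G)
      qed
      then have "C = rco (rco C (ginv l)) l" using cc by (simp add: coset_mult_assoc coset_mult_one)
      then show "C \<in> (\<lambda>C. rco C l) ` dq (h \<star> k)" using 1 by blast
    qed
    then have "(\<lambda>C. rco C l) ` E = dq (h \<star> k \<star> l)" unfolding hk(3) using sub[OF m_closed[OF cc(1,2)] E(2)] by blast
    also have "h \<star> k \<star> l = h \<star> (k \<star> l)" using cc by (simp add: m_assoc)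
    finally show ?thesis unfolding \<E>_def using hk E(2) by blast
  qed
  \<comment> \<open>Translation invariance of the integral is obtained by reindexing the finite sum
    over the pieces.\<close>
  have trans: "has_bochner_integral \<mu> (\<lambda>C. f (rco C l)) I" if l: "l \<in> KK" for l
  proof -
    have lc: "l \<in> carrier GLxGL" using l KK_carrier by blast
    let ?m = "\<lambda>E. (\<lambda>C. rco C l) ` E"
    have cancel: "(\<lambda>C. rco C b) ` (\<lambda>C. rco C a) ` E = E" if "E \<in> \<E>" "a \<in> carrier GLxGL" "b \<in> carrier GLxGL" "a \<star> b = \<one>\<^bsub>GLxGL\<^esub>" for E a b
    proof -
      have "rco (rco C a) b = C" if "C \<in> E" for C
        using EG[OF that \<open>E \<in> \<E>\<close>] \<open>a \<star> b = _\<close> \<open>a \<in> _\<close> \<open>b \<in> _\<close> by (simp add: coset_mult_assoc coset_mult_one)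
      then show ?thesis by (simp add: image_image)
    qed
    have bij: "bij_betw ?m \<E> \<E>"
    proof (rule bij_betw_byWitness[where f' = "\<lambda>E. (\<lambda>C. rco C (ginv l)) ` E"])
      show "\<forall>E\<in>\<E>. (\<lambda>C. rco C (ginv l)) ` ?m E = E" using cancel lc by simp
      show "\<forall>E\<in>\<E>. ?m ((\<lambda>C. rco C (ginv l)) ` E) = E" using cancel lc by simp
    qed (use move l K.m_inv_closed in blast)+
    have "has_bochner_integral \<mu> (\<lambda>C. f (rco C l)) (\<Sum>E\<in>\<E>. measure \<mu> E *\<^sub>R c (?m E))"
    proof (rule has_bochner_integral_partition[OF fin\<E> disj meas\<E> fin_meas])
      show "f (rco C l) = c (?m E)" if "E \<in> \<E>" "C \<in> E" for E C
        by (rule const[OF move[OF that(1) l]]) (use that(2) in blast)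
      show "f (rco C l) = 0" if C: "C \<in> space \<mu>" "C \<notin> \<Union>\<E>" for C
      proof (rule zero)
        obtain h where h: "h \<in> carrier GLxGL" "C = rco T h" using C(1) unfolding space by (auto simp: RCOSETS_def)
        then have eq: "rco C l = rco T (h \<star> l)" using lc TG by (simp add: coset_mult_assoc)
        then show "rco C l \<in> space \<mu>" unfolding space using h lc TG by (auto intro: rcosetsI)
        show "rco C l \<notin> \<Union>\<E>"
        proof
          assume "rco C l \<in> \<Union>\<E>"
          then obtain E where E: "E \<in> \<E>" "rco C l \<in> E" by blast
          have "rco (rco C l) (ginv l) \<in> (\<lambda>C. rco C (ginv l)) ` E" using E(2) by blast
          moreover have "rco (rco C l) (ginv l) = C"
            unfolding eq h(2) using h lc TG by (simp add: coset_mult_assoc m_assoc)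
          ultimately show False using C(2) move[OF E(1), of "ginv l"] l by auto
        qed
      qed
    qed
    moreover have "(\<Sum>E\<in>\<E>. measure \<mu> E *\<^sub>R c (?m E)) = (\<Sum>E\<in>\<E>. measure \<mu> (?m E) *\<^sub>R c (?m E))"
      using inv[OF lc meas\<E>] by (intro sum.cong) (simp_all add: measure_def)
    moreover have "\<dots> = I" unfolding I_def
      by (rule sum.reindex_bij_betw[OF bij, of "\<lambda>E. measure \<mu> E *\<^sub>R c E"])
    ultimately show ?thesis by simp
  qed
  define F where "F C = (\<Sum>s\<in>R. f (rco C (ginv s)))" for C
  have "has_bochner_integral \<mu> F (\<Sum>s\<in>R. I)"
    unfolding F_def using R(2) by (intro has_bochner_integral_sum trans) auto
  then have 1: "has_bochner_integral \<mu> F (of_nat (card R) * I)" by simp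
  have F: "F (rco T h) = (\<Sum>s\<in>R. \<phi> (act s (act (ginv h) x)))" if h: "h \<in> carrier GLxGL" for h
    unfolding F_def
  proof (rule sum.cong)
    fix s assume "s \<in> R"
    then have sc: "s \<in> carrier GLxGL" using R(2) KK_carrier by blast
    have "f (rco (rco T h) (ginv s)) = \<phi> (act (ginv (h \<star> ginv s)) x)"
      using f[of "h \<star> ginv s"] h sc TG by (simp add: coset_mult_assoc)
    also have "ginv (h \<star> ginv s) = s \<star> ginv h" using h sc by (simp add: inv_mult_group)
    also have "act (s \<star> ginv h) x = act s (act (ginv h) x)" using h sc by (intro act_mult) auto
    finally show "f (rco (rco T h) (ginv s)) = \<phi> (act s (act (ginv h) x))" .
  qed simp
  have "has_bochner_integral \<mu> F (\<Sum>D\<in>dcoset T ` Hs. measure \<mu> D *\<^sub>R (\<Sum>s\<in>R. \<phi> (act s (act (ginv (dcoset_rep T D)) x))))"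
  proof (rule has_bochner_integral_partition)
    show "finite (dcoset T ` Hs)" using Hs by simp
    show "D \<in> sets \<mu>" "emeasure \<mu> D < \<infinity>" if "D \<in> dcoset T ` Hs" for D using that dcfin Hs(2) by blast+
    show "D \<inter> D' = {}" if DD: "D \<in> dcoset T ` Hs" "D' \<in> dcoset T ` Hs" "D \<noteq> D'" for D D'
    proof (rule ccontr)
      assume "D \<inter> D' \<noteq> {}"
      then obtain C where C: "C \<in> D" "C \<in> D'" by blast
      obtain h h' where h: "h \<in> carrier GLxGL" "D = dcoset T h" "h' \<in> carrier GLxGL" "D' = dcoset T h'" using DD Hs by blast
      obtain k where k: "k \<in> KK" "C = rco T (h \<star> k)" using C h unfolding dcoset_def by blast
      have hk: "h \<star> k \<in> carrier GLxGL" using h KK_carrier[OF k(1)] by simp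
      have "dcoset T (h \<star> k) = D" "dcoset T (h \<star> k) = D'"
        using dcoset_eqI[OF T h(1) hk] dcoset_eqI[OF T h(3) hk] C unfolding k(2) h(2,4) by blast+
      then show False using DD(3) by simp
    qed
    show "F C = (\<Sum>s\<in>R. \<phi> (act s (act (ginv (dcoset_rep T D)) x)))" if D: "D \<in> dcoset T ` Hs" "C \<in> D" for D C
    proof -
      obtain h where h: "h \<in> carrier GLxGL" "D = dcoset T h" using D(1) Hs by blast
      let ?g = "dcoset_rep T D"
      have g: "?g \<in> carrier GLxGL" "dcoset T ?g = D" using dcoset_rep[OF h(1), of T] h(2) by auto
      obtain k where k: "k \<in> KK" "C = rco T (?g \<star> k)" using D(2) g(2) unfolding dcoset_def by blast
      have kc: "k \<in> carrier GLxGL" using k KK_carrier by blast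
      have "F C = (\<Sum>s\<in>R. \<phi> (act s (act (ginv k \<star> ginv ?g) x)))"
        unfolding k(2) using F[of "?g \<star> k"] g kc by (simp add: inv_mult_group)
      also have "act (ginv k \<star> ginv ?g) x = act (ginv k) (act (ginv ?g) x)" using g kc by (intro act_mult) auto
      also have "(\<Sum>s\<in>R. \<phi> (act s (act (ginv k) (act (ginv ?g) x)))) = (\<Sum>s\<in>R. \<phi> (act s (act (ginv ?g) x)))"
        using k by (intro R(3)) simp
      finally show ?thesis .
    qed
    show "F C = 0" if C: "C \<in> space \<mu>" "C \<notin> \<Union>(dcoset T ` Hs)" for C
    proof (rule ccontr)
      assume nz: "F C \<noteq> 0"
      obtain h where h: "h \<in> carrier GLxGL" "C = rco T h" using C(1) unfolding space by (auto simp: RCOSETS_def)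
      obtain s where s: "s \<in> R" "f (rco C (ginv s)) \<noteq> 0" using nz unfolding F_def by (meson sum.neutral)
      have sc: "s \<in> carrier GLxGL" and sK: "s \<in> KK" using s R(2) KK_carrier by blast+
      have hs: "h \<star> ginv s \<in> carrier GLxGL" using h sc by simp
      have "rco C (ginv s) = rco T (h \<star> ginv s)" using h sc TG by (simp add: coset_mult_assoc)
      then have "\<phi> (act (ginv (h \<star> ginv s)) x) \<noteq> 0" using s(2) f[OF hs] by simp
      then obtain h' where h': "h' \<in> Hs" "rco T (h \<star> ginv s) \<in> dcoset T h'" using supp[OF hs] by blast
      then obtain k where k: "k \<in> KK" "rco T (h \<star> ginv s) = rco T (h' \<star> k)" unfolding dcoset_def by blast
      have h'c: "h' \<in> carrier GLxGL" and kc: "k \<in> carrier GLxGL" using h' Hs k KK_carrier by blast+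
      have "C = rco (rco T (h \<star> ginv s)) s" unfolding h(2) using h sc TG by (simp add: coset_mult_assoc m_assoc)
      also have "\<dots> = rco T (h' \<star> (k \<star> s))" unfolding k(2) using h'c kc sc TG by (simp add: coset_mult_assoc m_assoc)
      finally have "C \<in> dcoset T h'" unfolding dcoset_def using k sK by blast
      then show False using C(2) h' by blast
    qed
  qed
  then show ?thesis unfolding Orb using 1 has_bochner_integral_eq by blast
qed

section \<open>Weights of double cosets\<close>

text \<open>\<open>PZ v\<close> is the power \<open>\<Pi>\<^sup>v\<close> with \<open>v \<in> \<int>\<close>, written with an exponent of \<open>\<Pi>\<close> below \<open>n\<close> by means of \<open>\<Pi>\<^sup>n = w\<close>.\<close>

definition PZ :: "int \<Rightarrow> 'a::nonarch_local_field_0^'n^'n" where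
  "PZ v = meval Pi_mat (monom (uniformizer powi (v div int CARD('n))) (nat (v mod int CARD('n))))"

lemma meval_monom_eq_PZ:
  "meval (Pi_mat :: 'a::nonarch_local_field_0^'n^'n) (monom (uniformizer powi m) k) = PZ (int CARD('n) * m + int k)"
proof -
  let ?n = "CARD('n)" and ?w = "uniformizer :: 'a" and ?M = "Pi_mat :: 'a^'n^'n"
  define q j where "q = k div ?n" and "j = k mod ?n"
  have k: "k = ?n * q + j" by (simp add: q_def j_def)
  have j: "j < ?n" by (simp add: j_def)
  have "int ?n * m + int k = int ?n * (m + int q) + int j" by (simp add: k algebra_simps)
  then have dm: "(int ?n * m + int k) div int ?n = m + int q" "nat ((int ?n * m + int k) mod int ?n) = j"
    using j by simp_all
  have "monom (?w powi m) k = monom 1 (?n * q) * monom (?w powi m) j" by (simp add: k mult_monom)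
  then have "meval ?M (monom (?w powi m) k) = mat (?w ^ q) ** meval ?M (monom (?w powi m) j)"
    by (simp only: meval_mult cyc_power_CARD_mult)
  also have "\<dots> = meval ?M (smult (?w ^ q) (monom (?w powi m) j))" by (rule meval_smult [symmetric])
  also have "smult (?w ^ q) (monom (?w powi m) j) = monom (?w powi (m + int q)) j"
    by (simp add: smult_monom power_int_add mult.commute)
  finally show ?thesis unfolding PZ_def dm .
qed

lemma PZ_add: "PZ (u + v) = PZ u ** (PZ v :: 'a::nonarch_local_field_0^'n^'n)"
proof -
  let ?n = "int CARD('n)" and ?w = "uniformizer :: 'a"
  have "PZ u ** PZ v = meval (Pi_mat :: 'a^'n^'n) (monom (?w powi (u div ?n + v div ?n)) (nat (u mod ?n) + nat (v mod ?n)))"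
    unfolding PZ_def meval_mult [symmetric] mult_monom by (simp add: power_int_add)
  also have "\<dots> = PZ (?n * (u div ?n + v div ?n) + int (nat (u mod ?n) + nat (v mod ?n)))"
    by (rule meval_monom_eq_PZ)
  also have "?n * (u div ?n + v div ?n) + int (nat (u mod ?n) + nat (v mod ?n)) = u + v"
    by (simp add: distrib_left)
  finally show ?thesis by simp
qed

lemma PZ_0: "PZ 0 = (mat 1 :: 'a::nonarch_local_field_0^'n^'n)"
  by (simp add: PZ_def monom_0)

lemma PZ_inverse: "PZ v ** PZ (- v) = (mat 1 :: 'a::nonarch_local_field_0^'n^'n)"
  using PZ_add[of v "- v", where ?'n = 'n and ?'a = 'a] by (simp add: PZ_0)

lemma invertible_PZ: "invertible (PZ v :: 'a::nonarch_local_field_0^'n^'n)" and matrix_inv_PZ: "matrix_inv (PZ v) = (PZ (- v) :: 'a::nonarch_local_field_0^'n^'n)"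
  using matrix_inv_unique_right[OF PZ_inverse[of v, where ?'n = 'n and ?'a = 'a]] by auto

lemma PZ_commute: "PZ v ** Pi_mat = Pi_mat ** (PZ v :: 'a::nonarch_local_field_0^'n^'n)"
  unfolding PZ_def by (rule meval_commute_base)

lemma PZ_nat: "PZ (int k) = meval (Pi_mat :: 'a::nonarch_local_field_0^'n^'n) (monom 1 k)"
  using meval_monom_eq_PZ[of 0 k, where ?'n = 'n and ?'a = 'a] by simp

lemma PZ_1: "PZ 1 = (Pi_mat :: 'a::nonarch_local_field_0^'n^'n)"
  using PZ_nat[of 1, where ?'n = 'n and ?'a = 'a] by (simp add: monom_altdef)

lemma PZ_CARD: "PZ (int CARD('n) * m) = (mat (uniformizer powi m) :: 'a::nonarch_local_field_0^'n^'n)"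
  using meval_monom_eq_PZ[of m 0, where ?'n = 'n and ?'a = 'a] by (simp add: monom_0)

lemma val_powi: "val ((uniformizer :: 'a::nonarch_local_field_0) powi m) = m"
  by (rule val_unique) (simp_all add: power_int_def absval_power absval_inverse)

lemma val_det_PZ: "val (det (PZ v :: 'a::nonarch_local_field_0^'n^'n)) = v"
proof -
  have "val (det (PZ v :: 'a^'n^'n)) = int CARD('n) * (v div int CARD('n)) + int (nat (v mod int CARD('n)))"
    unfolding PZ_def by (subst det_Pi_monom) (simp_all add: val_powi)
  then show ?thesis by simp
qed

lemma bnd_PZ:
  assumes "int CARD('n) * q \<le> v"
  shows "bnd (absval (uniformizer :: 'a::nonarch_local_field_0) powi q) (PZ v :: 'a^'n^'n)"
proof -
  let ?w = "uniformizer :: 'a" and ?j = "v - int CARD('n) * q"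
  have "PZ v = (PZ (int CARD('n) * q) :: 'a^'n^'n) ** PZ ?j" using PZ_add[of "int CARD('n) * q" ?j, where ?'n = 'n and ?'a = 'a] by simp
  moreover have "bnd 1 (PZ ?j :: 'a^'n^'n)"
    using PZ_nat[of "nat ?j", where ?'n = 'n and ?'a = 'a] assms by (simp add: bnd_meval int_poly_def)
  moreover have "bnd (absval ?w powi q) (mat (?w powi q) :: 'a^'n^'n)"
    by (rule bnd_mat) (simp add: power_int_def absval_power absval_inverse)
  ultimately show ?thesis unfolding PZ_CARD using bnd_mult'[of "absval ?w powi q" _ 1] by fastforce
qed

lemma normalize_lattice_PZ:
  fixes h :: "'a::nonarch_local_field_0^'n^'n"
  assumes "invertible h" "\<And>k. k < CARD('n) \<Longrightarrow> bnd r (matrix_inv h ** PZ (int k) ** h)"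
  shows "\<exists>v. bnd 1 (PZ v ** h) \<and> bnd r (matrix_inv (PZ v ** h))"
  using normalize_lattice[OF assms(1), of r] assms(2) unfolding PZ_nat meval_monom_eq_PZ by blast

definition TT :: "('a::nonarch_local_field_0, 'n::finite) mat2 set" where
  "TT = {(e, e) | e. invertible e \<and> e ** Pi_mat = Pi_mat ** e}"

text \<open>The product of the centralizers of Pi in both factors: a commutative group containing
  both \<open>TT\<close> and the shifts (1, Pi^j), so these shifts preserve weights.\<close>

definition ZZ :: "('a::nonarch_local_field_0, 'n::finite) mat2 set" where
  "ZZ = {z. invertible (fst z) \<and> invertible (snd z) \<and> fst z ** Pi_mat = Pi_mat ** fst z \<and> snd z ** Pi_mat = Pi_mat ** snd z}"

definition ell :: "nat \<Rightarrow> ('a::nonarch_local_field_0, 'n::finite) mat2" where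
  "ell k = (mat (uniformizer ^ k) ** Pi_mat, mat 1)"

lemma stabilizer_ell: "stabilizer GLxGL act (ell k) = TT"
  unfolding ell_def TT_def by (rule stabilizer_cyc) simp

lemma TT_ZZ: "TT \<subseteq> ZZ"
  by (auto simp: TT_def ZZ_def)

lemma ZZ_carrier: "z \<in> ZZ \<Longrightarrow> z \<in> carrier GLxGL"
  by (simp add: ZZ_def carrier_GLxGL)

lemma commutant_commutes:
  assumes "a ** cyc c = cyc c ** a" "b ** cyc c = cyc c ** (b :: 'k::field^'n^'n)"
  shows "a ** b = b ** a"
  using commute_meval[OF assms(1)] commutant_cyc[OF assms(2)] by metis

lemma ZZ_commute: "z \<in> ZZ \<Longrightarrow> z' \<in> ZZ \<Longrightarrow> z \<star> z' = z' \<star> z"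
  unfolding ZZ_def mult_GLxGL using commutant_commutes[of "fst z" uniformizer "fst z'"] commutant_commutes[of "snd z" uniformizer "snd z'"] by simp

lemma inverse_commutes:
  assumes "invertible e" "e ** A = A ** (e :: 'k::field^'n^'n)"
  shows "matrix_inv e ** A = A ** matrix_inv e"
proof -
  have "matrix_inv e ** (e ** A) ** matrix_inv e = matrix_inv e ** (A ** e) ** matrix_inv e" using assms(2) by simp
  then have "(matrix_inv e ** e) ** A ** matrix_inv e = matrix_inv e ** A ** (e ** matrix_inv e)"
    by (simp only: matrix_mul_assoc)
  then show ?thesis using assms(1) by (simp add: matrix_inv_props)
qed

lemma product_commutes:
  assumes "a ** A = A ** a" "b ** A = A ** (b :: 'k::field^'n^'n)"
  shows "(a ** b) ** A = A ** (a ** b)"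
proof -
  have "(a ** b) ** A = a ** (b ** A)" by (simp add: matrix_mul_assoc)
  also have "\<dots> = (a ** A) ** b" unfolding assms(2) by (simp add: matrix_mul_assoc)
  finally show ?thesis unfolding assms(1) by (simp add: matrix_mul_assoc)
qed

lemma subgroup_ZZ: "subgroup ZZ (GLxGL :: ('a::nonarch_local_field_0, 'n::finite) mat2 monoid)"
proof -
  interpret group "GLxGL :: ('a, 'n) mat2 monoid" by (rule group_GLxGL)
  show ?thesis
  proof (rule subgroupI)
    show "ZZ \<subseteq> carrier (GLxGL :: ('a, 'n) mat2 monoid)" using ZZ_carrier by blast
    have "(mat 1, mat 1) \<in> (ZZ :: ('a, 'n) mat2 set)" by (simp add: ZZ_def invertible_mat)
    then show "(ZZ :: ('a, 'n) mat2 set) \<noteq> {}" by blast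
    fix a :: "('a, 'n) mat2" assume a: "a \<in> ZZ"
    then show "ginv a \<in> ZZ"
      by (simp add: inv_GLxGL[OF ZZ_carrier]) (simp add: ZZ_def matrix_inv_props inverse_commutes)
    fix b :: "('a, 'n) mat2" assume b: "b \<in> ZZ"
    show "a \<star> b \<in> ZZ" using a b unfolding ZZ_def mult_GLxGL
      by (auto simp: invertible_mult intro!: product_commutes)
  qed
qed

lemma subgroup_TT: "subgroup TT (GLxGL :: ('a::nonarch_local_field_0, 'n::finite) mat2 monoid)"
proof -
  interpret group "GLxGL :: ('a, 'n) mat2 monoid" by (rule group_GLxGL)
  have T: "t \<in> TT \<longleftrightarrow> t \<in> ZZ \<and> fst t = snd t" for t :: "('a, 'n) mat2" by (cases t) (auto simp: TT_def ZZ_def)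
  show ?thesis
  proof (rule subgroupI)
    show "TT \<subseteq> carrier (GLxGL :: ('a, 'n) mat2 monoid)" using T ZZ_carrier by blast
    have "(mat 1, mat 1) \<in> (TT :: ('a, 'n) mat2 set)" by (simp add: TT_def invertible_mat)
    then show "(TT :: ('a, 'n) mat2 set) \<noteq> {}" by blast
    fix a :: "('a, 'n) mat2" assume a: "a \<in> TT"
    then have az: "a \<in> ZZ" "fst a = snd a" using T by auto
    show "ginv a \<in> TT" using az subgroup.m_inv_closed[OF subgroup_ZZ az(1)] unfolding T
      by (simp add: inv_GLxGL[OF ZZ_carrier])
    fix b :: "('a, 'n) mat2" assume b: "b \<in> TT"
    show "a \<star> b \<in> TT" using az b subgroup.m_closed[OF subgroup_ZZ az(1), of b] unfolding T
      by (simp add: mult_GLxGL)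
  qed
qed

text \<open>Conjugation does not change the determinant, and an element of F[Pi] with unit
  determinant is integral.\<close>

lemma TT_conj_KK:
  fixes h t :: "('a::nonarch_local_field_0, 'n::finite) mat2"
  assumes h: "h \<in> carrier GLxGL" and t: "t \<in> TT" and k: "ginv h \<star> t \<star> h \<in> KK"
  shows "t \<in> KK"
proof -
  obtain e where e: "t = (e, e)" "invertible e" "e ** Pi_mat = Pi_mat ** e" using t by (auto simp: TT_def)
  have hi: "invertible (fst h)" using h by (simp add: carrier_GLxGL)
  have "matrix_inv (fst h) ** e ** fst h \<in> GLO" using k by (simp add: inv_GLxGL[OF h] mult_GLxGL KK_def e(1))
  then have "absval (det (matrix_inv (fst h) ** e ** fst h)) = 1" by (rule GLO_det)
  moreover have "det (matrix_inv (fst h)) * det (fst h) = 1"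
    using hi by (simp add: det_mul [symmetric] matrix_inv_props)
  then have "absval (det (matrix_inv (fst h))) * absval (det (fst h)) = 1" by (metis absval_1 absval_mult)
  ultimately have "absval (det e) = 1" by (simp add: det_mul absval_mult mult_ac)
  then have "e \<in> GLO" using e by (intro commuting_unit_det_GLO)
  then show ?thesis by (simp add: e(1) KK_def)
qed

definition wt :: "('a::nonarch_local_field_0, 'n::finite) mat2 \<Rightarrow> nat" where
  "wt h = card ((\<lambda>t. lco (t \<star> h) KK) ` (TT \<inter> KK))"

text \<open>The element s^-1 s' commutes with z, and conjugation by k preserves K.\<close>

lemma coset_eq_ZZ:
  fixes h :: "('a::nonarch_local_field_0, 'n::finite) mat2"
  assumes h: "h \<in> carrier GLxGL" and z: "z \<in> ZZ" and k: "k \<in> KK" and s: "s \<in> TT" "s' \<in> TT"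
  shows "lco (s \<star> (z \<star> h \<star> k)) KK = lco (s' \<star> (z \<star> h \<star> k)) KK \<longleftrightarrow> ginv h \<star> (ginv s \<star> s') \<star> h \<in> KK"
proof -
  interpret group "GLxGL :: ('a, 'n) mat2 monoid" by (rule group_GLxGL)
  interpret K: subgroup KK "GLxGL :: ('a, 'n) mat2 monoid" by (rule subgroup_KK)
  have c: "z \<in> carrier GLxGL" "k \<in> carrier GLxGL" "s \<in> carrier GLxGL" "s' \<in> carrier GLxGL"
    using z k s TT_ZZ ZZ_carrier KK_carrier by blast+
  let ?u = "ginv s \<star> s'"
  have uZ: "?u \<in> ZZ" using s TT_ZZ subgroup.m_closed[OF subgroup_ZZ] subgroup.m_inv_closed[OF subgroup_ZZ] by blast
  have uc: "?u \<in> carrier GLxGL" using c by simp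
  have "ginv (s \<star> (z \<star> h \<star> k)) \<star> (s' \<star> (z \<star> h \<star> k)) = ginv k \<star> (ginv h \<star> (ginv z \<star> (?u \<star> z)) \<star> h) \<star> k"
    using c h by (simp add: inv_mult_group m_assoc)
  also have "?u \<star> z = z \<star> ?u" using uZ z by (rule ZZ_commute)
  also have "ginv z \<star> (z \<star> ?u) = ?u"
  proof -
    have "ginv z \<star> (z \<star> ?u) = (ginv z \<star> z) \<star> ?u" using c uc by (simp only: m_assoc inv_closed)
    then show ?thesis using c uc by simp
  qed
  finally have eq: "ginv (s \<star> (z \<star> h \<star> k)) \<star> (s' \<star> (z \<star> h \<star> k)) = ginv k \<star> (ginv h \<star> ?u \<star> h) \<star> k" .
  let ?m = "ginv h \<star> ?u \<star> h"
  have mc: "?m \<in> carrier GLxGL" using h uc by simp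
  have "ginv k \<star> ?m \<star> k \<in> KK \<longleftrightarrow> ?m \<in> KK"
  proof
    assume m: "ginv k \<star> ?m \<star> k \<in> KK"
    have "k \<star> (ginv k \<star> ?m \<star> k) \<star> ginv k = (k \<star> ginv k) \<star> ?m \<star> (k \<star> ginv k)"
      using c mc by (simp only: m_assoc inv_closed m_closed)
    then have "?m = k \<star> (ginv k \<star> ?m \<star> k) \<star> ginv k" using c mc by simp
    also have "\<dots> \<in> KK" using m k K.m_closed K.m_inv_closed by blast
    finally show "?m \<in> KK" .
  qed (use k K.m_closed K.m_inv_closed in blast)
  then show ?thesis using c h eq by (subst lcoset_eq_iff[OF subgroup_KK]) auto
qed

lemma wt_ZZ:
  fixes h :: "('a::nonarch_local_field_0, 'n::finite) mat2"
  assumes h: "h \<in> carrier GLxGL" and z: "z \<in> ZZ" and k: "k \<in> KK"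
  shows "wt (z \<star> h \<star> k) = wt h"
proof -
  interpret group "GLxGL :: ('a, 'n) mat2 monoid" by (rule group_GLxGL)
  have one: "\<one>\<^bsub>GLxGL\<^esub> \<in> (ZZ :: ('a, 'n) mat2 set)" "\<one>\<^bsub>GLxGL\<^esub> \<in> (KK :: ('a, 'n) mat2 set)"
    using subgroup.one_closed[OF subgroup_ZZ] subgroup.one_closed[OF subgroup_KK] by blast+
  have h1: "\<one>\<^bsub>GLxGL\<^esub> \<star> h \<star> \<one>\<^bsub>GLxGL\<^esub> = h" using h by simp
  show ?thesis unfolding wt_def
  proof (rule card_image_cong_iff)
    fix s s' :: "('a, 'n) mat2" assume s: "s \<in> TT \<inter> KK" "s' \<in> TT \<inter> KK"
    show "(lco (s \<star> (z \<star> h \<star> k)) KK = lco (s' \<star> (z \<star> h \<star> k)) KK) = (lco (s \<star> h) KK = lco (s' \<star> h) KK)"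
      using coset_eq_ZZ[OF h z k, of s s'] coset_eq_ZZ[OF h one, of s s'] s unfolding h1 by blast
  qed
qed

lemma finite_wt:
  fixes h :: "('a::nonarch_local_field_0, 'n::finite) mat2"
  assumes "h \<in> carrier GLxGL"
  shows "finite ((\<lambda>t. lco (t \<star> h) KK) ` (TT \<inter> KK))"
  by (rule finite_subset[OF _ finite_KK_orbit[OF assms]]) blast

lemma wt_one: "wt (mat 1, mat 1 :: 'a::nonarch_local_field_0^'n^'n) = 1"
proof -
  interpret group "GLxGL :: ('a, 'n) mat2 monoid" by (rule group_GLxGL)
  have "(\<lambda>t. lco (t \<star> (mat 1, mat 1)) KK) ` (TT \<inter> KK) = {lco \<one>\<^bsub>GLxGL\<^esub> (KK :: ('a, 'n) mat2 set)}"
  proof -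
    have "lco (t \<star> (mat 1, mat 1)) KK = lco \<one>\<^bsub>GLxGL\<^esub> KK" if "t \<in> TT \<inter> KK" for t :: "('a, 'n) mat2"
    proof -
      have tc: "t \<in> carrier GLxGL" and tK: "t \<in> KK" using that KK_carrier by blast+
      have "t \<star> (mat 1, mat 1) = t" by (simp add: mult_GLxGL)
      moreover have "lco \<one>\<^bsub>GLxGL\<^esub> KK = lco t KK" using tc tK by (subst lcoset_eq_iff[OF subgroup_KK]) auto
      ultimately show ?thesis by simp
    qed
    moreover have "\<one>\<^bsub>GLxGL\<^esub> \<in> (TT \<inter> KK :: ('a, 'n) mat2 set)"
      using subgroup.one_closed[OF subgroup_TT] subgroup.one_closed[OF subgroup_KK] by blast
    ultimately show ?thesis by blast
  qed
  then show ?thesis unfolding wt_def by simp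
qed

text \<open>A converse to \<open>meval_GLO\<close>. With a non-unit constant coefficient the matrix
  would be Pi times an integral matrix, and its determinant would not be a unit.\<close>

lemma commuting_GLO_poly:
  fixes e :: "'a::nonarch_local_field_0^'n^'n"
  assumes e: "e \<in> GLO" "e ** Pi_mat = Pi_mat ** e"
  shows "\<exists>f. e = meval Pi_mat f \<and> int_poly f \<and> absval (coeff f 0) = 1"
proof -
  let ?M = "Pi_mat :: 'a^'n^'n" and ?w = "uniformizer :: 'a" and ?n = "CARD('n)"
  define f where "f = col_poly (e *v axis (ix 0) 1)"
  have ef: "e = meval ?M f" unfolding f_def by (rule commutant_cyc[OF e(2)])
  have int: "int_poly f" using e(1) by (simp add: f_def int_poly_def coeff_col_poly mult_axis GLO_def bnd_def)
  have "\<not> absval (coeff f 0) < 1"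
  proof
    assume "absval (coeff f 0) < 1"
    then have le: "absval (coeff f 0) \<le> absval ?w" by (rule absval_le_uniformizer)
    obtain a g where ag: "f = pCons a g" by (cases f)
    define b where "b = a / ?w"
    have b: "absval b \<le> 1" "a = b * ?w" using le by (simp_all add: b_def ag absval_divide divide_le_eq_1)
    have "meval ?M (monom b ?n) = mat a" by (subst meval_monom) (simp add: cyc_power_CARD mat_mult_mat b(2))
    then have "e = meval ?M (monom b ?n + [:0, 1:] * g)" unfolding ef ag by (simp add: meval_add)
    also have "monom b ?n = [:0, 1:] * monom b (?n - 1)"
      by (simp add: monom_Suc [symmetric])
    finally have "e = ?M ** meval ?M (monom b (?n - 1) + g)"
      by (simp only: distrib_left [symmetric] meval_mult meval_X)
    moreover have "bnd 1 (meval ?M (monom b (?n - 1) + g))"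
    proof (intro bnd_meval int_poly_add)
      show "int_poly (monom b (?n - 1))" using b(1) by (simp add: int_poly_def)
      have "coeff g k = coeff f (Suc k)" for k by (simp add: ag)
      then show "int_poly g" using int by (simp add: int_poly_def)
    qed
    ultimately have "absval (det e) \<le> absval (det ?M)"
      using absval_det_le[of "meval ?M (monom b (?n - 1) + g)"] by (simp add: det_mul absval_mult mult_left_le)
    moreover have "det ?M \<noteq> 0" "val (det ?M) = 1"
      using val_det_PZ[of 1, where ?'n = 'n and ?'a = 'a] invertible_PZ[of 1, where ?'n = 'n and ?'a = 'a]
      by (simp_all add: PZ_1 invertible_det_nz)
    then have "absval (det ?M) = absval ?w" using absval_eq_val[of "det ?M"] by simp
    ultimately show False using GLO_det[OF e(1)] absval_uniformizer_less_1[where 'a = 'a] by simp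
  qed
  moreover have "absval (coeff f 0) \<le> 1" using int by (simp add: int_poly_def)
  ultimately show ?thesis using ef int by (intro exI[of _ f]) auto
qed

text \<open>The weight is the index in T \<inter> K of the subgroup N of elements that h conjugates
  into K. Suitable p-power powers are scalar units times elements near 1, and both kinds of factors
  are conjugated into K.\<close>

lemma wt_prime_power:
  fixes h :: "('a::nonarch_local_field_0, 'n::finite) mat2"
  assumes h: "h \<in> carrier GLxGL" and p: "prime p" "absval (of_nat p :: 'a) < 1"
  shows "\<exists>k. wt h = p ^ k"
proof -
  interpret group "GLxGL :: ('a, 'n) mat2 monoid" by (rule group_GLxGL)
  interpret K: subgroup KK "GLxGL :: ('a, 'n) mat2 monoid" by (rule subgroup_KK)
  let ?C = "TT \<inter> KK :: ('a, 'n) mat2 set"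
  define N where "N = {t \<in> ?C. ginv h \<star> t \<star> h \<in> KK}"
  have C: "subgroup ?C GLxGL" using subgroup_TT subgroup_KK by (rule subgroups_Inter_pair)
  have Cc: "t \<in> carrier GLxGL" if "t \<in> ?C" for t using that KK_carrier by blast
  have one: "\<one>\<^bsub>GLxGL\<^esub> \<in> (ZZ :: ('a, 'n) mat2 set)" "\<one>\<^bsub>GLxGL\<^esub> \<in> (KK :: ('a, 'n) mat2 set)"
    using subgroup.one_closed[OF subgroup_ZZ] subgroup.one_closed[OF subgroup_KK] by blast+
  have N: "subgroup N GLxGL"
  proof (rule subgroupI)
    show "N \<subseteq> carrier GLxGL" unfolding N_def using Cc by blast
    have "\<one>\<^bsub>GLxGL\<^esub> \<in> N" unfolding N_def using subgroup.one_closed[OF C] one h by simp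
    then show "N \<noteq> {}" by blast
    fix a assume a: "a \<in> N"
    then have ac: "a \<in> carrier GLxGL" unfolding N_def using Cc by blast
    have "ginv h \<star> ginv a \<star> h = ginv (ginv h \<star> a \<star> h)" using ac h by (simp add: inv_mult_group m_assoc)
    then show "ginv a \<in> N" using a subgroup.m_inv_closed[OF C] K.m_inv_closed unfolding N_def by simp
    fix b assume b: "b \<in> N"
    then have bc: "b \<in> carrier GLxGL" unfolding N_def using Cc by blast
    have "(ginv h \<star> a \<star> h) \<star> (ginv h \<star> b \<star> h) = ginv h \<star> a \<star> (h \<star> ginv h) \<star> b \<star> h"
      using ac bc h by (simp only: m_assoc inv_closed m_closed)
    also have "\<dots> = ginv h \<star> (a \<star> b) \<star> h" using ac bc h by (simp add: m_assoc)
    finally show "a \<star> b \<in> N" using a b subgroup.m_closed[OF C] K.m_closed unfolding N_def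
      by (metis (no_types, lifting) mem_Collect_eq)
  qed
  have comm: "s \<star> s' = s' \<star> s" if "s \<in> ?C" "s' \<in> ?C" for s s' using that TT_ZZ ZZ_commute by blast
  have iff: "(lco (s \<star> h) KK = lco (s' \<star> h) KK) = (rco N s = rco N s')" if s: "s \<in> ?C" "s' \<in> ?C" for s s'
  proof -
    have c: "s \<in> carrier GLxGL" "s' \<in> carrier GLxGL" using s Cc by auto
    have iS: "ginv s \<star> s' \<in> ?C" using s C subgroup.m_closed subgroup.m_inv_closed by metis
    have "(lco (s \<star> h) KK = lco (s' \<star> h) KK) = (ginv h \<star> (ginv s \<star> s') \<star> h \<in> KK)"
      using coset_eq_ZZ[OF h one, of s s'] s h by simp
    also have "\<dots> = (ginv s \<star> s' \<in> N)" unfolding N_def using iS by blast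
    also have "\<dots> = (rco N s = rco N s')"
    proof
      assume n: "ginv s \<star> s' \<in> N"
      have "s' = s \<star> (ginv s \<star> s')" using c by (simp add: m_assoc [symmetric])
      also have "\<dots> = (ginv s \<star> s') \<star> s" using comm[OF s(1) iS] .
      finally have "s' \<in> rco N s" using n unfolding r_coset_def by blast
      then show "rco N s = rco N s'" using c N by (intro repr_independence)
    next
      assume "rco N s = rco N s'"
      then have "s' \<in> rco N s" using rcos_self[OF c(2) N] by simp
      then obtain n where n: "n \<in> N" "s' = n \<star> s" unfolding r_coset_def by blast
      have nC: "n \<in> ?C" using n unfolding N_def by blast
      have "ginv s \<star> s' = ginv s \<star> (s \<star> n)" unfolding n(2) using comm[OF nC s(1)] by simp
      also have "\<dots> = n" using c Cc[OF nC] by (simp add: m_assoc [symmetric])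
      finally show "ginv s \<star> s' \<in> N" using n by simp
    qed
    finally show ?thesis .
  qed
  have card: "wt h = card (rco N ` ?C)" unfolding wt_def by (rule card_image_cong_iff) (rule iff)
  have "wt h \<noteq> 0" unfolding wt_def using finite_wt[OF h] subgroup.one_closed[OF C] by auto
  then have fin: "finite (rco N ` ?C)" unfolding card by (simp add: card_eq_0_iff)
  have "\<exists>k. card (rco N ` ?C) = p ^ k"
  proof (rule prime_power_card_cosets[OF C _ N _ fin p(1)])
    show "N \<subseteq> ?C" unfolding N_def by blast
    show "x \<star> y = y \<star> x" if "x \<in> ?C" "y \<in> ?C" for x y using comm that .
    fix t assume t: "t \<in> ?C"
    then obtain e where e: "t = (e, e)" "e ** Pi_mat = Pi_mat ** e" "e \<in> GLO" by (auto simp: TT_def KK_def)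
    obtain f where f: "e = meval Pi_mat f" "int_poly f" "absval (coeff f 0) = 1" using commuting_GLO_poly[OF e(3,2)] by blast
    have pow: "t [^]\<^bsub>GLxGL\<^esub> k = (meval Pi_mat (f ^ k), meval Pi_mat (f ^ k))" for k :: nat
    proof (induction k)
      case 0
      show ?case by (simp add: one_GLxGL)
    next
      case (Suc k)
      have "meval Pi_mat (f ^ k) ** e = meval Pi_mat (f ^ Suc k)" unfolding f(1) by (simp only: meval_mult [symmetric] power_Suc2)
      then show ?case using Suc by (simp add: e(1) mult_GLxGL)
    qed
    obtain r where r: "0 < r" "r < 1" "\<forall>q\<in>QQ r. ginv h \<star> q \<star> h \<in> KK" using QQ_conj[OF h] by blast
    obtain s a where sa: "absval a = 1" "bnd r (meval (Pi_mat :: 'a^'n^'n) (f ^ (p ^ s)) - mat a)"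
      using power_near_scalar[OF p(2) f(2,3) r(1)] by blast
    have a0: "a \<noteq> 0" using sa(1) by auto
    let ?P = "meval (Pi_mat :: 'a^'n^'n) (f ^ (p ^ s))"
    let ?q = "(mat (inverse a) ** ?P, mat (inverse a) ** ?P)"
    have "mat (inverse a) ** ?P - mat 1 = mat (inverse a) ** (?P - mat a)"
      using a0 by (simp add: matrix_mult_diff_ldistrib mat_mult_mat)
    moreover have "bnd (1 * r) (mat (inverse a) ** (?P - mat a))"
      using sa by (intro bnd_mult bnd_mat) (auto simp: absval_inverse)
    ultimately have qQ: "?q \<in> QQ r" by (simp add: QQ_def)
    have maK: "(mat a, mat a) \<in> (KK :: ('a, 'n) mat2 set)"
      unfolding KK_def using sa(1) a0 by (auto intro!: GLO_I[of _ "mat (inverse a)"] bnd_mat simp: mat_mult_mat absval_inverse)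
    have scal: "t [^]\<^bsub>GLxGL\<^esub> (p ^ s) = (mat a, mat a) \<star> ?q"
      unfolding pow mult_GLxGL using a0 by (simp add: matrix_mul_assoc mat_mult_mat)
    have qc: "?q \<in> carrier GLxGL" using qQ QQ_KK[OF r(2)] KK_carrier by blast
    have central: "ginv h \<star> (mat a, mat a) = (mat a, mat a) \<star> ginv h"
      using h by (simp add: inv_GLxGL mult_GLxGL mat_mult_commute)
    have "ginv h \<star> (t [^]\<^bsub>GLxGL\<^esub> (p ^ s)) \<star> h = (ginv h \<star> (mat a, mat a)) \<star> ?q \<star> h"
      unfolding scal using h qc KK_carrier[OF maK] by (simp only: m_assoc inv_closed m_closed)
    also have "\<dots> = (mat a, mat a) \<star> (ginv h \<star> ?q \<star> h)"
      unfolding central using h qc KK_carrier[OF maK] by (simp only: m_assoc inv_closed m_closed)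
    also have "\<dots> \<in> KK" using maK r(3) qQ K.m_closed by blast
    finally have conj: "ginv h \<star> (t [^]\<^bsub>GLxGL\<^esub> (p ^ s)) \<star> h \<in> KK" .
    have "t [^]\<^bsub>GLxGL\<^esub> (k :: nat) \<in> ?C" for k
      by (induction k) (use t C in \<open>auto simp: subgroup.one_closed subgroup.m_closed simp del: Int_iff\<close>)
    then have "t [^]\<^bsub>GLxGL\<^esub> (p ^ s) \<in> N" unfolding N_def using conj by blast
    then show "\<exists>s :: nat. t [^]\<^bsub>GLxGL\<^esub> (p ^ s) \<in> N" by blast
  qed
  then show ?thesis using card by simp
qed

section \<open>Double cosets of bounded weight\<close>

text \<open>With Z = H^-1 z H and m the integral conjugate, (1 + eps Z) m = 1 + Z. Solving for Z
  gives Z = (m - 1) (1 - eps m)^-1, whose second factor is in \<open>GLO\<close>.\<close>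

lemma conj_bound:
  fixes H z ua ub :: "'a::nonarch_local_field_0^'n^'n"
  assumes H: "invertible H" and ub: "invertible ub" and eps: "absval eps < 1"
    and ua_def: "ua = mat 1 + z" and ub_def: "ub = mat 1 + mat eps ** z"
    and m: "bnd 1 (matrix_inv H ** (matrix_inv ub ** ua) ** H)"
  shows "bnd 1 (matrix_inv H ** z ** H)"
proof -
  define m where "m = matrix_inv H ** (matrix_inv ub ** ua) ** H"
  define Z where "Z = matrix_inv H ** z ** H"
  have cm: "matrix_inv H ** A ** H ** (matrix_inv H ** B ** H) = matrix_inv H ** (A ** B) ** H" for A B
  proof -
    have "matrix_inv H ** A ** H ** (matrix_inv H ** B ** H) = matrix_inv H ** A ** (H ** matrix_inv H) ** B ** H"
      by (simp only: matrix_mul_assoc)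
    then show ?thesis using H by (simp add: matrix_inv_props matrix_mul_assoc)
  qed
  have ub': "matrix_inv H ** ub ** H = mat 1 + mat eps ** Z"
  proof -
    have "matrix_inv H ** (mat eps ** z) ** H = mat eps ** Z"
      unfolding Z_def matrix_mul_assoc mat_mult_commute[of eps "matrix_inv H"] ..
    then show ?thesis unfolding ub_def using H by (simp add: matrix_add_ldistrib matrix_mult_add_rdistrib matrix_inv_props)
  qed
  have ua': "matrix_inv H ** ua ** H = mat 1 + Z"
    unfolding ua_def Z_def using H by (simp add: matrix_add_ldistrib matrix_mult_add_rdistrib matrix_inv_props)
  have "(mat 1 + mat eps ** Z) ** m = mat 1 + Z"
    unfolding ub' [symmetric] ua' [symmetric] m_def cm using ub by (simp add: matrix_mul_assoc matrix_inv_props)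
  then have "m + mat eps ** Z ** m = mat 1 + Z" by (simp add: matrix_mult_add_rdistrib)
  moreover have "mat eps ** Z ** m = Z ** (mat eps ** m)"
    unfolding matrix_mul_assoc mat_mult_commute[of eps Z] ..
  ultimately have mZ: "m + Z ** (mat eps ** m) = mat 1 + Z" by simp
  have "Z ** (mat 1 + (- (mat eps ** m))) = Z - Z ** (mat eps ** m)"
    using matrix_mult_diff_ldistrib[of Z "mat 1" "mat eps ** m"] by simp
  also have "\<dots> = (mat 1 + Z) - Z ** (mat eps ** m) - mat 1" by simp
  also have "\<dots> = m - mat 1" unfolding mZ [symmetric] by simp
  finally have eq: "Z ** (mat 1 + (- (mat eps ** m))) = m - mat 1" .
  have "bnd 1 m" using m by (simp add: m_def)
  then have "bnd (absval eps) (- (mat eps ** m))"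
    using bnd_mult[OF bnd_mat[OF order_refl, of eps], of 1 m] by (simp add: bnd_uminus)
  then have G: "mat 1 + (- (mat eps ** m)) \<in> GLO" using eps by (intro GLO_near_one[of "absval eps"]) simp_all
  have "Z = (m - mat 1) ** matrix_inv (mat 1 + (- (mat eps ** m)))"
    unfolding eq [symmetric] using GLO_invertible[OF G] by (simp add: matrix_mul_assoc [symmetric] matrix_inv_props)
  moreover have "bnd 1 (m - mat 1)" using \<open>bnd 1 m\<close> by (intro bnd_diff bnd_mat) auto
  ultimately show ?thesis using G bnd_mult'[of 1 "m - mat 1" 1 _ 1] unfolding Z_def GLO_def by simp
qed

lemma one_plus_monom_TT:
  assumes "absval (c :: 'a::nonarch_local_field_0) \<le> 1" "0 < i \<or> absval c < 1"
  shows "(meval Pi_mat (1 + monom c i), meval Pi_mat (1 + monom c i)) \<in> (TT \<inter> KK :: ('a, 'n::finite) mat2 set)"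
proof -
  have "absval (1 + c) = 1" if "absval c < 1"
    using absval_add[of 1 c] absval_diff[of "1 + c" c] that by auto
  then have "absval (coeff (1 + monom c i) 0) = 1" using assms by (cases "i = 0") auto
  moreover have "int_poly (1 + monom c i)" using assms(1) by (intro int_poly_add) (auto simp: int_poly_def[of "monom c i"])
  ultimately have "meval (Pi_mat :: 'a^'n^'n) (1 + monom c i) \<in> GLO" by (intro meval_GLO)
  then show ?thesis using meval_commute_base[of "Pi_mat :: 'a^'n^'n" "1 + monom c i"]
    by (simp add: TT_def KK_def GLO_invertible)
qed

lemma lco_eq_conj:
  fixes h :: "('a::nonarch_local_field_0, 'n::finite) mat2"
  assumes h: "h \<in> carrier GLxGL" and e: "(a, a) \<in> TT" "(b, b) \<in> TT" and eq: "lco ((b, b) \<star> h) KK = lco ((a, a) \<star> h) KK"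
  shows "matrix_inv (fst h) ** (matrix_inv b ** a) ** fst h \<in> GLO" "matrix_inv (snd h) ** (matrix_inv b ** a) ** snd h \<in> GLO"
proof -
  interpret group "GLxGL :: ('a, 'n) mat2 monoid" by (rule group_GLxGL)
  have one: "\<one>\<^bsub>GLxGL\<^esub> \<in> (ZZ :: ('a, 'n) mat2 set)" "\<one>\<^bsub>GLxGL\<^esub> \<in> (KK :: ('a, 'n) mat2 set)"
    using subgroup.one_closed[OF subgroup_ZZ] subgroup.one_closed[OF subgroup_KK] by blast+
  have bc: "(b, b) \<in> carrier GLxGL" using e TT_ZZ ZZ_carrier by blast
  have "ginv h \<star> (ginv (b, b) \<star> (a, a)) \<star> h \<in> KK" using coset_eq_ZZ[OF h one e(2,1)] eq h by simp
  then show "matrix_inv (fst h) ** (matrix_inv b ** a) ** fst h \<in> GLO" "matrix_inv (snd h) ** (matrix_inv b ** a) ** snd h \<in> GLO"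
    by (simp_all add: inv_GLxGL[OF h] inv_GLxGL[OF bc] mult_GLxGL KK_def)
qed

text \<open>Among the A + 1 units 1 + w^a Pi^i with a = 1, ..., A + 1, two give the same coset;
  \<open>conj_bound\<close> then shows that h^-1 (w^a Pi^i) h is integral for the smaller exponent
  a.\<close>

lemma wt_le_bound:
  fixes h :: "('a::nonarch_local_field_0, 'n::finite) mat2"
  assumes h: "h \<in> carrier GLxGL" and A: "wt h \<le> A"
  defines "r \<equiv> inverse (absval (uniformizer :: 'a)) ^ Suc A"
  shows "bnd r (matrix_inv (fst h) ** PZ (int i) ** fst h)" "bnd r (matrix_inv (snd h) ** PZ (int i) ** snd h)"
proof -
  let ?w = "uniformizer :: 'a" and ?M = "Pi_mat :: 'a^'n^'n"
  define u where "u a = meval ?M (1 + monom (?w ^ a) i)" for a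
  \<comment> \<open>The exponents start at 1 because for i = 0 the element 1 + w^0 = 2 may fail to
    be a unit.\<close>
  have uT: "(u a, u a) \<in> TT \<inter> KK" if "0 < a" for a
    unfolding u_def using that by (intro one_plus_monom_TT) (auto simp: absval_power power_le_one power_less_one_iff less_imp_le)
  let ?f = "\<lambda>a. lco ((u a, u a) \<star> h) KK"
  have "\<not> inj_on ?f {1..Suc A}"
  proof
    assume "inj_on ?f {1..Suc A}"
    then have "card (?f ` {1..Suc A}) = Suc A" by (simp add: card_image)
    moreover have "?f ` {1..Suc A} \<subseteq> (\<lambda>t. lco (t \<star> h) KK) ` (TT \<inter> KK)" using uT by (auto intro!: imageI)
    then have "card (?f ` {1..Suc A}) \<le> wt h" unfolding wt_def by (rule card_mono[OF finite_wt[OF h]])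
    ultimately show False using A by simp
  qed
  then obtain a' b' where ab': "a' \<in> {1..Suc A}" "b' \<in> {1..Suc A}" "a' \<noteq> b'" "?f a' = ?f b'" unfolding inj_on_def by blast
  obtain a b where ab: "0 < a" "a < b" "b \<le> Suc A" "?f b = ?f a"
  proof (cases "a' < b'")
    case True
    then show ?thesis using that[of a' b'] ab' by simp
  next
    case False
    then show ?thesis using that[of b' a'] ab' by simp
  qed
  define z where "z = meval ?M (monom (?w ^ a) i)"
  have z: "z = mat (?w ^ a) ** PZ (int i)" unfolding z_def PZ_nat by (rule meval_monom)
  have ua: "u a = mat 1 + z" by (simp add: u_def z_def meval_add)
  have ub: "u b = mat 1 + mat (?w ^ (b - a)) ** z"
  proof -
    have "monom (?w ^ b) i = smult (?w ^ (b - a)) (monom (?w ^ a) i)"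
      using ab by (simp add: smult_monom power_add [symmetric])
    then show ?thesis by (simp add: u_def z_def meval_add meval_smult)
  qed
  have ubi: "invertible (u b)" using uT[of b] ab by (auto simp: KK_def GLO_invertible)
  have eps: "absval (?w ^ (b - a)) < 1" using ab by (simp add: absval_power power_less_one_iff)
  have TTs: "(u a, u a) \<in> TT" "(u b, u b) \<in> TT" using uT ab by auto
  note m = lco_eq_conj[OF h TTs ab(4)]
  have fin: "bnd r (matrix_inv H ** PZ (int i) ** H)"
    if H: "invertible H" "matrix_inv H ** (matrix_inv (u b) ** u a) ** H \<in> GLO" for H :: "'a^'n^'n"
  proof -
    have "bnd 1 (matrix_inv H ** z ** H)"
      by (rule conj_bound[OF H(1) ubi eps ua ub]) (use H(2) in \<open>simp add: GLO_def\<close>)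
    then have "bnd (inverse (absval ?w) ^ a * 1) (mat (inverse (?w ^ a)) ** (matrix_inv H ** z ** H))"
      by (intro bnd_mult bnd_mat) (simp_all add: absval_inverse absval_power power_inverse)
    moreover have "mat (inverse (?w ^ a)) ** (matrix_inv H ** z ** H) = matrix_inv H ** PZ (int i) ** H"
    proof -
      have "mat (inverse (?w ^ a)) ** (matrix_inv H ** z ** H) = matrix_inv H ** (mat (inverse (?w ^ a)) ** mat (?w ^ a) ** PZ (int i)) ** H"
        unfolding z matrix_mul_assoc mat_mult_commute[of "inverse (?w ^ a)" "matrix_inv H"] ..
      then show ?thesis by (simp add: mat_mult_mat)
    qed
    moreover have "inverse (absval ?w) ^ a * 1 \<le> r" unfolding r_def using ab power_increasing[of a "Suc A" "inverse (absval ?w)"]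
      by (simp add: one_le_inverse less_imp_le)
    ultimately show ?thesis using bnd_mono by fastforce
  qed
  have hi: "invertible (fst h)" "invertible (snd h)" using h by (auto simp: carrier_GLxGL)
  show "bnd r (matrix_inv (fst h) ** PZ (int i) ** fst h)" using fin[OF hi(1) m(1)] .
  show "bnd r (matrix_inv (snd h) ** PZ (int i) ** snd h)" using fin[OF hi(2) m(2)] .
qed

text \<open>For weight 1 the unit 1 + Pi^i can be compared with 1 itself, so no power of w is lost.
  The exact bound is what identifies the trivial double coset.\<close>

lemma wt_1_bound:
  fixes h :: "('a::nonarch_local_field_0, 'n::finite) mat2"
  assumes h: "h \<in> carrier GLxGL" and w1: "wt h = 1"
  shows "bnd 1 (matrix_inv (fst h) ** PZ (int i) ** fst h)" "bnd 1 (matrix_inv (snd h) ** PZ (int i) ** snd h)"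
proof -
  let ?M = "Pi_mat :: 'a^'n^'n"
  have hi: "invertible (fst h)" "invertible (snd h)" using h by (auto simp: carrier_GLxGL)
  have "bnd 1 (matrix_inv (fst h) ** PZ (int i) ** fst h) \<and> bnd 1 (matrix_inv (snd h) ** PZ (int i) ** snd h)"
  proof (cases "i = 0")
    case True
    then show ?thesis using hi by (simp add: PZ_0 matrix_inv_props bnd_mat)
  next
    case False
    define u where "u = meval ?M (1 + monom 1 i)"
    have uT: "(u, u) \<in> TT \<inter> KK" unfolding u_def using False by (intro one_plus_monom_TT) auto
    have oT: "(mat 1, mat 1) \<in> (TT \<inter> KK :: ('a, 'n) mat2 set)" by (simp add: TT_def KK_def invertible_mat)
    obtain c where c: "(\<lambda>t. lco (t \<star> h) KK) ` (TT \<inter> KK) = {c}" using w1 unfolding wt_def by (rule card_1_singletonE)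
    have eq: "lco ((mat 1, mat 1) \<star> h) KK = lco ((u, u) \<star> h) KK" using c uT oT by (metis (no_types, lifting) imageI singletonD)
    have m: "matrix_inv (fst h) ** u ** fst h \<in> GLO" "matrix_inv (snd h) ** u ** snd h \<in> GLO"
      using lco_eq_conj[OF h _ _ eq] uT oT by (simp_all add: matrix_inv_mat_1)
    have u: "u = mat 1 + PZ (int i)" by (simp add: u_def meval_add PZ_nat)
    have "bnd 1 (matrix_inv H ** PZ (int i) ** H)" if H: "invertible H" "matrix_inv H ** u ** H \<in> GLO" for H :: "'a^'n^'n"
    proof -
      have "matrix_inv H ** u ** H - mat 1 = matrix_inv H ** PZ (int i) ** H"
        using conj_near_one[OF H(1), of u] by (simp add: u)
      moreover have "bnd 1 (matrix_inv H ** u ** H - mat 1)" using H(2) by (intro bnd_diff bnd_mat) (auto simp: GLO_def)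
      ultimately show ?thesis by simp
    qed
    then show ?thesis using m hi by blast
  qed
  then show "bnd 1 (matrix_inv (fst h) ** PZ (int i) ** fst h)" "bnd 1 (matrix_inv (snd h) ** PZ (int i) ** snd h)" by auto
qed

definition deg2 :: "('a::nonarch_local_field_0, 'n::finite) mat2 \<Rightarrow> int" where
  "deg2 h = val (det (snd h)) - val (det (fst h))"

lemma val_det_mult:
  "invertible A \<Longrightarrow> invertible B \<Longrightarrow> val (det (A ** B)) = val (det A) + val (det (B :: 'a::nonarch_local_field_0^'n^'n))"
  by (simp add: det_mul val_mult invertible_det_nz)

lemma val_det_GLO: "A \<in> GLO \<Longrightarrow> val (det A) = 0"
  using GLO_det[of A] GLO_invertible[of A] by (simp add: val_eq_0_iff invertible_det_nz)

lemma deg2_mult: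
  "g \<in> carrier GLxGL \<Longrightarrow> h \<in> carrier GLxGL \<Longrightarrow> deg2 (g \<star> h) = deg2 g + deg2 (h :: ('a::nonarch_local_field_0, 'n::finite) mat2)"
  by (simp add: deg2_def mult_GLxGL carrier_GLxGL val_det_mult)

lemma deg2_TT: "t \<in> TT \<Longrightarrow> deg2 t = 0"
  by (auto simp: TT_def deg2_def)

lemma deg2_KK: "k \<in> KK \<Longrightarrow> deg2 k = 0"
  by (auto simp: KK_def deg2_def val_det_GLO)

lemma absval_det_le_power:
  fixes A :: "'a::nonarch_local_field_0^'n^'n"
  assumes "bnd r A"
  shows "absval (det A) \<le> r ^ CARD('n)"
proof -
  have "(\<Prod>i\<in>UNIV. absval (A $ i $ p i)) \<le> (\<Prod>i\<in>(UNIV :: 'n set). r)" for p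
    using assms by (intro prod_mono) (auto simp: bnd_def)
  then show ?thesis unfolding det_def using bnd_ge_0[OF assms]
    by (intro absval_sum) (auto simp: absval_mult absval_prod absval_sign)
qed

lemma val_det_bounds:
  "\<exists>C :: int. \<forall>g :: 'a::nonarch_local_field_0^'n^'n. invertible g \<and> bnd 1 g \<and> bnd r (matrix_inv g) \<longrightarrow> 0 \<le> val (det g) \<and> val (det g) \<le> C"
proof -
  let ?w = "uniformizer :: 'a"
  define R where "R = max r 1 ^ CARD('n)"
  have R: "1 \<le> R" by (simp add: R_def)
  obtain C where C: "absval ?w ^ C < inverse R" using real_arch_pow_inv[of "inverse R" "absval ?w"] R by auto
  have mono: "absval ?w powi l \<le> absval ?w powi k" if "k \<le> l" for k l :: int
    using that by (intro power_int_decreasing) (auto intro: less_imp_le)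
  show ?thesis
  proof (intro exI[of _ "int C"] allI impI)
    fix g :: "'a^'n^'n" assume g: "invertible g \<and> bnd 1 g \<and> bnd r (matrix_inv g)"
    have nz: "det g \<noteq> 0" using g by (simp add: invertible_det_nz)
    have v: "absval (det g) = absval ?w powi val (det g)" using nz by (rule absval_eq_val)
    have le: "absval ?w powi val (det g) \<le> 1" using absval_det_le[of g] g v by simp
    have "0 \<le> val (det g)"
    proof (rule ccontr)
      assume "\<not> 0 \<le> val (det g)"
      then have "absval ?w powi (- 1) \<le> absval ?w powi val (det g)" by (intro mono) simp
      moreover have "1 < inverse (absval ?w)" by (simp add: one_less_inverse)
      ultimately show False using le by simp
    qed
    moreover have "val (det g) \<le> int C"
    proof (rule ccontr)
      assume "\<not> val (det g) \<le> int C"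
      then have "absval (det g) \<le> absval ?w powi int C" unfolding v by (intro mono) simp
      then have lt: "absval (det g) < inverse R" using C by simp
      have "det g * det (matrix_inv g) = 1" using g by (simp add: det_mul [symmetric] matrix_inv_props)
      then have "absval (det g) * absval (det (matrix_inv g)) = 1" by (metis absval_1 absval_mult)
      moreover have "absval (det (matrix_inv g)) \<le> R"
        unfolding R_def using g by (intro absval_det_le_power) (auto intro: bnd_mono)
      moreover have "absval (det g) * R < 1" using lt R by (simp add: field_simps)
      moreover have "absval (det g) * absval (det (matrix_inv g)) \<le> absval (det g) * R"
        using calculation(2) by (intro mult_left_mono) auto
      ultimately show False by linarith
    qed
    ultimately show "0 \<le> val (det g) \<and> val (det g) \<le> int C" by blast
  qed
qed

lemma act_ell:
  fixes h :: "('a::nonarch_local_field_0, 'n::finite) mat2"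
  assumes "h \<in> carrier GLxGL"
  shows "act (ginv h) (ell k) = (matrix_inv (fst h) ** PZ (int CARD('n) * int k + 1) ** snd h, matrix_inv (snd h) ** fst h)"
proof -
  have "mat (uniformizer ^ k) ** Pi_mat = (PZ (int CARD('n) * int k + 1) :: 'a^'n^'n)"
    unfolding PZ_add PZ_1 PZ_CARD by simp
  then show ?thesis using assms by (simp add: act_def inv_GLxGL ell_def carrier_GLxGL matrix_inv_matrix_inv)
qed

lemma wt_normal_form:
  fixes h :: "('a::nonarch_local_field_0, 'n::finite) mat2"
  assumes h: "h \<in> carrier GLxGL"
    and b: "\<And>i. bnd r (matrix_inv (fst h) ** PZ (int i) ** fst h)" "\<And>i. bnd r (matrix_inv (snd h) ** PZ (int i) ** snd h)"
  shows "\<exists>v1 v2 g1 g2. h = (PZ v1 ** g1, PZ v2 ** g2) \<and> invertible g1 \<and> invertible g2 \<and>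
    bnd 1 g1 \<and> bnd r (matrix_inv g1) \<and> bnd 1 g2 \<and> bnd r (matrix_inv g2)"
proof -
  have hi: "invertible (fst h)" "invertible (snd h)" using h by (auto simp: carrier_GLxGL)
  obtain v1 where v1: "bnd 1 (PZ v1 ** fst h)" "bnd r (matrix_inv (PZ v1 ** fst h))"
    using normalize_lattice_PZ[OF hi(1), of r] b(1) by blast
  obtain v2 where v2: "bnd 1 (PZ v2 ** snd h)" "bnd r (matrix_inv (PZ v2 ** snd h))"
    using normalize_lattice_PZ[OF hi(2), of r] b(2) by blast
  have "PZ (- v) ** (PZ v ** A) = A" for v and A :: "'a^'n^'n"
    using PZ_inverse[of "- v", where ?'a = 'a and ?'n = 'n] by (simp add: matrix_mul_assoc)
  then have "h = (PZ (- v1) ** (PZ v1 ** fst h), PZ (- v2) ** (PZ v2 ** snd h))" by simp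
  moreover have "invertible (PZ v1 ** fst h)" "invertible (PZ v2 ** snd h)" using hi by (simp_all add: invertible_mult invertible_PZ)
  ultimately show ?thesis using v1 v2 by blast
qed

text \<open>In the normal form h = (Pi^v1 g1, Pi^v2 g2) the components of h^-1 x_k are g1^-1
  Pi^(nk+1+v2-v1) g2 and g2^-1 Pi^(v1-v2) g1, where the matrices g and their inverses are bounded in
  terms of \<open>A\<close>.\<close>

lemma wt_small:
  assumes \<rho>: "0 < \<rho>"
  shows "\<exists>c. \<forall>h :: ('a::nonarch_local_field_0, 'n::finite) mat2. h \<in> carrier GLxGL \<and> wt h \<le> A \<longrightarrow>
    (\<forall>k. c \<le> int CARD('n) * int k + 1 + deg2 h \<longrightarrow> bnd \<rho> (fst (act (ginv h) (ell k)))) \<and>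
    (\<forall>k. c \<le> - deg2 h \<longrightarrow> bnd \<rho> (snd (act (ginv h) (ell k))))"
proof -
  let ?w = "uniformizer :: 'a" and ?n = "int CARD('n)"
  define r where "r = inverse (absval ?w) ^ Suc A"
  have r0: "0 < r" by (simp add: r_def)
  obtain C where C: "\<And>g :: 'a^'n^'n. invertible g \<Longrightarrow> bnd 1 g \<Longrightarrow> bnd r (matrix_inv g) \<Longrightarrow> 0 \<le> val (det g) \<and> val (det g) \<le> C"
    using val_det_bounds[of r, where ?'a = 'a and ?'n = 'n] by blast
  obtain q :: nat where q: "absval ?w ^ q < \<rho> / r" using real_arch_pow_inv[of "\<rho> / r" "absval ?w"] \<rho> r0 by auto
  then have qr: "r * absval ?w ^ q \<le> \<rho>" using r0 by (simp add: field_simps)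
  have small: "bnd \<rho> (matrix_inv g ** PZ v ** g')" if "bnd r (matrix_inv g)" "bnd 1 g'" "?n * int q \<le> v" for g g' :: "'a^'n^'n" and v
  proof -
    have "bnd (r * absval ?w powi int q * 1) (matrix_inv g ** PZ v ** g')" by (intro bnd_mult that bnd_PZ)
    then show ?thesis using qr by (auto intro: bnd_mono)
  qed
  show ?thesis
  \<comment> \<open>The power w^q outweighs the bound on g1^-1 and g2^-1, and \<open>C\<close>
    bounds the difference between \<open>deg2 h\<close> and v2 - v1.\<close>
  proof (intro exI[of _ "?n * int q + C"] allI impI)
    fix h :: "('a, 'n) mat2" assume h: "h \<in> carrier GLxGL \<and> wt h \<le> A"
    then have hc: "h \<in> carrier GLxGL" by blast
    obtain v1 v2 g1 g2 where nf: "h = (PZ v1 ** g1, PZ v2 ** g2)" "invertible g1" "invertible g2"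
      "bnd 1 g1" "bnd r (matrix_inv g1)" "bnd 1 g2" "bnd r (matrix_inv g2)"
      using wt_normal_form[OF hc, of r] wt_le_bound[of h A] h unfolding r_def by blast
    have C1: "0 \<le> val (det g1)" "val (det g1) \<le> C" and C2: "0 \<le> val (det g2)" "val (det g2) \<le> C" using C nf by auto
    have d: "deg2 h = (v2 + val (det g2)) - (v1 + val (det g1))"
      unfolding nf(1) deg2_def using nf(2,3) by (simp add: val_det_mult invertible_PZ val_det_PZ)
    have inv: "matrix_inv (PZ v ** g) ** PZ u ** (PZ v' ** g') = matrix_inv g ** PZ (u + v' - v) ** g'"
      if "invertible g" for g g' :: "'a^'n^'n" and u v v'
    proof -
      have "PZ (u + v' - v) = (PZ (- v) ** PZ u ** PZ v' :: 'a^'n^'n)" unfolding PZ_add [symmetric] by (simp add: algebra_simps)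
      then show ?thesis using that by (simp add: matrix_inv_mult invertible_PZ matrix_inv_PZ matrix_mul_assoc)
    qed
    have inv0: "matrix_inv (PZ v ** g) ** (PZ v' ** g') = matrix_inv g ** PZ (v' - v) ** g'"
      if "invertible g" for g g' :: "'a^'n^'n" and v v'
      using inv[OF that, of v 0 v' g'] by (simp add: PZ_0)
    show "(\<forall>k. ?n * int q + C \<le> ?n * int k + 1 + deg2 h \<longrightarrow> bnd \<rho> (fst (act (ginv h) (ell k)))) \<and>
      (\<forall>k. ?n * int q + C \<le> - deg2 h \<longrightarrow> bnd \<rho> (snd (act (ginv h) (ell k))))"
    proof (intro conjI allI impI)
      fix k assume "?n * int q + C \<le> ?n * int k + 1 + deg2 h"
      then have "?n * int q \<le> ?n * int k + 1 + v2 - v1" using d C1 C2 by linarith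
      then show "bnd \<rho> (fst (act (ginv h) (ell k)))"
        unfolding act_ell[OF hc] using nf by (simp add: inv small)
    next
      fix k assume "?n * int q + C \<le> - deg2 h"
      then have "?n * int q \<le> v1 - v2" using d C1 C2 by linarith
      then show "bnd \<rho> (snd (act (ginv h) (ell k)))"
        unfolding act_ell[OF hc] using nf by (simp add: inv0 small)
    qed
  qed
qed

lemma dcoset_TT_normal:
  fixes g1 g2 s1 s2 :: "'a::nonarch_local_field_0^'n^'n"
  assumes g: "invertible g1" "invertible g2" and s: "invertible s1" "invertible s2" and k: "matrix_inv s1 ** g1 \<in> GLO" "matrix_inv s2 ** g2 \<in> GLO"
  shows "dcoset TT (PZ v1 ** g1, PZ v2 ** g2) = dcoset TT (s1, PZ (v2 - v1) ** s2)"
proof -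
  have sc: "(s1, PZ (v2 - v1) ** s2) \<in> carrier GLxGL" using s by (simp add: carrier_GLxGL invertible_mult invertible_PZ)
  have t: "(PZ v1, PZ v1) \<in> (TT :: ('a, 'n) mat2 set)" by (simp add: TT_def invertible_PZ PZ_commute)
  have kK: "(matrix_inv s1 ** g1, matrix_inv s2 ** g2) \<in> KK" using k by (simp add: KK_def)
  have "(PZ v1, PZ v1) \<star> (s1, PZ (v2 - v1) ** s2) \<star> (matrix_inv s1 ** g1, matrix_inv s2 ** g2) = (PZ v1 ** g1, PZ v2 ** g2)"
  proof -
    have "PZ v1 ** s1 ** (matrix_inv s1 ** g1) = PZ v1 ** (s1 ** matrix_inv s1) ** g1" by (simp only: matrix_mul_assoc)
    moreover have "PZ v1 ** (PZ (v2 - v1) ** s2) ** (matrix_inv s2 ** g2) = (PZ v1 ** PZ (v2 - v1)) ** (s2 ** matrix_inv s2) ** g2"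
      by (simp only: matrix_mul_assoc)
    moreover have "PZ v1 ** PZ (v2 - v1) = (PZ v2 :: 'a^'n^'n)" unfolding PZ_add [symmetric] by simp
    ultimately show ?thesis using s by (simp add: mult_GLxGL matrix_inv_props)
  qed
  then show ?thesis using dcoset_eq[OF subgroup_TT sc t kK] by simp
qed

text \<open>Left multiplication by T removes Pi^v1; there remain finitely many classes of g1 and g2
  modulo GL_n(O), and they determine v2 - v1 once the degree is fixed.\<close>

lemma finite_level:
  "finite {dcoset TT h | h :: ('a::nonarch_local_field_0, 'n::finite) mat2. h \<in> carrier GLxGL \<and> wt h \<le> A \<and> deg2 h = d}"
proof -
  let ?w = "uniformizer :: 'a"
  define r where "r = inverse (absval ?w) ^ Suc A"
  have r1: "1 \<le> r" unfolding r_def by (intro one_le_power) (simp add: one_le_inverse less_imp_le)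
  obtain S :: "('a^'n^'n) set" where S: "finite S" "\<And>g. invertible g \<Longrightarrow> bnd r g \<Longrightarrow> bnd r (matrix_inv g) \<Longrightarrow> \<exists>s\<in>S. invertible s \<and> matrix_inv s ** g \<in> GLO"
    using finite_mod_GLO[of r, where ?'a = 'a and ?'n = 'n] by blast
  let ?F = "\<lambda>(s1, s2). dcoset TT (s1, PZ (d - val (det s2) + val (det s1)) ** s2)"
  have "{dcoset TT h | h :: ('a, 'n) mat2. h \<in> carrier GLxGL \<and> wt h \<le> A \<and> deg2 h = d} \<subseteq> ?F ` (S \<times> S)"
  proof
    fix D assume "D \<in> {dcoset TT h | h :: ('a, 'n) mat2. h \<in> carrier GLxGL \<and> wt h \<le> A \<and> deg2 h = d}"
    then obtain h :: "('a, 'n) mat2" where h: "D = dcoset TT h" "h \<in> carrier GLxGL" "wt h \<le> A" "deg2 h = d" by blast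
    obtain v1 v2 g1 g2 where nf: "h = (PZ v1 ** g1, PZ v2 ** g2)" "invertible g1" "invertible g2"
      "bnd 1 g1" "bnd r (matrix_inv g1)" "bnd 1 g2" "bnd r (matrix_inv g2)"
      using wt_normal_form[OF h(2), of r] wt_le_bound[OF h(2,3)] unfolding r_def by blast
    obtain s1 where s1: "s1 \<in> S" "invertible s1" "matrix_inv s1 ** g1 \<in> GLO"
      using S(2)[OF nf(2) bnd_mono[OF nf(4) r1] nf(5)] by blast
    obtain s2 where s2: "s2 \<in> S" "invertible s2" "matrix_inv s2 ** g2 \<in> GLO"
      using S(2)[OF nf(3) bnd_mono[OF nf(6) r1] nf(7)] by blast
    have vg: "val (det g) = val (det s)" if "invertible s" "matrix_inv s ** g \<in> GLO" for g s :: "'a^'n^'n"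
    proof -
      have "g = s ** (matrix_inv s ** g)" using that(1) by (simp add: matrix_mul_assoc matrix_inv_props)
      then show ?thesis using val_det_mult[OF that(1) GLO_invertible[OF that(2)]] val_det_GLO[OF that(2)] by simp
    qed
    have "d = (v2 + val (det g2)) - (v1 + val (det g1))"
      unfolding h(4) [symmetric] nf(1) deg2_def using nf(2,3) by (simp add: val_det_mult invertible_PZ val_det_PZ)
    then have "v2 - v1 = d - val (det s2) + val (det s1)" using vg[OF s1(2,3)] vg[OF s2(2,3)] by simp
    then have "D = ?F (s1, s2)" unfolding h(1) nf(1) using dcoset_TT_normal[OF nf(2,3) s1(2) s2(2) s1(3) s2(3)] by simp
    then show "D \<in> ?F ` (S \<times> S)" using s1 s2 by blast
  qed
  then show ?thesis using S(1) finite_subset by blast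
qed

text \<open>Weight 1 puts both g1 and g2 into GL_n(O), and degree 0 makes the two powers of Pi
  equal, so that T absorbs them.\<close>

lemma unique_level:
  fixes h :: "('a::nonarch_local_field_0, 'n::finite) mat2"
  assumes h: "h \<in> carrier GLxGL" "wt h = 1" "deg2 h = 0"
  shows "dcoset TT h = dcoset TT (mat 1, mat 1)"
proof -
  obtain v1 v2 g1 g2 where nf: "h = (PZ v1 ** g1, PZ v2 ** g2)" "invertible g1" "invertible g2"
    "bnd 1 g1" "bnd 1 (matrix_inv g1)" "bnd 1 g2" "bnd 1 (matrix_inv g2)"
    using wt_normal_form[OF h(1), of 1] wt_1_bound[OF h(1,2)] by blast
  have G: "g1 \<in> GLO" "g2 \<in> GLO" using nf by (auto simp: GLO_def)
  have "deg2 h = (v2 + val (det g2)) - (v1 + val (det g1))"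
    unfolding nf(1) deg2_def using nf(2,3) by (simp add: val_det_mult invertible_PZ val_det_PZ)
  then have "v2 = v1" using h(3) G by (simp add: val_det_GLO)
  then show ?thesis unfolding nf(1)
    using dcoset_TT_normal[OF nf(2,3), of "mat 1" "mat 1" v1 v2] G by (simp add: PZ_0 matrix_inv_mat_1 invertible_mat)
qed

section \<open>Comparing consecutive orbital integrals\<close>

lemma dcoset_rep_cong:
  fixes \<Phi> :: "('a::nonarch_local_field_0, 'n::finite) mat2 \<Rightarrow> 'b"
  assumes inv: "\<And>t h k. t \<in> TT \<Longrightarrow> h \<in> carrier GLxGL \<Longrightarrow> k \<in> KK \<Longrightarrow> \<Phi> (t \<star> h \<star> k) = \<Phi> h"
    and g: "g \<in> carrier GLxGL"
  shows "\<Phi> (dcoset_rep TT (dcoset TT g)) = \<Phi> g"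
proof -
  let ?h = "dcoset_rep TT (dcoset TT g)"
  have h: "?h \<in> carrier GLxGL" "dcoset TT ?h = dcoset TT g" using dcoset_rep[OF g] by auto
  have "rco TT ?h \<in> dcoset TT g" using rco_in_dcoset_self[OF subgroup_TT h(1)] h(2) by simp
  then obtain t k where "t \<in> TT" "k \<in> KK" "?h = t \<star> g \<star> k" using rco_in_dcoset[OF subgroup_TT g h(1)] by blast
  then show ?thesis using inv[of t g k] g by simp
qed

text \<open>\<open>F\<close> and \<open>G\<close> stand for the terms of two consecutive sums. Above
  - c they agree; below - c - n those of \<open>G\<close> are those of \<open>F\<close> shifted
  upwards by n, which exhausts what \<open>F\<close> has at or below - c. The n levels in between
  remain, and \<sigma> gives them all the same total weight.\<close>

lemma shift_count:
  fixes w dg F G :: "'d \<Rightarrow> int" and \<sigma> :: "int \<Rightarrow> 'd \<Rightarrow> 'd" and n :: nat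
  assumes \<sigma>B: "\<And>j D. D \<in> B \<Longrightarrow> \<sigma> j D \<in> B" and \<sigma>\<sigma>: "\<And>j D. D \<in> B \<Longrightarrow> \<sigma> (- j) (\<sigma> j D) = D"
    and dg\<sigma>: "\<And>j D. D \<in> B \<Longrightarrow> dg (\<sigma> j D) = dg D + j" and w\<sigma>: "\<And>j D. D \<in> B \<Longrightarrow> w (\<sigma> j D) = w D"
    and finF: "finite {D \<in> B. F D \<noteq> 0}" and finG: "finite {D \<in> B. G D \<noteq> 0}" and finL: "\<And>d. finite {D \<in> B. dg D = d}"
    and pos: "\<And>D. D \<in> B \<Longrightarrow> - c < dg D \<Longrightarrow> G D = F D"
    and mid: "\<And>D. D \<in> B \<Longrightarrow> - c - int n < dg D \<Longrightarrow> dg D \<le> - c \<Longrightarrow> G D = a"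
    and neg: "\<And>D. D \<in> B \<Longrightarrow> dg D \<le> - c - int n \<Longrightarrow> G D = F (\<sigma> (int n) D)"
  shows "(\<Sum>D\<in>{D \<in> B. G D \<noteq> 0}. w D * G D) - (\<Sum>D\<in>{D \<in> B. F D \<noteq> 0}. w D * F D)
    = int n * a * (\<Sum>D\<in>{D \<in> B. dg D = 0}. w D)"
proof -
  let ?L = "\<lambda>d. {D \<in> B. dg D = d}"
  define W where "W = {D \<in> B. - c - int n < dg D \<and> dg D \<le> - c}"
  have \<sigma>\<sigma>': "\<sigma> j (\<sigma> (- j) D) = D" if "D \<in> B" for j D using \<sigma>\<sigma>[OF that, of "- j"] by simp
  have level: "sum w (?L d) = sum w (?L 0)" for d
    by (rule sum.reindex_bij_witness[where i = "\<sigma> d" and j = "\<sigma> (- d)"])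
       (auto simp: \<sigma>B \<sigma>\<sigma> \<sigma>\<sigma>' dg\<sigma> w\<sigma>)
  have WU: "W = (\<Union>d\<in>{- c - int n<..- c}. ?L d)" unfolding W_def by auto
  have finW: "finite W" unfolding WU using finL by blast
  have "sum w W = (\<Sum>d\<in>{- c - int n<..- c}. sum w (?L d))"
    unfolding WU using finL by (intro sum.UNION_disjoint) auto
  also have "\<dots> = (\<Sum>d\<in>{- c - int n<..- c}. sum w (?L 0))" by (rule sum.cong[OF refl level])
  also have "\<dots> = int n * sum w (?L 0)" by simp
  finally have sumW: "sum w W = int n * sum w (?L 0)" .
  let ?P = "{D \<in> B. F D \<noteq> 0 \<and> - c < dg D}" and ?M = "{D \<in> B. F D \<noteq> 0 \<and> dg D \<le> - c}"
  let ?P' = "{D \<in> B. G D \<noteq> 0 \<and> - c < dg D}" and ?M' = "{D \<in> B. G D \<noteq> 0 \<and> dg D \<le> - c - int n}"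
    and ?W' = "{D \<in> B. G D \<noteq> 0 \<and> - c - int n < dg D \<and> dg D \<le> - c}"
  have "(\<Sum>D\<in>{D \<in> B. F D \<noteq> 0}. w D * F D) = (\<Sum>D\<in>?P \<union> ?M. w D * F D)"
    by (intro sum.cong) auto
  also have "\<dots> = (\<Sum>D\<in>?P. w D * F D) + (\<Sum>D\<in>?M. w D * F D)"
    by (intro sum.union_disjoint finite_subset[OF _ finF]) auto
  finally have sF: "(\<Sum>D\<in>{D \<in> B. F D \<noteq> 0}. w D * F D) = (\<Sum>D\<in>?P. w D * F D) + (\<Sum>D\<in>?M. w D * F D)" .
  have "(\<Sum>D\<in>{D \<in> B. G D \<noteq> 0}. w D * G D) = (\<Sum>D\<in>?P' \<union> (?W' \<union> ?M'). w D * G D)"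
    by (intro sum.cong) auto
  also have "\<dots> = (\<Sum>D\<in>?P'. w D * G D) + (\<Sum>D\<in>?W' \<union> ?M'. w D * G D)"
    by (intro sum.union_disjoint finite_subset[OF _ finG]) auto
  also have "(\<Sum>D\<in>?W' \<union> ?M'. w D * G D) = (\<Sum>D\<in>?W'. w D * G D) + (\<Sum>D\<in>?M'. w D * G D)"
    by (intro sum.union_disjoint finite_subset[OF _ finG]) auto
  also have "(\<Sum>D\<in>?P'. w D * G D) = (\<Sum>D\<in>?P. w D * F D)"
    using pos by (intro sum.cong) auto
  also have "(\<Sum>D\<in>?W'. w D * G D) = (\<Sum>D\<in>W. w D * G D)"
    unfolding W_def using finW by (intro sum.mono_neutral_left) (auto simp: W_def)
  also have "\<dots> = sum w W * a" unfolding sum_distrib_right W_def using mid by (intro sum.cong) auto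
  also have "(\<Sum>D\<in>?M'. w D * G D) = (\<Sum>D\<in>?M. w D * F D)"
  proof (rule sum.reindex_bij_witness[where i = "\<sigma> (- int n)" and j = "\<sigma> (int n)"])
    fix D assume D: "D \<in> ?M"
    let ?E = "\<sigma> (- int n) D"
    have E: "?E \<in> B" "dg ?E \<le> - c - int n" using D \<sigma>B dg\<sigma> by auto
    then show "?E \<in> ?M'" using neg[OF E] \<sigma>\<sigma>'[of D "int n"] D by auto
  qed (use \<sigma>B \<sigma>\<sigma> \<sigma>\<sigma>' dg\<sigma> w\<sigma> neg in auto)
  finally show ?thesis unfolding sF sumW by simp
qed

lemma shift_ZZ: "(mat 1, PZ j) \<in> (ZZ :: ('a::nonarch_local_field_0, 'n::finite) mat2 set)"
  by (simp add: ZZ_def invertible_mat invertible_PZ PZ_commute)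

text \<open>The integer form of the argument: \<open>\<psi>\<close> is K-invariant and constant on
  cosets of a small lattice, and all weighted sums over double cosets vanish.\<close>

lemma level_vanish:
  fixes \<psi> :: "('a::nonarch_local_field_0, 'n::finite) mat2 \<Rightarrow> int"
  assumes K: "\<And>k y. k \<in> KK \<Longrightarrow> \<psi> (act k y) = \<psi> y"
    and \<rho>: "0 < \<rho>" "\<And>x x' Y Y'. bnd \<rho> (x - x') \<Longrightarrow> bnd \<rho> (Y - Y') \<Longrightarrow> \<psi> (x, Y) = \<psi> (x', Y')"
    and fin: "\<And>k. finite {dcoset TT h | h. h \<in> carrier GLxGL \<and> \<psi> (act (ginv h) (ell k)) \<noteq> 0}"
    and zero: "\<And>k. (\<Sum>D\<in>{dcoset TT h | h. h \<in> carrier GLxGL \<and> \<psi> (act (ginv h) (ell k)) \<noteq> 0}.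
      int (wt (dcoset_rep TT D)) * \<psi> (act (ginv (dcoset_rep TT D)) (ell k))) = 0"
  shows "\<psi> (0, 0) = 0"
proof (rule ccontr)
  assume a0: "\<psi> (0, 0) \<noteq> 0"
  interpret group "GLxGL :: ('a, 'n) mat2 monoid" by (rule group_GLxGL)
  interpret K: subgroup KK "GLxGL :: ('a, 'n) mat2 monoid" by (rule subgroup_KK)
  let ?n = "CARD('n)" and ?C = "carrier GLxGL :: ('a, 'n) mat2 set"
  define a where "a = \<psi> (0, 0)"
  obtain p where p: "prime p" "absval (of_nat p :: 'a) < 1" using exists_residue_prime by blast
  have p1: "1 < p" using p(1) prime_gt_1_nat by blast
  define E where "E = dcoset TT ` ?C"
  define rp where "rp = (dcoset_rep TT :: ('a, 'n) mat2 set set \<Rightarrow> ('a, 'n) mat2)"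
  define w where "w D = int (wt (rp D))" for D
  define dg where "dg D = deg2 (rp D)" for D
  define f where "f k D = \<psi> (act (ginv (rp D)) (ell k))" for k D
  have rp: "rp D \<in> ?C" "dcoset TT (rp D) = D" if "D \<in> E" for D
    using that dcoset_rep unfolding E_def rp_def by blast+
  have TC: "t \<in> ?C" if "t \<in> TT" for t using that TT_ZZ ZZ_carrier by blast
  have KC: "k \<in> ?C" if "k \<in> KK" for k using that KK_carrier by blast
  have w_d: "w (dcoset TT h) = int (wt h)" if "h \<in> ?C" for h
    unfolding w_def rp_def by (rule dcoset_rep_cong[where \<Phi> = "\<lambda>h. int (wt h)", OF _ that]) (simp add: wt_ZZ subsetD[OF TT_ZZ])
  have dg_d: "dg (dcoset TT h) = deg2 h" if "h \<in> ?C" for h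
    unfolding dg_def rp_def
    by (rule dcoset_rep_cong[where \<Phi> = deg2, OF _ that]) (simp add: deg2_mult TC KC deg2_TT deg2_KK)
  have f_d: "f k (dcoset TT h) = \<psi> (act (ginv h) (ell k))" if "h \<in> ?C" for k h
    unfolding f_def rp_def
  proof (rule dcoset_rep_cong[where \<Phi> = "\<lambda>h. \<psi> (act (ginv h) (ell k))", OF _ that])
    fix t g u :: "('a, 'n) mat2" assume t: "t \<in> TT" and g: "g \<in> ?C" and u: "u \<in> KK"
    have tc: "ginv t \<in> ?C" "ginv g \<in> ?C" "ginv u \<in> ?C" using TC[OF t] g KC[OF u] by auto
    have "ginv t \<in> stabilizer GLxGL act (ell k)" unfolding stabilizer_ell using t subgroup.m_inv_closed[OF subgroup_TT] by blast
    then have "act (ginv t) (ell k) = ell k" by (simp add: stabilizer_def)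
    then have "act (ginv (t \<star> g \<star> u)) (ell k) = act (ginv u) (act (ginv g) (ell k))"
      using tc TC[OF t] g KC[OF u] by (simp add: inv_mult_group act_mult)
    then show "\<psi> (act (ginv (t \<star> g \<star> u)) (ell k)) = \<psi> (act (ginv g) (ell k))"
      using K[OF K.m_inv_closed[OF u]] by simp
  qed
  have supp: "{dcoset TT h | h. h \<in> ?C \<and> \<psi> (act (ginv h) (ell k)) \<noteq> 0} = {D \<in> E. f k D \<noteq> 0}" for k
  proof (intro equalityI subsetI)
    fix D assume "D \<in> {dcoset TT h | h. h \<in> ?C \<and> \<psi> (act (ginv h) (ell k)) \<noteq> 0}"
    then obtain h where h: "D = dcoset TT h" "h \<in> ?C" "\<psi> (act (ginv h) (ell k)) \<noteq> 0" by blast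
    then show "D \<in> {D \<in> E. f k D \<noteq> 0}" using f_d[OF h(2), of k] unfolding E_def by simp
  next
    fix D assume "D \<in> {D \<in> E. f k D \<noteq> 0}"
    then have "D \<in> E" "f k D \<noteq> 0" by auto
    then show "D \<in> {dcoset TT h | h. h \<in> ?C \<and> \<psi> (act (ginv h) (ell k)) \<noteq> 0}" using rp[of D] unfolding f_def by blast
  qed
  have finE: "finite {D \<in> E. f k D \<noteq> 0}" for k using fin[of k] unfolding supp .
  have zeroE: "(\<Sum>D\<in>{D \<in> E. f k D \<noteq> 0}. w D * f k D) = 0" for k
    using zero[of k] unfolding supp w_def f_def rp_def .
  \<comment> \<open>Any exponent with p^(v+1) > |n a| > 0 serves; this one does because p^m >
    m.\<close>
  define v where "v = nat \<bar>int ?n * a\<bar>"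
  have v: "\<not> int p ^ Suc v dvd int ?n * a"
  proof
    assume "int p ^ Suc v dvd int ?n * a"
    then have "\<bar>int p ^ Suc v\<bar> \<le> \<bar>int ?n * a\<bar>" using a0 by (intro dvd_imp_le_int) (auto simp: a_def)
    moreover have "int (Suc v) < int (p ^ Suc v)" using power_gt_expt[of p "Suc v"] p1 by (simp only: of_nat_less_iff)
    ultimately show False by (simp add: v_def)
  qed
  have ppow: "\<exists>i. wt h = p ^ i" if "h \<in> ?C" for h using wt_prime_power[OF that p] .
  define B where "B = {D \<in> E. \<not> p ^ Suc v dvd wt (rp D)}"
  have BE: "B \<subseteq> E" by (auto simp: B_def)
  have Bw: "wt (rp D) \<le> p ^ v" if DB: "D \<in> B" for D
  proof -
    obtain i where i: "wt (rp D) = p ^ i" using ppow[OF rp(1)[OF subsetD[OF BE DB]]] by blast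
    have "\<not> Suc v \<le> i" using that le_imp_power_dvd[of "Suc v" i p] unfolding B_def by (auto simp: i)
    then show ?thesis unfolding i using p1 by (intro power_increasing) auto
  qed
  define z where "z j = (mat 1 :: 'a^'n^'n, PZ j :: 'a^'n^'n)" for j
  have zZ: "z j \<in> ZZ" for j unfolding z_def by (rule shift_ZZ)
  have zC: "z j \<in> ?C" for j using zZ ZZ_carrier by blast
  define \<sigma> where "\<sigma> j D = dcoset TT (z j \<star> rp D)" for j D
  have \<sigma>_d: "\<sigma> j (dcoset TT h) = dcoset TT (z j \<star> h)" if "h \<in> ?C" for j h
    unfolding \<sigma>_def rp_def
  proof (rule dcoset_rep_cong[where \<Phi> = "\<lambda>h. dcoset TT (z j \<star> h)", OF _ that])
    fix t g u :: "('a, 'n) mat2" assume t: "t \<in> TT" and g: "g \<in> ?C" and u: "u \<in> KK"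
    have zt: "z j \<star> t = t \<star> z j" using t TT_ZZ zZ ZZ_commute by blast
    have "z j \<star> (t \<star> g \<star> u) = z j \<star> t \<star> (g \<star> u)" using zC TC[OF t] g KC[OF u] by (simp add: m_assoc)
    also have "\<dots> = t \<star> (z j \<star> g) \<star> u" unfolding zt using zC TC[OF t] g KC[OF u] by (simp add: m_assoc)
    finally show "dcoset TT (z j \<star> (t \<star> g \<star> u)) = dcoset TT (z j \<star> g)"
      using dcoset_eq[OF subgroup_TT m_closed[OF zC[of j] g] t u] by simp
  qed
  have wtz: "wt (z j \<star> h) = wt h" if "h \<in> ?C" for j h
    using wt_ZZ[OF that zZ K.one_closed] that zC by simp
  have degz: "deg2 (z j \<star> h) = deg2 h + j" if "h \<in> ?C" for j h
  proof -
    have "deg2 (z j) = j" using val_powi[of 0, where ?'a = 'a] by (simp add: deg2_def z_def val_det_PZ)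
    then show ?thesis using deg2_mult[OF zC that] by simp
  qed
  have zz: "z i \<star> (z j \<star> h) = z (i + j) \<star> h" for i j h
    unfolding z_def mult_GLxGL by (simp add: PZ_add matrix_mul_assoc)
  have z0: "z 0 \<star> h = h" for h unfolding z_def mult_GLxGL by (simp add: PZ_0)
  have \<sigma>E: "\<sigma> j D \<in> E" if "D \<in> E" for j D unfolding \<sigma>_def E_def using rp(1)[OF that] zC by blast
  have dg\<sigma>: "dg (\<sigma> j D) = dg D + j" if "D \<in> E" for j D
    using dg_d[OF m_closed[OF zC[of j] rp(1)[OF that]]] degz[OF rp(1)[OF that]] unfolding \<sigma>_def by (simp add: dg_def)
  have w\<sigma>: "w (\<sigma> j D) = w D" if "D \<in> E" for j D
    using w_d[OF m_closed[OF zC[of j] rp(1)[OF that]]] wtz[OF rp(1)[OF that]] unfolding \<sigma>_def by (simp add: w_def)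
  have \<sigma>B: "\<sigma> j D \<in> B" if "D \<in> B" for j D
    using \<sigma>E[of D j] w\<sigma>[of D j] that unfolding B_def w_def by simp
  have \<sigma>\<sigma>: "\<sigma> (- j) (\<sigma> j D) = D" if "D \<in> E" for j D
    using \<sigma>_d[OF m_closed[OF zC[of j] rp(1)[OF that]], of "- j"] rp(2)[OF that] unfolding \<sigma>_def[of j] zz by (simp add: z0)
  obtain c0 where c0: "\<And>h :: ('a, 'n) mat2. h \<in> carrier GLxGL \<Longrightarrow> wt h \<le> p ^ v \<Longrightarrow>
      (\<forall>k. c0 \<le> int ?n * int k + 1 + deg2 h \<longrightarrow> bnd \<rho> (fst (act (ginv h) (ell k)))) \<and>
      (\<forall>k. c0 \<le> - deg2 h \<longrightarrow> bnd \<rho> (snd (act (ginv h) (ell k))))"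
    using wt_small[OF \<rho>(1), of "p ^ v", where ?'a = 'a and ?'n = 'n] by blast
  define c where "c = max c0 0"
  \<comment> \<open>Large enough that n k + 1 + d is at least c for d > - c, and n (k + 1) + 1 + d
    is at least c for d > - c - n.\<close>
  define k where "k = Suc (nat (2 * c))"
  have n1: "1 \<le> int ?n" by (simp add: Suc_le_eq)
  have "1 * (2 * c) \<le> int ?n * (2 * c)" using n1 by (intro mult_right_mono) (simp_all add: c_def)
  then have big: "2 * c + int ?n \<le> int ?n * int k" by (simp add: k_def c_def algebra_simps)
  have bigS: "int ?n * int (Suc k) = int ?n * int k + int ?n" by (simp add: algebra_simps)
  have drop: "\<psi> (x, Y) = \<psi> (0, Y)" if "bnd \<rho> x" for x Y using that \<rho> by (intro \<rho>(2)) (auto intro: bnd_0 less_imp_le)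
  have drop': "\<psi> (x, Y) = \<psi> (x, 0)" if "bnd \<rho> Y" for x Y using that \<rho> by (intro \<rho>(2)) (auto intro: bnd_0 less_imp_le)
  have psi: "\<psi> y = \<psi> (fst y, snd y)" for y by simp
  have snd_eq: "snd (act (ginv h) (ell i)) = snd (act (ginv h) (ell j))" if "h \<in> ?C" for h i j unfolding act_ell[OF that] by simp
  have main: "(\<Sum>D\<in>{D \<in> B. f (Suc k) D \<noteq> 0}. w D * f (Suc k) D) - (\<Sum>D\<in>{D \<in> B. f k D \<noteq> 0}. w D * f k D)
    = int ?n * a * (\<Sum>D\<in>{D \<in> B. dg D = 0}. w D)"
  proof (rule shift_count[where \<sigma> = \<sigma> and c = c])
    fix D assume D: "D \<in> B"
    then have DE: "D \<in> E" using BE by blast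
    note sm = c0[OF rp(1)[OF DE] Bw[OF D]]
    \<comment> \<open>Both first components are negligible, and the second component does not depend
      on k.\<close>
    { assume dc: "- c < dg D"
      have "c0 \<le> int ?n * int k + 1 + dg D" "c0 \<le> int ?n * int (Suc k) + 1 + dg D"
        using big dc n1 unfolding bigS by (simp_all add: c_def)
      then have "bnd \<rho> (fst (act (ginv (rp D)) (ell k)))" "bnd \<rho> (fst (act (ginv (rp D)) (ell (Suc k))))"
        using sm unfolding dg_def by blast+
      then show "f (Suc k) D = f k D"
        unfolding f_def psi[of "act _ _"] using drop snd_eq[OF rp(1)[OF DE], of k "Suc k"] by metis }
    { assume dc: "- c - int ?n < dg D" "dg D \<le> - c"
      have "c0 \<le> int ?n * int (Suc k) + 1 + dg D" "c0 \<le> - dg D"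
        using big dc n1 unfolding bigS by (simp_all add: c_def)
      then have "bnd \<rho> (fst (act (ginv (rp D)) (ell (Suc k))))" "bnd \<rho> (snd (act (ginv (rp D)) (ell (Suc k))))"
        using sm unfolding dg_def by blast+
      then show "f (Suc k) D = a" unfolding f_def a_def psi[of "act _ _"] using drop drop' by metis }
    \<comment> \<open>Multiplying h_2 by Pi^n turns the first component for k into the one for k +
      1; the second components are negligible before and after the shift.\<close>
    { assume dc: "dg D \<le> - c - int ?n"
      let ?h = "rp D" and ?g = "z (int ?n) \<star> rp D"
      have gC: "?g \<in> ?C" using rp(1)[OF DE] zC by simp
      have gw: "wt ?g \<le> p ^ v" using wtz[OF rp(1)[OF DE]] Bw[OF D] by simp
      have "c0 \<le> - deg2 ?h" "c0 \<le> - deg2 ?g" using dc n1 unfolding degz[OF rp(1)[OF DE]] by (simp_all add: c_def dg_def)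
      then have s: "bnd \<rho> (snd (act (ginv ?h) (ell (Suc k))))" "bnd \<rho> (snd (act (ginv ?g) (ell k)))"
        using sm c0[OF gC gw] by blast+
      have "fst (act (ginv ?g) (ell k)) = fst (act (ginv ?h) (ell (Suc k)))"
      proof -
        have "PZ (int ?n * int (Suc k) + 1) = (PZ (int ?n * int k + 1) ** PZ (int ?n) :: 'a^'n^'n)"
          unfolding PZ_add [symmetric] by (simp add: algebra_simps)
        then show ?thesis unfolding act_ell[OF gC] act_ell[OF rp(1)[OF DE]]
          by (simp add: z_def mult_GLxGL matrix_mul_assoc)
      qed
      then have "\<psi> (act (ginv ?h) (ell (Suc k))) = \<psi> (act (ginv ?g) (ell k))"
        unfolding psi[of "act _ _"] using drop' s by metis
      then show "f (Suc k) D = f k (\<sigma> (int ?n) D)"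
        unfolding \<sigma>_def using f_d[OF gC] by (simp add: f_def) }
    fix j
    show "\<sigma> j D \<in> B" "\<sigma> (- j) (\<sigma> j D) = D" "dg (\<sigma> j D) = dg D + j" "w (\<sigma> j D) = w D"
      using \<sigma>B[OF D] \<sigma>\<sigma>[OF DE] dg\<sigma>[OF DE] w\<sigma>[OF DE] by auto
  next
    show "finite {D \<in> B. f k D \<noteq> 0}" "finite {D \<in> B. f (Suc k) D \<noteq> 0}"
      using BE by (auto intro: finite_subset[OF _ finE])
    fix d
    have "{D \<in> B. dg D = d} \<subseteq> {dcoset TT h | h :: ('a, 'n) mat2. h \<in> carrier GLxGL \<and> wt h \<le> p ^ v \<and> deg2 h = d}"
    proof
      fix D assume "D \<in> {D \<in> B. dg D = d}"
      then have D: "D \<in> B" "D \<in> E" "deg2 (rp D) = d" using BE by (auto simp: dg_def)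
      then show "D \<in> {dcoset TT h | h :: ('a, 'n) mat2. h \<in> carrier GLxGL \<and> wt h \<le> p ^ v \<and> deg2 h = d}"
        using rp[OF D(2)] Bw[OF D(1)] by blast
    qed
    then show "finite {D \<in> B. dg D = d}" by (rule finite_subset[OF _ finite_level])
  qed
  \<comment> \<open>The full sum vanishes and the omitted terms carry weights divisible by
    p^(v+1).\<close>
  have dvdB: "int p ^ Suc v dvd (\<Sum>D\<in>{D \<in> B. f i D \<noteq> 0}. w D * f i D)" for i
  proof -
    let ?B' = "{D \<in> E. f i D \<noteq> 0 \<and> D \<notin> B}"
    have "(\<Sum>D\<in>{D \<in> E. f i D \<noteq> 0}. w D * f i D) = (\<Sum>D\<in>{D \<in> B. f i D \<noteq> 0} \<union> ?B'. w D * f i D)"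
      using BE by (intro sum.cong) auto
    also have "\<dots> = (\<Sum>D\<in>{D \<in> B. f i D \<noteq> 0}. w D * f i D) + (\<Sum>D\<in>?B'. w D * f i D)"
      using BE by (intro sum.union_disjoint finite_subset[OF _ finE[of i]]) auto
    finally have "(\<Sum>D\<in>{D \<in> B. f i D \<noteq> 0}. w D * f i D) = - (\<Sum>D\<in>?B'. w D * f i D)" using zeroE[of i] by simp
    moreover have "int p ^ Suc v dvd (\<Sum>D\<in>?B'. w D * f i D)"
    proof (rule dvd_sum)
      fix D assume "D \<in> ?B'"
      then have "p ^ Suc v dvd wt (rp D)" unfolding B_def by blast
      then have "int (p ^ Suc v) dvd w D" unfolding w_def by (simp only: of_nat_dvd_iff)
      then show "int p ^ Suc v dvd w D * f i D" by (simp only: of_nat_power dvd_mult2)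
    qed
    ultimately show ?thesis by simp
  qed
  have dvd: "int p ^ Suc v dvd int ?n * a * (\<Sum>D\<in>{D \<in> B. dg D = 0}. w D)"
    unfolding main [symmetric] using dvdB by (intro dvd_diff)
  define D1 where "D1 = dcoset TT (mat 1, mat 1 :: 'a^'n^'n)"
  have oC: "(mat 1, mat 1) \<in> ?C" by (simp add: carrier_GLxGL invertible_mat)
  have D1: "D1 \<in> E" "w D1 = 1" "dg D1 = 0"
    using w_d[OF oC] dg_d[OF oC] oC unfolding D1_def by (auto simp: E_def wt_one deg2_def)
  have D1B: "D1 \<in> B" using D1 p1 unfolding B_def w_def by auto
  have finL: "finite {D \<in> B. dg D = 0}"
  proof -
    have "D \<in> {dcoset TT h | h :: ('a, 'n) mat2. h \<in> carrier GLxGL \<and> wt h \<le> p ^ v \<and> deg2 h = 0}" if "D \<in> B" "dg D = 0" for D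
      using rp[of D] Bw[of D] that BE unfolding dg_def by blast
    then have "{D \<in> B. dg D = 0} \<subseteq> {dcoset TT h | h :: ('a, 'n) mat2. h \<in> carrier GLxGL \<and> wt h \<le> p ^ v \<and> deg2 h = 0}" by blast
    then show ?thesis by (rule finite_subset[OF _ finite_level])
  qed
  \<comment> \<open>A weight that is a power of p and not divisible by p is 1, which on level 0
    occurs only for the trivial double coset.\<close>
  have "int p dvd (\<Sum>D\<in>{D \<in> B. dg D = 0} - {D1}. w D)"
  proof (rule dvd_sum)
    fix D assume D: "D \<in> {D \<in> B. dg D = 0} - {D1}"
    then have DE: "D \<in> E" using BE by blast
    obtain i where i: "wt (rp D) = p ^ i" using ppow rp(1)[OF DE] by blast
    have "i \<noteq> 0"
    proof
      assume "i = 0"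
      then have "wt (rp D) = 1" using i by simp
      then have "dcoset TT (rp D) = D1" unfolding D1_def using D by (intro unique_level rp(1)[OF DE]) (auto simp: dg_def)
      then show False using rp(2)[OF DE] D by simp
    qed
    then show "int p dvd w D" unfolding w_def i by simp
  qed
  moreover have "(\<Sum>D\<in>{D \<in> B. dg D = 0}. w D) = 1 + (\<Sum>D\<in>{D \<in> B. dg D = 0} - {D1}. w D)"
    using sum.remove[OF finL, of D1 w] D1 D1B by simp
  ultimately have "int p dvd (\<Sum>D\<in>{D \<in> B. dg D = 0}. w D) \<longleftrightarrow> int p dvd 1" by (simp only: dvd_add_left_iff)
  then have "\<not> int p dvd (\<Sum>D\<in>{D \<in> B. dg D = 0}. w D)" using p1 by simp
  then have "coprime (int p ^ Suc v) (\<Sum>D\<in>{D \<in> B. dg D = 0}. w D)"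
    using p(1) by (intro coprime_power_left_iff[THEN iffD2] disjI1) (auto intro!: prime_imp_coprime)
  then have "int p ^ Suc v dvd int ?n * a" using dvd by (simp only: coprime_dvd_mult_left_iff)
  then show False using v by simp
qed

section \<open>Smooth functions of compact support\<close>

text \<open>The product of the two components of h^-1 x_k is h_1^-1 Pi^(nk+1) h_1, so a bound on
  both of them bounds the conjugates of Pi by h_1 and \<open>normalize_lattice_PZ\<close> applies.
  The bounds on the components then carry over to h_2 after multiplication by the same power of
  Pi.\<close>

lemma finite_support_mod_TT:
  assumes R: "1 \<le> R"
  shows "\<exists>Hs :: ('a::nonarch_local_field_0, 'n::finite) mat2 set. finite Hs \<and> Hs \<subseteq> carrier GLxGL \<and>
    (\<forall>h\<in>carrier GLxGL. bnd R (fst (act (ginv h) (ell k))) \<and> bnd R (snd (act (ginv h) (ell k))) \<longrightarrow>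
      (\<exists>h'\<in>Hs. rco TT h \<in> dcoset TT h'))"
proof -
  let ?w = "uniformizer :: 'a" and ?n = "CARD('n)"
  define N where "N = int ?n * int k + 1"
  define b where "b = inverse (absval ?w) ^ k * (R * R)"
  define r where "r = b ^ ?n"
  have w1: "1 \<le> inverse (absval ?w)" by (simp add: one_le_inverse less_imp_le)
  have RR: "1 \<le> R * R" using R by (metis mult_mono' mult_1 zero_le_one order_trans)
  have b1: "1 \<le> b" unfolding b_def using mult_mono[OF one_le_power[OF w1, of k] RR] R by simp
  have r1: "1 \<le> r" unfolding r_def using b1 by (rule one_le_power)
  obtain s0 where s0: "1 \<le> s0" "bnd s0 (PZ (- N) :: 'a^'n^'n)" using exists_bnd by blast
  \<comment> \<open>Covers g_1^-1 (bound r), g_2 (bound s0 R) and g_2^-1 (bound R r), while g_1 is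
    integral.\<close>
  define M where "M = max r (max (s0 * R) (R * r))"
  obtain S :: "('a^'n^'n) set" where S: "finite S" "\<And>g. invertible g \<Longrightarrow> bnd M g \<Longrightarrow> bnd M (matrix_inv g) \<Longrightarrow> \<exists>s\<in>S. invertible s \<and> matrix_inv s ** g \<in> GLO"
    using finite_mod_GLO[of M, where ?'a = 'a and ?'n = 'n] by blast
  let ?Hs = "{h \<in> S \<times> S. invertible (fst h) \<and> invertible (snd h)}"
  have "\<exists>h'\<in>?Hs. rco TT h \<in> dcoset TT h'"
    if h: "h \<in> carrier GLxGL" and bx: "bnd R (fst (act (ginv h) (ell k)))" and bY: "bnd R (snd (act (ginv h) (ell k)))"
    for h :: "('a, 'n) mat2"
  proof -
    define h1 h2 where "h1 = fst h" and "h2 = snd h"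
    have hi: "invertible h1" "invertible h2" using h by (auto simp: carrier_GLxGL h1_def h2_def)
    have x: "bnd R (matrix_inv h1 ** PZ N ** h2)" and y: "bnd R (matrix_inv h2 ** h1)"
      using bx bY unfolding act_ell[OF h] by (simp_all add: N_def h1_def h2_def)
    have "matrix_inv h1 ** PZ N ** h2 ** (matrix_inv h2 ** h1) = matrix_inv h1 ** PZ N ** (h2 ** matrix_inv h2) ** h1"
      by (simp only: matrix_mul_assoc)
    then have cN: "bnd (R * R) (matrix_inv h1 ** PZ N ** h1)"
      using bnd_mult[OF x y] hi by (simp add: matrix_inv_props)
    have "bnd (inverse (absval ?w) ^ k * (R * R)) (mat (inverse ?w ^ k) ** (matrix_inv h1 ** PZ N ** h1))"
      by (intro bnd_mult bnd_mat cN) (simp add: absval_power absval_inverse)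
    moreover have "mat (inverse ?w ^ k) ** (matrix_inv h1 ** PZ N ** h1) = matrix_inv h1 ** PZ 1 ** h1"
    proof -
      have "mat (inverse ?w ^ k) ** (matrix_inv h1 ** PZ N ** h1) = matrix_inv h1 ** (mat (inverse ?w ^ k) ** PZ N) ** h1"
        unfolding matrix_mul_assoc mat_mult_commute[of "inverse ?w ^ k" "matrix_inv h1"] ..
      also have "mat (inverse ?w ^ k) ** PZ N = (mat (inverse ?w ^ k) ** mat (?w ^ k) ** PZ 1 :: 'a^'n^'n)"
        unfolding N_def PZ_add PZ_CARD by (simp add: matrix_mul_assoc)
      also have "\<dots> = PZ 1" by (simp add: mat_mult_mat power_mult_distrib [symmetric])
      finally show ?thesis .
    qed
    ultimately have c1: "bnd b (matrix_inv h1 ** PZ 1 ** h1)" unfolding b_def by simp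
    have cj: "bnd (b ^ j) (matrix_inv h1 ** PZ (int j) ** h1)" for j
    proof (induction j)
      case 0
      show ?case using hi by (simp add: PZ_0 matrix_inv_props bnd_mat)
    next
      case (Suc j)
      have "matrix_inv h1 ** PZ (int j) ** h1 ** (matrix_inv h1 ** PZ 1 ** h1) = matrix_inv h1 ** PZ (int j) ** (h1 ** matrix_inv h1) ** PZ 1 ** h1"
        by (simp only: matrix_mul_assoc)
      also have "\<dots> = matrix_inv h1 ** (PZ (int j) ** PZ 1) ** h1" using hi by (simp add: matrix_inv_props matrix_mul_assoc)
      also have "PZ (int j) ** PZ 1 = (PZ (int (Suc j)) :: 'a^'n^'n)" unfolding PZ_add [symmetric] by (simp add: add.commute)
      finally show ?case using bnd_mult[OF Suc c1] by (simp add: mult.commute)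
    qed
    have "bnd r (matrix_inv h1 ** PZ (int j) ** h1)" if "j < ?n" for j
      unfolding r_def using b1 that by (intro bnd_mono[OF cj[of j]] power_increasing) auto
    then obtain v where v: "bnd 1 (PZ v ** h1)" "bnd r (matrix_inv (PZ v ** h1))" using normalize_lattice_PZ[OF hi(1)] by blast
    define g1 g2 where "g1 = PZ v ** h1" and "g2 = PZ v ** h2"
    have gi: "invertible g1" "invertible g2" using hi by (simp_all add: g1_def g2_def invertible_mult invertible_PZ)
    have "PZ (- N) ** g1 ** (matrix_inv h1 ** PZ N ** h2) = g2"
    proof -
      have "PZ (- N) ** g1 ** (matrix_inv h1 ** PZ N ** h2) = PZ (- N) ** PZ v ** (h1 ** matrix_inv h1) ** PZ N ** h2"
        unfolding g1_def by (simp only: matrix_mul_assoc)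
      also have "\<dots> = (PZ (- N) ** PZ v ** PZ N) ** h2" using hi by (simp add: matrix_inv_props)
      also have "PZ (- N) ** PZ v ** PZ N = (PZ v :: 'a^'n^'n)" unfolding PZ_add [symmetric] by simp
      finally show ?thesis by (simp add: g2_def)
    qed
    then have bg2: "bnd (s0 * 1 * R) g2" using bnd_mult[OF bnd_mult[OF s0(2) v(1)] x] by (simp add: g1_def)
    have "(matrix_inv h2 ** h1) ** matrix_inv g1 = matrix_inv g2"
    proof -
      have "(matrix_inv h2 ** h1) ** matrix_inv g1 = matrix_inv h2 ** (h1 ** matrix_inv h1) ** matrix_inv (PZ v)"
        unfolding g1_def using hi by (simp add: matrix_inv_mult invertible_PZ matrix_mul_assoc)
      then show ?thesis unfolding g2_def using hi by (simp add: matrix_inv_mult invertible_PZ matrix_inv_props)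
    qed
    then have bg2': "bnd (R * r) (matrix_inv g2)" using bnd_mult[OF y v(2)] by (simp add: g1_def)
    have rM: "r \<le> M" "1 \<le> M" "s0 * 1 * R \<le> M" "R * r \<le> M" using r1 by (auto simp: M_def)
    obtain s1 where s1: "s1 \<in> S" "invertible s1" "matrix_inv s1 ** g1 \<in> GLO"
      using S(2)[OF gi(1)] v bnd_mono rM unfolding g1_def by blast
    obtain s2 where s2: "s2 \<in> S" "invertible s2" "matrix_inv s2 ** g2 \<in> GLO"
      using S(2)[OF gi(2)] bg2 bg2' bnd_mono rM by blast
    have "PZ (- v) ** (PZ v ** A) = A" for A :: "'a^'n^'n"
      using PZ_inverse[of "- v", where ?'a = 'a and ?'n = 'n] by (simp add: matrix_mul_assoc)
    then have "h = (PZ (- v) ** g1, PZ (- v) ** g2)" by (simp add: g1_def g2_def h1_def h2_def)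
    then have "dcoset TT h = dcoset TT (s1, s2)"
      using dcoset_TT_normal[OF gi s1(2) s2(2) s1(3) s2(3), of "- v" "- v"] by (simp add: PZ_0)
    then have "rco TT h \<in> dcoset TT (s1, s2)" using rco_in_dcoset_self[OF subgroup_TT h] by simp
    then show ?thesis using s1 s2 by (intro bexI[of _ "(s1, s2)"]) auto
  qed
  moreover have "finite ?Hs" by (rule finite_subset[OF _ finite_cartesian_product[OF S(1) S(1)]]) blast
  moreover have "?Hs \<subseteq> carrier GLxGL" using carrier_GLxGL by blast
  ultimately show ?thesis by (intro exI[of _ ?Hs]) blast
qed

text \<open>A Lebesgue number of the cover of the compact support by open sets of constancy; outside
  the support both values vanish or the other point can be used as centre.\<close>

lemma Cc_infinity_uniform:
  fixes \<phi> :: "('a::nonarch_local_field_0, 'n::finite) mat2 \<Rightarrow> complex"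
  assumes "\<phi> \<in> Cc_infinity"
  shows "\<exists>\<rho>>0. \<forall>x x' Y Y'. bnd \<rho> (x - x') \<longrightarrow> bnd \<rho> (Y - Y') \<longrightarrow> \<phi> (x, Y) = \<phi> (x', Y')"
proof -
  let ?S = "closure {x. \<phi> x \<noteq> 0}" and ?G = "{U. open U \<and> (\<forall>x\<in>U. \<forall>y\<in>U. \<phi> x = \<phi> y)}"
  have lc: "\<exists>U. open U \<and> x \<in> U \<and> (\<forall>y\<in>U. \<phi> y = \<phi> x)" for x using assms unfolding Cc_infinity_def by blast
  have S: "compact ?S" using assms unfolding Cc_infinity_def by blast
  have "x \<in> \<Union>?G" for x
  proof -
    obtain U where U: "open U" "x \<in> U" "\<forall>y\<in>U. \<phi> y = \<phi> x" using lc by blast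
    have "\<forall>a\<in>U. \<forall>b\<in>U. \<phi> a = \<phi> b" using U(3) by metis
    then have "U \<in> ?G" using U(1) by blast
    then show ?thesis using U(2) by blast
  qed
  then have "?S \<subseteq> \<Union>?G" by blast
  then obtain e where e: "0 < e" "\<And>x. x \<in> ?S \<Longrightarrow> \<exists>U\<in>?G. ball x e \<subseteq> U"
    using Heine_Borel_lemma[OF S, of ?G] by blast
  have near: "\<phi> x = \<phi> y" if "x \<in> ?S" "dist x y < e" for x y
  proof -
    obtain U where "U \<in> ?G" "ball x e \<subseteq> U" using e(2)[OF \<open>x \<in> ?S\<close>] by blast
    moreover have "x \<in> ball x e" "y \<in> ball x e" using e(1) that(2) by simp_all
    ultimately show ?thesis by blast
  qed
  have unif: "\<phi> x = \<phi> y" if d: "dist x y < e" for x y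
  proof -
    have "\<phi> z = 0" if "z \<notin> ?S" for z using that closure_subset[of "{x. \<phi> x \<noteq> 0}"] by blast
    then show ?thesis using near[OF _ d] near[of y x] d by (metis dist_commute)
  qed
  \<comment> \<open>A sup norm bound \<rho> gives a distance of at most n^2 \<rho> = e/4 in each of
    the two components.\<close>
  define \<rho> where "\<rho> = e / (4 * (real CARD('n) * real CARD('n)))"
  have n0: "0 < real CARD('n) * real CARD('n)" by simp
  have \<rho>0: "0 < \<rho>" unfolding \<rho>_def using e(1) n0 by simp
  have n\<rho>: "real CARD('n) * (real CARD('n) * \<rho>) = e / 4" by (simp add: \<rho>_def)
  have "\<phi> (x, Y) = \<phi> (x', Y')" if "bnd \<rho> (x - x')" "bnd \<rho> (Y - Y')" for x x' Y Y'
  proof (rule unif)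
    have "dist (x, Y) (x', Y') \<le> dist x x' + dist Y Y'" unfolding dist_Pair_Pair by (rule sqrt_sum_squares_le_sum) simp_all
    also have "\<dots> \<le> e / 4 + e / 4" using dist_of_bnd[OF that(1)] dist_of_bnd[OF that(2)] unfolding n\<rho> by (rule add_mono)
    finally show "dist (x, Y) (x', Y') < e" using e(1) by simp
  qed
  then show ?thesis using \<rho>0 by blast
qed

lemma Cc_infinity_bounded:
  fixes \<phi> :: "('a::nonarch_local_field_0, 'n::finite) mat2 \<Rightarrow> complex"
  assumes "\<phi> \<in> Cc_infinity"
  shows "\<exists>R\<ge>1. \<forall>y. \<phi> y \<noteq> 0 \<longrightarrow> bnd R (fst y) \<and> bnd R (snd y)"
proof -
  have "bounded (closure {x. \<phi> x \<noteq> 0})" using assms unfolding Cc_infinity_def by (blast intro: compact_imp_bounded)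
  then obtain e where e: "\<And>y. y \<in> closure {x. \<phi> x \<noteq> 0} \<Longrightarrow> dist (0, 0) y \<le> e"
    unfolding bounded_any_center[where a = "(0, 0)"] by blast
  have "bnd (max e 1) (fst y) \<and> bnd (max e 1) (snd y)" if "\<phi> y \<noteq> 0" for y
  proof -
    have d: "dist y (0, 0) \<le> e" using e[of y] that closure_subset[of "{x. \<phi> x \<noteq> 0}"] by (auto simp: dist_commute)
    have "dist (fst y) 0 \<le> max e 1" "dist (snd y) 0 \<le> max e 1"
      using dist_fst_le[of y "(0, 0)"] dist_snd_le[of y "(0, 0)"] d by auto
    then show ?thesis using bnd_of_dist[of "fst y" 0] bnd_of_dist[of "snd y" 0] by (auto intro: bnd_mono)
  qed
  then show ?thesis by (intro exI[of _ "max e 1"]) auto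
qed

lemma act_KK_bnd:
  fixes k y :: "('a::nonarch_local_field_0, 'n::finite) mat2"
  assumes k: "k \<in> KK" and y: "bnd R (fst y)" "bnd R (snd y)"
  shows "bnd R (fst (act k y))" "bnd R (snd (act k y))"
proof -
  have G: "bnd 1 (fst k)" "bnd 1 (snd k)" "bnd 1 (matrix_inv (fst k))" "bnd 1 (matrix_inv (snd k))"
    using k unfolding KK_def GLO_def by auto
  show "bnd R (fst (act k y))" "bnd R (snd (act k y))"
    using bnd_mult[OF bnd_mult[OF G(1) y(1)] G(4)] bnd_mult[OF bnd_mult[OF G(2) y(2)] G(3)] by (simp_all add: act_def)
qed

lemma act_diff:
  "fst (act h y) - fst (act h y') = fst (act h (y - y'))" "snd (act h y) - snd (act h y') = snd (act h (y - (y' :: ('a::nonarch_local_field_0, 'n::finite) mat2)))"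
  by (simp_all add: act_def matrix_mult_diff_ldistrib matrix_mult_diff_rdistrib)

lemma act_zero: "act h (0, 0) = (0, 0 :: 'a::nonarch_local_field_0^'n^'n)"
proof -
  have "A ** 0 = 0" "0 ** A = 0" for A :: "'a^'n^'n" by (simp_all add: matrix_matrix_mult_def vec_eq_iff)
  then show ?thesis by (simp add: act_def)
qed

lemma act_QQ_near:
  fixes q y :: "('a::nonarch_local_field_0, 'n::finite) mat2"
  assumes q: "q \<in> QQ r" and r: "0 \<le> r" "r < 1" and y: "bnd R (fst y)" "bnd R (snd y)"
  shows "bnd (r * R) (fst (act q y) - fst y)" "bnd (r * R) (snd (act q y) - snd y)"
proof -
  have qK: "q \<in> KK" using q QQ_KK[OF r(2)] by blast
  have "ginv q \<in> QQ r" using q subgroup.m_inv_closed[OF subgroup_QQ[OF r]] by blast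
  then have iq: "bnd r (matrix_inv (fst q) - mat 1)" "bnd r (matrix_inv (snd q) - mat 1)"
    unfolding inv_GLxGL[OF KK_carrier[OF qK]] by (simp_all add: QQ_def)
  have q1: "bnd r (fst q - mat 1)" "bnd r (snd q - mat 1)" using q by (simp_all add: QQ_def)
  have qi: "bnd 1 (matrix_inv (fst q))" "bnd 1 (matrix_inv (snd q))" using qK unfolding KK_def GLO_def by auto
  have "bnd (r * R) (A ** Z ** B - Z)"
    if "bnd r (A - mat 1)" "bnd r (B - mat 1)" "bnd 1 B" "bnd R Z" for A B Z :: "'a^'n^'n"
  proof -
    have "A ** Z ** B - Z = (A - mat 1) ** Z ** B + Z ** (B - mat 1)"
      by (simp add: matrix_mult_diff_ldistrib matrix_mult_diff_rdistrib)
    moreover have "bnd (r * R * 1) ((A - mat 1) ** Z ** B)" by (intro bnd_mult that)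
    moreover have "bnd (R * r) (Z ** (B - mat 1))" by (intro bnd_mult that)
    ultimately show ?thesis by (simp add: bnd_add mult.commute)
  qed
  then show "bnd (r * R) (fst (act q y) - fst y)" "bnd (r * R) (snd (act q y) - snd y)"
    using q1 iq qi y by (simp_all add: act_def)
qed

text \<open>The complex numbers are a rational vector space, and a nonzero vector extends to a
  basis.\<close>

lemma exists_rat_functional:
  assumes "u \<noteq> (0 :: complex)"
  shows "\<exists>l :: complex \<Rightarrow> rat. l u = 1 \<and> (\<forall>x y. l (x + y) = l x + l y) \<and> (\<forall>q x. l (of_rat q * x) = q * l x)"
proof -
  interpret V: vector_space_pair "\<lambda>(q :: rat) (z :: complex). of_rat q * z" "(*) :: rat \<Rightarrow> rat \<Rightarrow> rat"
    by unfold_locales (auto simp: algebra_simps of_rat_add of_rat_mult)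
  have "V.vs1.independent {u}" using assms by (simp add: V.vs1.dependent_single)
  then obtain l where l: "Vector_Spaces.linear (\<lambda>(q :: rat) (z :: complex). of_rat q * z) (*) l" "l u = 1"
    using V.linear_independent_extend[of "{u}" "\<lambda>_. 1"] by auto
  then interpret L: Vector_Spaces.linear "\<lambda>(q :: rat) (z :: complex). of_rat q * z" "(*)" l by simp
  show ?thesis using l(2) L.add L.scale by blast
qed

lemma common_denominator:
  assumes "finite (A :: rat set)"
  shows "\<exists>d :: int. d \<noteq> 0 \<and> (\<forall>q\<in>A. \<exists>m. of_int d * q = of_int m)"
  using assms
proof induction
  case (insert q A)
  then obtain d where d: "d \<noteq> 0" "\<forall>q\<in>A. \<exists>m. of_int d * q = of_int m" by blast
  obtain a b where ab: "quotient_of q = (a, b)" by fastforce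
  have b: "0 < b" "q = of_int a / of_int b" using quotient_of_denom_pos[OF ab] quotient_of_div[OF ab] by auto
  have "\<exists>m. of_int (b * d) * x = of_int m" if x: "x \<in> insert q A" for x
  proof (cases "x = q")
    case True
    then have "of_int (b * d) * x = of_int (a * d)" using b by simp
    then show ?thesis ..
  next
    case False
    then obtain m where "of_int d * x = of_int m" using d x by blast
    then have "of_int (b * d) * x = of_int (b * m)" by simp
    then show ?thesis ..
  qed
  then show ?case using d b by (intro exI[of _ "b * d"]) auto
qed (auto intro: exI[of _ 1])

text \<open>Division by the measure of the trivial double coset turns measures into weights. The
  measures for different \<open>k\<close> therefore need no common normalization.\<close>

lemma weighted_sum_vanish:
  fixes \<phi> :: "('a::nonarch_local_field_0, 'n::finite) mat2 \<Rightarrow> complex"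
  assumes \<mu>: "invariant_coset_measure TT \<mu>" and O0: "Orb \<mu> \<phi> (ell k) = 0"
    and r: "0 < r" "r < 1" and \<phi>: "\<And>q y. q \<in> QQ r \<Longrightarrow> \<phi> (act q y) = \<phi> y"
    and R: "finite R" "R \<subseteq> KK" "\<And>k y. k \<in> KK \<Longrightarrow> (\<Sum>s\<in>R. \<phi> (act s (act k y))) = (\<Sum>s\<in>R. \<phi> (act s y))"
    and Hs: "finite Hs" "Hs \<subseteq> carrier GLxGL"
    and supp: "\<And>h. h \<in> carrier GLxGL \<Longrightarrow> \<phi> (act (ginv h) (ell k)) \<noteq> 0 \<Longrightarrow> \<exists>h'\<in>Hs. rco TT h \<in> dcoset TT h'"
  shows "(\<Sum>D\<in>dcoset TT ` Hs. of_nat (wt (dcoset_rep TT D)) * (\<Sum>s\<in>R. \<phi> (act s (act (ginv (dcoset_rep TT D)) (ell k))))) = 0"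
proof -
  let ?f = "\<lambda>D. \<Sum>s\<in>R. \<phi> (act s (act (ginv (dcoset_rep TT D)) (ell k)))"
  define m0 where "m0 = measure \<mu> (dcoset TT (mat 1, mat 1))"
  have "emeasure \<mu> (dcoset TT (mat 1, mat 1)) \<noteq> 0"
    by (rule emeasure_dcoset_one_pos[OF subgroup_TT \<mu>]) (rule TT_conj_KK)
  moreover have "emeasure \<mu> (dcoset TT (mat 1, mat 1)) < \<infinity>" by (rule emeasure_dcoset_one_finite[OF subgroup_TT \<mu>])
  ultimately have m0: "m0 \<noteq> 0" unfolding m0_def measure_def by (auto simp: enn2real_eq_0_iff)
  have meas: "measure \<mu> D = real (wt (dcoset_rep TT D)) * m0" if "D \<in> dcoset TT ` Hs" for D
  proof -
    have D: "dcoset_rep TT D \<in> carrier GLxGL" "dcoset TT (dcoset_rep TT D) = D"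
      using that Hs(2) dcoset_rep by blast+
    have "emeasure \<mu> D = of_nat (wt (dcoset_rep TT D)) * emeasure \<mu> (dcoset TT (mat 1, mat 1))"
      using emeasure_dcoset(2)[OF subgroup_TT \<mu> D(1) TT_conj_KK[OF D(1)]] unfolding D(2) wt_def .
    then show ?thesis unfolding measure_def m0_def by (simp add: enn2real_mult)
  qed
  have "0 = (\<Sum>D\<in>dcoset TT ` Hs. measure \<mu> D *\<^sub>R ?f D)"
    using Orb_sum[where x = "ell k", unfolded stabilizer_ell, OF subgroup_TT \<mu> TT_conj_KK r \<phi> R Hs supp] O0 by simp
  also have "\<dots> = (\<Sum>D\<in>dcoset TT ` Hs. of_real m0 * (of_nat (wt (dcoset_rep TT D)) * ?f D))"
    by (rule sum.cong[OF refl]) (simp add: meas scaleR_conv_of_real mult_ac)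
  also have "\<dots> = of_real m0 * (\<Sum>D\<in>dcoset TT ` Hs. of_nat (wt (dcoset_rep TT D)) * ?f D)"
    by (rule sum_distrib_left [symmetric])
  finally show ?thesis using m0 by simp
qed

theorem theoremA5:
  fixes \<phi> :: "('a::nonarch_local_field_0, 'n::finite) mat2 \<Rightarrow> complex"
    and \<mu> :: "('a, 'n) mat2 \<Rightarrow> ('a, 'n) mat2 set measure"
  assumes "\<And>x. H_regular_semisimple x \<Longrightarrow>
      invariant_coset_measure (stabilizer GLxGL act x) (\<mu> x)"
    and "\<phi> \<in> Cc_infinity"
    and "\<phi> (0, 0) \<noteq> 0"
  shows "\<exists>x. H_regular_elliptic x \<and> Orb (\<mu> x) \<phi> x \<noteq> 0"
proof (rule ccontr)
  assume "\<not> ?thesis"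
  then have Orb0: "Orb (\<mu> x) \<phi> x = 0" if "H_regular_elliptic x" for x using that by blast
  have reg: "H_regular_semisimple (ell k :: ('a, 'n) mat2)" for k
    unfolding ell_def by (rule H_regular_semisimple_cyc) simp_all
  have elliptic: "H_regular_elliptic (ell k :: ('a, 'n) mat2)" for k
    using reg[of k] stabilizer_anisotropic_cyc[of "uniformizer ^ k :: 'a", where ?'n = 'n] unfolding H_regular_elliptic_def ell_def by simp
  obtain \<rho> where \<rho>: "0 < \<rho>" "\<And>x x' Y Y'. bnd \<rho> (x - x') \<Longrightarrow> bnd \<rho> (Y - Y') \<Longrightarrow> \<phi> (x, Y) = \<phi> (x', Y')"
    using Cc_infinity_uniform[OF assms(2)] by blast
  have \<rho>': "\<phi> y = \<phi> y'" if "bnd \<rho> (fst y - fst y')" "bnd \<rho> (snd y - snd y')" for y y'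
    using \<rho>(2)[OF that] by simp
  obtain b where b: "1 \<le> b" "\<And>y. \<phi> y \<noteq> 0 \<Longrightarrow> bnd b (fst y) \<and> bnd b (snd y)"
    using Cc_infinity_bounded[OF assms(2)] by blast
  have pull: "bnd b (fst y) \<and> bnd b (snd y)" if s: "s \<in> KK" "\<phi> (act s y) \<noteq> 0" for s y
  proof -
    interpret group "GLxGL :: ('a, 'n) mat2 monoid" by (rule group_GLxGL)
    have sc: "s \<in> carrier GLxGL" using KK_carrier[OF s(1)] .
    have "act (ginv s) (act s y) = y" using sc by (simp add: act_mult [symmetric] act_one)
    moreover have "ginv s \<in> KK" using subgroup.m_inv_closed[OF subgroup_KK s(1)] .
    ultimately show ?thesis using act_KK_bnd[of "ginv s" b "act s y"] b(2)[OF s(2)] by simp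
  qed
  \<comment> \<open>An element of \<open>QQ r\<close> moves points of the ball of radius b by at
    most \<rho>; outside this ball the function vanishes before and after.\<close>
  define r where "r = min (1 / 2) (\<rho> / b)"
  have r: "0 < r" "r < 1" "r * b \<le> \<rho>" using \<rho>(1) b(1) by (auto simp: r_def min_def field_simps)
  have inv: "\<phi> (act q y) = \<phi> y" if q: "q \<in> QQ r" for q y
  proof (cases "bnd b (fst y) \<and> bnd b (snd y)")
    case True
    then show ?thesis using act_QQ_near[OF q _ r(2), of b y] r by (intro \<rho>') (auto intro: bnd_mono)
  next
    case False
    have "q \<in> KK" using q QQ_KK[OF r(2)] by blast
    then show ?thesis using False pull b(2) by metis
  qed
  from exists_averaging_set[OF r(1,2), where ?'a = 'a and ?'n = 'n] obtain R :: "('a, 'n) mat2 set"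
    where R0: "finite R \<and> R \<subseteq> KK \<and> R \<noteq> {} \<and> (\<forall>\<phi> :: ('a, 'n) mat2 \<Rightarrow> complex.
      (\<forall>q\<in>QQ r. \<forall>y. \<phi> (act q y) = \<phi> y) \<longrightarrow> (\<forall>k\<in>KK. \<forall>y. (\<Sum>s\<in>R. \<phi> (act s (act k y))) = (\<Sum>s\<in>R. \<phi> (act s y))))"
    by (rule exE)
  have inv': "\<forall>q\<in>QQ r. \<forall>y. \<phi> (act q y) = \<phi> y" using inv by (intro ballI allI)
  have ave: "(\<Sum>s\<in>R. \<phi> (act s (act k y))) = (\<Sum>s\<in>R. \<phi> (act s y))" if "k \<in> KK" for k y
    by (rule R0[THEN conjunct2, THEN conjunct2, THEN conjunct2, THEN spec, THEN mp, OF inv', THEN bspec, OF that, THEN spec])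
  note R = R0[THEN conjunct1] R0[THEN conjunct2, THEN conjunct1] R0[THEN conjunct2, THEN conjunct2, THEN conjunct1]
  define f where "f y = (\<Sum>s\<in>R. \<phi> (act s y))" for y
  have f0: "f (0, 0) \<noteq> 0" using R assms(3) by (simp add: f_def act_zero)
  have f\<rho>: "f y = f y'" if "bnd \<rho> (fst y - fst y')" "bnd \<rho> (snd y - snd y')" for y y'
    unfolding f_def
  proof (rule sum.cong[OF refl])
    fix s assume "s \<in> R"
    then have s: "s \<in> KK" using R by blast
    show "\<phi> (act s y) = \<phi> (act s y')"
      using act_KK_bnd[OF s, of \<rho> "y - y'"] that by (intro \<rho>') (simp_all add: act_diff)
  qed
  have fb: "bnd b (fst y) \<and> bnd b (snd y)" if "f y \<noteq> 0" for y
  proof -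
    obtain s where "s \<in> R" "\<phi> (act s y) \<noteq> 0" using \<open>f y \<noteq> 0\<close> unfolding f_def by (meson sum.neutral)
    then show ?thesis using pull R(2) by blast
  qed
  \<comment> \<open>Finiteness of the range is what provides one denominator for all rational values
    of the functional.\<close>
  have "finite (range f)"
  proof -
    obtain S :: "('a^'n^'n) set" where S: "finite S" "\<And>A. bnd b A \<Longrightarrow> \<exists>B\<in>S. bnd \<rho> (A - B)"
      using finite_approx_bnd[OF \<rho>(1), of b, where ?'a = 'a and ?'n = 'n] by blast
    have "f y \<in> insert 0 (f ` (S \<times> S))" for y
    proof (cases "f y = 0")
      case False
      then obtain A B where "A \<in> S" "B \<in> S" "bnd \<rho> (fst y - A)" "bnd \<rho> (snd y - B)" using S(2) fb by meson
      then have "f y = f (A, B)" "(A, B) \<in> S \<times> S" by (auto intro: f\<rho>)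
      then show ?thesis by blast
    qed simp
    then have "range f \<subseteq> insert 0 (f ` (S \<times> S))" by blast
    then show ?thesis using S(1) by (auto intro: finite_subset)
  qed
  obtain l where l: "l (f (0, 0)) = (1 :: rat)" "\<And>x y. l (x + y) = l x + l y" "\<And>q x. l (of_rat q * x) = q * l x"
    using exists_rat_functional[OF f0] by blast
  have l0: "l 0 = 0" using l(3)[of 0 0] by simp
  have lsum: "l (sum g A) = (\<Sum>x\<in>A. l (g x))" for g and A :: "('a, 'n) mat2 set set set"
    by (induction A rule: infinite_finite_induct) (simp_all add: l0 l(2))
  have lnat: "l (of_nat m * x) = of_nat m * l x" for m x using l(3)[of "of_nat m" x] by simp
  obtain d :: int where d: "d \<noteq> 0" "\<forall>q\<in>l ` range f. \<exists>m. of_int d * q = of_int m"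
    using common_denominator[OF finite_imageI[OF \<open>finite (range f)\<close>]] by blast
  \<comment> \<open>The floor only changes the type, since multiplication by \<open>d\<close> has
    already made the value integral.\<close>
  define \<psi> where "\<psi> y = \<lfloor>of_int d * l (f y)\<rfloor>" for y
  have \<psi>: "of_int (\<psi> y) = of_int d * l (f y)" for y
  proof -
    obtain m where "of_int d * l (f y) = of_int m" using d(2) by blast
    then show ?thesis unfolding \<psi>_def by simp
  qed
  have \<psi>b: "bnd b (fst y) \<and> bnd b (snd y)" if "\<psi> y \<noteq> 0" for y
    using \<psi>[of y] that by (intro fb) (auto simp: l0)
  let ?S = "\<lambda>k. {dcoset TT h | h :: ('a, 'n) mat2. h \<in> carrier GLxGL \<and> \<psi> (act (ginv h) (ell k)) \<noteq> 0}"
  have level: "finite (?S k) \<and> (\<Sum>D\<in>?S k. int (wt (dcoset_rep TT D)) * \<psi> (act (ginv (dcoset_rep TT D)) (ell k))) = 0" for k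
  proof -
    obtain Hs :: "('a, 'n) mat2 set" where Hs: "finite Hs" "Hs \<subseteq> carrier GLxGL"
      "\<And>h. h \<in> carrier GLxGL \<Longrightarrow> bnd b (fst (act (ginv h) (ell k))) \<and> bnd b (snd (act (ginv h) (ell k))) \<Longrightarrow> \<exists>h'\<in>Hs. rco TT h \<in> dcoset TT h'"
      using finite_support_mod_TT[OF b(1), of k, where ?'a = 'a and ?'n = 'n] by blast
    let ?rp = "dcoset_rep TT :: ('a, 'n) mat2 set set \<Rightarrow> ('a, 'n) mat2"
    have \<mu>: "invariant_coset_measure TT (\<mu> (ell k))" using assms(1)[OF reg[of k]] unfolding stabilizer_ell .
    have "(\<Sum>D\<in>dcoset TT ` Hs. of_nat (wt (?rp D)) * f (act (ginv (?rp D)) (ell k))) = 0"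
      unfolding f_def
      by (rule weighted_sum_vanish[OF \<mu> Orb0[OF elliptic] r(1,2) inv R(1,2) ave Hs(1,2)]) (use Hs(3) b(2) in blast)+
    then have "(\<Sum>D\<in>dcoset TT ` Hs. of_nat (wt (?rp D)) * l (f (act (ginv (?rp D)) (ell k)))) = 0"
      using lsum[of "\<lambda>D. of_nat (wt (?rp D)) * f (act (ginv (?rp D)) (ell k))" "dcoset TT ` Hs"] by (simp add: lnat l0)
    then have "of_int d * (\<Sum>D\<in>dcoset TT ` Hs. of_nat (wt (?rp D)) * l (f (act (ginv (?rp D)) (ell k)))) = 0" by simp
    then have "of_int (\<Sum>D\<in>dcoset TT ` Hs. int (wt (?rp D)) * \<psi> (act (ginv (?rp D)) (ell k))) = (0 :: rat)"
      by (simp add: sum_distrib_left \<psi> mult.left_commute)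
    then have sum0: "(\<Sum>D\<in>dcoset TT ` Hs. int (wt (?rp D)) * \<psi> (act (ginv (?rp D)) (ell k))) = 0"
      by (simp only: of_int_eq_0_iff)
    have sub: "?S k \<subseteq> dcoset TT ` Hs"
    proof
      fix D assume "D \<in> ?S k"
      then obtain h :: "('a, 'n) mat2" where h: "D = dcoset TT h" "h \<in> carrier GLxGL" "\<psi> (act (ginv h) (ell k)) \<noteq> 0" by blast
      obtain h' where h': "h' \<in> Hs" "rco TT h \<in> dcoset TT h'" using Hs(3)[OF h(2) \<psi>b[OF h(3)]] by blast
      then have "D = dcoset TT h'" unfolding h(1) using dcoset_eqI[OF subgroup_TT _ h(2), of h'] Hs(2) by blast
      then show "D \<in> dcoset TT ` Hs" using h' by blast
    qed
    have z: "\<psi> (act (ginv (?rp D)) (ell k)) = 0" if D: "D \<in> dcoset TT ` Hs - ?S k" for D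
    proof -
      have "?rp D \<in> carrier GLxGL" "dcoset TT (?rp D) = D" using D Hs(2) dcoset_rep by blast+
      then show ?thesis using D by blast
    qed
    have "(\<Sum>D\<in>?S k. int (wt (?rp D)) * \<psi> (act (ginv (?rp D)) (ell k))) = 0"
      using sum.mono_neutral_left[OF finite_imageI[OF Hs(1)] sub, of "\<lambda>D. int (wt (?rp D)) * \<psi> (act (ginv (?rp D)) (ell k))"] z sum0 by simp
    then show ?thesis using finite_subset[OF sub] Hs(1) by blast
  qed
  have "\<psi> (0, 0) = 0"
  proof (rule level_vanish[OF _ \<rho>(1)])
    show "\<psi> (act k y) = \<psi> y" if "k \<in> KK" for k y using ave[OF that, of y] by (simp add: \<psi>_def f_def)
    show "\<psi> (x, Y) = \<psi> (x', Y')" if "bnd \<rho> (x - x')" "bnd \<rho> (Y - Y')" for x x' Y Y'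
      using f\<rho>[of "(x, Y)" "(x', Y')"] that by (simp add: \<psi>_def)
  qed (use level in blast)+
  then show False using \<psi>[of "(0, 0)"] l(1) d(1) by simp
qed

end
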